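(* Let $k$ be an algebraically closed field, $\Lambda=kQ/\langle\rho\rangle$ a basic finite-dimensional $k$-algebra given by a quiver $Q$ with vertices $1,\ldots,n$ and admissible relations $\rho$, and let $E=\{e_1,\ldots,e_n\}$ be the trivial paths. Let $\mathbf{c}=(c_1,\ldots,c_d)\in E^d$, let $\mu,\nu\in T_{\mathbf{c}}(\Lambda)$, and let $M_1\xrightarrow{i_1}\cdots\xrightarrow{i_{d-1}}M_d$ and $N_1\xrightarrow{j_1}\cdots\xrightarrow{j_{d-1}}N_d$ be the composition series corresponding to $\mu$ and $\nu$. Then $\nu\in\overline{N_{U_d(k)}(T_{\mathbf{c}}(\Lambda))*\mu}$ (Zariski closure of the orbit) if and only if there exist $\Lambda$-modules $X_1,\ldots,X_d$, homomorphisms $h_l:X_l\to X_{l+1}$ ($1\leq l\leq d-1$), and short exact sequences $0\to X_l\xrightarrow{a_l}X_l\oplus M_l\xrightarrow{b_l}N_l\to 0$ ($1\leq l\leq d$) such that $\begin{pmatrix}h_l&0\\0&i_l\end{pmatrix}a_l=a_{l+1}h_l$ and $j_lb_l=b_{l+1}\begin{pmatrix}h_l&0\\0&i_l\end{pmatrix}$ for all $1\leq l\leq d-1$.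
   Context: A $d$-dimensional representation of $\Lambda$ is a $k$-algebra homomorphism $\rho:\Lambda\to M_d(k)$, corresponding to the module structure $\lambda\cdot v=\rho(\lambda)v$ on $k^d$. It is triangular if all $\rho(\lambda)$ are upper triangular; $T_d(\Lambda)$ is the variety of triangular $d$-dimensional representations. For $\mathbf{c}\in E^d$ and $1\leq i\leq n$ let $A_i^{\mathbf{c}}$ be the diagonal $d\times d$ matrix whose $j$-th diagonal entry is $1$ if $c_j=e_i$ and $0$ otherwise, and let $T_{\mathbf{c}}(\Lambda)=\{\mu\in T_d(\Lambda)\mid \mu(e_i)=A_i^{\mathbf{c}}\text{ for all }i\}$. $U_d(k)$ is the group of invertible upper triangular matrices acting by conjugation $(g*\mu)(\lambda)=g\mu(\lambda)g^{-1}$, and $N_{U_d(k)}(T_{\mathbf{c}}(\Lambda))=\{g\in U_d(k)\mid g*T_{\mathbf{c}}(\Lambda)=T_{\mathbf{c}}(\Lambda)\}$ is its normalizer. The composition series corresponding to a triangular $\mu$: $M_d$ is $k^d$ with the module structure from $\mu$, $M_i\subseteq M_d$ is the submodule spanned by the first $i$ unit vectors, and $i_l:M_l\hookrightarrow M_{l+1}$ are the inclusions. *)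

theory Defs
  imports "Jordan_Normal_Form.Matrix" "HOL-Computational_Algebra.Polynomial"
begin

definition alg_closed :: "'k::field itself \<Rightarrow> bool" where
  "alg_closed TYPE('k) \<longleftrightarrow> (\<forall>p :: 'k poly. degree p > 0 \<longrightarrow> (\<exists>x. poly p x = 0))"

text \<open>A quiver has vertices 0..n-1 (the trivial paths e_0..e_(n-1)) and a finite
  set Arr of arrows with source src and target tgt.  A nontrivial path is a
  nonempty list of arrows in traversal order [a1,...,am] with tgt a_k = src a_(k+1).
  An element of the arrow ideal is a finitely supported function on such lists.\<close>

definition is_quiver :: "nat \<Rightarrow> 'a set \<Rightarrow> ('a \<Rightarrow> nat) \<Rightarrow> ('a \<Rightarrow> nat) \<Rightarrow> bool" where
  "is_quiver n Arr src tgt \<longleftrightarrow> finite Arr \<and> (\<forall>a\<in>Arr. src a < n \<and> tgt a < n)"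

definition is_path :: "'a set \<Rightarrow> ('a \<Rightarrow> nat) \<Rightarrow> ('a \<Rightarrow> nat) \<Rightarrow> 'a list \<Rightarrow> bool" where
  "is_path Arr src tgt p \<longleftrightarrow> p \<noteq> [] \<and> set p \<subseteq> Arr \<and>
     (\<forall>k. Suc k < length p \<longrightarrow> tgt (p ! k) = src (p ! Suc k))"

definition lin_comb_len :: "'a set \<Rightarrow> ('a \<Rightarrow> nat) \<Rightarrow> ('a \<Rightarrow> nat) \<Rightarrow> nat \<Rightarrow> ('a list \<Rightarrow> 'k::field) \<Rightarrow> bool" where
  "lin_comb_len Arr src tgt m r \<longleftrightarrow> finite {p. r p \<noteq> 0} \<and>
     (\<forall>p. r p \<noteq> 0 \<longrightarrow> is_path Arr src tgt p \<and> length p \<ge> m)"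

text \<open>The two-sided ideal of kQ generated by a set rho of elements of R_Q^2.
  Since the ideal is two-sided, the order convention for multiplying paths is
  irrelevant here: the generators are the products (path u) r (path w), i.e. the
  concatenations u p w (traversal order) for p in the support of r, where u, w may
  also be trivial paths e_i, e_j; path_sandwich i j u w r is this product further
  multiplied by e_i at the start and e_j at the end (incompatible products are 0).\<close>
definition path_sandwich :: "'a set \<Rightarrow> ('a \<Rightarrow> nat) \<Rightarrow> ('a \<Rightarrow> nat) \<Rightarrow> nat \<Rightarrow> nat \<Rightarrow> 'a list \<Rightarrow> 'a list \<Rightarrow> ('a list \<Rightarrow> 'k::field) \<Rightarrow> ('a list \<Rightarrow> 'k)" where
  "path_sandwich Arr src tgt i j u w r = (\<lambda>q. if (\<exists>p. q = u @ p @ w \<and> r p \<noteq> 0) \<and> is_path Arr src tgt q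
        \<and> src (hd q) = i \<and> tgt (last q) = j
        then r (take (length q - length u - length w) (drop (length u) q)) else 0)"

inductive_set gen_ideal :: "'a set \<Rightarrow> ('a \<Rightarrow> nat) \<Rightarrow> ('a \<Rightarrow> nat) \<Rightarrow> ('a list \<Rightarrow> 'k::field) set \<Rightarrow> ('a list \<Rightarrow> 'k) set"
  for Arr src tgt rho where
  gen_zero: "(\<lambda>_. 0) \<in> gen_ideal Arr src tgt rho"
| gen_rel: "r \<in> rho \<Longrightarrow> path_sandwich Arr src tgt i j u w r \<in> gen_ideal Arr src tgt rho"
| gen_add: "x \<in> gen_ideal Arr src tgt rho \<Longrightarrow> y \<in> gen_ideal Arr src tgt rho \<Longrightarrow> (\<lambda>q. x q + y q) \<in> gen_ideal Arr src tgt rho"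
| gen_smult: "x \<in> gen_ideal Arr src tgt rho \<Longrightarrow> (\<lambda>q. c * x q) \<in> gen_ideal Arr src tgt rho"

definition admissible :: "'a set \<Rightarrow> ('a \<Rightarrow> nat) \<Rightarrow> ('a \<Rightarrow> nat) \<Rightarrow> ('a list \<Rightarrow> 'k::field) set \<Rightarrow> bool" where
  "admissible Arr src tgt rho \<longleftrightarrow> finite rho \<and> (\<forall>r\<in>rho. lin_comb_len Arr src tgt 2 r) \<and>
     (\<exists>m\<ge>2. \<forall>p. is_path Arr src tgt p \<and> length p = m \<longrightarrow>
         (\<lambda>q. if q = p then 1 else 0) \<in> gen_ideal Arr src tgt rho)"

text \<open>An algebra homomorphism Lambda -> M_m(k) is determined by the images E i of the
  trivial paths e_i and X a of the arrows a.  Convention: an arrow a : src a -> tgt a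
  satisfies a = e_(tgt a) a e_(src a) in Lambda, and the path [a1,...,am]
  (traversal order) is the product a_m ... a_1.  Values outside the vertex
  resp. arrow set are normalised to zero.\<close>

definition path_mat :: "nat \<Rightarrow> ('a \<Rightarrow> 'k::field mat) \<Rightarrow> 'a list \<Rightarrow> 'k mat" where
  "path_mat m X p = fold (\<lambda>a M. X a * M) p (1\<^sub>m m)"

definition is_rep :: "nat \<Rightarrow> 'a set \<Rightarrow> ('a \<Rightarrow> nat) \<Rightarrow> ('a \<Rightarrow> nat) \<Rightarrow> ('a list \<Rightarrow> 'k::field) set \<Rightarrow>
    nat \<Rightarrow> (nat \<Rightarrow> 'k mat) \<times> ('a \<Rightarrow> 'k mat) \<Rightarrow> bool" where
  "is_rep n Arr src tgt rho m R \<longleftrightarrow>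
     (let E = fst R; X = snd R in
       (\<forall>i<n. E i \<in> carrier_mat m m) \<and> (\<forall>i\<ge>n. E i = 0\<^sub>m m m) \<and>
       (\<forall>a\<in>Arr. X a \<in> carrier_mat m m) \<and> (\<forall>a. a \<notin> Arr \<longrightarrow> X a = 0\<^sub>m m m) \<and>
       (\<forall>i<n. \<forall>j<n. E i * E j = (if i = j then E i else 0\<^sub>m m m)) \<and>
       (\<forall>r<m. \<forall>s<m. (\<Sum>i<n. E i $$ (r,s)) = (if r = s then 1 else 0)) \<and>
       (\<forall>a\<in>Arr. X a = E (tgt a) * X a * E (src a)) \<and>
       (\<forall>rel\<in>rho. \<forall>r<m. \<forall>s<m. (\<Sum>p\<in>{p. rel p \<noteq> 0}. rel p * path_mat m X p $$ (r,s)) = 0))"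

definition is_hom :: "nat \<Rightarrow> 'a set \<Rightarrow> nat \<Rightarrow> nat \<Rightarrow> (nat \<Rightarrow> 'k::field mat) \<times> ('a \<Rightarrow> 'k mat) \<Rightarrow>
    (nat \<Rightarrow> 'k mat) \<times> ('a \<Rightarrow> 'k mat) \<Rightarrow> 'k mat \<Rightarrow> bool" where
  "is_hom n Arr m m' R R' h \<longleftrightarrow> h \<in> carrier_mat m' m \<and>
     (\<forall>i<n. h * fst R i = fst R' i * h) \<and> (\<forall>a\<in>Arr. h * snd R a = snd R' a * h)"

definition dsum_rep :: "nat \<Rightarrow> nat \<Rightarrow> (nat \<Rightarrow> 'k::field mat) \<times> ('a \<Rightarrow> 'k mat) \<Rightarrow>
    (nat \<Rightarrow> 'k mat) \<times> ('a \<Rightarrow> 'k mat) \<Rightarrow> (nat \<Rightarrow> 'k mat) \<times> ('a \<Rightarrow> 'k mat)" where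
  "dsum_rep m m' R R' =
     ((\<lambda>i. four_block_mat (fst R i) (0\<^sub>m m m') (0\<^sub>m m' m) (fst R' i)),
      (\<lambda>a. four_block_mat (snd R a) (0\<^sub>m m m') (0\<^sub>m m' m) (snd R' a)))"

definition diag2 :: "'k::field mat \<Rightarrow> 'k mat \<Rightarrow> 'k mat" where
  "diag2 f g = four_block_mat f (0\<^sub>m (dim_row f) (dim_col g)) (0\<^sub>m (dim_row g) (dim_col f)) g"

definition short_exact :: "nat \<Rightarrow> nat \<Rightarrow> nat \<Rightarrow> 'k::field mat \<Rightarrow> 'k mat \<Rightarrow> bool" where
  "short_exact p q r A B \<longleftrightarrow> A \<in> carrier_mat q p \<and> B \<in> carrier_mat r q \<and>
     (\<forall>v\<in>carrier_vec p. A *\<^sub>v v = 0\<^sub>v q \<longrightarrow> v = 0\<^sub>v p) \<and>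
     (\<forall>w\<in>carrier_vec r. \<exists>v\<in>carrier_vec q. B *\<^sub>v v = w) \<and>
     (\<forall>v\<in>carrier_vec q. B *\<^sub>v v = 0\<^sub>v r \<longleftrightarrow> (\<exists>u\<in>carrier_vec p. A *\<^sub>v u = v))"

definition A_mat :: "nat \<Rightarrow> (nat \<Rightarrow> nat) \<Rightarrow> nat \<Rightarrow> 'k::field mat" where
  "A_mat d c i = mat d d (\<lambda>(r,s). if r = s \<and> c r = i then 1 else 0)"

definition A_c :: "nat \<Rightarrow> nat \<Rightarrow> (nat \<Rightarrow> nat) \<Rightarrow> nat \<Rightarrow> 'k::field mat" where
  "A_c n d c i = (if i < n then A_mat d c i else 0\<^sub>m d d)"

definition T_c :: "nat \<Rightarrow> 'a set \<Rightarrow> ('a \<Rightarrow> nat) \<Rightarrow> ('a \<Rightarrow> nat) \<Rightarrow> ('a list \<Rightarrow> 'k::field) set \<Rightarrow>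
    nat \<Rightarrow> (nat \<Rightarrow> nat) \<Rightarrow> ((nat \<Rightarrow> 'k mat) \<times> ('a \<Rightarrow> 'k mat)) set" where
  "T_c n Arr src tgt rho d c = {R. is_rep n Arr src tgt rho d R \<and>
     (\<forall>i<n. upper_triangular (fst R i)) \<and> (\<forall>a\<in>Arr. upper_triangular (snd R a)) \<and>
     fst R = A_c n d c}"

definition U_group :: "nat \<Rightarrow> 'k::field mat set" where
  "U_group d = {g. g \<in> carrier_mat d d \<and> upper_triangular g \<and> invertible_mat g}"

definition mat_inv :: "nat \<Rightarrow> 'k::field mat \<Rightarrow> 'k mat" where
  "mat_inv d g = (SOME g'. g' \<in> carrier_mat d d \<and> g * g' = 1\<^sub>m d \<and> g' * g = 1\<^sub>m d)"

definition conj_rep :: "nat \<Rightarrow> 'k::field mat \<Rightarrow> (nat \<Rightarrow> 'k mat) \<times> ('a \<Rightarrow> 'k mat) \<Rightarrow>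
    (nat \<Rightarrow> 'k mat) \<times> ('a \<Rightarrow> 'k mat)" where
  "conj_rep d g R = ((\<lambda>i. g * fst R i * mat_inv d g), (\<lambda>a. g * snd R a * mat_inv d g))"

definition normalizer :: "nat \<Rightarrow> ((nat \<Rightarrow> 'k::field mat) \<times> ('a \<Rightarrow> 'k mat)) set \<Rightarrow> 'k mat set" where
  "normalizer d T = {g \<in> U_group d. conj_rep d g ` T = T}"

inductive_set poly_fun :: "nat \<Rightarrow> 'a set \<Rightarrow> nat \<Rightarrow> (((nat \<Rightarrow> 'k::field mat) \<times> ('a \<Rightarrow> 'k mat)) \<Rightarrow> 'k) set"
  for n Arr d where
  pf_const: "(\<lambda>_. c) \<in> poly_fun n Arr d"
| pf_E: "i < n \<Longrightarrow> r < d \<Longrightarrow> s < d \<Longrightarrow> (\<lambda>R. fst R i $$ (r,s)) \<in> poly_fun n Arr d"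
| pf_X: "a \<in> Arr \<Longrightarrow> r < d \<Longrightarrow> s < d \<Longrightarrow> (\<lambda>R. snd R a $$ (r,s)) \<in> poly_fun n Arr d"
| pf_add: "f \<in> poly_fun n Arr d \<Longrightarrow> g \<in> poly_fun n Arr d \<Longrightarrow> (\<lambda>R. f R + g R) \<in> poly_fun n Arr d"
| pf_mult: "f \<in> poly_fun n Arr d \<Longrightarrow> g \<in> poly_fun n Arr d \<Longrightarrow> (\<lambda>R. f R * g R) \<in> poly_fun n Arr d"

definition zariski_closure :: "nat \<Rightarrow> 'a set \<Rightarrow> nat \<Rightarrow> ((nat \<Rightarrow> 'k::field mat) \<times> ('a \<Rightarrow> 'k mat)) set \<Rightarrow>
    ((nat \<Rightarrow> 'k mat) \<times> ('a \<Rightarrow> 'k mat)) set" where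
  "zariski_closure n Arr d S = {P. \<forall>f\<in>poly_fun n Arr d. (\<forall>Q\<in>S. f Q = 0) \<longrightarrow> f P = 0}"

definition topleft :: "nat \<Rightarrow> 'k::field mat \<Rightarrow> 'k mat" where
  "topleft l A = mat l l (\<lambda>(r,s). A $$ (r,s))"

text \<open>M_l: the submodule of k^d spanned by the first l unit vectors, identified with k^l.\<close>
definition sub_rep :: "nat \<Rightarrow> (nat \<Rightarrow> 'k::field mat) \<times> ('a \<Rightarrow> 'k mat) \<Rightarrow> (nat \<Rightarrow> 'k mat) \<times> ('a \<Rightarrow> 'k mat)" where
  "sub_rep l R = ((\<lambda>i. topleft l (fst R i)), (\<lambda>a. topleft l (snd R a)))"

definition incl_mat :: "nat \<Rightarrow> 'k::field mat" where
  "incl_mat l = mat (Suc l) l (\<lambda>(r,s). if r = s then 1 else 0)"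

end

(* For the direction from sequences to closure, the homomorphisms a_d give a one-parameter family
   of representations G(t)^-1 mu G(t), rational in t, with G(t) in the normalizer for almost all
   t (upper triangular and compatible with the vertex grading), whose value at t = 0 is nu.
   Conversely, if nu lies in the closure, the functions g |-> f(g * mu) with f(nu) nonzero have no
   common obstruction, so an ultrapower of k contains a generic matrix g for which f(g * mu) |-> f(nu)
   is well defined. A maximal place extending it is a valuation with residue field k such that
   g mu g^-1 is integral and reduces to nu. This valuation need not be discrete; but it is given by
   finitely many strict valuation inequalities, and a Zorn argument over subfields (adjoining
   algebraic elements through norms and arbitrary elements through their nearest roots) solves
   every such system over a discretely valued subfield. Over the discrete valuation ring R with
   uniformizer pi, the quotients X_l = R^l / g R^l with u |-> (pi u, digit of g^-1 pi u) give the
   exact sequences, and they are compatible with the flag because g is triangular. *)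
theory Submission
  imports Defs "Jordan_Normal_Form.Determinant" "Jordan_Normal_Form.Char_Poly"
begin

subsection \<open>Ultrapowers\<close>

text \<open>The sequences come from a tautological one. Let \<open>L = R^l\<close> carry
  \<open>g \<mu> g^-1\<close>. In 0 -> pi L/pi gL -> L/pi gL -> L/pi L -> 0 the last term is
  \<open>N_l\<close> and the first is \<open>X_l = L/gL\<close>. The middle term is the sum of
  \<open>X_l\<close> and \<open>M_l\<close>: since \<open>gL\<close> is \<open>M_l\<close> with
  scalars extended to \<open>R\<close> and \<open>\<mu>\<close> has entries in \<open>k\<close>,
  taking a digit of \<open>g^-1 u\<close> is linear over Lambda and splits off \<open>M_l\<close>.
  For \<open>X_l\<close> to be finite-dimensional, some power of pi must carry \<open>L\<close> into
  \<open>gL\<close>; this is why a discrete valuation is sought. The obstacle in the descent is an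
  algebraic element: once the coefficients of its minimal polynomial are specialized, it is lost
  which root was meant, and a norm inequality only yields some root for one inequality. A system is
  therefore replaced by generic linear combinations of its members, so many that a single root must
  serve enough of them. The ultrapower also receives a second generic element, different from all
  constants, which makes the valuation nontrivial.\<close>

definition ultra :: "'i filter \<Rightarrow> bool" where
  "ultra F \<longleftrightarrow> F \<noteq> bot \<and> (\<forall>P. eventually P F \<or> eventually (\<lambda>x. \<not> P x) F)"

text \<open>Zorn's lemma for the proper filters below \<open>F\<close>, ordered by refinement. A
  chain is directed, so its infimum is still proper. A finest proper filter \<open>U\<close> decides
  every \<open>P\<close>, since otherwise \<open>inf U (principal {x. P x})\<close> would be proper
  and strictly finer.\<close>

lemma exists_ultra_le:
  fixes F :: "'i filter"
  assumes "F \<noteq> bot"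
  shows "\<exists>U\<le>F. ultra U"
proof -
  define A where "A = {G. G \<le> F \<and> G \<noteq> bot}"
  define r :: "('i filter \<times> 'i filter) set" where "r = {(G,G'). G \<in> A \<and> G' \<in> A \<and> G' \<le> G}"
  have Fld: "Field r = A" by (auto simp: r_def Field_def)
  have po: "Partial_order r"
    unfolding partial_order_on_def preorder_on_def Fld
    by (auto simp: r_def refl_on_def trans_def antisym_def)
  have "\<exists>m\<in>Field r. \<forall>a\<in>Field r. (m, a) \<in> r \<longrightarrow> a = m"
  proof (rule Zorns_po_lemma[OF po], unfold Fld)
    fix C assume C: "C \<in> Chains r"
    have CA: "C \<subseteq> A" using C by (auto simp: Chains_def r_def)
    show "\<exists>u\<in>A. \<forall>a\<in>C. (a, u) \<in> r"
    proof (cases "C = {}")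
      case True
      then show ?thesis using assms by (auto simp: A_def)
    next
      case False
      have dir: "\<exists>x\<in>C. x \<le> inf a b" if "a \<in> C" "b \<in> C" for a b
        using C that unfolding Chains_def r_def by (auto simp: le_infI)
      have "Inf C \<noteq> bot"
      proof
        assume "Inf C = bot"
        then have "eventually (\<lambda>x. False) (INF x\<in>C. x)" by simp
        then obtain b where "b \<in> C" "eventually (\<lambda>x. False) b"
          using eventually_INF_base[OF False, of "\<lambda>x. x"] dir by auto
        then show False using CA by (auto simp: A_def trivial_limit_def)
      qed
      moreover have "Inf C \<le> F" using False CA
        by (auto simp: A_def intro: Inf_lower2)
      ultimately have "Inf C \<in> A" by (simp add: A_def)
      then show ?thesis using CA by (intro bexI[of _ "Inf C"]) (auto simp: r_def Inf_lower)
    qed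
  qed
  then obtain U where U: "U \<in> A" "\<And>a. a \<in> A \<Longrightarrow> a \<le> U \<Longrightarrow> a = U"
    unfolding Fld by (auto simp: r_def)
  have "eventually P U \<or> eventually (\<lambda>x. \<not> P x) U" for P
  proof (rule ccontr)
    assume n: "\<not> ?thesis"
    let ?G = "inf U (principal {x. P x})"
    have "?G \<noteq> bot"
    proof
      assume "?G = bot"
      then have "eventually (\<lambda>x. False) ?G" by simp
      then show False using n by (simp add: eventually_inf_principal)
    qed
    then have "?G \<in> A" using U(1) by (auto simp: A_def le_infI1)
    then have "?G = U" using U(2) by simp
    moreover have "eventually P ?G" by (simp add: eventually_inf_principal)
    ultimately show False using n by simp
  qed
  then show ?thesis using U(1) by (auto simp: A_def ultra_def)
qed

definition base_filter :: "('s filter \<Rightarrow> 's) filter" where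
  "base_filter = (INF B\<in>{B. B \<noteq> bot}. filtercomap (\<lambda>i. i B) B)"

text \<open>Conditions that belong to different filters \<open>B\<close> concern different
  coordinates \<open>i B\<close> of the index, so finitely many of them are met by choosing each
  coordinate separately.\<close>

lemma base_filter_neq_bot: "(base_filter :: ('s filter \<Rightarrow> 's) filter) \<noteq> bot"
  unfolding base_filter_def
proof (rule INF_filter_not_bot)
  fix X :: "'s filter set"
  assume X: "X \<subseteq> {B. B \<noteq> bot}" "finite X"
  show "(INF B\<in>X. filtercomap (\<lambda>i. i B) B) \<noteq> bot"
  proof
    assume "(INF B\<in>X. filtercomap (\<lambda>i. i B) B) = bot"
    then have "eventually (\<lambda>x. False) (INF B\<in>X. filtercomap (\<lambda>i. i B) B)" by simp
    then obtain Q where Q: "\<And>B. B \<in> X \<Longrightarrow> eventually (Q B) (filtercomap (\<lambda>i. i B) B)"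
      "\<And>y. (\<forall>B\<in>X. Q B y) \<Longrightarrow> False"
      unfolding eventually_INF_finite[OF X(2)] by blast
    have "\<exists>P. eventually P B \<and> (\<forall>i. P (i B) \<longrightarrow> Q B i)" if "B \<in> X" for B
      using Q(1)[OF that] by (simp add: eventually_filtercomap)
    then obtain P where P: "\<And>B. B \<in> X \<Longrightarrow> eventually (P B) B"
      "\<And>B i. B \<in> X \<Longrightarrow> P B (i B) \<Longrightarrow> Q B i" by metis
    have "\<exists>x. P B x" if "B \<in> X" for B
      using P(1)[OF that] X(1) that eventually_happens' by blast
    then obtain i where "\<And>B. B \<in> X \<Longrightarrow> P B (i B)" by metis
    then show False using P(2) Q(2) by blast
  qed
qed

text \<open>One ultrafilter that is pushed onto a refinement of every proper filter on the
  index type, so that a single quotient type serves for all of them.\<close>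

definition univ_ultra :: "('s filter \<Rightarrow> 's) filter" where
  "univ_ultra = (SOME U. U \<le> base_filter \<and> ultra U)"

lemma univ_ultra:
  fixes U :: "('s filter \<Rightarrow> 's) filter"
  assumes "U = univ_ultra"
  shows "U \<le> base_filter" "ultra U"
proof -
  have "\<exists>U :: ('s filter \<Rightarrow> 's) filter. U \<le> base_filter \<and> ultra U"
    using exists_ultra_le[OF base_filter_neq_bot] by blast
  then have "U \<le> base_filter \<and> ultra U"
    unfolding assms univ_ultra_def by (rule someI_ex)
  then show "U \<le> base_filter" "ultra U" by auto
qed

text \<open>The way the ultrafilter is used: conditions with the finite intersection property are
  packed into a proper filter \<open>B\<close>, and evaluation at \<open>B\<close> then satisfies
  each of them almost everywhere.\<close>

lemma eventually_univ_ultra_proj: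
  assumes "B \<noteq> bot" "eventually P B"
  shows "eventually (\<lambda>i. P (i B)) univ_ultra"
proof -
  have "univ_ultra \<le> filtercomap (\<lambda>i. i B) B"
    using univ_ultra(1)[OF refl] assms(1) unfolding base_filter_def
    by (auto intro: order_trans INF_lower)
  moreover have "eventually (\<lambda>i. P (i B)) (filtercomap (\<lambda>i. i B) B)"
    using assms(2) by (auto simp: eventually_filtercomap)
  ultimately show ?thesis by (rule filter_leD)
qed

lemma univ_ultra_neq_bot [simp]: "(univ_ultra :: ('s filter \<Rightarrow> 's) filter) \<noteq> bot"
proof -
  have "ultra (univ_ultra :: ('s filter \<Rightarrow> 's) filter)" by (rule univ_ultra) simp
  then show ?thesis by (simp add: ultra_def)
qed

lemma not_eventually_univ_ultra:
  fixes P :: "('s filter \<Rightarrow> 's) \<Rightarrow> bool"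
  shows "\<not> eventually P univ_ultra \<longleftrightarrow> eventually (\<lambda>x. \<not> P x) univ_ultra"
proof
  assume "\<not> eventually P univ_ultra"
  moreover have "ultra (univ_ultra :: ('s filter \<Rightarrow> 's) filter)" by (rule univ_ultra) simp
  ultimately show "eventually (\<lambda>x. \<not> P x) univ_ultra" unfolding ultra_def by blast
next
  assume a: "eventually (\<lambda>x. \<not> P x) univ_ultra"
  show "\<not> eventually P univ_ultra"
  proof
    assume "eventually P univ_ultra"
    with a have "eventually (\<lambda>x. False) (univ_ultra :: ('s filter \<Rightarrow> 's) filter)"
      by (rule eventually_elim2) simp
    then show False by (simp add: trivial_limit_def[symmetric])
  qed
qed

quotient_type ('s, 'k) ultrapower = "('s filter \<Rightarrow> 's) \<Rightarrow> 'k" /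
  "\<lambda>f g. eventually (\<lambda>i. f i = g i) univ_ultra"
  by (rule equivpI) (auto simp: reflp_def symp_def transp_def elim: eventually_mono eventually_elim2)

lemma abs_ultrapower_eq_iff:
  "abs_ultrapower f = abs_ultrapower g \<longleftrightarrow> eventually (\<lambda>i. f i = g i) univ_ultra"
  using ultrapower.abs_eq_iff by blast

instantiation ultrapower :: (type, field) field
begin

lift_definition zero_ultrapower :: "('a, 'b) ultrapower" is "\<lambda>_. 0" .
lift_definition one_ultrapower :: "('a, 'b) ultrapower" is "\<lambda>_. 1" .
lift_definition plus_ultrapower :: "('a, 'b) ultrapower \<Rightarrow> ('a, 'b) ultrapower \<Rightarrow> ('a, 'b) ultrapower"
  is "\<lambda>f g i. f i + g i" by (auto elim: eventually_elim2)
lift_definition times_ultrapower :: "('a, 'b) ultrapower \<Rightarrow> ('a, 'b) ultrapower \<Rightarrow> ('a, 'b) ultrapower"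
  is "\<lambda>f g i. f i * g i" by (auto elim: eventually_elim2)
lift_definition uminus_ultrapower :: "('a, 'b) ultrapower \<Rightarrow> ('a, 'b) ultrapower"
  is "\<lambda>f i. - f i" by (auto elim: eventually_mono)
lift_definition minus_ultrapower :: "('a, 'b) ultrapower \<Rightarrow> ('a, 'b) ultrapower \<Rightarrow> ('a, 'b) ultrapower"
  is "\<lambda>f g i. f i - g i" by (auto elim: eventually_elim2)
lift_definition inverse_ultrapower :: "('a, 'b) ultrapower \<Rightarrow> ('a, 'b) ultrapower"
  is "\<lambda>f i. inverse (f i)" by (auto elim: eventually_mono)
lift_definition divide_ultrapower :: "('a, 'b) ultrapower \<Rightarrow> ('a, 'b) ultrapower \<Rightarrow> ('a, 'b) ultrapower"
  is "\<lambda>f g i. f i / g i" by (auto elim: eventually_elim2)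

instance
proof
  fix a :: "('a, 'b) ultrapower"
  show "a \<noteq> 0 \<Longrightarrow> inverse a * a = 1"
    by transfer (auto simp: not_eventually_univ_ultra elim: eventually_mono)
  show "(0 :: ('a, 'b) ultrapower) \<noteq> 1" by transfer simp
qed (transfer; simp add: algebra_simps divide_inverse)+

end

definition ultra_const :: "'k \<Rightarrow> ('s, 'k) ultrapower" where
  "ultra_const c = abs_ultrapower (\<lambda>_. c)"

lemma abs_ultrapower_simps:
  "abs_ultrapower (\<lambda>i. f i + g i) = abs_ultrapower f + abs_ultrapower g"
  "abs_ultrapower (\<lambda>i. f i * g i) = abs_ultrapower f * abs_ultrapower g"
  "abs_ultrapower (\<lambda>i. f i - g i) = abs_ultrapower f - abs_ultrapower g"
  "abs_ultrapower (\<lambda>i. - f i) = - abs_ultrapower f"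
  "abs_ultrapower (\<lambda>i. 0) = 0" "abs_ultrapower (\<lambda>i. 1) = 1"
  by (simp_all add: plus_ultrapower.abs_eq times_ultrapower.abs_eq minus_ultrapower.abs_eq
      uminus_ultrapower.abs_eq zero_ultrapower.abs_eq one_ultrapower.abs_eq)

lemma abs_ultrapower_sum:
  "abs_ultrapower (\<lambda>i. \<Sum>x\<in>A. f x i) = (\<Sum>x\<in>A. abs_ultrapower (f x))"
  by (induction A rule: infinite_finite_induct) (simp_all add: abs_ultrapower_simps)

lemma ultra_const_hom:
  "ultra_const (a + b) = ultra_const a + ultra_const b"
  "ultra_const (a * b) = ultra_const a * ultra_const b"
  "ultra_const 1 = 1" "ultra_const 0 = 0"
  by (simp_all add: ultra_const_def flip: abs_ultrapower_simps)

text \<open>Los's argument for one family of sentences: almost all coordinate polynomials keep a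
  nonzero coefficient at \<open>n\<close>, hence have a root, and the chosen roots form a root in
  the ultrapower.\<close>

lemma alg_closed_ultrapower:
  assumes "alg_closed TYPE('k::field)"
  shows "alg_closed TYPE(('s, 'k) ultrapower)"
  unfolding alg_closed_def
proof (intro allI impI)
  fix p :: "('s, 'k) ultrapower poly"
  assume dp: "degree p > 0"
  define n where "n = degree p"
  define cf where "cf j = rep_ultrapower (coeff p j)" for j
  have cf: "abs_ultrapower (cf j) = coeff p j" for j
    unfolding cf_def using Quotient_abs_rep[OF Quotient_ultrapower] by blast
  define q where "q i = (\<Sum>j\<le>n. monom (cf j i) j)" for i
  have cq: "coeff (q i) j = (if j \<le> n then cf j i else 0)" for i j
    unfolding q_def coeff_sum by (simp add: coeff_monom)
  have "coeff p n \<noteq> 0" using dp n_def by auto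
  then have "eventually (\<lambda>i. cf n i \<noteq> 0) univ_ultra"
    unfolding cf[symmetric] zero_ultrapower_def map_fun_apply id_apply
    by (simp add: abs_ultrapower_eq_iff zero_ultrapower.abs_eq not_eventually_univ_ultra)
  then have "eventually (\<lambda>i. \<exists>x. poly (q i) x = 0) univ_ultra"
  proof (rule eventually_mono)
    fix i assume "cf n i \<noteq> 0"
    then have "coeff (q i) n \<noteq> 0" by (simp add: cq)
    then have "degree (q i) \<ge> n" by (rule le_degree)
    then have "degree (q i) > 0" using dp n_def by simp
    then show "\<exists>x. poly (q i) x = 0" using assms by (auto simp: alg_closed_def)
  qed
  then obtain x where x: "eventually (\<lambda>i. poly (q i) (x i) = 0) univ_ultra"
  proof -
    assume a: "eventually (\<lambda>i. \<exists>x. poly (q i) x = 0) univ_ultra"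
      and b: "\<And>x. eventually (\<lambda>i. poly (q i) (x i) = 0) univ_ultra \<Longrightarrow> thesis"
    from a have "eventually (\<lambda>i. poly (q i) (SOME x. poly (q i) x = 0) = 0) univ_ultra"
      by (rule eventually_mono) (rule someI_ex)
    then show thesis by (rule b)
  qed
  have pw: "abs_ultrapower (\<lambda>i. x i ^ j) = abs_ultrapower x ^ j" for j
    by (induction j) (simp_all add: abs_ultrapower_simps)
  have "poly p (abs_ultrapower x) = (\<Sum>j\<le>n. coeff p j * abs_ultrapower x ^ j)"
    by (simp add: poly_altdef n_def)
  also have "\<dots> = abs_ultrapower (\<lambda>i. \<Sum>j\<le>n. cf j i * x i ^ j)"
    by (simp add: abs_ultrapower_sum abs_ultrapower_simps pw cf)
  also have "\<dots> = abs_ultrapower (\<lambda>i. poly (q i) (x i))"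
    by (simp add: q_def poly_sum poly_monom)
  also have "\<dots> = 0"
    unfolding abs_ultrapower_simps(5)[symmetric] abs_ultrapower_eq_iff using x by simp
  finally show "\<exists>x. poly p x = 0" by blast
qed

subsection \<open>Places and valuations\<close>

locale field_embedding =
  fixes emb :: "'k::field \<Rightarrow> 'w::field"
  assumes emb_add: "emb (a + b) = emb a + emb b"
    and emb_mult: "emb (a * b) = emb a * emb b"
    and emb_1 [simp]: "emb 1 = 1"
begin

lemma emb_0 [simp]: "emb 0 = 0"
proof -
  have "emb 0 + 0 = emb 0 + emb 0" using emb_add[of 0 0] by simp
  then show ?thesis by (metis add_left_cancel)
qed

lemma emb_uminus: "emb (- a) = - emb a"
  using emb_add[of a "- a"] by (simp add: eq_neg_iff_add_eq_0 add.commute)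

lemma emb_diff: "emb (a - b) = emb a - emb b"
  using emb_add[of a "- b"] by (simp add: emb_uminus)

lemma emb_eq_0_iff [simp]: "emb a = 0 \<longleftrightarrow> a = 0"
proof
  assume "emb a = 0"
  then have "emb (a * inverse a) = 0" by (simp add: emb_mult)
  then show "a = 0" by (cases "a = 0") auto
qed simp

lemma emb_eq_iff [simp]: "emb a = emb b \<longleftrightarrow> a = b"
  using emb_eq_0_iff[of "a - b"] by (simp add: emb_diff)

lemma emb_inverse: "emb (inverse a) = inverse (emb a)"
proof (cases "a = 0")
  case False
  then have "emb a * emb (inverse a) = 1" by (simp flip: emb_mult)
  then show ?thesis by (rule inverse_unique[symmetric])
qed simp

lemma emb_sum: "emb (\<Sum>x\<in>A. f x) = (\<Sum>x\<in>A. emb (f x))"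
  by (induction A rule: infinite_finite_induct) (simp_all add: emb_add)

lemma emb_power: "emb (a ^ n) = emb a ^ n"
  by (induction n) (simp_all add: emb_mult)

text \<open>The graph of a ring homomorphism to \<open>'k\<close> that is defined on a subring
  containing the constants and fixes them. The last clause makes the relation single-valued. As a
  relation it can be extended by mere inclusion, which is the form Zorn's lemma needs.\<close>

definition place :: "('w \<times> 'k) set \<Rightarrow> bool" where
  "place G \<longleftrightarrow> (\<forall>c. (emb c, c) \<in> G) \<and>
     (\<forall>a c b e. (a, c) \<in> G \<longrightarrow> (b, e) \<in> G \<longrightarrow> (a + b, c + e) \<in> G \<and> (a * b, c * e) \<in> G) \<and>
     (\<forall>c. (0, c) \<in> G \<longrightarrow> c = 0)"

lemma placeD:
  assumes "place G"
  shows "(emb c, c) \<in> G" "(a, c) \<in> G \<Longrightarrow> (b, e) \<in> G \<Longrightarrow> (a + b, c + e) \<in> G"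
    "(a, c) \<in> G \<Longrightarrow> (b, e) \<in> G \<Longrightarrow> (a * b, c * e) \<in> G" "(0, c) \<in> G \<Longrightarrow> c = 0"
  using assms unfolding place_def by blast+

lemma place_0_1:
  assumes "place G" shows "(0, 0) \<in> G" "(1, 1) \<in> G"
  using placeD(1)[OF assms, of 0] placeD(1)[OF assms, of 1] by auto

lemma place_uminus:
  assumes "place G" "(a, c) \<in> G" shows "(- a, - c) \<in> G"
  using placeD(3)[OF assms(1) placeD(1)[OF assms(1), of "- 1"] assms(2)]
  by (simp add: emb_uminus)

lemma place_diff:
  assumes "place G" "(a, c) \<in> G" "(b, e) \<in> G" shows "(a - b, c - e) \<in> G"
  using placeD(2)[OF assms(1,2) place_uminus[OF assms(1,3)]] by simp

lemma place_fun:
  assumes "place G" "(a, c) \<in> G" "(a, e) \<in> G" shows "c = e"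
  using placeD(4)[OF assms(1), of "c - e"] place_diff[OF assms] by simp

lemma place_sum:
  assumes "place G" "\<And>x. x \<in> A \<Longrightarrow> (f x, g x) \<in> G"
  shows "(sum f A, sum g A) \<in> G"
  using assms(2) by (induction A rule: infinite_finite_induct)
    (auto simp: place_0_1[OF assms(1)] intro: placeD(2)[OF assms(1)])

definition place_poly :: "('w \<times> 'k) set \<Rightarrow> 'w poly \<Rightarrow> 'k poly \<Rightarrow> bool" where
  "place_poly G g h \<longleftrightarrow> (\<forall>i. (coeff g i, coeff h i) \<in> G)"

lemma place_poly_add:
  "place G \<Longrightarrow> place_poly G g h \<Longrightarrow> place_poly G g' h' \<Longrightarrow> place_poly G (g + g') (h + h')"
  by (auto simp: place_poly_def intro: placeD)

lemma place_poly_diff: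
  "place G \<Longrightarrow> place_poly G g h \<Longrightarrow> place_poly G g' h' \<Longrightarrow> place_poly G (g - g') (h - h')"
  by (auto simp: place_poly_def intro: place_diff)

lemma place_poly_mult:
  "place G \<Longrightarrow> place_poly G g h \<Longrightarrow> place_poly G g' h' \<Longrightarrow> place_poly G (g * g') (h * h')"
  by (auto simp: place_poly_def coeff_mult intro!: place_sum placeD(3))

lemma place_poly_monom:
  "place G \<Longrightarrow> (a, c) \<in> G \<Longrightarrow> place_poly G (monom a i) (monom c i)"
  by (auto simp: place_poly_def coeff_monom place_0_1)

lemma place_poly_map: "place G \<Longrightarrow> place_poly G (map_poly emb q) q"
  by (auto simp: place_poly_def coeff_map_poly intro: placeD(1))

section \<open>Chevalley's extension theorem: maximal places have valuation rings as domains\<close>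

definition max_place :: "('w \<times> 'k) set \<Rightarrow> bool" where
  "max_place G \<longleftrightarrow> place G \<and> (\<forall>G'. place G' \<longrightarrow> G \<subseteq> G' \<longrightarrow> G' = G)"

text \<open>Otherwise the localization of the domain at the elements of nonzero residue would carry
  a strictly larger place.\<close>

lemma max_place_inverse:
  assumes "max_place G" "(r, c) \<in> G" "c \<noteq> 0"
  shows "(inverse r, inverse c) \<in> G"
proof -
  have G: "place G" using assms(1) by (simp add: max_place_def)
  define G' where "G' = {(x / s, y / z) | x y s z. (x, y) \<in> G \<and> (s, z) \<in> G \<and> z \<noteq> 0}"
  have s0: "s \<noteq> 0" if "(s, z) \<in> G" "z \<noteq> 0" for s z
    using placeD(4)[OF G] that by blast
  have sub: "G \<subseteq> G'"
  proof
    fix p assume "p \<in> G"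
    then obtain x y where "p = (x / 1, y / 1)" "(x, y) \<in> G" by (cases p) auto
    then show "p \<in> G'" using place_0_1(2)[OF G] unfolding G'_def by fastforce
  qed
  have "place G'"
    unfolding place_def
  proof (intro conjI allI impI)
    fix c show "(emb c, c) \<in> G'" using sub placeD(1)[OF G] by blast
  next
    fix a c b e assume "(a, c) \<in> G'" "(b, e) \<in> G'"
    then obtain x y s z x' y' s' z' where *: "a = x / s" "c = y / z" "b = x' / s'" "e = y' / z'"
      "(x, y) \<in> G" "(s, z) \<in> G" "z \<noteq> 0" "(x', y') \<in> G" "(s', z') \<in> G" "z' \<noteq> 0"
      by (auto simp: G'_def)
    have "a + b = (x * s' + x' * s) / (s * s')" "c + e = (y * z' + y' * z) / (z * z')"
      using * s0 by (auto simp: field_simps)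
    moreover have "a * b = (x * x') / (s * s')" "c * e = (y * y') / (z * z')" using * by auto
    moreover have "(x * s' + x' * s, y * z' + y' * z) \<in> G" "(s * s', z * z') \<in> G"
      "(x * x', y * y') \<in> G" using * placeD(2,3)[OF G] by blast+
    moreover have "z * z' \<noteq> 0" using * by simp
    ultimately show "(a + b, c + e) \<in> G'" "(a * b, c * e) \<in> G'"
      unfolding G'_def by blast+
  next
    fix c assume "(0, c) \<in> G'"
    then obtain x y s z where *: "0 = x / s" "c = y / z" "(x, y) \<in> G" "(s, z) \<in> G" "z \<noteq> 0"
      by (auto simp: G'_def)
    then have "x = 0" using s0 by auto
    then show "c = 0" using * placeD(4)[OF G] by auto
  qed
  then have "G' = G" using assms(1) sub by (auto simp: max_place_def)
  moreover have "(1 / r, 1 / c) \<in> G'"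
    using assms(2,3) place_0_1(2)[OF G] unfolding G'_def by blast
  ultimately show ?thesis by (simp add: inverse_eq_divide)
qed

text \<open>If the reductions of all relations satisfied by \<open>a\<close> had a common root
  \<open>c\<close>, sending \<open>a\<close> to \<open>c\<close> would extend the place. Over an
  algebraically closed field an ideal of polynomials without a common root contains 1.\<close>

lemma max_place_relation:
  assumes ac: "alg_closed TYPE('k)" and "max_place G" "a \<notin> Domain G"
  shows "\<exists>g. place_poly G g 1 \<and> poly g a = 0"
proof -
  have G: "place G" using assms(2) by (simp add: max_place_def)
  define J where "J = {h. \<exists>g. place_poly G g h \<and> poly g a = 0}"
  have no_root: "\<exists>h\<in>J. poly h c \<noteq> 0" for c
  proof (rule ccontr)
    assume "\<not> ?thesis"
    then have J: "\<And>h. h \<in> J \<Longrightarrow> poly h c = 0" by blast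
    define G' where "G' = {(poly g a, poly h c) | g h. place_poly G g h}"
    have sub: "(x, y) \<in> G'" if "(x, y) \<in> G" for x y
      using place_poly_monom[OF G that, of 0] unfolding G'_def by (force simp: poly_monom)
    have "place G'"
      unfolding place_def
    proof (intro conjI allI impI)
      fix c show "(emb c, c) \<in> G'" using sub placeD(1)[OF G] by blast
    next
      fix x y x' y' assume "(x, y) \<in> G'" "(x', y') \<in> G'"
      then obtain g h g' h' where *: "x = poly g a" "y = poly h c" "x' = poly g' a" "y' = poly h' c"
        "place_poly G g h" "place_poly G g' h'" by (auto simp: G'_def)
      have "x + x' = poly (g + g') a" "y + y' = poly (h + h') c"
        "x * x' = poly (g * g') a" "y * y' = poly (h * h') c" using * by auto
      then show "(x + x', y + y') \<in> G'" "(x * x', y * y') \<in> G'"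
        using place_poly_add[OF G *(5,6)] place_poly_mult[OF G *(5,6)] unfolding G'_def by blast+
    next
      fix y assume "(0, y) \<in> G'"
      then obtain g h where "poly g a = 0" "y = poly h c" "place_poly G g h" by (auto simp: G'_def)
      then show "y = 0" using J by (auto simp: J_def)
    qed
    moreover have "G \<subseteq> G'" using sub by auto
    ultimately have "G' = G" using assms(2) by (auto simp: max_place_def)
    moreover have "(a, c) \<in> G'"
      using place_poly_monom[OF G place_0_1(2)[OF G], of 1] unfolding G'_def
      by (force simp: poly_monom)
    ultimately show False using assms(3) by auto
  qed
  have J_mult: "q * h \<in> J" if "h \<in> J" for q h
    using that place_poly_mult[OF G place_poly_map[OF G, of q]] unfolding J_def by fastforce
  have J_diff: "h - h' \<in> J" if hh: "h \<in> J" "h' \<in> J" for h h'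
  proof -
    obtain g g' where "place_poly G g h" "poly g a = 0" "place_poly G g' h'" "poly g' a = 0"
      using hh unfolding J_def by blast
    then show ?thesis using place_poly_diff[OF G, of g h g' h'] unfolding J_def by force
  qed
  have "\<exists>h. h \<in> J \<and> h \<noteq> 0" using no_root[of 0] by force
  \<comment> \<open>An element of least degree generates \<open>J\<close>; if it were not constant,
    each of its roots would be a common root.\<close>
  then obtain f where f: "f \<in> J" "f \<noteq> 0" "\<And>h. h \<in> J \<Longrightarrow> h \<noteq> 0 \<Longrightarrow> degree f \<le> degree h"
    using ex_has_least_nat[of "\<lambda>h. h \<in> J \<and> h \<noteq> 0" _ degree] by blast
  have dvd: "f dvd h" if "h \<in> J" for h
  proof (rule ccontr)
    assume "\<not> f dvd h"
    then have "h mod f \<noteq> 0" by auto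
    moreover have "h mod f \<in> J"
      using J_diff[OF that J_mult[OF f(1), of "h div f"]] by (simp add: minus_div_mult_eq_mod)
    ultimately show False using f(3)[of "h mod f"] degree_mod_less'[of f h] f(2) by auto
  qed
  have "degree f = 0"
  proof (rule ccontr)
    assume "degree f \<noteq> 0"
    then obtain c where "poly f c = 0" using ac by (auto simp: alg_closed_def)
    moreover obtain h where "h \<in> J" "poly h c \<noteq> 0" using no_root by blast
    moreover obtain q where "h = f * q" using dvd[OF \<open>h \<in> J\<close>] by (rule dvdE)
    ultimately show False by simp
  qed
  then obtain c where c: "f = [:c:]" by (rule degree_eq_zeroE)
  then have "[:inverse c:] * f = 1" using f(2) by (simp add: one_pCons)
  then have "1 \<in> J" using J_mult[OF f(1)] by metis
  then show ?thesis by (simp add: J_def)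
qed

text \<open>Of two relations 1 = m_1 a + ... for a and for its inverse, with coefficients in the
  maximal ideal, the shorter one lowers the degree of the longer one.\<close>

lemma place_relation_reduce:
  assumes "max_place G" "a \<noteq> 0" "place_poly G g 1" "poly g a = 0"
    and "place_poly G h 1" "poly h (inverse a) = 0" "degree h \<le> degree g"
  shows "\<exists>g'. place_poly G g' 1 \<and> poly g' a = 0 \<and> degree g' < degree g"
proof -
  have G: "place G" using assms(1) by (simp add: max_place_def)
  have "(coeff h 0, coeff 1 0) \<in> G" using assms(5) unfolding place_poly_def by blast
  then have h0: "(coeff h 0, 1) \<in> G" by simp
  then have h0n: "coeff h 0 \<noteq> 0" using placeD(4)[OF G] by force
  have dg: "degree g > 0"
  proof (rule ccontr)
    assume "\<not> ?thesis"
    then obtain b where b: "g = [:b:]" using degree_eq_zeroE by blast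
    with assms(4) have "g = 0" by simp
    moreover have "(coeff g 0, coeff 1 0) \<in> G" using assms(3) unfolding place_poly_def by blast
    ultimately show False using placeD(4)[OF G, of 1] by simp
  qed
  define n where "n = degree g"
  define m where "m = degree h"
  \<comment> \<open>The reversed polynomial \<open>r\<close> vanishes at \<open>a\<close>, reduces
    to \<open>monom 1 m\<close> and has leading coefficient \<open>coeff h 0\<close>. Subtracting
    \<open>s\<close> times a shift of it removes the leading term of \<open>g\<close>; the reduction
    stays 1 because \<open>s\<close> has residue 0.\<close>
  define s where "s = coeff g n * inverse (coeff h 0)"
  define r where "r = reflect_poly h"
  have "(coeff g n, coeff 1 n) \<in> G" using assms(3) unfolding place_poly_def by blast
  then have "(coeff g n, 0) \<in> G" using dg by (simp add: n_def)
  from placeD(3)[OF G this max_place_inverse[OF assms(1) h0]]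
  have s: "(s, 0) \<in> G" by (simp add: s_def)
  have "place_poly G r (monom 1 m)"
    unfolding place_poly_def
  proof
    fix i
    have "coeff (monom (1::'k) m) i = (if i > m then 0 else coeff 1 (m - i))"
      by (auto simp: coeff_monom)
    moreover have "coeff r i = (if i > m then 0 else coeff h (m - i))"
      by (simp add: r_def coeff_reflect_poly m_def)
    moreover have "(coeff h (m - i), coeff 1 (m - i)) \<in> G"
      using assms(5) unfolding place_poly_def by blast
    ultimately show "(coeff r i, coeff (monom 1 m) i) \<in> G"
      using place_0_1(1)[OF G] by (cases "i > m") (simp_all only: if_True if_False simp_thms)
  qed
  from place_poly_diff[OF G assms(3) place_poly_mult[OF G place_poly_monom[OF G s, of "n - m"] this]]
  have 1: "place_poly G (g - monom s (n - m) * r) 1" by simp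
  have "poly r a = 0" using assms(2,6) by (simp add: r_def poly_reflect_poly_nz)
  then have 2: "poly (g - monom s (n - m) * r) a = 0" using assms(4) by simp
  have co: "coeff (g - monom s (n - m) * r) i = 0" if "i \<ge> n" for i
  proof (cases "i = n")
    case True
    have "coeff r m = coeff h 0" by (simp add: r_def coeff_reflect_poly m_def)
    then show ?thesis using True assms(7) h0n
      by (simp add: coeff_monom_mult s_def n_def m_def)
  next
    case False
    then have "i > n" using that by simp
    then have "coeff g i = 0" by (simp add: n_def coeff_eq_0)
    moreover have "coeff r (i - (n - m)) = 0" using \<open>i > n\<close> assms(7)
      by (auto simp: r_def coeff_reflect_poly n_def m_def)
    ultimately show ?thesis by (simp add: coeff_monom_mult)
  qed
  have "degree (g - monom s (n - m) * r) \<le> n - 1"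
    by (rule degree_le) (use co in auto)
  then have "degree (g - monom s (n - m) * r) < degree g" using dg by (simp add: n_def)
  with 1 2 show ?thesis by blast
qed

text \<open>If neither \<open>a\<close> nor its inverse had a residue, both would satisfy relations
  reducing to 1. Taken of least degree, the one that is not shorter than the other could still be
  shortened.\<close>

lemma max_place_total:
  assumes "alg_closed TYPE('k)" "max_place G"
  shows "a \<in> Domain G \<or> inverse a \<in> Domain G"
proof (rule ccontr)
  assume n: "\<not> ?thesis"
  have G: "place G" using assms(2) by (simp add: max_place_def)
  have a0: "a \<noteq> 0" using n place_0_1(1)[OF G] by auto
  define Q where "Q b g \<longleftrightarrow> place_poly G g 1 \<and> poly g b = 0" for b g
  obtain g where g: "Q a g" "\<And>g'. Q a g' \<Longrightarrow> degree g \<le> degree g'"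
    using max_place_relation[OF assms, of a] n ex_has_least_nat[of "Q a" _ degree]
    unfolding Q_def by blast
  obtain h where h: "Q (inverse a) h" "\<And>g'. Q (inverse a) g' \<Longrightarrow> degree h \<le> degree g'"
    using max_place_relation[OF assms, of "inverse a"] n ex_has_least_nat[of "Q (inverse a)" _ degree]
    unfolding Q_def by blast
  consider "degree h \<le> degree g" | "degree g \<le> degree h" by linarith
  then show False
  proof cases
    case 1
    then show False using place_relation_reduce[OF assms(2) a0, of g h] g h
      unfolding Q_def by (meson linorder_not_less)
  next
    case 2
    then show False using place_relation_reduce[OF assms(2), of "inverse a" h g] g h a0
      unfolding Q_def by (simp) (meson linorder_not_less)
  qed
qed

lemma max_place_exists:
  assumes "place G0"
  shows "\<exists>G. G0 \<subseteq> G \<and> max_place G"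
proof -
  define A where "A = {G. place G \<and> G0 \<subseteq> G}"
  have "\<exists>M\<in>A. \<forall>X\<in>A. M \<subseteq> X \<longrightarrow> X = M"
  proof (rule subset_Zorn_nonempty)
    show "A \<noteq> {}" using assms by (auto simp: A_def)
  next
    fix C assume C: "C \<noteq> {}" "subset.chain A C"
    have CA: "\<And>G. G \<in> C \<Longrightarrow> place G" "\<And>G. G \<in> C \<Longrightarrow> G0 \<subseteq> G"
      using C(2) by (auto simp: A_def subset_chain_def)
    have "place (\<Union>C)"
      unfolding place_def
    proof (intro conjI allI impI)
      fix c show "(emb c, c) \<in> \<Union>C" using C(1) CA(1) placeD(1) by blast
    next
      fix a c b e assume "(a, c) \<in> \<Union>C" "(b, e) \<in> \<Union>C"
      then obtain G G' where "G \<in> C" "G' \<in> C" "(a, c) \<in> G" "(b, e) \<in> G'" by blast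
      moreover have "G \<subseteq> G' \<or> G' \<subseteq> G" using C(2) calculation by (auto simp: subset_chain_def)
      ultimately obtain H where "H \<in> C" "(a, c) \<in> H" "(b, e) \<in> H" by blast
      then show "(a + b, c + e) \<in> \<Union>C" "(a * b, c * e) \<in> \<Union>C"
        using CA(1) placeD(2,3) by blast+
    next
      fix c assume "(0, c) \<in> \<Union>C"
      then show "c = 0" using CA(1) placeD(4) by blast
    qed
    then show "\<Union>C \<in> A" using C(1) CA(2) by (auto simp: A_def)
  qed
  then obtain M where "place M" "G0 \<subseteq> M" "\<forall>X\<in>A. M \<subseteq> X \<longrightarrow> X = M"
    by (auto simp: A_def)
  moreover have "X \<in> A" if "place X" "M \<subseteq> X" for X using that \<open>G0 \<subseteq> M\<close> by (auto simp: A_def)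
  ultimately show ?thesis unfolding max_place_def by blast
qed

end

text \<open>A valuation ring \<open>V\<close> with maximal ideal \<open>M\<close> whose residue
  field is \<open>'k\<close> itself, realized inside \<open>V\<close> by the constants. This
  coefficient field is what allows generic constants to be chosen later.\<close>

locale valued_field = field_embedding emb
  for emb :: "'k::field \<Rightarrow> 'w::field" +
  fixes V M :: "'w set"
  assumes V_add: "a \<in> V \<Longrightarrow> b \<in> V \<Longrightarrow> a + b \<in> V"
    and V_mult: "a \<in> V \<Longrightarrow> b \<in> V \<Longrightarrow> a * b \<in> V"
    and V_emb: "emb c \<in> V"
    and V_total: "a \<in> V \<or> inverse a \<in> V"
    and M_iff: "a \<in> M \<longleftrightarrow> a \<in> V \<and> (a = 0 \<or> inverse a \<notin> V)"
    and residue_exists: "a \<in> V \<Longrightarrow> \<exists>c. a - emb c \<in> M"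

text \<open>By maximality an element of nonzero residue has its inverse in the domain, so the
  nonunits are exactly the elements of residue 0.\<close>

lemma (in field_embedding) max_place_valued_field:
  assumes ac: "alg_closed TYPE('k)" and mp: "max_place G"
  shows "valued_field emb (Domain G) {a. (a, 0) \<in> G}"
proof unfold_locales
  have G: "place G" using mp by (simp add: max_place_def)
  show "a + b \<in> Domain G" if "a \<in> Domain G" "b \<in> Domain G" for a b
    using that placeD(2)[OF G] by blast
  show "a * b \<in> Domain G" if "a \<in> Domain G" "b \<in> Domain G" for a b
    using that placeD(3)[OF G] by blast
  show "emb c \<in> Domain G" for c using placeD(1)[OF G] by blast
  show "a \<in> Domain G \<or> inverse a \<in> Domain G" for a by (rule max_place_total[OF ac mp])
  show "a \<in> {a. (a, 0) \<in> G} \<longleftrightarrow> a \<in> Domain G \<and> (a = 0 \<or> inverse a \<notin> Domain G)" for a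
  proof (cases "a = 0")
    case True
    then show ?thesis using place_0_1(1)[OF G] by blast
  next
    case False
    show ?thesis
    proof
      assume a: "a \<in> {a. (a, 0) \<in> G}"
      have "inverse a \<notin> Domain G"
      proof
        assume "inverse a \<in> Domain G"
        then obtain c where "(inverse a, c) \<in> G" by blast
        from placeD(3)[OF G _ this, of a 0] a False have "(1, 0) \<in> G" by simp
        then show False using place_fun[OF G place_0_1(2)[OF G]] by force
      qed
      then show "a \<in> Domain G \<and> (a = 0 \<or> inverse a \<notin> Domain G)" using a by blast
    next
      assume a: "a \<in> Domain G \<and> (a = 0 \<or> inverse a \<notin> Domain G)"
      then obtain c where "(a, c) \<in> G" by blast
      then have "c = 0" using a False max_place_inverse[OF mp] by blast
      then show "a \<in> {a. (a, 0) \<in> G}" using \<open>(a, c) \<in> G\<close> by simp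
    qed
  qed
  show "\<exists>c. a - emb c \<in> {a. (a, 0) \<in> G}" if "a \<in> Domain G" for a
  proof -
    obtain c where "(a, c) \<in> G" using \<open>a \<in> Domain G\<close> by blast
    from place_diff[OF G this placeD(1)[OF G, of c]] show ?thesis by auto
  qed
qed

section \<open>Comparison of elements by their values\<close>

context valued_field
begin

lemma V_0: "0 \<in> V" and V_1: "1 \<in> V" and V_uminus: "a \<in> V \<Longrightarrow> - a \<in> V"
  using V_emb[of 0] V_emb[of 1] V_mult[OF V_emb[of "- 1"], of a] by (auto simp: emb_uminus)

lemma V_diff: "a \<in> V \<Longrightarrow> b \<in> V \<Longrightarrow> a - b \<in> V"
  using V_add[of a "- b"] V_uminus by simp

lemma M_V: "a \<in> M \<Longrightarrow> a \<in> V" by (simp add: M_iff)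
lemma M_0: "0 \<in> M" by (simp add: M_iff V_0)

text \<open>Divisibility in \<open>V\<close> plays the role of comparing absolute values, so that no
  value group has to be built: \<open>M\<close> consists of the elements below 1, and 0 is the least
  element.\<close>

definition vle :: "'w \<Rightarrow> 'w \<Rightarrow> bool" (infix "\<preceq>" 50) where
  "a \<preceq> b \<longleftrightarrow> (\<exists>v\<in>V. a = v * b)"

abbreviation vlt :: "'w \<Rightarrow> 'w \<Rightarrow> bool" (infix "\<prec>" 50) where
  "a \<prec> b \<equiv> \<not> b \<preceq> a"

definition veq :: "'w \<Rightarrow> 'w \<Rightarrow> bool" (infix "\<approx>" 50) where
  "a \<approx> b \<longleftrightarrow> a \<preceq> b \<and> b \<preceq> a"

lemma vle_refl [simp]: "a \<preceq> a" and zero_vle [simp]: "0 \<preceq> a"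
  unfolding vle_def using V_0 V_1 by force+

lemma vle_zero [simp]: "a \<preceq> 0 \<longleftrightarrow> a = 0"
  unfolding vle_def using V_0 by auto

lemma vle_trans: "a \<preceq> b \<Longrightarrow> b \<preceq> c \<Longrightarrow> a \<preceq> c"
  unfolding vle_def using V_mult by (metis mult.assoc)

lemma vle_iff: "b \<noteq> 0 \<Longrightarrow> a \<preceq> b \<longleftrightarrow> a / b \<in> V"
  unfolding vle_def by (metis nonzero_mult_div_cancel_right nonzero_eq_divide_eq)

lemma vle_total: "a \<preceq> b \<or> b \<preceq> a"
  using V_total[of "a / b"] by (cases "a = 0 \<or> b = 0") (auto simp: vle_iff)

lemma vlt_iff: "b \<noteq> 0 \<Longrightarrow> a \<prec> b \<longleftrightarrow> a / b \<in> M"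
  using V_total[of "a / b"] by (cases "a = 0") (auto simp: vle_iff M_iff V_0)

lemma vlt_imp_vle: "a \<prec> b \<Longrightarrow> a \<preceq> b" using vle_total by blast

lemma vlt_vle_trans: "a \<prec> b \<Longrightarrow> b \<preceq> c \<Longrightarrow> a \<prec> c"
  and vle_vlt_trans: "a \<preceq> b \<Longrightarrow> b \<prec> c \<Longrightarrow> a \<prec> c"
  using vle_trans by blast+

lemma vle_mult: "a \<preceq> b \<Longrightarrow> c \<preceq> d \<Longrightarrow> a * c \<preceq> b * d"
  unfolding vle_def by (metis V_mult mult.assoc mult.left_commute)

lemma vle_mult_cancel: "c \<noteq> 0 \<Longrightarrow> a * c \<preceq> b * c \<longleftrightarrow> a \<preceq> b"
  by (auto simp: vle_def)

lemma vlt_mult: "a \<prec> b \<Longrightarrow> c \<preceq> d \<Longrightarrow> d \<noteq> 0 \<Longrightarrow> a * c \<prec> b * d"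
  by (metis vle_mult vle_mult_cancel vle_refl vle_trans)

lemma vle_uminus [simp]: "- a \<preceq> b \<longleftrightarrow> a \<preceq> b" "b \<preceq> - a \<longleftrightarrow> b \<preceq> a"
  unfolding vle_def using V_uminus by (metis minus_minus mult_minus_left mult_minus_right)+

lemma vle_add: "a \<preceq> c \<Longrightarrow> b \<preceq> c \<Longrightarrow> a + b \<preceq> c"
  unfolding vle_def using V_add by (metis distrib_right)

lemma vle_diff: "a \<preceq> c \<Longrightarrow> b \<preceq> c \<Longrightarrow> a - b \<preceq> c"
  using vle_add[of a c "- b"] by simp

lemma vlt_add: "a \<prec> c \<Longrightarrow> b \<prec> c \<Longrightarrow> a + b \<prec> c"
  using vle_total[of a b] vle_add[of a b b] vle_add[of a a b] vle_trans vle_refl by metis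

lemma veq_refl [simp]: "a \<approx> a" by (simp add: veq_def)
lemma veq_sym: "a \<approx> b \<Longrightarrow> b \<approx> a" by (simp add: veq_def)
lemma veq_trans: "a \<approx> b \<Longrightarrow> b \<approx> c \<Longrightarrow> a \<approx> c" using vle_trans by (auto simp: veq_def)
lemma veq_mult: "a \<approx> b \<Longrightarrow> c \<approx> d \<Longrightarrow> a * c \<approx> b * d" using vle_mult by (auto simp: veq_def)
lemma veq_zero [simp]: "a \<approx> 0 \<longleftrightarrow> a = 0" "0 \<approx> a \<longleftrightarrow> a = 0" by (auto simp: veq_def)
lemma veq_vle: "a \<approx> b \<Longrightarrow> c \<approx> d \<Longrightarrow> a \<preceq> c \<longleftrightarrow> b \<preceq> d"
  unfolding veq_def using vle_trans by blast
lemma veq_power: "a \<approx> b \<Longrightarrow> a ^ n \<approx> b ^ n"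
  by (induction n) (auto intro: veq_mult)

lemma vle_power: "a \<preceq> b \<Longrightarrow> a ^ n \<preceq> b ^ n"
  by (induction n) (auto intro: vle_mult)

lemma vlt_power: "a \<prec> b \<Longrightarrow> n > 0 \<Longrightarrow> a ^ n \<prec> b ^ n"
proof (induction n)
  case (Suc n)
  have "b \<noteq> 0" using Suc.prems by auto
  then show ?case using vlt_mult[OF Suc.prems(1) vle_power[OF vlt_imp_vle[OF Suc.prems(1)], of n]] by simp
qed simp

lemma veq_inverse: "a \<approx> b \<Longrightarrow> inverse a \<approx> inverse b"
proof (cases "a = 0 \<or> b = 0")
  case False
  assume "a \<approx> b"
  then have "a * (inverse a * inverse b) \<approx> b * (inverse a * inverse b)" by (intro veq_mult) auto
  moreover have "a * (inverse a * inverse b) = inverse b" "b * (inverse a * inverse b) = inverse a"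
    using False by (auto simp: field_simps)
  ultimately show ?thesis by (simp add: veq_sym)
qed (auto simp: veq_def)

lemma veq_add_vlt: "a \<prec> b \<Longrightarrow> a + b \<approx> b"
proof -
  assume a: "a \<prec> b"
  have "b \<preceq> a + b"
  proof (rule ccontr)
    assume "a + b \<prec> b"
    moreover have "- a \<prec> b" using a by simp
    ultimately have "(a + b) + (- a) \<prec> b" by (rule vlt_add)
    then show False by simp
  qed
  then show ?thesis using a vlt_imp_vle vle_add[of a b b] by (auto simp: veq_def)
qed

lemma veq_diff_vlt: "a \<prec> b \<Longrightarrow> b - a \<approx> b" "a \<prec> b \<Longrightarrow> a - b \<approx> b"
  using veq_add_vlt[where a = "- a" and b = b] veq_add_vlt[where a = a and b = "- b"]
  by (auto simp: veq_def)

lemma emb_unit: "c \<noteq> 0 \<Longrightarrow> emb c \<approx> 1"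
  unfolding veq_def vle_def
  by (metis V_emb emb_eq_0_iff emb_inverse left_inverse mult.right_neutral)

lemma vlt_1_iff: "a \<prec> 1 \<longleftrightarrow> a \<in> M" and vle_1_iff: "a \<preceq> 1 \<longleftrightarrow> a \<in> V"
  using vlt_iff[of 1 a] vle_iff[of 1 a] by auto

lemma M_add: "a \<in> M \<Longrightarrow> b \<in> M \<Longrightarrow> a + b \<in> M"
  using vlt_add[where a = a and b = b and c = 1] by (simp add: vlt_1_iff)

lemma M_mult: "a \<in> M \<Longrightarrow> b \<in> V \<Longrightarrow> a * b \<in> M"
  using vlt_mult[where a = a and b = 1 and c = b and d = 1] by (simp add: vlt_1_iff vle_1_iff)

lemma M_uminus: "a \<in> M \<Longrightarrow> - a \<in> M" using vlt_1_iff[of a] vlt_1_iff[of "- a"] by simp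

lemma M_diff: "a \<in> M \<Longrightarrow> b \<in> M \<Longrightarrow> a - b \<in> M" using M_add[of a "- b"] M_uminus by simp

lemma emb_in_M: "emb c \<in> M \<longleftrightarrow> c = 0"
  using emb_unit[of c] vlt_1_iff[of "emb c"] M_0 by (auto simp: veq_def)

definition res :: "'w \<Rightarrow> 'k" where "res a = (THE c. a - emb c \<in> M)"

lemma res_unique: "a - emb c \<in> M \<Longrightarrow> a - emb e \<in> M \<Longrightarrow> c = e"
  using M_diff[of "a - emb e" "a - emb c"] emb_in_M[of "c - e"] by (simp add: emb_diff)

lemma res_eqI: "a - emb c \<in> M \<Longrightarrow> res a = c"
  unfolding res_def using res_unique by blast

lemma res: "a \<in> V \<Longrightarrow> a - emb (res a) \<in> M"
  using residue_exists res_eqI by blast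

text \<open>Cancellation in \<open>emb c * a - b\<close> happens for one constant only, the residue
  of \<open>b / a\<close>. Finitely many such cancellations are avoided below by one choice of
  \<open>c\<close>, because \<open>'k\<close> is infinite.\<close>

lemma veq_emb_minus:
  assumes "b \<preceq> a" "a \<noteq> 0" "c \<noteq> res (b / a)"
  shows "emb c * a - b \<approx> a"
proof -
  have v: "b / a \<in> V" using assms vle_iff by blast
  have "emb c - b / a \<in> V" using v V_emb V_diff by blast
  moreover have "emb c - b / a \<notin> M"
    using assms(3) res_eqI[of "b / a" c] M_uminus[of "emb c - b / a"] by auto
  ultimately have "emb c - b / a \<approx> 1" using vlt_1_iff vle_1_iff by (auto simp: veq_def)
  from veq_mult[OF this veq_refl[of a]] show ?thesis using assms(2) by (simp add: algebra_simps)
qed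

lemma vle_prod:
  "finite A \<Longrightarrow> (\<And>i. i \<in> A \<Longrightarrow> f i \<preceq> g i) \<Longrightarrow> prod f A \<preceq> prod g A"
  by (induction A rule: finite_induct) (auto intro: vle_mult)

lemma vlt_prod:
  assumes "finite A" "\<And>i. i \<in> A \<Longrightarrow> f i \<preceq> g i" "\<And>i. i \<in> A \<Longrightarrow> g i \<noteq> 0" "j \<in> A" "f j \<prec> g j"
  shows "prod f A \<prec> prod g A"
proof -
  have "prod f (A - {j}) \<preceq> prod g (A - {j})" using assms by (intro vle_prod) auto
  moreover have "prod g (A - {j}) \<noteq> 0" using assms by auto
  ultimately have "f j * prod f (A - {j}) \<prec> g j * prod g (A - {j})" using assms(5) vlt_mult by blast
  then show ?thesis using assms(1,4) by (simp add: prod.remove)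
qed

lemma finite_vmax:
  "finite A \<Longrightarrow> A \<noteq> {} \<Longrightarrow> \<exists>a\<in>A. \<forall>b\<in>A. b \<preceq> a"
proof (induction A rule: finite_ne_induct)
  case (insert x F)
  then obtain a where a: "a \<in> F" "\<And>b. b \<in> F \<Longrightarrow> b \<preceq> a" by blast
  show ?case
  proof (cases "x \<preceq> a")
    case True
    then show ?thesis using a by (intro bexI[of _ a]) auto
  next
    case False
    then have "b \<preceq> x" if "b \<in> F" for b using vle_trans[OF a(2)[OF that] vlt_imp_vle] by blast
    then show ?thesis by (intro bexI[of _ x]) auto
  qed
qed auto

lemma finite_vmin:
  "finite A \<Longrightarrow> A \<noteq> {} \<Longrightarrow> \<exists>a\<in>A. \<forall>b\<in>A. a \<preceq> b"
proof (induction A rule: finite_ne_induct)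
  case (insert x F)
  then obtain a where a: "a \<in> F" "\<And>b. b \<in> F \<Longrightarrow> a \<preceq> b" by blast
  show ?case
  proof (cases "a \<preceq> x")
    case True
    then show ?thesis using a by (intro bexI[of _ a]) auto
  next
    case False
    then have "x \<preceq> b" if "b \<in> F" for b using vle_trans[OF vlt_imp_vle a(2)[OF that]] by blast
    then show ?thesis by (intro bexI[of _ x]) auto
  qed
qed auto

end

context field_embedding
begin

subsection \<open>Polynomial functions and subfields\<close>

text \<open>Coefficients are restricted to constants of the small field. The same function therefore
  makes sense over every intermediate field, and an inequality between two such functions can be
  transported to other points.\<close>

inductive_set pfun :: "nat \<Rightarrow> ((nat \<Rightarrow> 'w) \<Rightarrow> 'w) set" for N where
  pfun_const: "(\<lambda>_. emb c) \<in> pfun N"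
| pfun_coord: "i < N \<Longrightarrow> (\<lambda>y. y i) \<in> pfun N"
| pfun_add: "f \<in> pfun N \<Longrightarrow> g \<in> pfun N \<Longrightarrow> (\<lambda>y. f y + g y) \<in> pfun N"
| pfun_mult: "f \<in> pfun N \<Longrightarrow> g \<in> pfun N \<Longrightarrow> (\<lambda>y. f y * g y) \<in> pfun N"

lemma pfun_0: "(\<lambda>_. 0) \<in> pfun N" and pfun_1: "(\<lambda>_. 1) \<in> pfun N"
  using pfun_const[of 0] pfun_const[of 1] by auto

lemma pfun_uminus: "f \<in> pfun N \<Longrightarrow> (\<lambda>y. - f y) \<in> pfun N"
  using pfun_mult[OF pfun_const[of "- 1"], of f] by (simp add: emb_uminus)

lemma pfun_diff: "f \<in> pfun N \<Longrightarrow> g \<in> pfun N \<Longrightarrow> (\<lambda>y. f y - g y) \<in> pfun N"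
  using pfun_add[OF _ pfun_uminus, of f N g] by simp

lemma pfun_sum: "(\<And>x. x \<in> A \<Longrightarrow> f x \<in> pfun N) \<Longrightarrow> (\<lambda>y. \<Sum>x\<in>A. f x y) \<in> pfun N"
  by (induction A rule: infinite_finite_induct) (auto intro: pfun_add pfun_0)

lemma pfun_prod: "(\<And>x. x \<in> A \<Longrightarrow> f x \<in> pfun N) \<Longrightarrow> (\<lambda>y. \<Prod>x\<in>A. f x y) \<in> pfun N"
  by (induction A rule: infinite_finite_induct) (auto intro: pfun_mult pfun_1)

lemma pfun_power: "f \<in> pfun N \<Longrightarrow> (\<lambda>y. f y ^ n) \<in> pfun N"
  by (induction n) (auto intro: pfun_mult pfun_1)

lemma pfun_cong: "f \<in> pfun N \<Longrightarrow> (\<And>i. i < N \<Longrightarrow> y i = y' i) \<Longrightarrow> f y = f y'"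
  by (induction rule: pfun.induct) auto

text \<open>The exponent \<open>e\<close> depends on \<open>f\<close> alone and not on the point
  \<open>z\<close>, so that both sides of an inequality can later be brought to one common
  factor.\<close>

lemma pfun_clear_denominators:
  assumes "f \<in> pfun N" "\<And>i. i < N \<Longrightarrow> R i \<in> pfun N'" "\<And>i. i < N \<Longrightarrow> S i \<in> pfun N'"
  shows "\<exists>g\<in>pfun N'. \<exists>e. \<forall>z. (\<forall>i<N. S i z \<noteq> 0) \<longrightarrow>
    g z = (\<Prod>i<N. S i z) ^ e * f (\<lambda>i. R i z / S i z)"
  using assms(1)
proof (induction rule: pfun.induct)
  case (pfun_const c)
  show ?case by (rule bexI[OF _ pfun.pfun_const[of c]], rule exI[of _ 0]) auto
next
  case (pfun_coord i)
  have "(\<lambda>z. R i z * (\<Prod>j\<in>{..<N} - {i}. S j z)) \<in> pfun N'"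
    using assms(2,3) pfun_coord by (intro pfun_mult pfun_prod) auto
  moreover have "R i z * (\<Prod>j\<in>{..<N} - {i}. S j z) = (\<Prod>j<N. S j z) ^ 1 * (R i z / S i z)"
    if "\<forall>j<N. S j z \<noteq> 0" for z
  proof -
    have "(\<Prod>j<N. S j z) = S i z * (\<Prod>j\<in>{..<N} - {i}. S j z)"
      using pfun_coord by (intro prod.remove) auto
    then show ?thesis using pfun_coord that by simp
  qed
  ultimately show ?case
    by (intro bexI[of _ "\<lambda>z. R i z * (\<Prod>j\<in>{..<N} - {i}. S j z)"] exI[of _ 1]) blast+
next
  case (pfun_add f g)
  then obtain f' e g' e' where *: "f' \<in> pfun N'" "g' \<in> pfun N'"
    "\<And>z. (\<forall>i<N. S i z \<noteq> 0) \<Longrightarrow> f' z = (\<Prod>i<N. S i z) ^ e * f (\<lambda>i. R i z / S i z)"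
    "\<And>z. (\<forall>i<N. S i z \<noteq> 0) \<Longrightarrow> g' z = (\<Prod>i<N. S i z) ^ e' * g (\<lambda>i. R i z / S i z)" by blast
  have "(\<lambda>z. f' z * (\<Prod>i<N. S i z) ^ e' + g' z * (\<Prod>i<N. S i z) ^ e) \<in> pfun N'"
    using * assms(3) by (intro pfun.pfun_add pfun.pfun_mult pfun_power pfun_prod) auto
  then show ?case
    by (rule bexI[rotated], intro exI[of _ "e + e'"]) (auto simp: * power_add algebra_simps)
next
  case (pfun_mult f g)
  then obtain f' e g' e' where *: "f' \<in> pfun N'" "g' \<in> pfun N'"
    "\<And>z. (\<forall>i<N. S i z \<noteq> 0) \<Longrightarrow> f' z = (\<Prod>i<N. S i z) ^ e * f (\<lambda>i. R i z / S i z)"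
    "\<And>z. (\<forall>i<N. S i z \<noteq> 0) \<Longrightarrow> g' z = (\<Prod>i<N. S i z) ^ e' * g (\<lambda>i. R i z / S i z)" by blast
  have "(\<lambda>z. f' z * g' z) \<in> pfun N'" using * by (intro pfun.pfun_mult) auto
  then show ?case
    by (rule bexI[rotated], intro exI[of _ "e + e'"]) (auto simp: * power_add algebra_simps)
qed

section \<open>Intermediate fields, simple extensions and linear algebra over them\<close>

definition subfield_emb :: "'w set \<Rightarrow> bool" where
  "subfield_emb E \<longleftrightarrow> range emb \<subseteq> E \<and>
     (\<forall>a\<in>E. \<forall>b\<in>E. a + b \<in> E \<and> a * b \<in> E) \<and> (\<forall>a\<in>E. - a \<in> E \<and> inverse a \<in> E)"

lemma subfieldD:
  assumes "subfield_emb E"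
  shows "emb c \<in> E" "a \<in> E \<Longrightarrow> b \<in> E \<Longrightarrow> a + b \<in> E" "a \<in> E \<Longrightarrow> b \<in> E \<Longrightarrow> a * b \<in> E"
    "a \<in> E \<Longrightarrow> - a \<in> E" "a \<in> E \<Longrightarrow> inverse a \<in> E"
    "a \<in> E \<Longrightarrow> b \<in> E \<Longrightarrow> a - b \<in> E" "a \<in> E \<Longrightarrow> b \<in> E \<Longrightarrow> a / b \<in> E" "0 \<in> E" "1 \<in> E"
proof -
  show *: "emb c \<in> E" "a \<in> E \<Longrightarrow> b \<in> E \<Longrightarrow> a + b \<in> E" "a \<in> E \<Longrightarrow> b \<in> E \<Longrightarrow> a * b \<in> E"
    "a \<in> E \<Longrightarrow> - a \<in> E" "a \<in> E \<Longrightarrow> inverse a \<in> E" for a b c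
    using assms unfolding subfield_emb_def by auto
  show "a \<in> E \<Longrightarrow> b \<in> E \<Longrightarrow> a - b \<in> E" using *(2)[of a "- b"] *(4)[of b] by simp
  show "a \<in> E \<Longrightarrow> b \<in> E \<Longrightarrow> a / b \<in> E" using *(3)[of a "inverse b"] *(5)[of b] by (simp add: divide_inverse)
  show "0 \<in> E" "1 \<in> E" using *(1)[of 0] *(1)[of 1] by auto
qed

lemma subfield_sum: "subfield_emb E \<Longrightarrow> (\<And>x. x \<in> A \<Longrightarrow> f x \<in> E) \<Longrightarrow> sum f A \<in> E"
  by (induction A rule: infinite_finite_induct) (auto simp: subfieldD)

lemma pfun_in_subfield:
  assumes "subfield_emb E" "f \<in> pfun N" "\<And>i. i < N \<Longrightarrow> y i \<in> E"
  shows "f y \<in> E"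
  using assms(2,3) by (induction rule: pfun.induct) (auto intro: subfieldD[OF assms(1)])

definition polys_over :: "'w set \<Rightarrow> 'w poly set" where
  "polys_over E = {p. \<forall>i. coeff p i \<in> E}"

lemma polys_over_coeff: "p \<in> polys_over E \<Longrightarrow> coeff p i \<in> E" by (simp add: polys_over_def)

lemma polys_over_add:
  "subfield_emb E \<Longrightarrow> p \<in> polys_over E \<Longrightarrow> q \<in> polys_over E \<Longrightarrow> p + q \<in> polys_over E"
  and polys_over_diff:
  "subfield_emb E \<Longrightarrow> p \<in> polys_over E \<Longrightarrow> q \<in> polys_over E \<Longrightarrow> p - q \<in> polys_over E"
  and polys_over_uminus: "subfield_emb E \<Longrightarrow> p \<in> polys_over E \<Longrightarrow> - p \<in> polys_over E"
  and polys_over_mult: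
  "subfield_emb E \<Longrightarrow> p \<in> polys_over E \<Longrightarrow> q \<in> polys_over E \<Longrightarrow> p * q \<in> polys_over E"
  and polys_over_monom: "subfield_emb E \<Longrightarrow> a \<in> E \<Longrightarrow> monom a n \<in> polys_over E"
  and polys_over_const: "subfield_emb E \<Longrightarrow> a \<in> E \<Longrightarrow> [:a:] \<in> polys_over E"
  and polys_over_smult: "subfield_emb E \<Longrightarrow> a \<in> E \<Longrightarrow> p \<in> polys_over E \<Longrightarrow> smult a p \<in> polys_over E"
  by (auto simp: polys_over_def coeff_mult coeff_monom coeff_pCons subfieldD
      intro!: subfield_sum subfieldD(3) split: nat.splits)

lemma polys_over_power:
  "subfield_emb E \<Longrightarrow> p \<in> polys_over E \<Longrightarrow> p ^ n \<in> polys_over E"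
  using polys_over_const[of E 1] by (induction n) (auto simp: polys_over_mult subfieldD one_pCons)

text \<open>Removing leading terms only ever uses quotients of coefficients, so quotient and
  remainder stay over \<open>E\<close>.\<close>

lemma polys_over_division:
  assumes E: "subfield_emb E" and q: "q \<in> polys_over E" "q \<noteq> 0" and p: "p \<in> polys_over E"
  shows "\<exists>h\<in>polys_over E. \<exists>r\<in>polys_over E. p = q * h + r \<and> (r = 0 \<or> degree r < degree q)"
  using p
proof (induction "degree p" arbitrary: p rule: less_induct)
  case less
  show ?case
  proof (cases "p = 0 \<or> degree p < degree q")
    case True
    then show ?thesis using less.prems polys_over_const[OF E subfieldD(8)[OF E]]
      by (intro bexI[of _ 0] bexI[of _ p]) auto
  next
    case False
    define s where "s = monom (lead_coeff p / lead_coeff q) (degree p - degree q)"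
    have s: "s \<in> polys_over E" unfolding s_def
      using less.prems q by (intro polys_over_monom E subfieldD(7)) (auto simp: polys_over_def)
    define p' where "p' = p - q * s"
    have p': "p' \<in> polys_over E" unfolding p'_def
      using less.prems q s by (intro polys_over_diff polys_over_mult E)
    have lc: "coeff p' i = 0" if "i \<ge> degree p" for i
    proof -
      have "coeff (q * s) i = (if i < degree p - degree q then 0
          else lead_coeff p / lead_coeff q * coeff q (i - (degree p - degree q)))"
        unfolding s_def by (simp add: mult.commute[of q] coeff_monom_mult)
      moreover have "coeff q (i - (degree p - degree q)) = 0" if "i > degree p"
        using that False by (intro coeff_eq_0) auto
      ultimately show ?thesis using that False q(2)
        by (cases "i = degree p") (auto simp: p'_def coeff_eq_0)
    qed
    have "p' = 0 \<or> degree p' < degree p"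
      using lc[of "degree p'"] by (metis leading_coeff_0_iff not_le)
    then consider "p' = 0" | "degree p' < degree p" by blast
    then obtain h r where "h \<in> polys_over E" "r \<in> polys_over E" "p' = q * h + r"
      "r = 0 \<or> degree r < degree q"
    proof cases
      case 1
      have z: "0 \<in> polys_over E" using polys_over_const[OF E subfieldD(8)[OF E]] by simp
      show ?thesis using that[OF z z] 1 by simp
    next
      case 2
      from less.hyps[OF 2 p'] show ?thesis using that by blast
    qed
    then show ?thesis
      using polys_over_add[OF E s, of h]
      by (intro bexI[of _ "s + h"] bexI[of _ r]) (auto simp: p'_def algebra_simps)
  qed
qed

text \<open>The simple extension \<open>E(x)\<close>. Fractions are used so that algebraic and
  transcendental \<open>x\<close> are treated alike.\<close>

definition adjoin :: "'w set \<Rightarrow> 'w \<Rightarrow> 'w set" where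
  "adjoin E x = {poly r x / poly s x | r s.
     r \<in> polys_over E \<and> s \<in> polys_over E \<and> poly s x \<noteq> 0}"

lemma adjoinI:
  "r \<in> polys_over E \<Longrightarrow> s \<in> polys_over E \<Longrightarrow> poly s x \<noteq> 0 \<Longrightarrow> poly r x / poly s x \<in> adjoin E x"
  by (auto simp: adjoin_def)

lemma adjoin_poly: "subfield_emb E \<Longrightarrow> r \<in> polys_over E \<Longrightarrow> poly r x \<in> adjoin E x"
  using adjoinI[of r E "[:1:]" x] polys_over_const[of E 1] subfieldD(9) by simp

lemma adjoin_base: "subfield_emb E \<Longrightarrow> E \<subseteq> adjoin E x"
  using adjoin_poly[OF _ polys_over_const] by fastforce

lemma adjoin_self: "subfield_emb E \<Longrightarrow> x \<in> adjoin E x"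
  using adjoin_poly[OF _ polys_over_monom, of E 1 1 x] subfieldD(9) by (simp add: poly_monom)

lemma subfield_adjoin:
  assumes E: "subfield_emb E"
  shows "subfield_emb (adjoin E x)"
  unfolding subfield_emb_def
proof (intro conjI ballI)
  show "range emb \<subseteq> adjoin E x" using adjoin_base[OF E] subfieldD(1)[OF E] by blast
next
  fix a b assume "a \<in> adjoin E x" "b \<in> adjoin E x"
  then obtain r s r' s' where *: "a = poly r x / poly s x" "b = poly r' x / poly s' x"
    "r \<in> polys_over E" "s \<in> polys_over E" "poly s x \<noteq> 0"
    "r' \<in> polys_over E" "s' \<in> polys_over E" "poly s' x \<noteq> 0" by (auto simp: adjoin_def)
  have "a + b = poly (r * s' + r' * s) x / poly (s * s') x" "a * b = poly (r * r') x / poly (s * s') x"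
    using *(1,2,5,8) by (auto simp: add_frac_eq)
  moreover have "poly (s * s') x \<noteq> 0" using * by simp
  ultimately show "a + b \<in> adjoin E x" "a * b \<in> adjoin E x"
    using * by (auto simp del: poly_mult poly_add intro!: adjoinI polys_over_add polys_over_mult E)
next
  fix a assume "a \<in> adjoin E x"
  then obtain r s where *: "a = poly r x / poly s x"
    "r \<in> polys_over E" "s \<in> polys_over E" "poly s x \<noteq> 0" by (auto simp: adjoin_def)
  have "- a = poly (- r) x / poly s x" using * by simp
  then show "- a \<in> adjoin E x" using * adjoinI[OF polys_over_uminus[OF E *(2)] *(3,4)] by simp
  show "inverse a \<in> adjoin E x"
  proof (cases "poly r x = 0")
    case True
    then show ?thesis using * adjoin_base[OF E] subfieldD(8)[OF E] by auto
  next
    case False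
    then have "inverse a = poly s x / poly r x" using * by simp
    then show ?thesis using * False by (auto intro!: adjoinI)
  qed
qed

text \<open>Gaussian elimination inside \<open>E\<close>: a row \<open>p\<close> with nonzero last
  entry removes the last unknown from the other rows, leaving one equation and one unknown
  fewer.\<close>

lemma nontrivial_solution:
  assumes E: "subfield_emb E" and "\<And>i j. i < n \<Longrightarrow> j < Suc n \<Longrightarrow> A i j \<in> E"
  shows "\<exists>x. (\<forall>j<Suc n. x j \<in> E) \<and> (\<exists>j<Suc n. x j \<noteq> 0) \<and> (\<forall>i<n. (\<Sum>j<Suc n. A i j * x j) = 0)"
  using assms(2)
proof (induction n arbitrary: A)
  case 0
  show ?case by (rule exI[of _ "\<lambda>_. 1"]) (auto simp: subfieldD[OF E])
next
  case (Suc n)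
  show ?case
  proof (cases "\<forall>i<Suc n. A i (Suc n) = 0")
    case True
    then show ?thesis
      by (intro exI[of _ "\<lambda>j. if j = Suc n then 1 else 0"]) (auto simp: subfieldD[OF E])
  next
    case False
    then obtain p where p: "p < Suc n" "A p (Suc n) \<noteq> 0" by blast
    \<comment> \<open>Enumerates the rows other than \<open>p\<close>.\<close>
    define s where "s i = (if i < p then i else Suc i)" for i
    have s: "s i < Suc n" "s i \<noteq> p" if "i < n" for i using that p by (auto simp: s_def)
    define B where "B i j = A (s i) j - A (s i) (Suc n) / A p (Suc n) * A p j" for i j
    have BE: "B i j \<in> E" if "i < n" "j < Suc n" for i j
      unfolding B_def using that s Suc.prems p by (intro subfieldD[OF E]) auto
    obtain x where x: "\<And>j. j < Suc n \<Longrightarrow> x j \<in> E" "\<exists>j<Suc n. x j \<noteq> 0"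
      "\<And>i. i < n \<Longrightarrow> (\<Sum>j<Suc n. B i j * x j) = 0" using Suc.IH[of B] BE by blast
    define w where "w = - (\<Sum>j<Suc n. A p j * x j) / A p (Suc n)"
    define y where "y j = (if j = Suc n then w else x j)" for j
    have yS: "(\<Sum>j<Suc (Suc n). A i j * y j) = (\<Sum>j<Suc n. A i j * x j) + A i (Suc n) * w" for i
      by (simp add: y_def)
    have y0: "(\<Sum>j<Suc (Suc n). A i j * y j) = 0" if "i < Suc n" for i
    proof (cases "i = p")
      case True
      then show ?thesis using p by (simp add: yS w_def del: sum.lessThan_Suc)
    next
      case False
      define i' where "i' = (if i < p then i else i - 1)"
      have i': "i' < n" "s i' = i" using False that p by (auto simp: i'_def s_def)
      have "0 = (\<Sum>j<Suc n. A i j * x j) - A i (Suc n) / A p (Suc n) * (\<Sum>j<Suc n. A p j * x j)"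
        using x(3)[OF i'(1)] unfolding B_def i'(2)
        by (simp add: sum_distrib_left sum_subtractf algebra_simps del: sum.lessThan_Suc)
      then show ?thesis using p by (simp add: yS w_def del: sum.lessThan_Suc)
    qed
    have yE: "\<forall>j<Suc (Suc n). y j \<in> E"
      unfolding y_def w_def using x(1) Suc.prems p
      by (auto intro!: subfieldD[OF E] subfield_sum[OF E] simp del: sum.lessThan_Suc)
    have yn: "\<exists>j<Suc (Suc n). y j \<noteq> 0"
    proof -
      obtain j where "j < Suc n" "x j \<noteq> 0" using x(2) by blast
      then show ?thesis by (intro exI[of _ j]) (auto simp: y_def)
    qed
    show ?thesis
      by (rule exI[of _ y], intro conjI yE yn allI impI) (rule y0)
  qed
qed

text \<open>Modulo \<open>p\<close> every power of \<open>r\<close> has degree below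
  \<open>n = degree p\<close>. A dependence among the \<open>n + 1\<close> powers therefore amounts
  to \<open>n\<close> linear equations over \<open>E\<close> in \<open>n + 1\<close>
  unknowns.\<close>

lemma power_dependence:
  assumes E: "subfield_emb E" and p: "p \<in> polys_over E" "p \<noteq> 0" "poly p \<alpha> = 0"
    and r: "r \<in> polys_over E"
  shows "\<exists>x. (\<forall>j\<le>degree p. x j \<in> E) \<and> (\<exists>j\<le>degree p. x j \<noteq> 0) \<and>
    (\<Sum>j\<le>degree p. x j * poly r \<alpha> ^ j) = 0"
proof -
  define n where "n = degree p"
  have n: "n > 0"
  proof (rule ccontr)
    assume "\<not> n > 0"
    then obtain b where "p = [:b:]" by (auto simp: n_def elim: degree_eq_zeroE)
    then show False using p by simp
  qed
  have "\<exists>q\<in>polys_over E. degree q < n \<and> poly q \<alpha> = poly r \<alpha> ^ j" for j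
  proof -
    obtain h q where "h \<in> polys_over E" "q \<in> polys_over E" "r ^ j = p * h + q"
      "q = 0 \<or> degree q < n"
      using polys_over_division[OF E p(1,2) polys_over_power[OF E r, of j]] n_def by blast
    moreover from this have "poly q \<alpha> = poly r \<alpha> ^ j"
      using p(3) by (metis add_0 mult_zero_left poly_add poly_mult poly_power)
    ultimately show ?thesis using n by (intro bexI[of _ q]) auto
  qed
  then obtain q where q: "\<And>j. q j \<in> polys_over E" "\<And>j. degree (q j) < n"
    "\<And>j. poly (q j) \<alpha> = poly r \<alpha> ^ j" by metis
  obtain x where x: "\<And>j. j < Suc n \<Longrightarrow> x j \<in> E" "\<exists>j<Suc n. x j \<noteq> 0"
    "\<And>i. i < n \<Longrightarrow> (\<Sum>j<Suc n. coeff (q j) i * x j) = 0"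
    using nontrivial_solution[OF E, of n "\<lambda>i j. coeff (q j) i"] q(1)
    by (auto simp: polys_over_def)
  have "(\<Sum>j<Suc n. x j * poly r \<alpha> ^ j) = (\<Sum>j<Suc n. x j * (\<Sum>i<n. coeff (q j) i * \<alpha> ^ i))"
  proof (rule sum.cong[OF refl])
    fix j
    have "poly (q j) \<alpha> = (\<Sum>i<n. coeff (q j) i * \<alpha> ^ i)"
      unfolding poly_altdef using q(2)[of j]
      by (intro sum.mono_neutral_left) (auto simp: coeff_eq_0)
    then show "x j * poly r \<alpha> ^ j = x j * (\<Sum>i<n. coeff (q j) i * \<alpha> ^ i)" by (simp add: q(3))
  qed
  also have "\<dots> = (\<Sum>i<n. (\<Sum>j<Suc n. coeff (q j) i * x j) * \<alpha> ^ i)"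
    unfolding sum_distrib_left sum_distrib_right
    by (subst sum.swap) (intro sum.cong refl, simp)
  also have "\<dots> = 0" using x(3) by simp
  finally show ?thesis using x(1,2) unfolding n_def[symmetric] lessThan_Suc_atMost[symmetric]
    by (auto simp: less_Suc_eq_le)
qed

end

subsection \<open>Approximation in root-closed subfields\<close>

lemma alg_closed_splits:
  assumes "alg_closed TYPE('w::field)" "(p :: 'w poly) \<noteq> 0"
  shows "\<exists>as. length as = degree p \<and> p = smult (lead_coeff p) (\<Prod>a\<leftarrow>as. [:- a, 1:])"
  using assms(2)
proof (induction "degree p" arbitrary: p)
  case 0
  then obtain b where "p = [:b:]" by (metis degree_eq_zeroE)
  then show ?case by (intro exI[of _ "[]"]) auto
next
  case (Suc n)
  then obtain x where "poly p x = 0" using assms(1) unfolding alg_closed_def by (metis zero_less_Suc)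
  then obtain q where q: "p = [:- x, 1:] * q" by (metis poly_eq_0_iff_dvd dvdE)
  then have q0: "q \<noteq> 0" using Suc.prems by auto
  have "degree p = Suc (degree q)" unfolding q using q0 by (subst degree_mult_eq) auto
  then obtain as where as: "length as = degree q" "q = smult (lead_coeff q) (\<Prod>a\<leftarrow>as. [:- a, 1:])"
    using Suc.hyps(1)[of q] Suc.hyps(2) q0 by (metis Suc_inject)
  have "lead_coeff p = lead_coeff q" unfolding q lead_coeff_mult by simp
  then have "p = smult (lead_coeff p) (\<Prod>a\<leftarrow>x # as. [:- a, 1:])"
    unfolding list.simps(9) prod_list.Cons mult_smult_right[symmetric]
    using as(2) q by simp
  then show ?case using as(1) \<open>degree p = Suc (degree q)\<close> by (intro exI[of _ "x # as"]) auto
qed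

lemma poly_linear_factors: "poly (\<Prod>a\<leftarrow>as. [:- a, 1:]) y = (\<Prod>a\<leftarrow>as. y - (a :: 'w::field))"
  by (induction as) (auto simp: algebra_simps)

text \<open>The element \<open>t\<close> makes the valuation nontrivial; its integer powers later
  serve as the scale on which values are measured.\<close>

locale valued_alg_closed = valued_field emb V M
  for emb :: "'k::field \<Rightarrow> 'w::field" and V M +
  fixes t :: 'w
  assumes alg_closed: "alg_closed TYPE('w)"
    and infinite_k: "infinite (UNIV :: 'k set)"
    and t_M: "t \<in> M" and t_0: "t \<noteq> 0"
begin

lemma t_vlt_1: "t \<prec> 1" using t_M by (simp add: vlt_1_iff)

lemma nth_root:
  assumes "n > 0" shows "\<exists>r. r ^ n = (d :: 'w)"
proof -
  let ?p = "monom 1 n - [:d:]"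
  have "coeff ?p n \<noteq> 0" using assms by (simp add: coeff_pCons split: nat.splits)
  then have "degree ?p > 0" using le_degree[of ?p n] assms by simp
  then obtain r where "poly ?p r = 0" using alg_closed unfolding alg_closed_def by blast
  then show ?thesis by (auto simp: poly_monom)
qed

text \<open>Relative algebraic closedness in \<open>'w\<close>. As \<open>'w\<close> is
  algebraically closed, every nonzero polynomial over such an \<open>E\<close> splits with all its
  roots in \<open>E\<close>.\<close>

definition root_closed :: "'w set \<Rightarrow> bool" where
  "root_closed E \<longleftrightarrow> (\<forall>p\<in>polys_over E. \<forall>a. p \<noteq> 0 \<longrightarrow> poly p a = 0 \<longrightarrow> a \<in> E)"

lemma root_closedD: "root_closed E \<Longrightarrow> p \<in> polys_over E \<Longrightarrow> p \<noteq> 0 \<Longrightarrow> poly p a = 0 \<Longrightarrow> a \<in> E"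
  by (simp add: root_closed_def)

lemma root_closed_nth_root:
  assumes "subfield_emb E" "root_closed E" "n > 0" "d \<in> E"
  shows "\<exists>r\<in>E. r ^ n = d"
proof -
  obtain r where r: "r ^ n = d" using nth_root[OF assms(3)] by blast
  let ?p = "monom 1 n - [:d:]"
  have "?p \<in> polys_over E"
    using assms by (intro polys_over_diff polys_over_monom polys_over_const) (auto simp: subfieldD)
  moreover have "?p \<noteq> 0"
  proof
    assume "?p = 0"
    then have "coeff ?p n = 0" by simp
    then show False using assms(3) by (simp add: coeff_pCons split: nat.splits)
  qed
  moreover have "poly ?p r = 0" using r by (simp add: poly_monom)
  ultimately show ?thesis using assms(2) r unfolding root_closed_def by blast
qed

text \<open>The nonzero values of a root-closed field containing \<open>t\<close> form a dense order
  without end points: a square root of \<open>l * u\<close> lies strictly between \<open>l\<close>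
  and \<open>u\<close>, while \<open>l / t\<close> and \<open>t * u\<close> reach beyond the ends.
  So any cut that finitely many elements make at \<open>\<xi>\<close> contains an element of
  \<open>E\<close>.\<close>

lemma finite_between:
  assumes E: "subfield_emb E" "root_closed E" "t \<in> E" and F: "finite F" "F \<subseteq> E"
    and \<xi>: "\<xi> \<noteq> 0" "\<And>a. a \<in> F \<Longrightarrow> \<not> a \<approx> \<xi>"
  shows "\<exists>\<xi>'\<in>E. \<forall>a\<in>F. (a \<prec> \<xi> \<longrightarrow> a \<prec> \<xi>') \<and> (\<xi> \<prec> a \<longrightarrow> \<xi>' \<prec> a)"
proof -
  \<comment> \<open>With 0 added, a largest lower bound \<open>l\<close> always exists.\<close>
  define L where "L = insert 0 {a\<in>F. a \<prec> \<xi>}"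
  define U where "U = {a\<in>F. \<xi> \<prec> a}"
  have L: "finite L" "L \<noteq> {}" using F by (auto simp: L_def)
  obtain l where l: "l \<in> L" "\<And>a. a \<in> L \<Longrightarrow> a \<preceq> l" using finite_vmax[OF L] by blast
  have lE: "l \<in> E" "l \<prec> \<xi>" using l(1) F(2) \<xi>(1) subfieldD(8)[OF E(1)] by (auto simp: L_def)
  have "\<exists>\<xi>'\<in>E. l \<prec> \<xi>' \<and> (\<forall>a\<in>U. \<xi>' \<prec> a)"
  proof (cases "U = {}")
    case True
    show ?thesis
    proof (cases "l = 0")
      case True
      then show ?thesis using \<open>U = {}\<close> subfieldD(9)[OF E(1)] by (intro bexI[of _ 1]) auto
    next
      case False
      have "l * t \<prec> l * 1"
        using t_vlt_1 False vle_mult_cancel[of l 1 t] by (simp add: mult.commute)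
      then have "l \<prec> l / t" using vle_mult_cancel[of t "l / t" l] t_0 by simp
      then show ?thesis using \<open>U = {}\<close> subfieldD(7)[OF E(1) lE(1) E(3)] by (intro bexI[of _ "l / t"]) auto
    qed
  next
    case False
    have "finite U" using F by (auto simp: U_def)
    obtain u where u: "u \<in> U" "\<And>a. a \<in> U \<Longrightarrow> u \<preceq> a" using finite_vmin[OF \<open>finite U\<close> False] by blast
    have uE: "u \<in> E" "\<xi> \<prec> u" using u(1) F by (auto simp: U_def)
    then have u0: "u \<noteq> 0" by auto
    have lu: "l \<prec> u" using lE uE vle_trans vlt_imp_vle by blast
    have "\<exists>r\<in>E. l \<prec> r \<and> r \<prec> u"
    proof (cases "l = 0")
      case True
      have "t * u \<prec> 1 * u" using t_vlt_1 u0 vle_mult_cancel by blast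
      then show ?thesis using True t_0 u0 subfieldD(3)[OF E(1) E(3) uE(1)] by (intro bexI[of _ "t * u"]) auto
    next
      case False
      obtain r where r: "r \<in> E" "r ^ 2 = l * u"
        using root_closed_nth_root[OF E(1,2), of 2 "l * u"] subfieldD(3)[OF E(1) lE(1) uE(1)] by auto
      have "l \<prec> r"
      proof
        assume "r \<preceq> l"
        then have "l * u \<preceq> l * l" using vle_mult[of r l r l] r(2) by (simp add: power2_eq_square)
        then show False using lu False vle_mult_cancel[of l u l] by (simp add: mult.commute)
      qed
      moreover have "r \<prec> u"
      proof
        assume "u \<preceq> r"
        then have "u * u \<preceq> l * u" using vle_mult[of u r u r] r(2) by (simp add: power2_eq_square)
        then show False using lu u0 vle_mult_cancel[of u u l] by simp
      qed
      ultimately show ?thesis using r(1) by blast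
    qed
    then obtain r where r: "r \<in> E" "l \<prec> r" "r \<prec> u" by blast
    moreover have "r \<prec> a" if "a \<in> U" for a using vlt_vle_trans[OF r(3) u(2)[OF that]] .
    ultimately show ?thesis by blast
  qed
  then obtain \<xi>' where x: "\<xi>' \<in> E" "l \<prec> \<xi>'" "\<And>a. a \<in> U \<Longrightarrow> \<xi>' \<prec> a" by blast
  have "a \<prec> \<xi>'" if "a \<in> F" "a \<prec> \<xi>" for a
    using vle_vlt_trans[OF l(2) x(2), of a] that by (auto simp: L_def)
  moreover have "\<xi>' \<prec> a" if "a \<in> F" "\<xi> \<prec> a" for a using x(3) that by (auto simp: U_def)
  ultimately show ?thesis using x(1) by blast
qed

text \<open>In each factor \<open>\<xi>' - (a - \<alpha>)\<close> the larger of the two terms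
  dominates, and which one it is depends only on the cut made by \<open>\<xi>\<close>. The roots
  closer to \<open>\<alpha>\<close> contribute a power of \<open>\<xi>'\<close>, the others the
  constant \<open>C\<close>.\<close>

lemma linear_factors_monomial:
  assumes E: "subfield_emb E" and A: "set as \<subseteq> A" "A \<subseteq> E" "\<alpha> \<in> E"
    and ne: "\<And>a. a \<in> A \<Longrightarrow> \<not> a - \<alpha> \<approx> \<xi>"
  shows "\<exists>C\<in>E. C \<noteq> 0 \<and> (\<exists>n. \<forall>\<xi>'. (\<forall>a\<in>A. (a - \<alpha> \<prec> \<xi> \<longrightarrow> a - \<alpha> \<prec> \<xi>') \<and> (\<xi> \<prec> a - \<alpha> \<longrightarrow> \<xi>' \<prec> a - \<alpha>)) \<longrightarrow>
    (\<Prod>a\<leftarrow>as. \<alpha> + \<xi>' - a) \<approx> C * \<xi>' ^ n)"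
  using A(1)
proof (induction as)
  case Nil
  show ?case by (rule bexI[of _ 1], simp, rule exI[of _ 0]) (auto simp: subfieldD[OF E])
next
  case (Cons a as)
  define R where "R \<xi>' \<longleftrightarrow> (\<forall>a\<in>A. (a - \<alpha> \<prec> \<xi> \<longrightarrow> a - \<alpha> \<prec> \<xi>') \<and> (\<xi> \<prec> a - \<alpha> \<longrightarrow> \<xi>' \<prec> a - \<alpha>))" for \<xi>'
  obtain C n where C: "C \<in> E" "C \<noteq> 0" "\<And>\<xi>'. R \<xi>' \<Longrightarrow> (\<Prod>a\<leftarrow>as. \<alpha> + \<xi>' - a) \<approx> C * \<xi>' ^ n"
    using Cons unfolding R_def by auto
  have aA: "a \<in> A" using Cons.prems by simp
  show ?case unfolding R_def[symmetric]
  proof (cases "a - \<alpha> \<prec> \<xi>")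
    case True
    have "(\<Prod>a\<leftarrow>a # as. \<alpha> + \<xi>' - a) \<approx> C * \<xi>' ^ Suc n" if "R \<xi>'" for \<xi>'
    proof -
      have "\<xi>' - (a - \<alpha>) \<approx> \<xi>'" using that True aA by (intro veq_diff_vlt) (auto simp: R_def)
      from veq_mult[OF this C(3)[OF that]] show ?thesis by (simp add: algebra_simps)
    qed
    then show "\<exists>C\<in>E. C \<noteq> 0 \<and> (\<exists>n. \<forall>\<xi>'. R \<xi>' \<longrightarrow> (\<Prod>a\<leftarrow>a # as. \<alpha> + \<xi>' - a) \<approx> C * \<xi>' ^ n)"
      using C(1,2) by blast
  next
    case False
    then have lt: "\<xi> \<prec> a - \<alpha>" using ne[OF aA] by (auto simp: veq_def)
    have "(\<Prod>a\<leftarrow>a # as. \<alpha> + \<xi>' - a) \<approx> (C * (a - \<alpha>)) * \<xi>' ^ n" if "R \<xi>'" for \<xi>'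
    proof -
      have "\<xi>' - (a - \<alpha>) \<approx> a - \<alpha>" using that lt aA by (intro veq_diff_vlt) (auto simp: R_def)
      from veq_mult[OF this C(3)[OF that]] show ?thesis by (simp add: algebra_simps)
    qed
    moreover have "C * (a - \<alpha>) \<in> E" using C(1) aA A by (auto intro!: subfieldD[OF E])
    moreover have "C * (a - \<alpha>) \<noteq> 0" using C(2) lt by auto
    ultimately show "\<exists>C\<in>E. C \<noteq> 0 \<and> (\<exists>n. \<forall>\<xi>'. R \<xi>' \<longrightarrow> (\<Prod>a\<leftarrow>a # as. \<alpha> + \<xi>' - a) \<approx> C * \<xi>' ^ n)"
      by blast
  qed
qed

text \<open>Comparing two monomials amounts to bounding a power of \<open>\<xi>'\<close> by a
  quotient of the coefficients. A root \<open>\<rho>\<close> of this quotient lies in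
  \<open>E\<close> and turns the comparison into a one-sided bound on \<open>\<xi>'\<close> itself;
  for equal exponents the threshold is 0.\<close>

lemma monomial_vlt_threshold:
  assumes E: "subfield_emb E" "root_closed E" and C: "C \<in> E" "C \<noteq> 0" "C' \<in> E" "C' \<noteq> 0"
    and \<xi>: "\<xi> \<noteq> 0" "C * \<xi> ^ a \<prec> C' * \<xi> ^ b"
  shows "\<exists>\<rho>\<in>E. (\<rho> \<prec> \<xi> \<and> (\<forall>\<xi>'. \<rho> \<prec> \<xi>' \<longrightarrow> C * \<xi>' ^ a \<prec> C' * \<xi>' ^ b)) \<or>
    (\<xi> \<prec> \<rho> \<and> (\<forall>\<xi>'. \<xi>' \<noteq> 0 \<longrightarrow> \<xi>' \<prec> \<rho> \<longrightarrow> C * \<xi>' ^ a \<prec> C' * \<xi>' ^ b))"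
proof -
  consider "a = b" | n where "n > 0" "b = a + n" | n where "n > 0" "a = b + n"
    by (metis less_imp_add_positive linorder_neqE_nat)
  then show ?thesis
  proof cases
    case 1
    have iff: "C * \<xi>' ^ a \<prec> C' * \<xi>' ^ b \<longleftrightarrow> C \<prec> C'" if "\<xi>' \<noteq> 0" for \<xi>'
      using that 1 by (simp add: vle_mult_cancel)
    have "\<forall>\<xi>'. 0 \<prec> \<xi>' \<longrightarrow> C * \<xi>' ^ a \<prec> C' * \<xi>' ^ b" using \<xi> iff by simp
    then show ?thesis using subfieldD(8)[OF E(1)] \<xi>(1) by (intro bexI[of _ 0]) auto
  next
    case 2
    obtain \<rho> where \<rho>: "\<rho> \<in> E" "\<rho> ^ n = C / C'"
      using root_closed_nth_root[OF E 2(1), of "C / C'"] subfieldD(7)[OF E(1) C(1,3)] by blast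
    have iff: "C * \<xi>' ^ a \<prec> C' * \<xi>' ^ b \<longleftrightarrow> \<rho> ^ n \<prec> \<xi>' ^ n" if "\<xi>' \<noteq> 0" for \<xi>'
    proof -
      have "C * \<xi>' ^ a = (C / C') * (C' * \<xi>' ^ a)" "C' * \<xi>' ^ b = \<xi>' ^ n * (C' * \<xi>' ^ a)"
        using C by (auto simp: 2 power_add)
      moreover have "C' * \<xi>' ^ a \<noteq> 0" using C that by simp
      ultimately show ?thesis unfolding \<rho>(2) by (metis vle_mult_cancel)
    qed
    have "\<rho> \<prec> \<xi>" using \<xi> iff vle_power[of \<xi> \<rho> n] by blast
    moreover have "C * \<xi>' ^ a \<prec> C' * \<xi>' ^ b" if "\<rho> \<prec> \<xi>'" for \<xi>'
      using that iff[of \<xi>'] vlt_power[OF that 2(1)] by (cases "\<xi>' = 0") auto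
    ultimately show ?thesis using \<rho>(1) by blast
  next
    case 3
    obtain \<rho> where \<rho>: "\<rho> \<in> E" "\<rho> ^ n = C' / C"
      using root_closed_nth_root[OF E 3(1), of "C' / C"] subfieldD(7)[OF E(1) C(3,1)] by blast
    have iff: "C * \<xi>' ^ a \<prec> C' * \<xi>' ^ b \<longleftrightarrow> \<xi>' ^ n \<prec> \<rho> ^ n" if "\<xi>' \<noteq> 0" for \<xi>'
    proof -
      have "C' * \<xi>' ^ b = (C' / C) * (C * \<xi>' ^ b)" "C * \<xi>' ^ a = \<xi>' ^ n * (C * \<xi>' ^ b)"
        using C by (auto simp: 3 power_add)
      moreover have "C * \<xi>' ^ b \<noteq> 0" using C that by simp
      ultimately show ?thesis unfolding \<rho>(2) by (metis vle_mult_cancel)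
    qed
    have "\<xi> \<prec> \<rho>" using \<xi> iff vle_power[of \<rho> \<xi> n] by blast
    moreover have "C * \<xi>' ^ a \<prec> C' * \<xi>' ^ b" if "\<xi>' \<noteq> 0" "\<xi>' \<prec> \<rho>" for \<xi>'
      using that(1) iff[of \<xi>'] vlt_power[OF that(2) 3(1)] by auto
    ultimately show ?thesis using \<rho>(1) by blast
  qed
qed

lemma root_closed_splits:
  assumes "root_closed E" "p \<in> polys_over E" "p \<noteq> 0"
  shows "\<exists>as. set as \<subseteq> {a\<in>E. poly p a = 0} \<and> (\<forall>y. poly p y = lead_coeff p * (\<Prod>a\<leftarrow>as. y - a))"
proof -
  obtain as where as: "p = smult (lead_coeff p) (\<Prod>a\<leftarrow>as. [:- a, 1:])"
    using alg_closed_splits[OF alg_closed assms(3)] by blast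
  have v: "poly p y = lead_coeff p * (\<Prod>a\<leftarrow>as. y - a)" for y
    by (subst as) (simp add: poly_linear_factors)
  have "poly p a = 0" if "a \<in> set as" for a using that by (auto simp: v prod_list_zero_iff)
  then show ?thesis using v assms unfolding root_closed_def by blast
qed

text \<open>The valuations of finitely many polynomials at x are governed by the root nearest to x.\<close>

lemma approximate_in_root_closed:
  assumes E: "subfield_emb E" "root_closed E" "t \<in> E"
    and S: "finite S" "S \<subseteq> polys_over E \<times> polys_over E"
    and x: "\<And>p q. (p, q) \<in> S \<Longrightarrow> poly p x \<prec> poly q x"
  shows "\<exists>x'\<in>E. \<forall>(p, q)\<in>S. poly p x' \<prec> poly q x'"
proof (cases "x \<in> E")
  case True
  then show ?thesis using x by blast
next
  case False
  define P where "P = (fst ` S \<union> snd ` S) - {0}"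
  have P: "finite P" "P \<subseteq> polys_over E" "0 \<notin> P" using S by (auto simp: P_def)
  define A where "A = insert 0 (\<Union>p\<in>P. {a. poly p a = 0})"
  have fA: "finite A" using P by (auto simp: A_def intro!: poly_roots_finite)
  have "a \<in> E" if "p \<in> P" "poly p a = 0" for p a
  proof -
    have "p \<in> polys_over E" "p \<noteq> 0" using P that(1) by auto
    then show ?thesis using root_closedD[OF E(2)] that(2) by blast
  qed
  then have AE: "A \<subseteq> E" using subfieldD(8)[OF E(1)] by (auto simp: A_def)
  obtain \<alpha> where \<alpha>: "\<alpha> \<in> A" "\<And>a. a \<in> A \<Longrightarrow> x - \<alpha> \<preceq> x - a"
  proof -
    have "finite ((\<lambda>a. x - a) ` A)" "(\<lambda>a. x - a) ` A \<noteq> {}" using fA by (auto simp: A_def)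
    from finite_vmin[OF this] show ?thesis using that by blast
  qed
  have \<alpha>E: "\<alpha> \<in> E" using \<alpha>(1) AE by blast
  define \<xi> where "\<xi> = x - \<alpha>"
  have \<xi>0: "\<xi> \<noteq> 0" using False \<alpha>E by (auto simp: \<xi>_def)
  \<comment> \<open>A point of \<open>A\<close> that is at most \<open>\<xi>\<close> away from
    \<open>\<alpha>\<close> cannot be closer to \<open>x\<close> than \<open>\<alpha>\<close> is, so
    it is exactly as far away.\<close>
  have near: "x - a \<approx> \<xi>" if "a \<in> A" "a - \<alpha> \<preceq> \<xi>" for a
  proof -
    have "\<xi> - (a - \<alpha>) \<preceq> \<xi>" by (rule vle_diff[OF vle_refl that(2)])
    then show ?thesis using \<alpha>(2)[OF that(1)] by (auto simp: \<xi>_def veq_def)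
  qed
  have far: "x - a \<approx> a - \<alpha>" if "\<xi> \<prec> a - \<alpha>" for a
    using veq_diff_vlt(2)[OF that] by (simp add: \<xi>_def)
  have split: "\<exists>as. set as \<subseteq> A \<and> (\<forall>y. poly p y = lead_coeff p * (\<Prod>a\<leftarrow>as. y - a))" if "p \<in> P" for p
    using root_closed_splits[OF E(2), of p] P that unfolding A_def by (metis (mono_tags, lifting)
        UN_I insertCI mem_Collect_eq subset_eq)
  show ?thesis
  \<comment> \<open>If the value of \<open>\<xi>\<close> is attained in \<open>E\<close>, the step
    from \<open>\<alpha>\<close> to \<open>x\<close> is replaced by a constant multiple of
    \<open>\<eta>\<close>. A constant that avoids finitely many residues keeps the distances to all
    points of \<open>A\<close>, hence the values of all polynomials.\<close>
  proof (cases "\<exists>\<eta>\<in>E. \<eta> \<approx> \<xi>")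
    case True
    then obtain \<eta> where \<eta>: "\<eta> \<in> E" "\<eta> \<approx> \<xi>" by blast
    have \<eta>0: "\<eta> \<noteq> 0" using \<eta>(2) \<xi>0 by auto
    have "finite (insert 0 ((\<lambda>a. res ((a - \<alpha>) / \<eta>)) ` A))" using fA by auto
    then obtain \<epsilon> where \<epsilon>: "\<epsilon> \<notin> insert 0 ((\<lambda>a. res ((a - \<alpha>) / \<eta>)) ` A)"
      using ex_new_if_finite[OF infinite_k] by blast
    define x' where "x' = \<alpha> + emb \<epsilon> * \<eta>"
    have x'E: "x' \<in> E" using \<alpha>E \<eta>(1) by (auto simp: x'_def intro!: subfieldD[OF E(1)])
    have same: "x' - a \<approx> x - a" if "a \<in> A" for a
    proof (cases "a - \<alpha> \<preceq> \<xi>")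
      case True
      then have "a - \<alpha> \<preceq> \<eta>" using \<eta>(2) vle_trans by (auto simp: veq_def)
      then have "emb \<epsilon> * \<eta> - (a - \<alpha>) \<approx> \<eta>" using \<eta>0 \<epsilon> that by (intro veq_emb_minus) auto
      then have "x' - a \<approx> \<eta>" by (simp add: x'_def algebra_simps)
      then show ?thesis using \<eta>(2) near[OF that True] veq_trans veq_sym by blast
    next
      case False
      have "emb \<epsilon> * \<eta> \<approx> 1 * \<xi>" using \<epsilon> \<eta>(2) by (intro veq_mult emb_unit) auto
      then have "emb \<epsilon> * \<eta> \<prec> a - \<alpha>" using False vle_trans by (auto simp: veq_def)
      from veq_diff_vlt(2)[OF this] have "x' - a \<approx> a - \<alpha>" by (simp add: x'_def algebra_simps)
      then show ?thesis using far[OF False] veq_trans veq_sym by blast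
    qed
    have "poly p x' \<approx> poly p x" if pP: "p \<in> P" for p
    proof -
      obtain as where as: "set as \<subseteq> A" "\<And>y. poly p y = lead_coeff p * (\<Prod>a\<leftarrow>as. y - a)"
        using split[OF pP] by blast
      have "(\<Prod>a\<leftarrow>as. x' - a) \<approx> (\<Prod>a\<leftarrow>as. x - a)" using as(1)
        by (induction as) (auto intro!: veq_mult same)
      then show ?thesis unfolding as(2) by (intro veq_mult) auto
    qed
    then have eq: "poly p x' \<approx> poly p x" if "p \<in> fst ` S \<union> snd ` S" for p
      using that by (cases "p = 0") (auto simp: P_def)
    have "poly p x' \<prec> poly q x'" if "(p, q) \<in> S" for p q
    proof -
      have "p \<in> fst ` S \<union> snd ` S" "q \<in> fst ` S \<union> snd ` S" using that by force+
      then show ?thesis using x[OF that] veq_vle[OF eq eq, of q p] by blast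
    qed
    then show ?thesis using x'E by blast
  next
    \<comment> \<open>Now the value of \<open>\<xi>\<close> falls into a gap of the values of
      \<open>E\<close>. Near \<open>\<alpha>\<close> every polynomial behaves like a monomial on the
      cut made by \<open>\<xi>\<close>, each inequality becomes a one-sided threshold in
      \<open>E\<close>, and finitely many thresholds are met at once.\<close>
    case no: False
    have ne: "\<not> a \<approx> \<xi>" if "a \<in> E" for a using no that by blast
    have ne': "\<not> a - \<alpha> \<approx> \<xi>" if "a \<in> A" for a
      using ne subfieldD(6)[OF E(1) _ \<alpha>E] AE that by blast
    define R where "R \<xi>' \<longleftrightarrow> (\<forall>a\<in>A. (a - \<alpha> \<prec> \<xi> \<longrightarrow> a - \<alpha> \<prec> \<xi>') \<and> (\<xi> \<prec> a - \<alpha> \<longrightarrow> \<xi>' \<prec> a - \<alpha>))" for \<xi>'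
    \<comment> \<open>The instance \<open>a = \<alpha>\<close> of \<open>R\<close> reads
      \<open>0 \<prec> \<xi>'\<close>.\<close>
    have R0: "\<xi>' \<noteq> 0" if "R \<xi>'" for \<xi>' using that \<alpha>(1) \<xi>0 unfolding R_def by force
    have Rx: "R \<xi>" by (simp add: R_def)
    have mono: "\<exists>C\<in>E. C \<noteq> 0 \<and> (\<exists>n. \<forall>\<xi>'. R \<xi>' \<longrightarrow> poly p (\<alpha> + \<xi>') \<approx> C * \<xi>' ^ n)" if pP: "p \<in> P" for p
    proof -
      obtain as where as: "set as \<subseteq> A" "\<And>y. poly p y = lead_coeff p * (\<Prod>a\<leftarrow>as. y - a)"
        using split[OF pP] by blast
      obtain C n where C: "C \<in> E" "C \<noteq> 0" "\<And>\<xi>'. R \<xi>' \<Longrightarrow> (\<Prod>a\<leftarrow>as. \<alpha> + \<xi>' - a) \<approx> C * \<xi>' ^ n"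
        using linear_factors_monomial[OF E(1) as(1) AE \<alpha>E ne'] unfolding R_def by blast
      have "poly p (\<alpha> + \<xi>') \<approx> (lead_coeff p * C) * \<xi>' ^ n" if "R \<xi>'" for \<xi>'
        using veq_mult[OF veq_refl[of "lead_coeff p"] C(3)[OF that]] by (simp add: as(2) mult.assoc)
      moreover have "lead_coeff p * C \<in> E" "lead_coeff p * C \<noteq> 0"
        using C P \<open>p \<in> P\<close> polys_over_coeff by (auto intro!: subfieldD[OF E(1)])
      ultimately show ?thesis by blast
    qed
    have "\<exists>\<rho>\<in>E. (\<rho> \<prec> \<xi> \<and> (\<forall>\<xi>'. R \<xi>' \<longrightarrow> \<rho> \<prec> \<xi>' \<longrightarrow> poly (fst s) (\<alpha> + \<xi>') \<prec> poly (snd s) (\<alpha> + \<xi>'))) \<or>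
        (\<xi> \<prec> \<rho> \<and> (\<forall>\<xi>'. R \<xi>' \<longrightarrow> \<xi>' \<prec> \<rho> \<longrightarrow> poly (fst s) (\<alpha> + \<xi>') \<prec> poly (snd s) (\<alpha> + \<xi>')))"
      if sS: "s \<in> S" for s
    proof -
      obtain p q where s: "s = (p, q)" by (cases s)
      have lt: "poly p (\<alpha> + \<xi>) \<prec> poly q (\<alpha> + \<xi>)" using x sS s by (simp add: \<xi>_def)
      then have "q \<noteq> 0" by auto
      then have "q \<in> P" using sS s by (force simp: P_def)
      then obtain C' b where C': "C' \<in> E" "C' \<noteq> 0" "\<And>\<xi>'. R \<xi>' \<Longrightarrow> poly q (\<alpha> + \<xi>') \<approx> C' * \<xi>' ^ b"
        using mono by blast
      show ?thesis
      proof (cases "p = 0")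
        case True
        have "poly q (\<alpha> + \<xi>') \<noteq> 0" if "R \<xi>'" for \<xi>' using C'(2) C'(3)[OF that] R0[OF that] by auto
        then show ?thesis using True s \<xi>0 subfieldD(8)[OF E(1)] by (intro bexI[of _ 0]) auto
      next
        case False
        then have "p \<in> P" using sS s by (force simp: P_def)
        then obtain C a where C: "C \<in> E" "C \<noteq> 0" "\<And>\<xi>'. R \<xi>' \<Longrightarrow> poly p (\<alpha> + \<xi>') \<approx> C * \<xi>' ^ a"
          using mono by blast
        have iff: "poly p (\<alpha> + \<xi>') \<prec> poly q (\<alpha> + \<xi>') \<longleftrightarrow> C * \<xi>' ^ a \<prec> C' * \<xi>' ^ b" if "R \<xi>'" for \<xi>'
          using veq_vle[OF C'(3)[OF that] C(3)[OF that]] by blast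
        have "C * \<xi> ^ a \<prec> C' * \<xi> ^ b" using lt iff[OF Rx] by blast
        from monomial_vlt_threshold[OF E(1,2) C(1,2) C'(1,2) \<xi>0 this]
        show ?thesis unfolding s fst_conv snd_conv using iff R0 by (elim bexE disjE) (rule bexI, blast, assumption)+
      qed
    qed
    then obtain \<rho> where \<rho>: "\<And>s. s \<in> S \<Longrightarrow> \<rho> s \<in> E"
      "\<And>s. s \<in> S \<Longrightarrow> (\<rho> s \<prec> \<xi> \<and> (\<forall>\<xi>'. R \<xi>' \<longrightarrow> \<rho> s \<prec> \<xi>' \<longrightarrow> poly (fst s) (\<alpha> + \<xi>') \<prec> poly (snd s) (\<alpha> + \<xi>'))) \<or>
        (\<xi> \<prec> \<rho> s \<and> (\<forall>\<xi>'. R \<xi>' \<longrightarrow> \<xi>' \<prec> \<rho> s \<longrightarrow> poly (fst s) (\<alpha> + \<xi>') \<prec> poly (snd s) (\<alpha> + \<xi>')))"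
      by metis
    define F where "F = (\<lambda>a. a - \<alpha>) ` A \<union> \<rho> ` S"
    have FE: "F \<subseteq> E" using AE \<alpha>E \<rho>(1) by (auto simp: F_def intro!: subfieldD[OF E(1)])
    obtain \<xi>' where \<xi>': "\<xi>' \<in> E" "\<And>a. a \<in> F \<Longrightarrow> (a \<prec> \<xi> \<longrightarrow> a \<prec> \<xi>') \<and> (\<xi> \<prec> a \<longrightarrow> \<xi>' \<prec> a)"
    proof -
      have "finite F" using fA S(1) by (simp add: F_def)
      moreover have "\<not> a \<approx> \<xi>" if "a \<in> F" for a using ne FE that by blast
      ultimately show ?thesis using finite_between[OF E _ FE \<xi>0] that by blast
    qed
    have "R \<xi>'" using \<xi>'(2) by (auto simp: R_def F_def)
    have "poly (fst s) (\<alpha> + \<xi>') \<prec> poly (snd s) (\<alpha> + \<xi>')" if "s \<in> S" for s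
    proof -
      have "\<rho> s \<in> F" using that by (simp add: F_def)
      then show ?thesis using \<rho>(2)[OF that] \<xi>'(2)[of "\<rho> s"] \<open>R \<xi>'\<close> by blast
    qed
    then show ?thesis using \<xi>'(1) \<alpha>E subfieldD(2)[OF E(1)] by (intro bexI[of _ "\<alpha> + \<xi>'"]) auto
  qed
qed

end

context field_embedding
begin

subsection \<open>Norms through companion matrices\<close>

lemma pfun_det:
  assumes "\<And>z. F z \<in> carrier_mat n n" "\<And>i j. i < n \<Longrightarrow> j < n \<Longrightarrow> (\<lambda>z. F z $$ (i, j)) \<in> pfun N"
  shows "(\<lambda>z. det (F z)) \<in> pfun N"
proof -
  have "(\<lambda>_. signof p) \<in> pfun N" for p :: "nat \<Rightarrow> nat"
    using pfun_const[of "signof p"] by (cases "sign p = (1 :: int)") (auto simp: sign_def emb_uminus)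
  then have "(\<lambda>z. \<Sum>p\<in>{p. p permutes {0..<n}}. signof p * (\<Prod>i = 0..<n. F z $$ (i, p i))) \<in> pfun N"
    by (intro pfun_sum pfun_mult pfun_prod assms) (auto simp: permutes_in_image)
  then show ?thesis by (simp add: det_def'[OF assms(1)])
qed

lemma pfun_mat_mult:
  assumes "\<And>z. F z \<in> carrier_mat n n" "\<And>z. G z \<in> carrier_mat n n"
    and "\<And>i j. i < n \<Longrightarrow> j < n \<Longrightarrow> (\<lambda>z. F z $$ (i, j)) \<in> pfun N"
    and "\<And>i j. i < n \<Longrightarrow> j < n \<Longrightarrow> (\<lambda>z. G z $$ (i, j)) \<in> pfun N"
    and "i < n" "j < n"
  shows "(\<lambda>z. (F z * G z) $$ (i, j)) \<in> pfun N"
proof -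
  have "(F z * G z) $$ (i, j) = (\<Sum>l = 0..<n. F z $$ (i, l) * G z $$ (l, j))" for z
    using assms(1,2)[of z] assms(5,6) by (auto simp: scalar_prod_def)
  moreover have "(\<lambda>z. \<Sum>l = 0..<n. F z $$ (i, l) * G z $$ (l, j)) \<in> pfun N"
    using assms by (intro pfun_sum pfun_mult) auto
  ultimately show ?thesis by simp
qed

lemma pfun_adj_mat:
  assumes F: "\<And>z. F z \<in> carrier_mat n n" "\<And>i j. i < n \<Longrightarrow> j < n \<Longrightarrow> (\<lambda>z. F z $$ (i, j)) \<in> pfun N"
    and ij: "i < n" "j < n"
  shows "(\<lambda>z. adj_mat (F z) $$ (i, j)) \<in> pfun N"
proof -
  have "(\<lambda>z. det (mat_delete (F z) j i)) \<in> pfun N"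
  proof (rule pfun_det[of _ "n - 1"])
    show "mat_delete (F z) j i \<in> carrier_mat (n - 1) (n - 1)" for z
      using mat_delete_carrier[OF F(1)] .
    fix i' j' assume "i' < n - 1" "j' < n - 1"
    then have "mat_delete (F z) j i $$ (i', j') =
      F z $$ (if i' < j then i' else Suc i', if j' < i then j' else Suc j')" for z
      using F(1)[of z] by (simp add: mat_delete_def)
    moreover have "(\<lambda>z. F z $$ (if i' < j then i' else Suc i', if j' < i then j' else Suc j')) \<in> pfun N"
      using \<open>i' < n - 1\<close> \<open>j' < n - 1\<close> by (intro F(2)) auto
    ultimately show "(\<lambda>z. mat_delete (F z) j i $$ (i', j')) \<in> pfun N" by simp
  qed
  then have "(\<lambda>z. emb ((- 1) ^ (j + i)) * det (mat_delete (F z) j i)) \<in> pfun N"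
    by (intro pfun_mult pfun_const)
  then have "(\<lambda>z. cofactor (F z) j i) \<in> pfun N"
    by (simp add: cofactor_def emb_power emb_uminus)
  moreover have "adj_mat (F z) $$ (i, j) = cofactor (F z) j i" for z
    using F(1)[of z] ij by (simp add: adj_mat_def)
  ultimately show ?thesis by simp
qed

text \<open>The Newton basis attached to the roots: multiplication by the variable sends the
  \<open>j\<close>-th element to the next one plus \<open>as ! j\<close> times the
  \<open>j\<close>-th.\<close>

definition newton_poly :: "'w list \<Rightarrow> nat \<Rightarrow> 'w poly" where
  "newton_poly as j = (\<Prod>a\<leftarrow>take j as. [:- a, 1:])"

lemma newton_poly_Suc: "j < length as \<Longrightarrow> newton_poly as (Suc j) = newton_poly as j * [:- (as ! j), 1:]"
  by (simp add: newton_poly_def take_Suc_conv_app_nth)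

lemma newton_poly_monic: "j \<le> length as \<Longrightarrow> degree (newton_poly as j) = j \<and> lead_coeff (newton_poly as j) = 1"
proof (induction j)
  case (Suc j)
  then have IH: "degree (newton_poly as j) = j" "lead_coeff (newton_poly as j) = 1" by auto
  then have "newton_poly as j \<noteq> 0" by auto
  have eq: "newton_poly as (Suc j) = newton_poly as j * [:- (as ! j), 1:]"
    using Suc.prems by (intro newton_poly_Suc) simp
  have "degree (newton_poly as (Suc j)) = Suc j"
    unfolding eq using \<open>newton_poly as j \<noteq> 0\<close> IH(1) by (subst degree_mult_eq) auto
  moreover have "lead_coeff (newton_poly as (Suc j)) = 1"
    unfolding eq lead_coeff_mult IH(2) by simp
  ultimately show ?case by simp
qed (simp add: newton_poly_def)

definition newton_mat :: "'w list \<Rightarrow> 'w mat" where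
  "newton_mat as = mat (length as) (length as) (\<lambda>(i, j). coeff (newton_poly as j) i)"

lemma det_newton_mat: "det (newton_mat as) = 1"
proof -
  have "upper_triangular (newton_mat as)"
    by (rule upper_triangularI) (auto simp: newton_mat_def newton_poly_monic intro!: coeff_eq_0)
  then have "det (newton_mat as) = prod_list (diag_mat (newton_mat as))"
    by (rule det_upper_triangular) (auto simp: newton_mat_def)
  also have "\<dots> = (\<Prod>i<length as. newton_mat as $$ (i, i))"
    by (simp add: prod_list_diag_prod newton_mat_def lessThan_atLeast0)
  also have "\<dots> = 1"
  proof (rule prod.neutral, rule ballI)
    fix i assume "i \<in> {..<length as}"
    then show "newton_mat as $$ (i, i) = 1"
      using newton_poly_monic[of i as] by (auto simp: newton_mat_def)
  qed
  finally show ?thesis .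
qed

text \<open>In the Newton basis of the roots the companion matrix becomes triangular; hence so does
  every polynomial expression in it, with the conjugate values on the diagonal.\<close>

definition companion_at :: "nat \<Rightarrow> nat \<Rightarrow> (nat \<Rightarrow> 'w) \<Rightarrow> 'w mat" where
  "companion_at N n z = mat n n (\<lambda>(i, j). if j = n - 1 then (if i = 0 then 0 else if j = i - 1 then 1 else 0) - z (N + i)
     else if i = Suc j then 1 else 0)"

text \<open>Conjugation is written as \<open>F S = S T\<close> with
  \<open>S = newton_mat as\<close>, which is stable under sums and products without any inverse; as
  \<open>det S = 1\<close>, it also cancels in determinants.\<close>

definition triangular_values :: "nat \<Rightarrow> 'w list \<Rightarrow> 'w mat \<Rightarrow> (nat \<Rightarrow> 'w) \<Rightarrow> bool" where
  "triangular_values n as F v \<longleftrightarrow> (\<exists>T\<in>carrier_mat n n. F * newton_mat as = newton_mat as * T \<and>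
     (\<forall>i<n. \<forall>j<n. i < j \<longrightarrow> T $$ (i, j) = 0) \<and> (\<forall>i<n. T $$ (i, i) = v i))"

lemma newton_mat_carrier: "length as = n \<Longrightarrow> newton_mat as \<in> carrier_mat n n"
  by (simp add: newton_mat_def)

text \<open>Column \<open>j\<close> holds the variable times the \<open>j\<close>-th Newton
  polynomial modulo \<open>p\<close>, that is, the next Newton polynomial plus \<open>as ! j\<close>
  times the present one. For \<open>j = n - 1\<close> the next one is \<open>p\<close> and reduces
  to 0.\<close>

lemma companion_triangular:
  assumes len: "length as = n" and co: "\<And>i. i < n \<Longrightarrow> coeff (\<Prod>a\<leftarrow>as. [:- a, 1:]) i = z (N + i)"
  shows "triangular_values n as (companion_at N n z) (\<lambda>i. as ! i)"
proof -
  define T where "T = mat n n (\<lambda>(i, j). if i = j then as ! j else if i = Suc j then 1 else 0)"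
  define p where "p = newton_poly as n"
  have cp: "coeff p i = z (N + i)" if "i < n" for i
    using co[OF that] len by (simp add: p_def newton_poly_def)
  have "companion_at N n z * newton_mat as = newton_mat as * T"
  proof (rule eq_matI)
    fix i j assume "i < dim_row (newton_mat as * T)" "j < dim_col (newton_mat as * T)"
    then have ij: "i < n" "j < n" using len by (auto simp: newton_mat_def T_def)
    define q where "q = newton_poly as j"
    have mon: "degree q = j" "lead_coeff q = 1" using newton_poly_monic[of j as] ij len by (auto simp: q_def)
    have q1: "coeff q (n - 1) = (if j = n - 1 then 1 else 0)"
      using mon ij by (auto intro: coeff_eq_0)
    have "(companion_at N n z * newton_mat as) $$ (i, j) =
      (\<Sum>l<n. companion_at N n z $$ (i, l) * coeff q l)"
      using ij len by (auto simp: scalar_prod_def newton_mat_def companion_at_def q_def lessThan_atLeast0 intro!: sum.cong)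
    also have "\<dots> = (\<Sum>l<n. (if Suc l = i then coeff q l else 0) + (if l = n - 1 then - z (N + i) * coeff q l else 0))"
      using ij by (intro sum.cong refl) (auto simp: companion_at_def algebra_simps)
    also have "\<dots> = (\<Sum>l<n. if Suc l = i then coeff q l else 0) - z (N + i) * coeff q (n - 1)"
      using ij by (simp add: sum.distrib)
    also have "(\<Sum>l<n. if Suc l = i then coeff q l else 0) = coeff (pCons 0 q) i"
    proof (cases i)
      case (Suc i')
      then show ?thesis using ij by simp
    qed simp
    also have "coeff (pCons 0 q) i - z (N + i) * coeff q (n - 1) =
      coeff q i * as ! j + (if Suc j < n then coeff (newton_poly as (Suc j)) i else 0)"
    proof -
      have nS: "newton_poly as (Suc j) = pCons 0 q - smult (as ! j) q"
        using ij len by (subst newton_poly_Suc) (auto simp: q_def)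
      moreover have "newton_poly as (Suc j) = p" if "\<not> Suc j < n"
        using that ij by (metis Suc_lessI p_def)
      moreover from nS have "coeff (pCons 0 q) i = coeff (newton_poly as (Suc j)) i + coeff q i * as ! j"
        by simp
      ultimately show ?thesis using cp[OF ij(1)] q1 ij
        by (cases "Suc j < n") (auto simp: algebra_simps simp del: coeff_pCons)
    qed
    also have "\<dots> = (\<Sum>l<n. (if l = j then coeff q i * as ! j else 0) +
        (if l = Suc j then coeff (newton_poly as (Suc j)) i else 0))"
      using ij by (simp add: sum.distrib)
    also have "\<dots> = (\<Sum>l<n. newton_mat as $$ (i, l) * T $$ (l, j))"
      using ij len by (intro sum.cong refl) (auto simp: newton_mat_def T_def q_def)
    also have "\<dots> = (newton_mat as * T) $$ (i, j)"
      using ij len by (auto simp: scalar_prod_def newton_mat_def T_def lessThan_atLeast0 intro!: sum.cong)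
    finally show "(companion_at N n z * newton_mat as) $$ (i, j) = (newton_mat as * T) $$ (i, j)" .
  qed (use len in \<open>auto simp: companion_at_def newton_mat_def T_def\<close>)
  then show ?thesis unfolding triangular_values_def
    by (intro bexI[of _ T]) (auto simp: T_def)
qed

lemma triangular_values_add:
  assumes "length as = n" "F \<in> carrier_mat n n" "G \<in> carrier_mat n n"
    and "triangular_values n as F v" "triangular_values n as G w"
  shows "triangular_values n as (F + G) (\<lambda>i. v i + w i)"
proof -
  note S = newton_mat_carrier[OF assms(1)]
  obtain T T' where *: "T \<in> carrier_mat n n" "F * newton_mat as = newton_mat as * T"
    "\<forall>i<n. \<forall>j<n. i < j \<longrightarrow> T $$ (i, j) = 0" "\<forall>i<n. T $$ (i, i) = v i"
    "T' \<in> carrier_mat n n" "G * newton_mat as = newton_mat as * T'"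
    "\<forall>i<n. \<forall>j<n. i < j \<longrightarrow> T' $$ (i, j) = 0" "\<forall>i<n. T' $$ (i, i) = w i"
    using assms(4,5) unfolding triangular_values_def by blast
  have "(F + G) * newton_mat as = newton_mat as * (T + T')"
    using * S assms(2,3) by (simp add: add_mult_distrib_mat mult_add_distrib_mat)
  then show ?thesis unfolding triangular_values_def using * by (intro bexI[of _ "T + T'"]) auto
qed

lemma triangular_values_mult:
  assumes "length as = n" "F \<in> carrier_mat n n" "G \<in> carrier_mat n n"
    and "triangular_values n as F v" "triangular_values n as G w"
  shows "triangular_values n as (F * G) (\<lambda>i. v i * w i)"
proof -
  note S = newton_mat_carrier[OF assms(1)]
  obtain T T' where *: "T \<in> carrier_mat n n" "F * newton_mat as = newton_mat as * T"
    "\<forall>i<n. \<forall>j<n. i < j \<longrightarrow> T $$ (i, j) = 0" "\<forall>i<n. T $$ (i, i) = v i"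
    "T' \<in> carrier_mat n n" "G * newton_mat as = newton_mat as * T'"
    "\<forall>i<n. \<forall>j<n. i < j \<longrightarrow> T' $$ (i, j) = 0" "\<forall>i<n. T' $$ (i, i) = w i"
    using assms(4,5) unfolding triangular_values_def by blast
  have "(F * G) * newton_mat as = F * (newton_mat as * T')"
    using * S assms(2,3) by (simp add: assoc_mult_mat[of F n n G n "newton_mat as" n])
  also have "\<dots> = (F * newton_mat as) * T'"
    using *(5) S assms(2) by (intro assoc_mult_mat[symmetric])
  also have "\<dots> = newton_mat as * (T * T')"
    unfolding *(2) using *(1,5) S by (intro assoc_mult_mat)
  finally have eq: "(F * G) * newton_mat as = newton_mat as * (T * T')" .
  have ent: "(T * T') $$ (i, j) = (\<Sum>l<n. T $$ (i, l) * T' $$ (l, j))" if "i < n" "j < n" for i j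
    using * that by (auto simp: scalar_prod_def lessThan_atLeast0)
  have "(T * T') $$ (i, j) = 0" if "i < n" "j < n" "i < j" for i j
    unfolding ent[OF that(1,2)] using that *(3,7)
    by (intro sum.neutral) (metis lessThan_iff linorder_neqE_nat mult_zero_left mult_zero_right order.strict_trans)
  moreover have "(T * T') $$ (i, i) = v i * w i" if "i < n" for i
  proof -
    have "(\<Sum>l<n. T $$ (i, l) * T' $$ (l, i)) = (\<Sum>l<n. if l = i then T $$ (i, i) * T' $$ (i, i) else 0)"
      using that *(3,7) by (intro sum.cong refl)
        (metis lessThan_iff linorder_neqE_nat mult_zero_left mult_zero_right)
    then show ?thesis using ent[OF that that] that * by simp
  qed
  ultimately show ?thesis unfolding triangular_values_def using eq *
    by (intro bexI[of _ "T * T'"]) auto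
qed

lemma triangular_values_smult_one:
  assumes "length as = n"
  shows "triangular_values n as (c \<cdot>\<^sub>m 1\<^sub>m n) (\<lambda>_. c)"
proof -
  note S = newton_mat_carrier[OF assms(1)]
  have "(c \<cdot>\<^sub>m 1\<^sub>m n) * newton_mat as = newton_mat as * (c \<cdot>\<^sub>m 1\<^sub>m n)"
    using S by (simp add: mult_smult_assoc_mat[OF one_carrier_mat S] mult_smult_distrib[OF S one_carrier_mat])
  then show ?thesis unfolding triangular_values_def by (intro bexI[of _ "c \<cdot>\<^sub>m 1\<^sub>m n"]) auto
qed

text \<open>\<open>F\<close> is \<open>f\<close> with the companion matrix substituted for
  coordinate \<open>N\<close>. That coordinate changes its meaning: in \<open>f\<close> it holds a
  root, whereas in \<open>F\<close> the coordinates from \<open>N\<close> on hold the lower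
  coefficients of the monic polynomial.\<close>

definition companion_rep :: "nat \<Rightarrow> nat \<Rightarrow> ((nat \<Rightarrow> 'w) \<Rightarrow> 'w) \<Rightarrow> ((nat \<Rightarrow> 'w) \<Rightarrow> 'w mat) \<Rightarrow> bool" where
  "companion_rep N n f F \<longleftrightarrow> (\<forall>z. F z \<in> carrier_mat n n) \<and>
    (\<forall>i<n. \<forall>j<n. (\<lambda>z. F z $$ (i, j)) \<in> pfun (N + n)) \<and>
    (\<forall>z as. length as = n \<longrightarrow> (\<forall>i<n. coeff (\<Prod>a\<leftarrow>as. [:- a, 1:]) i = z (N + i)) \<longrightarrow>
       triangular_values n as (F z) (\<lambda>i. f (z(N := as ! i))))"

lemma companion_repD:
  assumes "companion_rep N n f F"
  shows "F z \<in> carrier_mat n n" "i < n \<Longrightarrow> j < n \<Longrightarrow> (\<lambda>z. F z $$ (i, j)) \<in> pfun (N + n)"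
    "length as = n \<Longrightarrow> (\<And>i. i < n \<Longrightarrow> coeff (\<Prod>a\<leftarrow>as. [:- a, 1:]) i = z (N + i)) \<Longrightarrow>
       triangular_values n as (F z) (\<lambda>i. f (z(N := as ! i)))"
  using assms unfolding companion_rep_def by blast+

lemma companion_repI:
  assumes "\<And>z. F z \<in> carrier_mat n n" "\<And>i j. i < n \<Longrightarrow> j < n \<Longrightarrow> (\<lambda>z. F z $$ (i, j)) \<in> pfun (N + n)"
    "\<And>z as. length as = n \<Longrightarrow> (\<And>i. i < n \<Longrightarrow> coeff (\<Prod>a\<leftarrow>as. [:- a, 1:]) i = z (N + i)) \<Longrightarrow>
       triangular_values n as (F z) (\<lambda>i. f (z(N := as ! i)))"
  shows "companion_rep N n f F"
  using assms unfolding companion_rep_def by blast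

lemma pfun_companion:
  assumes "f \<in> pfun (Suc N)" "n > 0"
  shows "\<exists>F. companion_rep N n f F"
  using assms(1)
proof (induction rule: pfun.induct)
  case (pfun_const c)
  have "companion_rep N n (\<lambda>_. emb c) (\<lambda>z. emb c \<cdot>\<^sub>m 1\<^sub>m n)"
  proof (rule companion_repI)
    fix i j assume "i < n" "j < n"
    then have "(emb c \<cdot>\<^sub>m 1\<^sub>m n) $$ (i, j) = emb (if i = j then c else 0)" by simp
    then show "(\<lambda>z. (emb c \<cdot>\<^sub>m 1\<^sub>m n) $$ (i, j)) \<in> pfun (N + n)"
      using pfun.pfun_const by simp
  qed (simp_all add: triangular_values_smult_one)
  then show ?case by blast
next
  case (pfun_coord i)
  show ?case
  proof (cases "i = N")
    case True
    have "companion_rep N n (\<lambda>z. z i) (companion_at N n)" unfolding True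
    proof (rule companion_repI)
      fix i j assume ij: "i < n" "j < n"
      show "(\<lambda>z. companion_at N n z $$ (i, j)) \<in> pfun (N + n)"
      proof (cases "j = n - 1")
        case True
        have "companion_at N n z $$ (i, j) =
          emb (if i = 0 then 0 else if j = i - 1 then 1 else 0) - z (N + i)" for z
          using ij True by (auto simp: companion_at_def)
        moreover have "(\<lambda>z. emb (if i = 0 then 0 else if j = i - 1 then 1 else 0) - z (N + i)) \<in> pfun (N + n)"
          using ij by (intro pfun_diff pfun.pfun_const pfun.pfun_coord) simp
        ultimately show ?thesis by (simp only:)
      next
        case False
        have "companion_at N n z $$ (i, j) = emb (if i = Suc j then 1 else 0)" for z
          using ij False by (auto simp: companion_at_def)
        then show ?thesis using pfun.pfun_const by (simp only:)
      qed
    next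
      show "companion_at N n z \<in> carrier_mat n n" for z by (simp add: companion_at_def)
      show "triangular_values n as (companion_at N n z) (\<lambda>i. (z(N := as ! i)) N)"
        if "length as = n" "\<And>i. i < n \<Longrightarrow> coeff (\<Prod>a\<leftarrow>as. [:- a, 1:]) i = z (N + i)" for z as
        using companion_triangular[OF that] by simp
    qed
    then show ?thesis by blast
  next
    case False
    then have "i < N" using pfun_coord by simp
    have "companion_rep N n (\<lambda>z. z i) (\<lambda>z. z i \<cdot>\<^sub>m 1\<^sub>m n)"
    proof (rule companion_repI)
      fix j l assume jl: "j < n" "l < n"
      show "(\<lambda>z. (z i \<cdot>\<^sub>m 1\<^sub>m n) $$ (j, l)) \<in> pfun (N + n)"
        using jl \<open>i < N\<close> by (cases "j = l") (simp_all add: pfun.pfun_coord pfun_0)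
    qed (use False in \<open>simp_all add: triangular_values_smult_one\<close>)
    then show ?thesis by blast
  qed
next
  case (pfun_add f g)
  then obtain F G where F: "companion_rep N n f F" and G: "companion_rep N n g G" by blast
  have "companion_rep N n (\<lambda>y. f y + g y) (\<lambda>z. F z + G z)"
  proof (rule companion_repI)
    show "F z + G z \<in> carrier_mat n n" for z using companion_repD(1)[OF G] by simp
    show "(\<lambda>z. (F z + G z) $$ (i, j)) \<in> pfun (N + n)" if "i < n" "j < n" for i j
    proof -
      have "(F z + G z) $$ (i, j) = F z $$ (i, j) + G z $$ (i, j)" for z
        using that companion_repD(1)[OF G, of z] by simp
      then show ?thesis using pfun.pfun_add[OF companion_repD(2)[OF F that] companion_repD(2)[OF G that]] by simp
    qed
  qed (intro triangular_values_add companion_repD(1,3)[OF F] companion_repD(1,3)[OF G])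
  then show ?case by blast
next
  case (pfun_mult f g)
  then obtain F G where F: "companion_rep N n f F" and G: "companion_rep N n g G" by blast
  have "companion_rep N n (\<lambda>y. f y * g y) (\<lambda>z. F z * G z)"
  proof (rule companion_repI)
    show "F z * G z \<in> carrier_mat n n" for z
      by (rule mult_carrier_mat[OF companion_repD(1)[OF F] companion_repD(1)[OF G]])
    show "(\<lambda>z. (F z * G z) $$ (i, j)) \<in> pfun (N + n)" if "i < n" "j < n" for i j
      using that companion_repD(1,2)[OF F] companion_repD(1,2)[OF G] by (intro pfun_mat_mult)
  qed (intro triangular_values_mult companion_repD(1,3)[OF F] companion_repD(1,3)[OF G])
  then show ?case by blast
qed

text \<open>The determinant of the substituted matrix is the product over the roots, and it is
  visibly polynomial in the coefficients. This takes the place of the theorem on symmetric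
  polynomials.\<close>

lemma pfun_norm:
  assumes "f \<in> pfun (Suc N)" "n > 0"
  shows "\<exists>\<nu>\<in>pfun (N + n). \<forall>z as. length as = n \<longrightarrow>
    (\<forall>i<n. coeff (\<Prod>a\<leftarrow>as. [:- a, 1:]) i = z (N + i)) \<longrightarrow> \<nu> z = (\<Prod>i<n. f (z(N := as ! i)))"
proof -
  obtain F where "companion_rep N n f F" using pfun_companion[OF assms] by blast
  note F = companion_repD[OF this]
  have "det (F z) = (\<Prod>i<n. f (z(N := as ! i)))"
    if as: "length as = n" "\<forall>i<n. coeff (\<Prod>a\<leftarrow>as. [:- a, 1:]) i = z (N + i)" for z as
  proof -
    obtain T where T: "T \<in> carrier_mat n n" "F z * newton_mat as = newton_mat as * T"
      "\<forall>i<n. \<forall>j<n. i < j \<longrightarrow> T $$ (i, j) = 0" "\<forall>i<n. T $$ (i, i) = f (z(N := as ! i))"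
      using F(3)[of as z] as unfolding triangular_values_def by blast
    have "det (F z) = det (F z * newton_mat as)"
      using det_mult[OF F(1) newton_mat_carrier[OF as(1)]] by (simp add: det_newton_mat)
    also have "\<dots> = det T" using det_mult[OF newton_mat_carrier[OF as(1)] T(1)]
      by (simp add: det_newton_mat T(2))
    also have "\<dots> = prod_list (diag_mat T)" by (rule det_lower_triangular[OF _ T(1)]) (use T(3) in auto)
    also have "\<dots> = (\<Prod>i<n. T $$ (i, i))" using T(1) by (auto simp: prod_list_diag_prod lessThan_atLeast0)
    finally show ?thesis using T(4) by simp
  qed
  then show ?thesis using pfun_det[OF F(1,2)] by (intro bexI[of _ "\<lambda>z. det (F z)"]) auto
qed

lemma pfun_last_poly:
  assumes E: "subfield_emb E" and "f \<in> pfun (Suc N)" "\<And>i. i < N \<Longrightarrow> e i \<in> E"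
  shows "\<exists>p\<in>polys_over E. \<forall>x. poly p x = f (e(N := x))"
  using assms(2)
proof (induction rule: pfun.induct)
  case (pfun_const c)
  show ?case by (rule bexI[of _ "[:emb c:]"]) (auto intro!: polys_over_const subfieldD E)
next
  case (pfun_coord i)
  show ?case
  proof (cases "i = N")
    case True
    then show ?thesis using polys_over_monom[OF E subfieldD(9)[OF E], of 1]
      by (intro bexI[of _ "monom 1 1"]) (auto simp: poly_monom)
  next
    case False
    then show ?thesis using pfun_coord assms(3)[of i]
      by (intro bexI[of _ "[:e i:]"]) (auto intro!: polys_over_const E)
  qed
next
  case (pfun_add f g)
  then obtain p q where "p \<in> polys_over E" "\<forall>x. poly p x = f (e(N := x))" "q \<in> polys_over E"
    "\<forall>x. poly q x = g (e(N := x))" by blast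
  then show ?case by (intro bexI[of _ "p + q"]) (auto simp: fun_upd_def intro!: polys_over_add E)
next
  case (pfun_mult f g)
  then obtain p q where "p \<in> polys_over E" "\<forall>x. poly p x = f (e(N := x))" "q \<in> polys_over E"
    "\<forall>x. poly q x = g (e(N := x))" by blast
  then show ?case by (intro bexI[of _ "p * q"]) (auto simp: fun_upd_def intro!: polys_over_mult E)
qed

text \<open>If \<open>q\<close> vanished at \<open>\<beta>\<close>, the minimal polynomial
  \<open>m\<close> of \<open>\<beta>\<close> would divide both \<open>p\<close> and
  \<open>q\<close>. By minimality of \<open>p\<close> the cofactor of \<open>m\<close> in
  \<open>p\<close> does not vanish at \<open>\<alpha>\<close>, so \<open>m\<close> does, and then so
  would \<open>q\<close>.\<close>

lemma minimal_polynomial_conjugate: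
  assumes E: "subfield_emb E" and p: "p \<in> polys_over E" "p \<noteq> 0" "poly p \<alpha> = 0"
    and min: "\<And>q. q \<in> polys_over E \<Longrightarrow> q \<noteq> 0 \<Longrightarrow> poly q \<alpha> = 0 \<Longrightarrow> degree p \<le> degree q"
    and q: "q \<in> polys_over E" "poly q \<alpha> \<noteq> 0" and \<beta>: "poly p \<beta> = 0"
  shows "poly q \<beta> \<noteq> 0"
proof
  assume q\<beta>: "poly q \<beta> = 0"
  obtain m where m: "m \<in> polys_over E" "m \<noteq> 0" "poly m \<beta> = 0"
    "\<And>m'. m' \<in> polys_over E \<Longrightarrow> m' \<noteq> 0 \<Longrightarrow> poly m' \<beta> = 0 \<Longrightarrow> degree m \<le> degree m'"
    using ex_has_least_nat[of "\<lambda>m. m \<in> polys_over E \<and> m \<noteq> 0 \<and> poly m \<beta> = 0" p degree] p \<beta> by blast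
  have dvd: "\<exists>h\<in>polys_over E. r = m * h" if r: "r \<in> polys_over E" "poly r \<beta> = 0" for r
  proof -
    obtain h s where hs: "h \<in> polys_over E" "s \<in> polys_over E" "r = m * h + s" "s = 0 \<or> degree s < degree m"
      using polys_over_division[OF E m(1,2) r(1)] by blast
    have "poly s \<beta> = 0" using hs(3) r(2) m(3) by simp
    then have "s = 0" using hs(2,4) m(4)[of s] by (meson linorder_not_less)
    then show ?thesis using hs by auto
  qed
  obtain h where h: "h \<in> polys_over E" "p = m * h" using dvd[OF p(1) \<beta>] by blast
  have h0: "h \<noteq> 0" using p(2) h by auto
  have deg: "degree p = degree m + degree h" using h(2) m(2) h0 by (simp add: degree_mult_eq)
  have "degree m \<noteq> 0"
  proof
    assume "degree m = 0"
    then obtain b where "m = [:b:]" by (rule degree_eq_zeroE)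
    then show False using m(2,3) by simp
  qed
  then have "poly h \<alpha> \<noteq> 0" using min[OF h(1) h0] deg by auto
  then have "poly m \<alpha> = 0" using p(3) h(2) by simp
  obtain h' where "q = m * h'" using dvd[OF q(1) q\<beta>] by blast
  then show False using q(2) \<open>poly m \<alpha> = 0\<close> by simp
qed

end

section \<open>Values of sums and of generic linear combinations\<close>

context valued_field
begin

lemma vlt_sum:
  assumes "finite A" "c \<noteq> 0" "\<And>i. i \<in> A \<Longrightarrow> f i \<prec> c"
  shows "sum f A \<prec> c"
  using assms(1,3)
proof (induction A rule: finite_induct)
  case (insert x F)
  then have "f x \<prec> c" "sum f F \<prec> c" by auto
  from vlt_add[OF this] show ?case using insert.hyps by simp
qed (simp add: assms(2))

text \<open>A unique largest term would dominate all others together and could not be cancelled by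
  them.\<close>

lemma sum_zero_two_maximal:
  assumes "finite A" "sum f A = 0" "j0 \<in> A" "f j0 \<noteq> 0"
  shows "\<exists>i\<in>A. \<exists>j\<in>A. i \<noteq> j \<and> f i \<approx> f j \<and> f i \<noteq> 0"
proof -
  have "finite (f ` A)" "f ` A \<noteq> {}" using assms by auto
  from finite_vmax[OF this] obtain j where j: "j \<in> A" "\<And>i. i \<in> A \<Longrightarrow> f i \<preceq> f j" by blast
  have fj: "f j \<noteq> 0" using j(2)[OF assms(3)] assms(4) by auto
  have "\<exists>i\<in>A - {j}. f j \<preceq> f i"
  proof (rule ccontr)
    assume "\<not> ?thesis"
    then have "sum f (A - {j}) \<prec> f j" using assms(1) fj by (intro vlt_sum) auto
    moreover have "f j = - sum f (A - {j})"
      using assms(1,2) j(1) by (simp add: sum.remove[of A j] eq_neg_iff_add_eq_0)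
    ultimately show False by (metis vle_refl vle_uminus(2))
  qed
  then obtain i where "i \<in> A" "i \<noteq> j" "f j \<preceq> f i" by blast
  then show ?thesis using j fj by (intro bexI[of _ j] bexI[of _ i]) (auto simp: veq_def)
qed

lemma emb_mult_vle: "emb c * a \<preceq> a"
  using vle_def V_emb by blast

text \<open>Otherwise the reduction of the scaled polynomial would be nonzero with too many roots.\<close>

lemma small_values_small_coeffs:
  assumes T: "finite (T :: 'k set)" "J \<le> card T" "c \<noteq> 0"
    and small: "\<And>\<epsilon>. \<epsilon> \<in> T \<Longrightarrow> (\<Sum>j<J. emb (\<epsilon> ^ j) * w j) \<prec> c"
    and j: "j < J"
  shows "w j \<prec> c"
proof (rule ccontr)
  assume wj: "\<not> w j \<prec> c"
  have "finite (w ` {..<J})" "w ` {..<J} \<noteq> {}" using j by auto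
  from finite_vmax[OF this] obtain m where m: "m < J" "\<And>i. i < J \<Longrightarrow> w i \<preceq> w m" by auto
  have cm: "c \<preceq> w m" using wj m(2)[OF j] vle_trans by blast
  then have wm: "w m \<noteq> 0" using T(3) by auto
  \<comment> \<open>Dividing by the largest \<open>w m\<close> makes all coefficients integral and
    one of them 1, so the reduction \<open>f\<close> is nonzero of degree below \<open>J\<close>;
    every element of \<open>T\<close> is a root of it.\<close>
  define f where "f = (\<Sum>i<J. monom (res (w i / w m)) i)"
  have uV: "w i / w m \<in> V" if "i < J" for i using m(2)[OF that] vle_iff[OF wm] by blast
  have "res (w m / w m) = 1" using wm M_0 by (intro res_eqI) simp
  then have "coeff f m = 1" using m(1) by (simp add: f_def coeff_sum coeff_monom)
  then have f0: "f \<noteq> 0" by auto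
  have deg: "degree f \<le> J - 1" unfolding f_def
    by (intro degree_sum_le) (auto intro: order_trans[OF degree_monom_le])
  have "poly f \<epsilon> = 0" if "\<epsilon> \<in> T" for \<epsilon>
  proof -
    define s where "s = (\<Sum>i<J. emb (\<epsilon> ^ i) * (w i / w m))"
    have "s = (\<Sum>i<J. emb (\<epsilon> ^ i) * w i) / w m" by (simp add: s_def sum_divide_distrib)
    then have sM: "s \<in> M" using vlt_vle_trans[OF small[OF that] cm] vlt_iff[OF wm] by blast
    have sumM: "(\<And>i. i \<in> A \<Longrightarrow> g i \<in> M) \<Longrightarrow> sum g A \<in> M" for A :: "nat set" and g
      by (induction A rule: infinite_finite_induct) (auto simp: M_0 M_add)
    have "s - emb (poly f \<epsilon>) = (\<Sum>i<J. (w i / w m - emb (res (w i / w m))) * emb (\<epsilon> ^ i))"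
      by (simp add: s_def f_def poly_sum poly_monom emb_sum emb_mult algebra_simps sum_subtractf)
    also have "\<dots> \<in> M" using uV by (intro sumM M_mult res V_emb) auto
    finally have "s - emb (poly f \<epsilon>) \<in> M" .
    from M_diff[OF sM this] show ?thesis by (simp add: emb_in_M)
  qed
  then have "card T \<le> card {x. poly f x = 0}"
    using poly_roots_finite[OF f0] by (intro card_mono) auto
  also have "\<dots> \<le> degree f" using card_poly_roots_bound[OF f0] .
  finally show False using T(2) deg j by simp
qed

end

section \<open>Discretely valued subfields\<close>

context valued_alg_closed
begin

lemma t_power_vle_iff: "t powi z \<preceq> 1 \<longleftrightarrow> z \<ge> 0" and t_power_vlt_iff: "t powi z \<prec> 1 \<longleftrightarrow> z > 0"
proof -
  have pos: "t powi z \<prec> 1" if "z > 0" for z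
    using vlt_power[OF t_vlt_1, of "nat z"] that by (simp add: power_int_def)
  have neg: "1 \<prec> t powi z" if "z < 0" for z
  proof
    assume "t powi z \<preceq> 1"
    then have "t powi z * t powi (- z) \<preceq> 1 * t powi (- z)" using vle_mult vle_refl by blast
    then show False using pos[of "- z"] that t_0 by (simp add: power_int_minus)
  qed
  have "t powi 0 \<preceq> 1" "1 \<preceq> t powi 0" by auto
  then show "t powi z \<preceq> 1 \<longleftrightarrow> z \<ge> 0" "t powi z \<prec> 1 \<longleftrightarrow> z > 0"
    using pos[of z] neg[of z] vlt_imp_vle[of 1 "t powi z"] by (cases "z = 0"; cases "z > 0"; auto intro: vlt_imp_vle)+
qed

text \<open>The last condition makes the restriction of the valuation to \<open>D\<close> discrete.\<close>

definition vbounded :: "'w set \<Rightarrow> bool" where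
  "vbounded D \<longleftrightarrow> subfield_emb D \<and> t \<in> D \<and>
     (\<exists>N>0. \<forall>a\<in>D. a \<noteq> 0 \<longrightarrow> (\<exists>z::int. a ^ N \<approx> t powi z))"

lemma subfield_range_emb: "subfield_emb (range emb)"
  unfolding subfield_emb_def
  by (auto simp flip: emb_add emb_mult emb_uminus emb_inverse)

lemma veq_power_int_quotient:
  "a \<approx> t powi z \<Longrightarrow> b \<approx> t powi z' \<Longrightarrow> a / b \<approx> t powi (z - z')"
  using veq_mult[OF _ veq_inverse, of a "t powi z" b "t powi z'"] t_0
  by (simp add: divide_inverse power_int_diff)

text \<open>A nonzero polynomial in \<open>t\<close> with constant coefficients has the value of its
  lowest nonzero term, because nonzero constants have value 1. So the bound \<open>N = 1\<close>
  serves for the field generated by \<open>t\<close>.\<close>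

lemma vbounded_base: "vbounded (adjoin (range emb) t)"
proof -
  have V: "poly r t \<in> V" if "r \<in> polys_over (range emb)" for r
  proof -
    have "sum f A \<in> V" if "\<And>i. i \<in> A \<Longrightarrow> f i \<in> V" for f and A :: "nat set"
      using that by (induction A rule: infinite_finite_induct) (auto simp: V_0 V_add)
    moreover have "t ^ i \<in> V" for i using M_V[OF t_M] by (induction i) (auto simp: V_1 V_mult)
    moreover have "coeff r i \<in> V" for i using polys_over_coeff[OF that, of i] V_emb by auto
    ultimately show ?thesis by (simp add: poly_altdef V_mult)
  qed
  have *: "r \<noteq> 0 \<Longrightarrow> r \<in> polys_over (range emb) \<Longrightarrow> \<exists>n::int. poly r t \<approx> t powi n" for r
  proof (induction r)
    case (pCons a q)
    have q: "q \<in> polys_over (range emb)"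
      unfolding polys_over_def
    proof (rule CollectI, rule allI)
      fix i show "coeff q i \<in> range emb"
        using polys_over_coeff[OF pCons.prems(2), of "Suc i"] by simp
    qed
    obtain c where c: "a = emb c" using polys_over_coeff[OF pCons.prems(2), of 0] by auto
    show ?case
    proof (cases "a = 0")
      case True
      then obtain n where "poly q t \<approx> t powi n" using pCons.IH[OF _ q] pCons.prems(1) by auto
      then have "t * poly q t \<approx> t * t powi n" by (intro veq_mult) auto
      then show ?thesis using True t_0 by (intro exI[of _ "1 + n"]) (simp add: power_int_add)
    next
      case False
      have "t * poly q t \<in> M" using M_mult[OF t_M V[OF q]] .
      then have "t * poly q t \<prec> 1" by (simp add: vlt_1_iff)
      moreover have "a \<approx> 1" using False c emb_unit by simp
      ultimately have "t * poly q t \<prec> a" by (meson veq_def vle_trans)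
      then have "t * poly q t + a \<approx> a" by (rule veq_add_vlt)
      then show ?thesis using \<open>a \<approx> 1\<close> veq_trans by (intro exI[of _ 0]) (auto simp: add.commute)
    qed
  qed simp
  have "\<exists>z::int. a ^ 1 \<approx> t powi z" if "a \<in> adjoin (range emb) t" "a \<noteq> 0" for a
  proof -
    obtain r s where rs: "a = poly r t / poly s t" "r \<in> polys_over (range emb)" "s \<in> polys_over (range emb)"
      "poly s t \<noteq> 0" using \<open>a \<in> adjoin _ _\<close> by (auto simp: adjoin_def)
    then have "r \<noteq> 0" "s \<noteq> 0" using \<open>a \<noteq> 0\<close> by auto
    then obtain n n' where "poly r t \<approx> t powi n" "poly s t \<approx> t powi n'"
      using *[OF _ rs(2)] *[OF _ rs(3)] by blast
    then show ?thesis unfolding rs(1) using veq_power_int_quotient by (metis power_one_right)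
  qed
  then show ?thesis unfolding vbounded_def
    using subfield_adjoin[OF subfield_range_emb] adjoin_self[OF subfield_range_emb] by blast
qed

text \<open>A linear dependence over \<open>D\<close> among the powers of \<open>b\<close> has two
  terms of equal value, so some \<open>b ^ e\<close> with \<open>0 < e \<le> n\<close> has the value
  of an element of \<open>D\<close>. The factorial of \<open>n\<close> is a multiple of every
  possible \<open>e\<close>, which gives one exponent for all \<open>b\<close>.\<close>

lemma vbounded_adjoin:
  assumes "vbounded D" "p \<in> polys_over D" "p \<noteq> 0" "poly p \<alpha> = 0"
  shows "vbounded (adjoin D \<alpha>)"
proof -
  obtain N where D: "subfield_emb D" "t \<in> D" "N > 0"
    "\<And>a. a \<in> D \<Longrightarrow> a \<noteq> 0 \<Longrightarrow> \<exists>z::int. a ^ N \<approx> t powi z"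
    using assms(1) unfolding vbounded_def by blast
  define n where "n = degree p"
  have *: "\<exists>z::int. b ^ (fact n * N) \<approx> t powi z" if b: "b = poly r \<alpha>" "r \<in> polys_over D" "b \<noteq> 0" for b r
  proof -
    obtain x where x: "\<And>j. j \<le> n \<Longrightarrow> x j \<in> D" "\<exists>j\<le>n. x j \<noteq> 0" "(\<Sum>j\<le>n. x j * b ^ j) = 0"
      using power_dependence[OF D(1) assms(2-4) b(2)] b(1) n_def by auto
    obtain j0 where j0: "j0 \<in> {..n}" "x j0 * b ^ j0 \<noteq> 0" using x(2) b(3) by auto
    obtain i j where ij: "i \<le> n" "j \<le> n" "i \<noteq> j" "x i * b ^ i \<approx> x j * b ^ j" "x i * b ^ i \<noteq> 0"
      using sum_zero_two_maximal[OF _ x(3) j0] by auto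
    have key: "\<exists>e d. 0 < e \<and> e \<le> n \<and> d \<in> D \<and> d \<noteq> 0 \<and> b ^ e \<approx> d"
      if "i < j" "j \<le> n" "x i * b ^ i \<approx> x j * b ^ j" "x i * b ^ i \<noteq> 0" for i j
    proof -
      have nz: "x i \<noteq> 0" "x j \<noteq> 0" using that(3,4) by auto
      have "b ^ j = b ^ i * b ^ (j - i)" using that(1) by (simp flip: power_add)
      then have "x j * b ^ j * (inverse (x j) * inverse (b ^ i)) = b ^ (j - i)"
        "x i * b ^ i * (inverse (x j) * inverse (b ^ i)) = x i / x j"
        using nz b(3) by (auto simp: field_simps)
      then have "x i / x j \<approx> b ^ (j - i)"
        using veq_mult[OF that(3) veq_refl[of "inverse (x j) * inverse (b ^ i)"]] by simp
      moreover have "x i / x j \<in> D" using x(1) that by (intro subfieldD(7)[OF D(1)]) auto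
      ultimately show ?thesis using nz that veq_sym
        by (intro exI[of _ "j - i"] exI[of _ "x i / x j"]) auto
    qed
    have "\<exists>e d. 0 < e \<and> e \<le> n \<and> d \<in> D \<and> d \<noteq> 0 \<and> b ^ e \<approx> d"
    proof (cases "i < j")
      case True
      then show ?thesis using key ij by blast
    next
      case False
      then have "x j * b ^ j \<noteq> 0" "j < i" using ij by auto
      then show ?thesis using key[OF _ ij(1) veq_sym[OF ij(4)]] by blast
    qed
    then obtain e d where e: "0 < e" "e \<le> n" "d \<in> D" "d \<noteq> 0" "b ^ e \<approx> d" by blast
    obtain z where z: "d ^ N \<approx> t powi z" using D(4)[OF e(3,4)] by blast
    have "e dvd fact n" using e by (simp add: dvd_fact)
    then obtain m where m: "fact n = e * m" by blast
    have "b ^ (fact n * N) = ((b ^ e) ^ N) ^ m" unfolding m by (simp add: power_mult[symmetric] mult_ac)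
    also have "\<dots> \<approx> (t powi z) ^ m"
      using veq_power[OF veq_trans[OF veq_power[OF e(5)] z]] .
    also have "(t powi z) ^ m = t powi (z * int m)" by (simp add: power_int_mult)
    finally show ?thesis by blast
  qed
  have "\<exists>z::int. a ^ (fact n * N) \<approx> t powi z" if "a \<in> adjoin D \<alpha>" "a \<noteq> 0" for a
  proof -
    obtain r s where rs: "a = poly r \<alpha> / poly s \<alpha>" "r \<in> polys_over D" "s \<in> polys_over D"
      "poly s \<alpha> \<noteq> 0" using \<open>a \<in> adjoin _ _\<close> by (auto simp: adjoin_def)
    then have "poly r \<alpha> \<noteq> 0" using \<open>a \<noteq> 0\<close> by auto
    then obtain z z' where "poly r \<alpha> ^ (fact n * N) \<approx> t powi z" "poly s \<alpha> ^ (fact n * N) \<approx> t powi z'"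
      using *[OF refl rs(2)] *[OF refl rs(3) rs(4)] by blast
    then show ?thesis unfolding rs(1) power_divide using veq_power_int_quotient by blast
  qed
  moreover have "fact n * N > 0" using D(3) by simp
  ultimately show ?thesis unfolding vbounded_def
    using subfield_adjoin[OF D(1)] adjoin_base[OF D(1)] D(2) by blast
qed

text \<open>The integer \<open>z a\<close> with \<open>a ^ N \<approx> t powi z a\<close> is
  \<open>N\<close> times the valuation of \<open>a\<close> in units of that of \<open>t\<close>. An
  element of \<open>M\<close> for which it is least divides all the others.\<close>

lemma vbounded_uniformizer:
  assumes "vbounded D"
  shows "\<exists>\<pi>\<in>D \<inter> M. \<pi> \<noteq> 0 \<and> (\<forall>a\<in>D \<inter> M. \<exists>v\<in>D \<inter> V. a = \<pi> * v) \<and> (\<forall>a\<in>D. \<exists>e. \<pi> ^ e * a \<in> V)"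
proof -
  obtain N where D: "subfield_emb D" "t \<in> D" "N > 0"
    "\<And>a. a \<in> D \<Longrightarrow> a \<noteq> 0 \<Longrightarrow> \<exists>z::int. a ^ N \<approx> t powi z"
    using assms unfolding vbounded_def by blast
  from D(4) obtain z :: "'w \<Rightarrow> int" where z: "\<And>a. a \<in> D \<Longrightarrow> a \<noteq> 0 \<Longrightarrow> a ^ N \<approx> t powi z a" by metis
  have V: "a \<in> V \<longleftrightarrow> z' \<ge> 0" if "a ^ N \<approx> t powi z'" for a z'
  proof -
    have "a \<preceq> 1 \<longleftrightarrow> a ^ N \<preceq> 1 ^ N" using vle_power[of a 1 N] vlt_power[of a 1 N] D(3) by auto
    then show ?thesis using veq_vle[OF that veq_refl[of 1]] t_power_vle_iff vle_1_iff by auto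
  qed
  have Mz: "a \<in> M \<longleftrightarrow> z a > 0" if "a \<in> D" "a \<noteq> 0" for a
  proof -
    have "1 \<preceq> a \<longleftrightarrow> 1 ^ N \<preceq> a ^ N" using vle_power[of 1 a N] vlt_power[of 1 a N] D(3) by auto
    then show ?thesis using veq_vle[OF veq_refl[of 1] z[OF that]] t_power_vlt_iff vlt_1_iff by auto
  qed
  obtain \<pi> where \<pi>: "\<pi> \<in> D \<inter> M" "\<pi> \<noteq> 0" "\<And>a. a \<in> D \<inter> M \<Longrightarrow> a \<noteq> 0 \<Longrightarrow> nat (z \<pi>) \<le> nat (z a)"
    using ex_has_least_nat[of "\<lambda>a. a \<in> D \<inter> M \<and> a \<noteq> 0" t "\<lambda>a. nat (z a)"] D(2) t_M t_0 by blast
  have "\<exists>v\<in>D \<inter> V. a = \<pi> * v" if "a \<in> D \<inter> M" for a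
  proof (cases "a = 0")
    case True
    then show ?thesis using V_0 subfieldD(8)[OF D(1)] by (intro bexI[of _ 0]) auto
  next
    case False
    have "z \<pi> \<le> z a" using \<pi>(3)[OF that False] Mz[of a] that False by auto
    moreover have "(a / \<pi>) ^ N \<approx> t powi (z a - z \<pi>)"
      unfolding power_divide using z that False \<pi> by (intro veq_power_int_quotient) auto
    ultimately have "a / \<pi> \<in> V" using V by auto
    moreover have "a / \<pi> \<in> D" using that \<pi>(1) by (intro subfieldD(7)[OF D(1)]) auto
    ultimately show ?thesis using \<pi>(2) by (intro bexI[of _ "a / \<pi>"]) auto
  qed
  moreover have "\<exists>e. \<pi> ^ e * a \<in> V" if "a \<in> D" for a
  proof (cases "a = 0")
    case True
    then show ?thesis using V_0 by simp
  next
    case False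
    \<comment> \<open>Since \<open>z \<pi> \<ge> 1\<close>, this many factors \<open>\<pi>\<close>
      compensate any negative \<open>z a\<close>.\<close>
    define e where "e = nat \<bar>z a\<bar>"
    have "(\<pi> ^ N) ^ e * a ^ N \<approx> (t powi z \<pi>) ^ e * t powi z a"
      using z that False \<pi> by (intro veq_mult veq_power) auto
    also have "(t powi z \<pi>) ^ e * t powi z a = t powi (z \<pi> * int e + z a)"
      using t_0 by (simp add: power_int_mult power_int_add)
    finally have "(\<pi> ^ e * a) ^ N \<approx> t powi (z \<pi> * int e + z a)"
      by (simp add: power_mult_distrib power_mult[symmetric] mult.commute)
    moreover have "z \<pi> * int e + z a \<ge> 0"
    proof -
      have "z \<pi> \<ge> 1" using Mz[of \<pi>] \<pi>(1,2) by auto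
      then have "int e \<le> z \<pi> * int e" by (simp add: mult_le_cancel_right1)
      then show ?thesis by (simp add: e_def)
    qed
    ultimately show ?thesis using V by blast
  qed
  ultimately show ?thesis using \<pi>(1,2) by blast
qed

section \<open>Descent of finite systems of strict inequalities\<close>

definition sat :: "(((nat \<Rightarrow> 'w) \<Rightarrow> 'w) \<times> ((nat \<Rightarrow> 'w) \<Rightarrow> 'w)) set \<Rightarrow> (nat \<Rightarrow> 'w) \<Rightarrow> bool" where
  "sat S y \<longleftrightarrow> (\<forall>(P, Q)\<in>S. P y \<prec> Q y)"

definition specializable :: "'w set \<Rightarrow> bool" where
  "specializable E \<longleftrightarrow> (\<forall>N S y. finite S \<longrightarrow> S \<subseteq> pfun N \<times> pfun N \<longrightarrow> (\<forall>i<N. y i \<in> E) \<longrightarrow> sat S y \<longrightarrow>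
     (\<exists>D y'. vbounded D \<and> (\<forall>i<N. y' i \<in> D) \<and> sat S y'))"

lemma specializableD:
  assumes "specializable E" "finite S" "S \<subseteq> pfun N \<times> pfun N" "\<And>i. i < N \<Longrightarrow> y i \<in> E" "sat S y"
  shows "\<exists>D y'. vbounded D \<and> (\<forall>i<N. y' i \<in> D) \<and> sat S y'"
  using assms unfolding specializable_def by blast

lemma sat_cong:
  assumes "S \<subseteq> pfun N \<times> pfun N" "\<And>i. i < N \<Longrightarrow> y i = y' i"
  shows "sat S y \<longleftrightarrow> sat S y'"
proof -
  have *: "P y = P y'" if "P \<in> pfun N" for P using pfun_cong[OF that assms(2)] .
  have "(case p of (P, Q) \<Rightarrow> P y \<prec> Q y) \<longleftrightarrow> (case p of (P, Q) \<Rightarrow> P y' \<prec> Q y')" if pS: "p \<in> S" for p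
  proof -
    obtain P Q where p: "p = (P, Q)" "P \<in> pfun N" "Q \<in> pfun N" using assms(1) pS by (cases p) auto
    then show ?thesis using *[OF p(2)] *[OF p(3)] by simp
  qed
  then show ?thesis unfolding sat_def by simp
qed

text \<open>Each element of \<open>E(x)\<close> is a fraction of polynomials in \<open>x\<close>.
  Taking the coefficients of all numerators and denominators as new coordinates leaves a system in
  which \<open>x\<close> is the only coordinate that may lie outside \<open>E\<close>.\<close>

lemma specializable_adjoin:
  assumes E: "subfield_emb E"
    and step: "\<And>N S e. finite S \<Longrightarrow> S \<subseteq> pfun (Suc N) \<times> pfun (Suc N) \<Longrightarrow> (\<And>i. i < N \<Longrightarrow> e i \<in> E) \<Longrightarrow>
      sat S (e(N := x)) \<Longrightarrow> \<exists>D y'. vbounded D \<and> (\<forall>i<Suc N. y' i \<in> D) \<and> sat S y'"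
  shows "specializable (adjoin E x)"
  unfolding specializable_def
proof (intro allI impI)
  fix N S y
  assume S: "finite S" "S \<subseteq> pfun N \<times> pfun N" and y: "\<forall>i<N. y i \<in> adjoin E x" and sat: "sat S y"
  have "\<forall>i<N. \<exists>r s. r \<in> polys_over E \<and> s \<in> polys_over E \<and> poly s x \<noteq> 0 \<and> y i = poly r x / poly s x"
    using y unfolding adjoin_def by blast
  then obtain r s where rs: "\<And>i. i < N \<Longrightarrow> r i \<in> polys_over E" "\<And>i. i < N \<Longrightarrow> s i \<in> polys_over E"
    "\<And>i. i < N \<Longrightarrow> poly (s i) x \<noteq> 0" "\<And>i. i < N \<Longrightarrow> y i = poly (r i) x / poly (s i) x" by metis
  \<comment> \<open>\<open>K\<close> exceeds every degree involved. Each old coordinate gets a block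
    of \<open>2 * K\<close> new ones, first the coefficients of its numerator, then those of its
    denominator; \<open>x\<close> follows as coordinate \<open>n\<close>.\<close>
  define K where "K = Suc (\<Sum>i<N. degree (r i) + degree (s i))"
  have K: "degree (r i) < K" "degree (s i) < K" if "i < N" for i
    using member_le_sum[of i "{..<N}" "\<lambda>i. degree (r i) + degree (s i)"] that by (auto simp: K_def)
  define n where "n = N * (2 * K)"
  have ind: "i * (2 * K) + j < n" if "i < N" "j < 2 * K" for i j
  proof -
    have "i * (2 * K) + 2 * K \<le> n" using mult_le_mono1[of "Suc i" N "2 * K"] that by (simp add: n_def)
    then show ?thesis using that by simp
  qed
  define e where "e m = (if m mod (2 * K) < K then coeff (r (m div (2 * K))) (m mod (2 * K))
      else coeff (s (m div (2 * K))) (m mod (2 * K) - K))" for m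
  define R where "R i z = (\<Sum>j<K. z (i * (2 * K) + j) * z n ^ j)" for i and z :: "nat \<Rightarrow> 'w"
  define Q where "Q i z = (\<Sum>j<K. z (i * (2 * K) + (K + j)) * z n ^ j)" for i and z :: "nat \<Rightarrow> 'w"
  have RQ: "R i \<in> pfun (Suc n)" "Q i \<in> pfun (Suc n)" if "i < N" for i
    unfolding R_def[abs_def] Q_def[abs_def]
    using ind[OF that] by (auto intro!: pfun_sum pfun_mult pfun_power pfun_coord less_SucI)
  have eE: "e m \<in> E" if "m < n" for m
  proof -
    have "m div (2 * K) < N" using that by (simp add: n_def div_less_iff_less_mult K_def)
    then show ?thesis using rs(1,2) polys_over_coeff by (auto simp: e_def)
  qed
  define z0 where "z0 = e(n := x)"
  have z0: "R i z0 = poly (r i) x" "Q i z0 = poly (s i) x" if "i < N" for i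
  proof -
    have e1: "z0 (i * (2 * K) + j) = coeff (r i) j" "z0 (i * (2 * K) + (K + j)) = coeff (s i) j" if "j < K" for j
    proof -
      have dm: "(i * m + l) div m = i" "(i * m + l) mod m = l" if "l < m" for m l :: nat
        using that by simp_all
      have a: "(i * (2 * K) + j) div (2 * K) = i" "(i * (2 * K) + j) mod (2 * K) = j"
        "(i * (2 * K) + (K + j)) div (2 * K) = i" "(i * (2 * K) + (K + j)) mod (2 * K) = K + j"
        using that by (intro dm; simp)+
      have b: "i * (2 * K) + j \<noteq> n" "i * (2 * K) + (K + j) \<noteq> n"
        using ind[OF \<open>i < N\<close>, of j] ind[OF \<open>i < N\<close>, of "K + j"] that by auto
      show "z0 (i * (2 * K) + j) = coeff (r i) j" "z0 (i * (2 * K) + (K + j)) = coeff (s i) j"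
        using b that unfolding z0_def e_def fun_upd_def a by simp_all
    qed
    have ps: "poly q x = (\<Sum>j<K. coeff q j * x ^ j)" if "degree q < K" for q
      unfolding poly_altdef using that by (intro sum.mono_neutral_left) (auto simp: coeff_eq_0)
    show "R i z0 = poly (r i) x" "Q i z0 = poly (s i) x"
      unfolding R_def Q_def ps[OF K(1)[OF that]] ps[OF K(2)[OF that]]
      by (intro sum.cong refl; simp add: e1; simp add: z0_def)+
  qed
  define ok where "ok f g e \<longleftrightarrow> g \<in> pfun (Suc n) \<and> (\<forall>z. (\<forall>i<N. Q i z \<noteq> 0) \<longrightarrow>
    g z = (\<Prod>i<N. Q i z) ^ e * f (\<lambda>i. R i z / Q i z))" for f g e
  have "\<forall>f\<in>pfun N. \<exists>p. ok f (fst p) (snd p)"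
  proof
    fix f assume "f \<in> pfun N"
    then have "\<exists>g\<in>pfun (Suc n). \<exists>e. \<forall>z. (\<forall>i<N. Q i z \<noteq> 0) \<longrightarrow>
      g z = (\<Prod>i<N. Q i z) ^ e * f (\<lambda>i. R i z / Q i z)"
      using RQ by (intro pfun_clear_denominators)
    then obtain g e where "ok f g e" unfolding ok_def by blast
    then show "\<exists>p. ok f (fst p) (snd p)" by (intro exI[of _ "(g, e)"]) simp
  qed
  from bchoice[OF this] obtain c where c: "\<And>f. f \<in> pfun N \<Longrightarrow> ok f (fst (c f)) (snd (c f))" by blast
  obtain g ex where g: "\<And>f. f \<in> pfun N \<Longrightarrow> g f \<in> pfun (Suc n)"
    "\<And>f z. f \<in> pfun N \<Longrightarrow> \<forall>i<N. Q i z \<noteq> 0 \<Longrightarrow> g f z = (\<Prod>i<N. Q i z) ^ ex f * f (\<lambda>i. R i z / Q i z)"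
    by (rule that[of "\<lambda>f. fst (c f)" "\<lambda>f. snd (c f)"]) (use c in \<open>auto simp: ok_def\<close>)
  \<comment> \<open>Each side is multiplied by the power that cleared the other one, so both carry
    the same factor and the inequality is unchanged.\<close>
  define h where "h = (\<lambda>(P, P'). (\<lambda>z. g P z * (\<Prod>i<N. Q i z) ^ ex P', \<lambda>z. g P' z * (\<Prod>i<N. Q i z) ^ ex P))"
  \<comment> \<open>The inequalities \<open>0 \<prec> Q i\<close> ensure that the denominators are
    still nonzero at the new solution.\<close>
  define S' where "S' = h ` S \<union> (\<lambda>i. (\<lambda>_. 0, Q i)) ` {..<N}"
  have fS': "finite S'" using S(1) by (simp add: S'_def)
  have S'p: "S' \<subseteq> pfun (Suc n) \<times> pfun (Suc n)"
    using S(2) RQ(2) by (auto simp: S'_def h_def intro!: pfun_mult pfun_power pfun_prod g(1) pfun_0)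
  have satS': "sat S' z \<longleftrightarrow> sat S (\<lambda>i. R i z / Q i z)" if nz: "\<forall>i<N. Q i z \<noteq> 0" for z
  proof -
    have "(case h p of (P, Q) \<Rightarrow> P z \<prec> Q z) \<longleftrightarrow>
      (case p of (P, Q') \<Rightarrow> P (\<lambda>i. R i z / Q i z) \<prec> Q' (\<lambda>i. R i z / Q i z))" if pS: "p \<in> S" for p
    proof -
      obtain P P' where p: "p = (P, P')" "P \<in> pfun N" "P' \<in> pfun N" using S(2) pS by (cases p) auto
      define \<sigma> where "\<sigma> = (\<Prod>i<N. Q i z) ^ (ex P + ex P')"
      have "\<sigma> \<noteq> 0" using nz by (simp add: \<sigma>_def)
      have "g P z * (\<Prod>i<N. Q i z) ^ ex P' = P (\<lambda>i. R i z / Q i z) * \<sigma>"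
        "g P' z * (\<Prod>i<N. Q i z) ^ ex P = P' (\<lambda>i. R i z / Q i z) * \<sigma>"
        using g(2)[OF p(2) nz] g(2)[OF p(3) nz] by (auto simp: \<sigma>_def power_add)
      then show ?thesis using vle_mult_cancel[OF \<open>\<sigma> \<noteq> 0\<close>] by (simp add: p h_def)
    qed
    moreover have "\<forall>i<N. 0 \<prec> Q i z" using nz by simp
    ultimately show ?thesis unfolding sat_def S'_def by (simp add: ball_Un)
  qed
  have "\<forall>i<N. Q i z0 \<noteq> 0" using z0 rs(3) by simp
  moreover have "sat S (\<lambda>i. R i z0 / Q i z0)"
    using sat sat_cong[OF S(2), of y "\<lambda>i. R i z0 / Q i z0"] z0 rs(4) by auto
  ultimately have "sat S' (e(n := x))" using satS' z0_def by simp
  then obtain D z where D: "vbounded D" "\<forall>i<Suc n. z i \<in> D" "sat S' z"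
    using step[OF fS' S'p, where e = e] eE by blast
  have nz: "\<forall>i<N. Q i z \<noteq> 0" using D(3) by (simp add: sat_def S'_def ball_Un)
  have sD: "subfield_emb D" using D(1) by (simp add: vbounded_def)
  have "R i z / Q i z \<in> D" if "i < N" for i
    using pfun_in_subfield[OF sD RQ(1)[OF that]] pfun_in_subfield[OF sD RQ(2)[OF that]] D(2)
    by (intro subfieldD(7)[OF sD]) auto
  then show "\<exists>D y'. vbounded D \<and> (\<forall>i<N. y' i \<in> D) \<and> sat S y'"
    using D(1,3) satS'[OF nz] by (intro exI[of _ D] exI[of _ "\<lambda>i. R i z / Q i z"]) simp
qed

end

section \<open>The algebraic step and the conclusion of the descent\<close>

context valued_alg_closed
begin

text \<open>The coefficients of the minimal polynomial of \<open>\<alpha>\<close> can be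
  specialized, but not the choice of the root. The system at \<open>\<alpha>\<close> is therefore
  encoded in norm inequalities between \<open>G \<epsilon>\<close> and \<open>H \<epsilon>\<close>
  for many constants. After specialization each of them holds at some root, the pigeonhole principle
  finds a root that serves more than \<open>J\<close> constants, and there the single inequalities
  can be recovered.\<close>

lemma specializable_adjoin_root:
  assumes E: "subfield_emb E" "specializable E" and p0: "p0 \<in> polys_over E" "p0 \<noteq> 0" "poly p0 \<alpha> = 0"
  shows "specializable (adjoin E \<alpha>)"
proof (rule specializable_adjoin[OF E(1)])
  fix N S e
  assume S: "finite S" "S \<subseteq> pfun (Suc N) \<times> pfun (Suc N)" and eE: "\<And>i. i < N \<Longrightarrow> e i \<in> E"
    and sat: "sat S (e(N := \<alpha>))"
  obtain p1 where p1: "p1 \<in> polys_over E" "p1 \<noteq> 0" "poly p1 \<alpha> = 0"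
    "\<And>q. q \<in> polys_over E \<Longrightarrow> q \<noteq> 0 \<Longrightarrow> poly q \<alpha> = 0 \<Longrightarrow> degree p1 \<le> degree q"
    using ex_has_least_nat[of "\<lambda>q. q \<in> polys_over E \<and> q \<noteq> 0 \<and> poly q \<alpha> = 0" p0 degree] p0 by blast
  define p where "p = smult (inverse (lead_coeff p1)) p1"
  have p: "p \<in> polys_over E" "p \<noteq> 0" "poly p \<alpha> = 0" "lead_coeff p = 1" "degree p = degree p1"
    using p1(1-3) polys_over_coeff[OF p1(1)] by (auto simp: p_def intro!: polys_over_smult E subfieldD)
  define n where "n = degree p"
  obtain as where as: "length as = n" "p = (\<Prod>a\<leftarrow>as. [:- a, 1:])"
    using alg_closed_splits[OF alg_closed p(2)] p(4) n_def by auto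
  have root: "poly p a = 0 \<longleftrightarrow> a \<in> set as" for a
    by (auto simp: as(2) poly_linear_factors prod_list_zero_iff image_iff)
  then obtain i0 where i0: "i0 < n" "as ! i0 = \<alpha>" using p(3) as(1) by (metis in_set_conv_nth)
  have n: "n > 0" using i0 by simp
  \<comment> \<open>The point over \<open>E\<close> that gets specialized: the old coordinates,
    followed from index \<open>N\<close> on by the coefficients of \<open>p\<close>.\<close>
  define z0 where "z0 m = (if m < N then e m else coeff p (m - N))" for m
  have z0E: "z0 m \<in> E" for m using eE polys_over_coeff[OF p(1)] by (auto simp: z0_def)
  have z0c: "\<And>i. i < n \<Longrightarrow> coeff (\<Prod>a\<leftarrow>as. [:- a, 1:]) i = z0 (N + i)"
    by (simp add: z0_def as(2))
  have z0e: "f (z0(N := a)) = f (e(N := a))" if "f \<in> pfun (Suc N)" for f a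
    by (rule pfun_cong[OF that]) (auto simp: z0_def)
  define J where "J = card S"
  obtain h where h: "bij_betw h {..<J} S"
    using ex_bij_betw_nat_finite[OF S(1)] by (auto simp: J_def lessThan_atLeast0)
  have hS: "h j \<in> S" if "j < J" for j using h that by (auto simp: bij_betw_def)
  define P where "P j = fst (h j)" for j
  define R where "R j = snd (h j)" for j
  have PR: "P j \<in> pfun (Suc N)" "R j \<in> pfun (Suc N)" if "j < J" for j
    using hS[OF that] S(2) unfolding P_def R_def by force+
  have satPR: "sat S y \<longleftrightarrow> (\<forall>j<J. P j y \<prec> R j y)" for y
  proof -
    have "S = h ` {..<J}" using h by (simp add: bij_betw_def)
    then show ?thesis unfolding sat_def P_def R_def by (auto simp: case_prod_beta)
  qed
  \<comment> \<open>Over the common denominator \<open>Q\<close> the system reads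
    \<open>w j \<prec> Q\<close> for all \<open>j\<close>, so that all members can be mixed into the
    combinations \<open>G \<epsilon>\<close>.\<close>
  define Q where "Q y = (\<Prod>j<J. R j y)" for y
  define w where "w j y = P j y * (\<Prod>l\<in>{..<J} - {j}. R l y)" for j y
  define G where "G \<epsilon> y = (\<Sum>j<J. emb (\<epsilon> ^ j) * w j y)" for \<epsilon> y
  have Qp: "Q \<in> pfun (Suc N)" unfolding Q_def[abs_def] using PR by (intro pfun_prod) auto
  have Gp: "G \<epsilon> \<in> pfun (Suc N)" for \<epsilon>
    unfolding G_def[abs_def] w_def[abs_def] using PR
    by (intro pfun_sum pfun_mult pfun_prod pfun_const) auto
  have Qr: "Q y = R j y * (\<Prod>l\<in>{..<J} - {j}. R l y)" if "j < J" for j y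
    unfolding Q_def using that by (intro prod.remove) auto
  define Qi where "Qi i = Q (e(N := as ! i))" for i
  define Gi where "Gi \<epsilon> i = G \<epsilon> (e(N := as ! i))" for \<epsilon> i
  have satj: "\<forall>j<J. P j (e(N := \<alpha>)) \<prec> R j (e(N := \<alpha>))" using sat satPR by blast
  have "\<forall>j<J. R j (e(N := \<alpha>)) \<noteq> 0" using satj by auto
  then have Q\<alpha>: "Q (e(N := \<alpha>)) \<noteq> 0" by (simp add: Q_def)
  have wlt: "w j (e(N := \<alpha>)) \<prec> Q (e(N := \<alpha>))" if "j < J" for j
  proof -
    have "(\<Prod>l\<in>{..<J} - {j}. R l (e(N := \<alpha>))) \<noteq> 0"
      using Q\<alpha> Qr[OF that, of "e(N := \<alpha>)"] by auto
    then show ?thesis unfolding w_def Qr[OF that] using satj that vle_mult_cancel by blast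
  qed
  have Glt: "Gi \<epsilon> i0 \<prec> Qi i0" for \<epsilon>
    unfolding Gi_def Qi_def i0(2) G_def
  proof (intro vlt_sum Q\<alpha>)
    fix j assume "j \<in> {..<J}"
    then show "emb (\<epsilon> ^ j) * w j (e(N := \<alpha>)) \<prec> Q (e(N := \<alpha>))"
      using vle_vlt_trans[OF emb_mult_vle wlt] by simp
  qed simp
  \<comment> \<open>Conjugates of \<open>\<alpha>\<close> annihilate the same polynomials over
    \<open>E\<close>; hence \<open>Q\<close> is nonzero at all of them and values can be compared
    with it.\<close>
  have Qnz: "Qi i \<noteq> 0" if "i < n" for i
  proof -
    obtain q where q: "q \<in> polys_over E" "\<forall>x. poly q x = Q (e(N := x))"
      using pfun_last_poly[OF E(1) Qp, of e] eE by blast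
    have "poly p (as ! i) = 0" using root that as(1) by simp
    from minimal_polynomial_conjugate[OF E(1) p(1-3) _ q(1) _ this]
    have "poly q (as ! i) \<noteq> 0" using p1(4) p(5) q(2) Q\<alpha> by simp
    then show ?thesis using q(2) by (simp add: Qi_def)
  qed
  have "\<exists>c. c \<notin> insert 0 ((\<lambda>i. res (Gi \<epsilon> i / Qi i)) ` {..<n})" for \<epsilon>
    by (rule ex_new_if_finite[OF infinite_k]) simp
  then obtain c where c: "\<And>\<epsilon>. c \<epsilon> \<notin> insert 0 ((\<lambda>i. res (Gi \<epsilon> i / Qi i)) ` {..<n})" by metis
  \<comment> \<open>The constant \<open>c \<epsilon>\<close> prevents cancellation at every
    conjugate: there \<open>H \<epsilon>\<close> has the larger of the values of \<open>Q\<close>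
    and \<open>G \<epsilon>\<close>. So \<open>G \<epsilon> \<preceq> H \<epsilon>\<close> holds at
    all conjugates and strictly at \<open>\<alpha>\<close>, which makes the norms strictly
    ordered.\<close>
  define H where "H \<epsilon> y = emb (c \<epsilon>) * Q y - G \<epsilon> y" for \<epsilon> y
  have Hp: "H \<epsilon> \<in> pfun (Suc N)" for \<epsilon>
    unfolding H_def[abs_def] by (intro pfun_diff pfun_mult pfun_const Qp Gp)
  have GH: "Gi \<epsilon> i \<preceq> H \<epsilon> (e(N := as ! i)) \<and> H \<epsilon> (e(N := as ! i)) \<noteq> 0 \<and>
      (i = i0 \<longrightarrow> Gi \<epsilon> i \<prec> H \<epsilon> (e(N := as ! i)))" if "i < n" for \<epsilon> i
  proof -
    have Hi: "H \<epsilon> (e(N := as ! i)) = emb (c \<epsilon>) * Qi i - Gi \<epsilon> i" by (simp add: H_def Qi_def Gi_def)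
    have cn: "c \<epsilon> \<noteq> 0" "c \<epsilon> \<noteq> res (Gi \<epsilon> i / Qi i)" using c[of \<epsilon>] that by auto
    show ?thesis
    proof (cases "Gi \<epsilon> i \<preceq> Qi i")
      case True
      have eq: "H \<epsilon> (e(N := as ! i)) \<approx> Qi i" unfolding Hi using veq_emb_minus[OF True Qnz[OF that] cn(2)] .
      have "H \<epsilon> (e(N := as ! i)) \<noteq> 0" using eq Qnz[OF that] by auto
      moreover have "Gi \<epsilon> i \<preceq> H \<epsilon> (e(N := as ! i))" using eq True vle_trans unfolding veq_def by blast
      moreover have "Gi \<epsilon> i \<prec> H \<epsilon> (e(N := as ! i))" if "i = i0"
        using eq Glt[of \<epsilon>] that vle_trans unfolding veq_def by blast
      ultimately show ?thesis by blast
    next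
      case False
      then have "emb (c \<epsilon>) * Qi i \<prec> Gi \<epsilon> i" using vle_vlt_trans[OF emb_mult_vle] by blast
      from veq_diff_vlt(2)[OF this] have eq: "H \<epsilon> (e(N := as ! i)) \<approx> Gi \<epsilon> i" unfolding Hi .
      have "Gi \<epsilon> i \<noteq> 0" using False by auto
      then have "H \<epsilon> (e(N := as ! i)) \<noteq> 0" using eq by auto
      moreover have "i \<noteq> i0" using False Glt[of \<epsilon>] vlt_imp_vle by blast
      ultimately show ?thesis using eq by (simp add: veq_def)
    qed
  qed
  have "\<exists>g. g \<in> pfun (N + n) \<and> (\<forall>z as. length as = n \<longrightarrow>
    (\<forall>i<n. coeff (\<Prod>a\<leftarrow>as. [:- a, 1:]) i = z (N + i)) \<longrightarrow> g z = (\<Prod>i<n. f (z(N := as ! i))))"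
    if "f \<in> pfun (Suc N)" for f using pfun_norm[OF that n] by blast
  note norm_ex = this
  define nm where "nm f = (SOME g. g \<in> pfun (N + n) \<and> (\<forall>z as. length as = n \<longrightarrow>
    (\<forall>i<n. coeff (\<Prod>a\<leftarrow>as. [:- a, 1:]) i = z (N + i)) \<longrightarrow> g z = (\<Prod>i<n. f (z(N := as ! i)))))" for f
  have nm: "nm f \<in> pfun (N + n)"
    "length bs = n \<Longrightarrow> (\<And>i. i < n \<Longrightarrow> coeff (\<Prod>a\<leftarrow>bs. [:- a, 1:]) i = z (N + i)) \<Longrightarrow>
      nm f z = (\<Prod>i<n. f (z(N := bs ! i)))" if "f \<in> pfun (Suc N)" for f bs z
    using someI_ex[OF norm_ex[OF that]] unfolding nm_def by blast+
  \<comment> \<open>With \<open>n * J + 1\<close> constants distributed among \<open>n\<close>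
    roots, some root receives more than \<open>J\<close>.\<close>
  obtain T :: "'k set" where T: "finite T" "card T = Suc (n * J)"
    using infinite_arbitrarily_large[OF infinite_k] by blast
  define S' where "S' = (\<lambda>\<epsilon>. (nm (G \<epsilon>), nm (H \<epsilon>))) ` T"
  have S': "finite S'" "S' \<subseteq> pfun (N + n) \<times> pfun (N + n)"
    using T(1) nm(1)[OF Gp] nm(1)[OF Hp] by (auto simp: S'_def)
  have "nm (G \<epsilon>) z0 \<prec> nm (H \<epsilon>) z0" for \<epsilon>
  proof -
    have "nm (G \<epsilon>) z0 = (\<Prod>i<n. Gi \<epsilon> i)" "nm (H \<epsilon>) z0 = (\<Prod>i<n. H \<epsilon> (e(N := as ! i)))"
      using nm(2)[OF Gp as(1) z0c] nm(2)[OF Hp as(1) z0c] z0e[OF Gp] z0e[OF Hp] by (auto simp: Gi_def)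
    then show ?thesis using vlt_prod[of "{..<n}" "Gi \<epsilon>" "\<lambda>i. H \<epsilon> (e(N := as ! i))" i0] GH i0(1)
      by simp
  qed
  then have "sat S' z0" by (auto simp: S'_def sat_def)
  from specializableD[OF E(2) S' z0E this] obtain D z where
    D: "vbounded D" "\<And>i. i < N + n \<Longrightarrow> z i \<in> D" "sat S' z" by blast
  have sD: "subfield_emb D" using D(1) by (simp add: vbounded_def)
  define p' where "p' = monom 1 n + (\<Sum>i<n. monom (z (N + i)) i)"
  have cp': "coeff p' i = (if i = n then 1 else if i < n then z (N + i) else 0)" for i
    by (auto simp: p'_def coeff_sum coeff_monom)
  have p'D: "p' \<in> polys_over D"
    unfolding polys_over_def using D(2) subfieldD(8,9)[OF sD] by (auto simp: cp')
  have p'0: "p' \<noteq> 0" using cp'[of n] by auto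
  have dp': "degree p' = n" using cp'
    by (intro antisym degree_le le_degree) auto
  have lp': "lead_coeff p' = 1" unfolding dp' cp' by simp
  obtain bs where bs: "length bs = n" "p' = (\<Prod>a\<leftarrow>bs. [:- a, 1:])"
    using alg_closed_splits[OF alg_closed p'0] lp' dp' by auto
  have bsc: "\<And>i. i < n \<Longrightarrow> coeff (\<Prod>a\<leftarrow>bs. [:- a, 1:]) i = z (N + i)"
    unfolding bs(2)[symmetric] by (simp add: cp')
  define y where "y i = z(N := bs ! i)" for i
  \<comment> \<open>A strict inequality of products is strict at some root. There
    \<open>Q \<preceq> G \<epsilon>\<close> is impossible, since it would give
    \<open>H \<epsilon> \<preceq> G \<epsilon>\<close>.\<close>
  have ex: "\<exists>i<n. G \<epsilon> (y i) \<prec> Q (y i)" if "\<epsilon> \<in> T" for \<epsilon>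
  proof -
    have "nm (G \<epsilon>) z \<prec> nm (H \<epsilon>) z" using D(3) that by (auto simp: S'_def sat_def)
    moreover have "nm (G \<epsilon>) z = (\<Prod>i<n. G \<epsilon> (y i))" "nm (H \<epsilon>) z = (\<Prod>i<n. H \<epsilon> (y i))"
      unfolding y_def by (intro nm(2) Gp Hp bs(1) bsc; assumption)+
    ultimately have "(\<Prod>i<n. G \<epsilon> (y i)) \<prec> (\<Prod>i<n. H \<epsilon> (y i))" by simp
    then obtain i where i: "i < n" "G \<epsilon> (y i) \<prec> H \<epsilon> (y i)"
      using vle_prod[of "{..<n}" "\<lambda>i. H \<epsilon> (y i)" "\<lambda>i. G \<epsilon> (y i)"] by auto
    have "G \<epsilon> (y i) \<prec> Q (y i)"
    proof
      assume a: "Q (y i) \<preceq> G \<epsilon> (y i)"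
      have "H \<epsilon> (y i) \<preceq> G \<epsilon> (y i)" unfolding H_def
        by (intro vle_diff vle_refl vle_trans[OF emb_mult_vle a])
      then show False using i(2) by simp
    qed
    then show ?thesis using i(1) by blast
  qed
  define Ti where "Ti i = {\<epsilon>\<in>T. G \<epsilon> (y i) \<prec> Q (y i)}" for i
  have "\<exists>i<n. J < card (Ti i)"
  proof (rule ccontr)
    assume "\<not> ?thesis"
    then have le: "card (Ti i) \<le> J" if "i < n" for i using that by (meson not_less)
    have "T \<subseteq> (\<Union>i<n. Ti i)" using ex by (auto simp: Ti_def)
    then have "card T \<le> card (\<Union>i<n. Ti i)" using T(1) by (intro card_mono) (auto simp: Ti_def)
    also have "\<dots> \<le> (\<Sum>i<n. card (Ti i))" by (rule card_UN_le) simp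
    also have "\<dots> \<le> (\<Sum>i<n. J)" using le by (intro sum_mono) auto
    finally show False using T(2) by simp
  qed
  then obtain i where i: "i < n" "J < card (Ti i)" by blast
  have fTi: "finite (Ti i)" using T(1) by (simp add: Ti_def)
  have "Ti i \<noteq> {}" using i(2) by auto
  then have Qy: "Q (y i) \<noteq> 0" by (auto simp: Ti_def)
  \<comment> \<open>The bounds on \<open>G \<epsilon>\<close> for more than \<open>J\<close>
    constants bound each coefficient \<open>w j\<close>; cancelling the other denominators leaves
    the original inequality.\<close>
  have "P j (y i) \<prec> R j (y i)" if "j < J" for j
  proof -
    have "w j (y i) \<prec> Q (y i)"
      by (rule small_values_small_coeffs[OF fTi _ Qy, of J "\<lambda>j. w j (y i)"])
        (use i(2) that in \<open>auto simp: Ti_def G_def\<close>)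
    moreover have "(\<Prod>l\<in>{..<J} - {j}. R l (y i)) \<noteq> 0" using Qy Qr[OF that, of "y i"] by auto
    ultimately show ?thesis unfolding w_def Qr[OF that] using vle_mult_cancel by blast
  qed
  then have "sat S (y i)" using satPR by blast
  moreover have rt: "poly p' (bs ! i) = 0"
    using i(1) bs(1) by (auto simp: bs(2) poly_linear_factors prod_list_zero_iff image_iff)
  then have "vbounded (adjoin D (bs ! i))" by (rule vbounded_adjoin[OF D(1) p'D p'0])
  moreover have "y i m \<in> adjoin D (bs ! i)" if "m < Suc N" for m
    using that D(2)[of m] adjoin_base[OF sD, of "bs ! i"] adjoin_self[OF sD, of "bs ! i"] n
    by (cases "m = N") (auto simp: y_def)
  ultimately show "\<exists>D y'. vbounded D \<and> (\<forall>i<Suc N. y' i \<in> D) \<and> sat S y'" by blast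
qed

text \<open>A system involves only finitely many elements of the union, and these already lie in one
  member of the chain.\<close>

lemma specializable_Union_chain:
  assumes C: "C \<noteq> {}" "subset.chain {E. subfield_emb E \<and> t \<in> E \<and> specializable E} C"
  shows "subfield_emb (\<Union>C) \<and> t \<in> \<Union>C \<and> specializable (\<Union>C)"
proof -
  have CE: "subfield_emb E" "t \<in> E" "specializable E" if "E \<in> C" for E
    using C(2) that by (auto simp: subset_chain_def)
  have tot: "E \<subseteq> E' \<or> E' \<subseteq> E" if "E \<in> C" "E' \<in> C" for E E'
    using C(2) that by (auto simp: subset_chain_def)
  have two: "\<exists>E\<in>C. a \<in> E \<and> b \<in> E" if "a \<in> \<Union>C" "b \<in> \<Union>C" for a b
    using that tot by blast
  have "subfield_emb (\<Union>C)"
    unfolding subfield_emb_def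
  proof (intro conjI ballI)
    show "range emb \<subseteq> \<Union>C" using C(1) CE(1) subfieldD(1) by blast
    fix a b assume "a \<in> \<Union>C" "b \<in> \<Union>C"
    then obtain E where "E \<in> C" "a \<in> E" "b \<in> E" using two by blast
    then show "a + b \<in> \<Union>C" "a * b \<in> \<Union>C" using subfieldD(2,3)[OF CE(1)] by blast+
  next
    fix a assume "a \<in> \<Union>C"
    then show "- a \<in> \<Union>C" "inverse a \<in> \<Union>C" using subfieldD(4,5)[OF CE(1)] by blast+
  qed
  moreover have "specializable (\<Union>C)"
    unfolding specializable_def
  proof (intro allI impI)
    fix N S y assume S: "finite S" "S \<subseteq> pfun N \<times> pfun N" "\<forall>i<N. y i \<in> \<Union>C" "sat S y"
    have "\<exists>E\<in>C. y ` {..<N} \<subseteq> E"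
      using S(3)
    proof (induction N)
      case 0
      then show ?case using C(1) by blast
    next
      case (Suc N)
      then obtain E E' where E: "E \<in> C" "y ` {..<N} \<subseteq> E" "E' \<in> C" "y N \<in> E'" by auto
      then consider "E \<subseteq> E'" | "E' \<subseteq> E" using tot by blast
      then show ?case
      proof cases
        case 1
        then show ?thesis using E by (intro bexI[of _ E']) (auto simp: lessThan_Suc)
      next
        case 2
        then show ?thesis using E by (intro bexI[of _ E]) (auto simp: lessThan_Suc)
      qed
    qed
    then obtain E where "E \<in> C" "\<And>i. i < N \<Longrightarrow> y i \<in> E" by blast
    then show "\<exists>D y'. vbounded D \<and> (\<forall>i<N. y' i \<in> D) \<and> sat S y'"
      by (intro specializableD[OF CE(3) S(1,2) _ S(4)])
  qed
  moreover have "t \<in> \<Union>C" using C(1) CE(2) by blast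
  ultimately show ?thesis by blast
qed

text \<open>A maximal specializable field is root-closed by the algebraic step. For any further
  \<open>x\<close> the approximation result replaces \<open>x\<close> by an element of the field
  satisfying the same system, so adjoining \<open>x\<close> keeps the field specializable and
  maximality gives \<open>x \<in> E\<close>.\<close>

theorem specializable_UNIV: "specializable UNIV"
proof -
  define A where "A = {E. subfield_emb E \<and> t \<in> E \<and> specializable E}"
  have "\<exists>M\<in>A. \<forall>X\<in>A. M \<subseteq> X \<longrightarrow> X = M"
  proof (rule subset_Zorn_nonempty)
    have "specializable (adjoin (range emb) t)"
      unfolding specializable_def using vbounded_base by blast
    then show "A \<noteq> {}" using vbounded_base by (auto simp: A_def vbounded_def)
    show "\<Union>C \<in> A" if "C \<noteq> {}" "subset.chain A C" for C
      using specializable_Union_chain that unfolding A_def by blast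
  qed
  then obtain E where E: "subfield_emb E" "t \<in> E" "specializable E"
    and max: "\<And>X. subfield_emb X \<Longrightarrow> t \<in> X \<Longrightarrow> specializable X \<Longrightarrow> E \<subseteq> X \<Longrightarrow> X = E"
    unfolding A_def by blast
  have step: "x \<in> E" if "specializable (adjoin E x)" for x
  proof -
    have "adjoin E x = E"
      using that E adjoin_base[OF E(1)] by (intro max subfield_adjoin) auto
    then show ?thesis using adjoin_self[OF E(1), of x] by simp
  qed
  have rc: "root_closed E"
    unfolding root_closed_def using step specializable_adjoin_root[OF E(1,3)] by blast
  have "x \<in> E" for x
  proof (rule step, rule specializable_adjoin[OF E(1)])
    fix N S e
    assume S: "finite S" "S \<subseteq> pfun (Suc N) \<times> pfun (Suc N)" and eE: "\<And>i. i < N \<Longrightarrow> e i \<in> E"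
      and sat: "sat S (e(N := x))"
    have "\<forall>f\<in>pfun (Suc N). \<exists>p. p \<in> polys_over E \<and> (\<forall>x. poly p x = f (e(N := x)))"
    proof
      fix f assume "f \<in> pfun (Suc N)"
      from pfun_last_poly[OF E(1) this, of e] eE
      show "\<exists>p. p \<in> polys_over E \<and> (\<forall>x. poly p x = f (e(N := x)))" by blast
    qed
    from bchoice[OF this] obtain q where q: "\<And>f. f \<in> pfun (Suc N) \<Longrightarrow> q f \<in> polys_over E"
      "\<And>f x. f \<in> pfun (Suc N) \<Longrightarrow> poly (q f) x = f (e(N := x))" by blast
    define S' where "S' = (\<lambda>(P, Q). (q P, q Q)) ` S"
    have S': "finite S'" "S' \<subseteq> polys_over E \<times> polys_over E" using S q(1) by (auto simp: S'_def)
    have satS': "(\<forall>(p, p')\<in>S'. poly p x \<prec> poly p' x) \<longleftrightarrow> sat S (e(N := x))" for x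
    proof -
      have "(case (case s of (P, Q) \<Rightarrow> (q P, q Q)) of (p, p') \<Rightarrow> poly p x \<prec> poly p' x) \<longleftrightarrow>
        (case s of (P, Q) \<Rightarrow> P (e(N := x)) \<prec> Q (e(N := x)))" if "s \<in> S" for s
        using that S(2) q(2) by (cases s) auto
      then show ?thesis unfolding S'_def sat_def by simp
    qed
    have "poly p x \<prec> poly p' x" if "(p, p') \<in> S'" for p p' using satS' sat that by blast
    from approximate_in_root_closed[OF E(1) rc E(2) S' this]
    obtain x' where x': "x' \<in> E" "sat S (e(N := x'))" using satS' by blast
    have "(e(N := x')) i \<in> E" if "i < Suc N" for i using that x'(1) eE by (cases "i = N") auto
    from specializableD[OF E(3) S this x'(2)]
    show "\<exists>D y'. vbounded D \<and> (\<forall>i<Suc N. y' i \<in> D) \<and> sat S y'" by blast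
  qed
  then have "E = UNIV" by blast
  then show ?thesis using E(3) by simp
qed

end

subsection \<open>The normalizer\<close>

lemma index_mult_mat_sum:
  "A \<in> carrier_mat n m \<Longrightarrow> B \<in> carrier_mat m k \<Longrightarrow> i < n \<Longrightarrow> j < k \<Longrightarrow>
    (A * B) $$ (i, j) = (\<Sum>l<m. A $$ (i, l) * B $$ (l, j))"
  by (auto simp: scalar_prod_def lessThan_atLeast0)

lemma index_mult_mat_vec_sum:
  "A \<in> carrier_mat n m \<Longrightarrow> v \<in> carrier_vec m \<Longrightarrow> i < n \<Longrightarrow>
    (A *\<^sub>v v) $ i = (\<Sum>l<m. A $$ (i, l) * v $ l)"
  by (auto simp: scalar_prod_def lessThan_atLeast0)

lemma mult_mat_unit_vec:
  fixes A :: "'a::comm_ring_1 mat"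
  assumes "A \<in> carrier_mat n m" "i < n" "j < m"
  shows "(A *\<^sub>v unit_vec m j) $ i = A $$ (i, j)"
proof -
  have "(A *\<^sub>v unit_vec m j) $ i = (\<Sum>l<m. if l = j then A $$ (i, j) else 0)"
    unfolding index_mult_mat_vec_sum[OF assms(1) unit_vec_carrier assms(2)]
    using assms(3) by (intro sum.cong) auto
  then show ?thesis using assms(3) by simp
qed

lemma mat_eq_on_vecs:
  fixes A B :: "'a::comm_ring_1 mat"
  assumes "A \<in> carrier_mat n m" "B \<in> carrier_mat n m"
    and "\<And>j. j < m \<Longrightarrow> A *\<^sub>v unit_vec m j = B *\<^sub>v unit_vec m j"
  shows "A = B"
proof (rule eq_matI)
  fix i j assume "i < dim_row B" "j < dim_col B"
  then have ij: "i < n" "j < m" using assms(2) by auto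
  then show "A $$ (i, j) = B $$ (i, j)"
    using mult_mat_unit_vec[OF assms(1) ij] mult_mat_unit_vec[OF assms(2) ij] assms(3) by simp
qed (use assms in auto)

lemma upper_triangular_mult:
  fixes A B :: "'a::comm_ring_1 mat"
  assumes "A \<in> carrier_mat d d" "B \<in> carrier_mat d d" "upper_triangular A" "upper_triangular B"
  shows "upper_triangular (A * B)"
proof (rule upper_triangularI)
  fix i j assume ij: "j < i" "i < dim_row (A * B)"
  have "A $$ (i, l) * B $$ (l, j) = 0" if "l < d" for l
    using assms ij that upper_triangularD[OF assms(3), of l i] upper_triangularD[OF assms(4), of j l]
    by (cases "l < i") auto
  then show "(A * B) $$ (i, j) = 0" using assms ij
    by (subst index_mult_mat_sum[of A d d B d]) auto
qed

lemma upper_triangular_diag_nonzero: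
  fixes g :: "'a::field mat"
  assumes "g \<in> carrier_mat d d" "upper_triangular g" "det g \<noteq> 0" "i < d"
  shows "g $$ (i, i) \<noteq> 0"
  using assms upper_triangular_imp_det_eq_0_iff[OF assms(1,2)] by (auto simp: diag_mat_def)

text \<open>Back substitution from the last row upwards; the diagonal entries of \<open>g\<close>
  are nonzero because its determinant is.\<close>

lemma upper_triangular_inverse:
  fixes g :: "'a::field mat"
  assumes g: "g \<in> carrier_mat d d" "upper_triangular g" and g': "g' \<in> carrier_mat d d" "g * g' = 1\<^sub>m d"
  shows "upper_triangular g'"
proof -
  have "det g * det g' = 1" using det_mult[OF g(1) g'(1)] g'(2) by simp
  then have "det g \<noteq> 0" by auto
  note nz = upper_triangular_diag_nonzero[OF g this]
  have "g' $$ (i, j) = 0" if "j < i" "i < d" for i j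
    using that
  proof (induction "d - i" arbitrary: i rule: less_induct)
    case less
    have t: "g $$ (i, l) * g' $$ (l, j) = (if l = i then g $$ (i, i) * g' $$ (i, j) else 0)" if "l < d" for l
    proof -
      consider "l < i" | "l = i" | "i < l" by linarith
      then show ?thesis
      proof cases
        case 1
        then show ?thesis using upper_triangularD[OF g(2)] g(1) less.prems by auto
      next
        case 3
        then show ?thesis using less.hyps[of l] less.prems that by auto
      qed simp
    qed
    have "(g * g') $$ (i, j) = (\<Sum>l<d. g $$ (i, l) * g' $$ (l, j))"
      using less.prems by (intro index_mult_mat_sum[OF g(1) g'(1)]) auto
    also have "\<dots> = (\<Sum>l<d. if l = i then g $$ (i, i) * g' $$ (i, j) else 0)"
      using t by (intro sum.cong) auto
    also have "\<dots> = g $$ (i, i) * g' $$ (i, j)" using less.prems by simp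
    finally have "g $$ (i, i) * g' $$ (i, j) = 0" using less.prems by (simp add: g'(2) del: index_mult_mat)
    then show ?case using less.prems nz by simp
  qed
  then show ?thesis using g'(1) by auto
qed

lemma mat_inv_eq:
  fixes g :: "'k::field mat"
  assumes "g \<in> carrier_mat d d" "g' \<in> carrier_mat d d" "g * g' = 1\<^sub>m d"
  shows "mat_inv d g = g'" "g' * g = 1\<^sub>m d"
proof -
  show inv: "g' * g = 1\<^sub>m d" using mat_mult_left_right_inverse[OF assms] .
  define h where "h = mat_inv d g"
  have "h \<in> carrier_mat d d \<and> g * h = 1\<^sub>m d \<and> h * g = 1\<^sub>m d"
    unfolding h_def mat_inv_def by (rule someI[of _ g']) (use assms inv in auto)
  then have h: "h \<in> carrier_mat d d" "g * h = 1\<^sub>m d" by auto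
  have "h = 1\<^sub>m d * h" using h(1) by simp
  also have "\<dots> = (g' * g) * h" by (simp only: inv)
  also have "\<dots> = g' * (g * h)" using assms(1,2) h(1) by (intro assoc_mult_mat)
  also have "\<dots> = g'" unfolding h(2) using assms(2) by simp
  finally show "mat_inv d g = g'" by (simp add: h_def)
qed

lemma det_nonzero_inverse:
  fixes g :: "'k::field mat"
  assumes "g \<in> carrier_mat d d" "det g \<noteq> 0"
  shows "\<exists>g'\<in>carrier_mat d d. g * g' = 1\<^sub>m d \<and> g' * g = 1\<^sub>m d"
proof -
  have 1: "g * (inverse (det g) \<cdot>\<^sub>m adj_mat g) = 1\<^sub>m d"
    using adj_mat[OF assms(1)] assms
    by (auto simp: mult_smult_distrib[OF assms(1) adj_mat(1)[OF assms(1)]])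
  have 2: "inverse (det g) \<cdot>\<^sub>m adj_mat g \<in> carrier_mat d d" using adj_mat(1)[OF assms(1)] by simp
  show ?thesis using 1 2 mat_mult_left_right_inverse[OF assms(1) 2 1] by blast
qed

lemma U_group_inverse:
  fixes g :: "'k::field mat"
  assumes "g \<in> U_group d"
  shows "\<exists>g'\<in>carrier_mat d d. g * g' = 1\<^sub>m d \<and> g' * g = 1\<^sub>m d"
proof -
  have g: "g \<in> carrier_mat d d" "invertible_mat g" using assms by (auto simp: U_group_def)
  then obtain B where B: "g * B = 1\<^sub>m (dim_row g)" "B * g = 1\<^sub>m (dim_row B)"
    unfolding invertible_mat_def inverts_mat_def by blast
  have "dim_row B = d" using arg_cong[OF B(2), of dim_col] g(1) by auto
  moreover have "dim_col B = d" using arg_cong[OF B(1), of dim_col] g(1) by auto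
  ultimately show ?thesis using B g(1) by (intro bexI[of _ B]) auto
qed

lemma U_groupI:
  fixes g :: "'k::field mat"
  assumes "g \<in> carrier_mat d d" "upper_triangular g" "g' \<in> carrier_mat d d" "g * g' = 1\<^sub>m d"
  shows "g \<in> U_group d"
  using assms mat_inv_eq(2)[OF assms(1,3,4)]
  unfolding U_group_def invertible_mat_def inverts_mat_def by auto

section \<open>Conjugation of representations\<close>

lemma conj_rep_eq:
  assumes "g \<in> carrier_mat d d" "g' \<in> carrier_mat d d" "g * g' = 1\<^sub>m d"
  shows "conj_rep d g R = (\<lambda>i. g * fst R i * g', \<lambda>a. g * snd R a * g')"
  unfolding conj_rep_def mat_inv_eq(1)[OF assms] ..

lemma conj_mult:
  fixes g :: "'k::field mat"
  assumes "g \<in> carrier_mat d d" "g' \<in> carrier_mat d d" "g' * g = 1\<^sub>m d"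
    and "A \<in> carrier_mat d d" "B \<in> carrier_mat d d"
  shows "(g * A * g') * (g * B * g') = g * (A * B) * g'"
proof -
  have e: "g' * (g * B * g') = B * g'"
  proof -
    have "g * B * g' = g * (B * g')" using assms by (intro assoc_mult_mat)
    moreover have "g' * (g * (B * g')) = (g' * g) * (B * g')"
      using assms by (intro assoc_mult_mat[symmetric]) auto
    moreover have "1\<^sub>m d * (B * g') = B * g'" using assms by (intro left_mult_one_mat[of _ d d]) auto
    ultimately show ?thesis using assms(3) by simp
  qed
  have "(g * A * g') * (g * B * g') = g * A * (g' * (g * B * g'))"
    using assms by (intro assoc_mult_mat) auto
  also have "\<dots> = g * A * (B * g')" unfolding e ..
  also have "g * A * (B * g') = g * (A * B) * g'"
    using assms(1,2,4,5) by (simp add: assoc_mult_mat[of _ d d _ d _ d])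
  finally show ?thesis .
qed

lemma conj_cancel:
  fixes g :: "'k::field mat"
  assumes "g \<in> carrier_mat d d" "g' \<in> carrier_mat d d" "g * g' = 1\<^sub>m d" "A \<in> carrier_mat d d"
  shows "g * (g' * A * g) * g' = A"
proof -
  have "g * (g' * A * g) * g' = (g * g') * (A * (g * g'))"
    using assms(1,2,4) by (simp add: assoc_mult_mat[of _ d d _ d _ d])
  then show ?thesis using assms by simp
qed

lemma path_mat_simps [simp]: "path_mat m X [] = 1\<^sub>m m"
  by (simp add: path_mat_def)

lemma path_mat_snoc: "path_mat m X (p @ [a]) = X a * path_mat m X p"
  by (simp add: path_mat_def)

lemma path_mat_carrier:
  assumes "\<And>a. X a \<in> carrier_mat m m"
  shows "path_mat m X p \<in> carrier_mat m m"
  by (induction p rule: rev_induct) (auto simp: path_mat_snoc intro: mult_carrier_mat[OF assms])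

text \<open>As values outside the vertices and arrows are normalised to zero matrices, the carrier
  conditions may range over all indices; this spares side conditions from here on.\<close>

lemma is_rep_iff:
  "is_rep n Arr src tgt rho m (E, X) \<longleftrightarrow>
     (\<forall>i. E i \<in> carrier_mat m m) \<and> (\<forall>i\<ge>n. E i = 0\<^sub>m m m) \<and>
     (\<forall>a. X a \<in> carrier_mat m m) \<and> (\<forall>a. a \<notin> Arr \<longrightarrow> X a = 0\<^sub>m m m) \<and>
     (\<forall>i<n. \<forall>j<n. E i * E j = (if i = j then E i else 0\<^sub>m m m)) \<and>
     (\<forall>r<m. \<forall>s<m. (\<Sum>i<n. E i $$ (r,s)) = (if r = s then 1 else 0)) \<and>
     (\<forall>a\<in>Arr. X a = E (tgt a) * X a * E (src a)) \<and>
     (\<forall>rel\<in>rho. \<forall>r<m. \<forall>s<m. (\<Sum>p\<in>{p. rel p \<noteq> 0}. rel p * path_mat m X p $$ (r,s)) = 0)"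
proof -
  have E: "(\<forall>i<n. E i \<in> carrier_mat m m) \<and> (\<forall>i\<ge>n. E i = 0\<^sub>m m m) \<longleftrightarrow>
    (\<forall>i. E i \<in> carrier_mat m m) \<and> (\<forall>i\<ge>n. E i = 0\<^sub>m m m)"
    by (metis linorder_not_less zero_carrier_mat)
  have X: "(\<forall>a\<in>Arr. X a \<in> carrier_mat m m) \<and> (\<forall>a. a \<notin> Arr \<longrightarrow> X a = 0\<^sub>m m m) \<longleftrightarrow>
    (\<forall>a. X a \<in> carrier_mat m m) \<and> (\<forall>a. a \<notin> Arr \<longrightarrow> X a = 0\<^sub>m m m)"
    by (metis zero_carrier_mat)
  have gen: "(A \<and> B \<and> C \<and> D \<and> R) = (A' \<and> B \<and> C' \<and> D \<and> R)"
    if "(A \<and> B) = (A' \<and> B)" "(C \<and> D) = (C' \<and> D)" for A B C D R A' C'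
    using that by blast
  show ?thesis unfolding is_rep_def Let_def fst_conv snd_conv by (rule gen[OF E X])
qed

lemma path_mat_conj:
  fixes g :: "'k::field mat"
  assumes g: "g \<in> carrier_mat d d" "g' \<in> carrier_mat d d" "g * g' = 1\<^sub>m d"
    and X: "\<And>a. X a \<in> carrier_mat d d"
  shows "path_mat d (\<lambda>a. g * X a * g') p = g * path_mat d X p * g'"
proof (induction p rule: rev_induct)
  case Nil
  then show ?case using g by simp
next
  case (snoc a p)
  show ?case unfolding path_mat_snoc snoc
    by (rule conj_mult[OF g(1,2) mat_inv_eq(2)[OF g] X path_mat_carrier[OF X]])
qed

lemma index_conj:
  fixes g :: "'k::field mat"
  assumes "g \<in> carrier_mat d d" "A \<in> carrier_mat d d" "g' \<in> carrier_mat d d" "r < d" "s < d"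
  shows "(g * A * g') $$ (r, s) = (\<Sum>x<d. \<Sum>y<d. g $$ (r, x) * A $$ (x, y) * g' $$ (y, s))"
proof -
  have "(g * A * g') $$ (r, s) = (\<Sum>y<d. (g * A) $$ (r, y) * g' $$ (y, s))"
    using assms by (intro index_mult_mat_sum mult_carrier_mat)
  also have "\<dots> = (\<Sum>y<d. (\<Sum>x<d. g $$ (r, x) * A $$ (x, y)) * g' $$ (y, s))"
    by (intro sum.cong refl) (simp add: index_mult_mat_sum[OF assms(1,2,4)] del: index_mult_mat)
  finally show ?thesis by (subst sum.swap) (simp add: sum_distrib_right)
qed

lemma is_rep_conj:
  fixes g :: "'k::field mat"
  assumes g: "g \<in> carrier_mat d d" "g' \<in> carrier_mat d d" "g * g' = 1\<^sub>m d"
    and R: "is_rep n Arr src tgt rho d R"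
  shows "is_rep n Arr src tgt rho d (\<lambda>i. g * fst R i * g', \<lambda>a. g * snd R a * g')"
proof -
  note g'g = mat_inv_eq(2)[OF g]
  obtain E X where EX: "R = (E, X)" by (cases R)
  note R' = R[unfolded EX is_rep_iff]
  have E: "\<And>i. E i \<in> carrier_mat d d" and X: "\<And>a. X a \<in> carrier_mat d d" using R' by auto
  show ?thesis unfolding EX fst_conv snd_conv is_rep_iff
  proof (intro conjI allI impI ballI)
    fix i j assume "i < n" "j < n"
    then show "g * E i * g' * (g * E j * g') = (if i = j then g * E i * g' else 0\<^sub>m d d)"
      using R' g unfolding conj_mult[OF g(1,2) g'g E E] by auto
  next
    fix r s assume rs: "r < d" "s < d"
    have "(\<Sum>i<n. (g * E i * g') $$ (r, s)) =
      (\<Sum>i<n. \<Sum>x<d. \<Sum>y<d. g $$ (r, x) * E i $$ (x, y) * g' $$ (y, s))"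
      using index_conj[OF g(1) E g(2) rs] by simp
    also have "\<dots> = (\<Sum>x<d. \<Sum>y<d. g $$ (r, x) * (\<Sum>i<n. E i $$ (x, y)) * g' $$ (y, s))"
      by (simp add: sum_distrib_left sum_distrib_right sum.swap[of _ "{..<d}" "{..<n}"])
    also have "\<dots> = (\<Sum>x<d. \<Sum>y<d. g $$ (r, x) * 1\<^sub>m d $$ (x, y) * g' $$ (y, s))"
      using R' by (intro sum.cong refl) auto
    also have "\<dots> = (g * 1\<^sub>m d * g') $$ (r, s)"
      using index_conj[OF g(1) one_carrier_mat g(2) rs] by simp
    also have "\<dots> = (if r = s then 1 else 0)" using g rs by simp
    finally show "(\<Sum>i<n. (g * E i * g') $$ (r, s)) = (if r = s then 1 else 0)" .
  next
    fix a assume a: "a \<in> Arr"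
    have "g * E (tgt a) * g' * (g * X a * g') * (g * E (src a) * g') = g * (E (tgt a) * X a * E (src a)) * g'"
      unfolding conj_mult[OF g(1,2) g'g E X] by (rule conj_mult[OF g(1,2) g'g mult_carrier_mat[OF E X] E])
    then show "g * X a * g' = g * E (tgt a) * g' * (g * X a * g') * (g * E (src a) * g')"
      using R' a by simp
  next
    fix rel r s assume rel: "rel \<in> rho" and rs: "r < d" "s < d"
    let ?S = "{p. rel p \<noteq> 0}"
    have "(\<Sum>p\<in>?S. rel p * path_mat d (\<lambda>a. g * X a * g') p $$ (r, s)) =
      (\<Sum>p\<in>?S. \<Sum>x<d. \<Sum>y<d. g $$ (r, x) * (rel p * path_mat d X p $$ (x, y)) * g' $$ (y, s))"
      using path_mat_conj[of g d g' X, OF g X] index_conj[OF g(1) path_mat_carrier[of X d, OF X] g(2) rs]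
      by (simp add: sum_distrib_left mult_ac)
    also have "\<dots> = (\<Sum>x<d. \<Sum>y<d. g $$ (r, x) * (\<Sum>p\<in>?S. rel p * path_mat d X p $$ (x, y)) * g' $$ (y, s))"
      by (simp add: sum_distrib_left sum_distrib_right sum.swap[of _ "{..<d}" ?S])
    also have "\<dots> = 0" using R' rel by (intro sum.neutral ballI) auto
    finally show "(\<Sum>p\<in>?S. rel p * path_mat d (\<lambda>a. g * X a * g') p $$ (r, s)) = 0" .
  qed (use R' g in auto)
qed

text \<open>Basis vector \<open>j\<close> sits at vertex \<open>c j\<close>. These are the matrices
  that respect the decomposition of the space by vertices, that is, those commuting with all the
  idempotents \<open>A_c n d c i\<close>.\<close>

definition graded :: "nat \<Rightarrow> (nat \<Rightarrow> nat) \<Rightarrow> 'k::field mat \<Rightarrow> bool" where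
  "graded d c g \<longleftrightarrow> (\<forall>r<d. \<forall>s<d. c r \<noteq> c s \<longrightarrow> g $$ (r, s) = 0)"

lemma A_c_carrier: "A_c n d c i \<in> carrier_mat d d"
  by (simp add: A_c_def A_mat_def)

lemma graded_commute:
  fixes g :: "'k::field mat"
  assumes g: "g \<in> carrier_mat d d" and c: "\<forall>j<d. c j < n"
  shows "graded d c g \<longleftrightarrow> (\<forall>i. g * A_c n d c i = A_c n d c i * g)"
proof -
  have dA: "dim_row (A_c n d c i :: 'k mat) = d" "dim_col (A_c n d c i :: 'k mat) = d" for i
    by (simp_all add: A_c_def A_mat_def)
  have l: "(g * A_c n d c i) $$ (r, s) = (if i = c s then g $$ (r, s) else 0)" if "r < d" "s < d" for i r s
  proof -
    have "g $$ (r, x) * A_c n d c i $$ (x, s) = (if x = s then (if i = c s then g $$ (r, s) else 0) else 0)" if "x < d" for x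
      using that \<open>s < d\<close> c by (auto simp: A_c_def A_mat_def)
    then show ?thesis using that by (simp add: index_mult_mat_sum[OF g A_c_carrier])
  qed
  have r: "(A_c n d c i * g) $$ (r, s) = (if i = c r then g $$ (r, s) else 0)" if "r < d" "s < d" for i r s
  proof -
    have "A_c n d c i $$ (r, x) * g $$ (x, s) = (if x = r then (if i = c r then g $$ (r, s) else 0) else 0)" if "x < d" for x
      using that \<open>r < d\<close> c by (auto simp: A_c_def A_mat_def)
    then show ?thesis using that by (simp add: index_mult_mat_sum[OF A_c_carrier g])
  qed
  show ?thesis
  proof
    assume gr: "graded d c g"
    show "\<forall>i. g * A_c n d c i = A_c n d c i * g"
    proof
      fix i show "g * A_c n d c i = A_c n d c i * g"
      proof (rule eq_matI)
        fix r s assume "r < dim_row (A_c n d c i * g)" "s < dim_col (A_c n d c i * g)"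
        then have rs: "r < d" "s < d" using g dA by auto
        show "(g * A_c n d c i) $$ (r, s) = (A_c n d c i * g) $$ (r, s)"
          unfolding l[OF rs] r[OF rs] using gr rs by (auto simp: graded_def)
      qed (use g dA in auto)
    qed
  next
    assume eq: "\<forall>i. g * A_c n d c i = A_c n d c i * g"
    show "graded d c g" unfolding graded_def
    proof (intro allI impI)
      fix a b assume ab: "a < d" "b < d" "c a \<noteq> c b"
      have "(g * A_c n d c (c b)) $$ (a, b) = (A_c n d c (c b) * g) $$ (a, b)" using eq by simp
      then show "g $$ (a, b) = 0" unfolding l[OF ab(1,2)] r[OF ab(1,2)] using ab(3) by simp
    qed
  qed
qed

lemma graded_inverse:
  fixes g :: "'k::field mat"
  assumes g: "g \<in> carrier_mat d d" "g' \<in> carrier_mat d d" "g * g' = 1\<^sub>m d" and c: "\<forall>j<d. c j < n"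
    and gr: "graded d c g"
  shows "graded d c g'"
  unfolding graded_commute[OF g(2) c]
proof
  fix i
  note g'g = mat_inv_eq(2)[OF g]
  have eq: "g * A_c n d c i = A_c n d c i * g" using gr graded_commute[OF g(1) c] by blast
  have A: "(A_c n d c i :: 'k mat) \<in> carrier_mat d d" by (rule A_c_carrier)
  have "g' * A_c n d c i = g' * (A_c n d c i * (g * g'))" unfolding g(3) right_mult_one_mat[OF A] ..
  also have "\<dots> = g' * ((A_c n d c i * g) * g')"
    by (simp only: assoc_mult_mat[OF A g(1,2)])
  also have "\<dots> = (g' * g) * (A_c n d c i * g')" unfolding eq[symmetric]
    using A g(1,2) by (simp add: assoc_mult_mat[of _ d d _ d _ d])
  also have "\<dots> = A_c n d c i * g'" using A g g'g by simp
  finally show "g' * A_c n d c i = A_c n d c i * g'" .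
qed

lemma T_cD:
  assumes "R \<in> T_c n Arr src tgt rho d c"
  shows "is_rep n Arr src tgt rho d R" "fst R = A_c n d c" "snd R a \<in> carrier_mat d d"
    "upper_triangular (snd R a)" "a \<notin> Arr \<Longrightarrow> snd R a = 0\<^sub>m d d"
proof -
  show r: "is_rep n Arr src tgt rho d R" "fst R = A_c n d c" using assms by (auto simp: T_c_def)
  have R: "\<forall>a. snd R a \<in> carrier_mat d d" "\<forall>a. a \<notin> Arr \<longrightarrow> snd R a = 0\<^sub>m d d"
    using r(1) is_rep_iff[of n Arr src tgt rho d "fst R" "snd R"] by auto
  then show "snd R a \<in> carrier_mat d d" "a \<notin> Arr \<Longrightarrow> snd R a = 0\<^sub>m d d" by auto
  show "upper_triangular (snd R a)"
    using assms R(2) by (cases "a \<in> Arr") (auto simp: T_c_def)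
qed

lemma conj_graded_A_c:
  fixes g :: "'k::field mat"
  assumes g: "g \<in> carrier_mat d d" "g' \<in> carrier_mat d d" "g * g' = 1\<^sub>m d" and c: "\<forall>j<d. c j < n"
  shows "graded d c g \<longleftrightarrow> (\<forall>i. g * A_c n d c i * g' = A_c n d c i)"
  unfolding graded_commute[OF g(1) c]
proof (intro iff_allI iffI)
  fix i
  have A: "(A_c n d c i :: 'k mat) \<in> carrier_mat d d" by (rule A_c_carrier)
  have "A_c n d c i * g * g' = A_c n d c i"
    unfolding assoc_mult_mat[OF A g(1,2)] g(3) by (rule right_mult_one_mat[OF A])
  then show "g * A_c n d c i = A_c n d c i * g \<Longrightarrow> g * A_c n d c i * g' = A_c n d c i" by simp
  assume a: "g * A_c n d c i * g' = A_c n d c i"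
  have "g * A_c n d c i = (g * A_c n d c i * g') * g"
    using right_mult_one_mat[OF mult_carrier_mat[OF g(1) A]]
    unfolding assoc_mult_mat[OF mult_carrier_mat[OF g(1) A] g(2,1)] mat_inv_eq(2)[OF g] by simp
  then show "g * A_c n d c i = A_c n d c i * g" unfolding a .
qed

lemma conj_rep_in_T_c:
  fixes g :: "'k::field mat"
  assumes g: "g \<in> carrier_mat d d" "g' \<in> carrier_mat d d" "g * g' = 1\<^sub>m d" and c: "\<forall>j<d. c j < n"
    and ut: "upper_triangular g" and gr: "graded d c g" and R: "R \<in> T_c n Arr src tgt rho d c"
  shows "conj_rep d g R \<in> T_c n Arr src tgt rho d c"
proof -
  have eq: "conj_rep d g R = (\<lambda>i. g * fst R i * g', \<lambda>a. g * snd R a * g')" by (rule conj_rep_eq[OF g])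
  have "fst (conj_rep d g R) = A_c n d c"
    unfolding eq fst_conv T_cD(2)[OF R] using conj_graded_A_c[OF g c] gr by auto
  moreover have "upper_triangular (g * snd R a * g')" for a
    using g T_cD(3,4)[OF R] ut upper_triangular_inverse[OF g(1) ut g(2,3)]
    by (intro upper_triangular_mult[of _ d]) auto
  moreover have "is_rep n Arr src tgt rho d (conj_rep d g R)"
    unfolding eq by (rule is_rep_conj[OF g T_cD(1)[OF R]])
  moreover have "upper_triangular (A_c n d c i)" for i
    by (auto simp: A_c_def A_mat_def)
  ultimately show ?thesis unfolding T_c_def by (auto simp: eq)
qed

text \<open>All members of \<open>T_c\<close> share the same idempotents, so as soon as one member
  is carried into \<open>T_c\<close>, the matrix commutes with them; this is where
  \<open>T_c\<close> must be nonempty. Conversely, graded triangular matrices and their inverses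
  preserve \<open>T_c\<close>.\<close>

lemma normalizer_T_c:
  fixes g :: "'k::field mat"
  assumes c: "\<forall>j<d. c j < n" and ne: "T_c n Arr src tgt rho d c \<noteq> ({} :: ((nat \<Rightarrow> 'k mat) \<times> ('a \<Rightarrow> 'k mat)) set)"
  shows "g \<in> normalizer d (T_c n Arr src tgt rho d c :: ((nat \<Rightarrow> 'k mat) \<times> ('a \<Rightarrow> 'k mat)) set) \<longleftrightarrow>
    g \<in> U_group d \<and> graded d c g"
proof
  assume "g \<in> normalizer d (T_c n Arr src tgt rho d c :: ((nat \<Rightarrow> 'k mat) \<times> ('a \<Rightarrow> 'k mat)) set)"
  then have g: "g \<in> U_group d" and im: "conj_rep d g ` (T_c n Arr src tgt rho d c :: ((nat \<Rightarrow> 'k mat) \<times> ('a \<Rightarrow> 'k mat)) set) = T_c n Arr src tgt rho d c"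
    by (auto simp: normalizer_def)
  obtain g' where g': "g' \<in> carrier_mat d d" "g * g' = 1\<^sub>m d" using U_group_inverse[OF g] by blast
  have gc: "g \<in> carrier_mat d d" using g by (simp add: U_group_def)
  obtain R :: "(nat \<Rightarrow> 'k mat) \<times> ('a \<Rightarrow> 'k mat)" where R: "R \<in> T_c n Arr src tgt rho d c" using ne by blast
  then have "conj_rep d g R \<in> T_c n Arr src tgt rho d c" using im by blast
  from T_cD(2)[OF this] have "\<forall>i. g * A_c n d c i * g' = A_c n d c i"
    unfolding conj_rep_eq[OF gc g'] fst_conv T_cD(2)[OF R] by metis
  then show "g \<in> U_group d \<and> graded d c g" using g conj_graded_A_c[OF gc g' c] by blast
next
  assume a: "g \<in> U_group d \<and> graded d c g"
  then have g: "g \<in> carrier_mat d d" "upper_triangular g" by (auto simp: U_group_def)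
  obtain g' where g': "g' \<in> carrier_mat d d" "g * g' = 1\<^sub>m d" "g' * g = 1\<^sub>m d" using U_group_inverse a by blast
  have "R \<in> conj_rep d g ` T_c n Arr src tgt rho d c" if R: "R \<in> T_c n Arr src tgt rho d c"
    for R :: "(nat \<Rightarrow> 'k mat) \<times> ('a \<Rightarrow> 'k mat)"
  proof -
    have "conj_rep d g' R \<in> T_c n Arr src tgt rho d c"
      using a by (intro conj_rep_in_T_c[OF g'(1) g(1) g'(3) c _ _ R] upper_triangular_inverse[OF g g'(1,2)]
          graded_inverse[OF g(1) g'(1,2) c]) auto
    moreover have "conj_rep d g (conj_rep d g' R) = R"
    proof -
      have "fst R i \<in> carrier_mat d d" for i using T_cD(2)[OF R] A_c_carrier by metis
      then show ?thesis unfolding conj_rep_eq[OF g(1) g'(1,2)] conj_rep_eq[OF g'(1) g(1) g'(3)] fst_conv snd_conv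
        using conj_cancel[OF g(1) g'(1,2)] T_cD(3)[OF R] by simp
    qed
    ultimately show ?thesis by (metis imageI)
  qed
  moreover have "conj_rep d g R \<in> T_c n Arr src tgt rho d c" if "R \<in> T_c n Arr src tgt rho d c"
    for R :: "(nat \<Rightarrow> 'k mat) \<times> ('a \<Rightarrow> 'k mat)"
    using conj_rep_in_T_c[OF g(1) g'(1,2) c g(2) _ that] a by blast
  ultimately show "g \<in> normalizer d (T_c n Arr src tgt rho d c :: ((nat \<Rightarrow> 'k mat) \<times> ('a \<Rightarrow> 'k mat)) set)"
    using a unfolding normalizer_def by blast
qed

lemma poly_fun_cong:
  assumes "f \<in> poly_fun n Arr d"
    and "\<And>i r s. i < n \<Longrightarrow> r < d \<Longrightarrow> s < d \<Longrightarrow> fst R i $$ (r, s) = fst R' i $$ (r, s)"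
    and "\<And>a r s. a \<in> Arr \<Longrightarrow> r < d \<Longrightarrow> s < d \<Longrightarrow> snd R a $$ (r, s) = snd R' a $$ (r, s)"
  shows "f R = f R'"
  using assms(1) by (induction rule: poly_fun.induct) (use assms(2,3) in auto)

subsection \<open>From exact sequences to the orbit closure\<close>

definition top_rows :: "nat \<Rightarrow> 'a mat \<Rightarrow> 'a mat" where
  "top_rows p A = mat p (dim_col A) (\<lambda>(i, j). A $$ (i, j))"

definition bot_rows :: "nat \<Rightarrow> nat \<Rightarrow> 'a mat \<Rightarrow> 'a mat" where
  "bot_rows p q A = mat q (dim_col A) (\<lambda>(i, j). A $$ (p + i, j))"

lemma rows_carrier:
  "A \<in> carrier_mat (p + q) r \<Longrightarrow> top_rows p A \<in> carrier_mat p r"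
  "A \<in> carrier_mat (p + q) r \<Longrightarrow> bot_rows p q A \<in> carrier_mat q r"
  by (auto simp: top_rows_def bot_rows_def)

lemma rows_mult_vec:
  fixes A :: "'a::comm_ring_1 mat"
  assumes "A \<in> carrier_mat (p + q) r" "y \<in> carrier_vec r"
  shows "A *\<^sub>v y = (top_rows p A *\<^sub>v y) @\<^sub>v (bot_rows p q A *\<^sub>v y)"
proof (rule eq_vecI)
  fix i assume "i < dim_vec ((top_rows p A *\<^sub>v y) @\<^sub>v (bot_rows p q A *\<^sub>v y))"
  then have i: "i < p + q" by (simp add: top_rows_def bot_rows_def)
  note c = rows_carrier[OF assms(1)]
  show "(A *\<^sub>v y) $ i = ((top_rows p A *\<^sub>v y) @\<^sub>v (bot_rows p q A *\<^sub>v y)) $ i"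
  proof (cases "i < p")
    case True
    then have "((top_rows p A *\<^sub>v y) @\<^sub>v (bot_rows p q A *\<^sub>v y)) $ i = (top_rows p A *\<^sub>v y) $ i"
      using i c by (simp add: top_rows_def bot_rows_def)
    then show ?thesis using True i assms c
      by (simp add: index_mult_mat_vec_sum[OF assms(1,2) i] index_mult_mat_vec_sum[OF c(1) assms(2) True])
        (intro sum.cong, auto simp: top_rows_def)
  next
    case False
    then have ip: "i - p < q" using i by simp
    have "((top_rows p A *\<^sub>v y) @\<^sub>v (bot_rows p q A *\<^sub>v y)) $ i = (bot_rows p q A *\<^sub>v y) $ (i - p)"
      using i False c by (simp add: top_rows_def bot_rows_def)
    then show ?thesis using False i assms c ip
      by (simp add: index_mult_mat_vec_sum[OF assms(1,2) i] index_mult_mat_vec_sum[OF c(2) assms(2) ip])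
        (intro sum.cong, auto simp: bot_rows_def)
  qed
qed (use assms in \<open>auto simp: top_rows_def bot_rows_def\<close>)

lemma vec_split_append:
  assumes "u \<in> carrier_vec (p + q)"
  shows "\<exists>x\<in>carrier_vec p. \<exists>v\<in>carrier_vec q. u = x @\<^sub>v v"
  using vec_first_last_append[OF assms] by (metis vec_first_carrier vec_last_carrier)

lemma incl_mat_carrier: "incl_mat l \<in> carrier_mat (Suc l) l"
  by (simp add: incl_mat_def)

lemma incl_mat_index:
  fixes v :: "'k::field vec"
  assumes "v \<in> carrier_vec l" "i < Suc l"
  shows "(incl_mat l *\<^sub>v v) $ i = (if i < l then v $ i else 0)"
proof -
  have "(incl_mat l *\<^sub>v v) $ i = (\<Sum>j<l. (if i = j then 1 else 0) * v $ j)"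
    unfolding index_mult_mat_vec_sum[OF incl_mat_carrier assms]
    using assms(2) by (intro sum.cong) (auto simp: incl_mat_def)
  also have "\<dots> = (\<Sum>j<l. if j = i then v $ i else 0)" by (intro sum.cong) auto
  finally show ?thesis by simp
qed

lemma diag2_mult_vec:
  fixes f :: "'k::field mat"
  assumes "f \<in> carrier_mat p q" "g \<in> carrier_mat r s" "x \<in> carrier_vec q" "v \<in> carrier_vec s"
  shows "diag2 f g *\<^sub>v (x @\<^sub>v v) = (f *\<^sub>v x) @\<^sub>v (g *\<^sub>v v)"
proof -
  have "diag2 f g *\<^sub>v (x @\<^sub>v v) = (f *\<^sub>v x + 0\<^sub>m p s *\<^sub>v v) @\<^sub>v (0\<^sub>m r q *\<^sub>v x + g *\<^sub>v v)"
    unfolding diag2_def using assms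
    by (subst four_block_mat_mult_vec[of _ p q _ s _ r]) auto
  also have "\<dots> = (f *\<^sub>v x) @\<^sub>v (g *\<^sub>v v)" using assms by auto
  finally show ?thesis .
qed

lemma diag2_carrier:
  "f \<in> carrier_mat p q \<Longrightarrow> g \<in> carrier_mat r s \<Longrightarrow> diag2 f g \<in> carrier_mat (p + r) (q + s)"
  by (auto simp: diag2_def)

lemma topleft_carrier: "topleft l A \<in> carrier_mat l l"
  by (simp add: topleft_def)

lemma topleft_id: "A \<in> carrier_mat l l \<Longrightarrow> topleft l A = A"
  by (intro eq_matI) (auto simp: topleft_def)

lemma topleft_A_c: "l \<le> d \<Longrightarrow> topleft l (A_c n d c i) = A_c n l c i"
  by (intro eq_matI) (auto simp: topleft_def A_c_def A_mat_def)

lemma A_c_mult_vec_index: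
  fixes v :: "'k::field vec"
  assumes "v \<in> carrier_vec l" "r < l" "i < n"
  shows "(A_c n l c i *\<^sub>v v) $ r = (if c r = i then v $ r else 0)"
proof -
  have "(A_c n l c i *\<^sub>v v) $ r = (\<Sum>j<l. if j = r then (if c r = i then v $ r else 0) else 0)"
    unfolding index_mult_mat_vec_sum[OF A_c_carrier assms(1,2)]
    using assms by (intro sum.cong) (auto simp: A_c_def A_mat_def)
  then show ?thesis using assms(2) by simp
qed

lemma dsum_rep_mult_vec:
  fixes x :: "'k::field vec"
  assumes "\<And>i. fst R i \<in> carrier_mat p p" "\<And>i. fst R' i \<in> carrier_mat q q"
    "\<And>a. snd R a \<in> carrier_mat p p" "\<And>a. snd R' a \<in> carrier_mat q q"
    and "x \<in> carrier_vec p" "v \<in> carrier_vec q"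
  shows "fst (dsum_rep p q R R') i *\<^sub>v (x @\<^sub>v v) = (fst R i *\<^sub>v x) @\<^sub>v (fst R' i *\<^sub>v v)"
    "snd (dsum_rep p q R R') a *\<^sub>v (x @\<^sub>v v) = (snd R a *\<^sub>v x) @\<^sub>v (snd R' a *\<^sub>v v)"
  using diag2_mult_vec[OF assms(1)[of i] assms(2)[of i] assms(5,6)]
    diag2_mult_vec[OF assms(3)[of a] assms(4)[of a] assms(5,6)]
    carrier_matD[OF assms(1)[of i]] carrier_matD[OF assms(2)[of i]]
    carrier_matD[OF assms(3)[of a]] carrier_matD[OF assms(4)[of a]]
  by (simp_all add: dsum_rep_def diag2_def)

lemma dsum_rep_carrier:
  assumes "\<And>i. fst R i \<in> carrier_mat p p" "\<And>i. fst R' i \<in> carrier_mat q q"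
    "\<And>a. snd R a \<in> carrier_mat p p" "\<And>a. snd R' a \<in> carrier_mat q q"
  shows "fst (dsum_rep p q R R') i \<in> carrier_mat (p + q) (p + q)"
    "snd (dsum_rep p q R R') a \<in> carrier_mat (p + q) (p + q)"
  using assms by (auto simp: dsum_rep_def)

lemma mult_mat_vec_commute:
  fixes A :: "'k::comm_ring_1 mat"
  assumes "A * B = C * D" "A \<in> carrier_mat p q" "B \<in> carrier_mat q r" "C \<in> carrier_mat p q'" "D \<in> carrier_mat q' r"
    "v \<in> carrier_vec r"
  shows "A *\<^sub>v (B *\<^sub>v v) = C *\<^sub>v (D *\<^sub>v v)"
  using assms by (metis assoc_mult_mat_vec)

text \<open>The family is built from the top level \<open>d\<close>, which carries a sequence only
  if \<open>d > 0\<close>. The field has to be infinite because a polynomial in the parameter is to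
  be determined by its values outside a finite set.\<close>

locale flag_sequences =
  fixes n d :: nat and Arr :: "'a set" and src tgt :: "'a \<Rightarrow> nat"
    and rho :: "('a list \<Rightarrow> 'k::field) set" and c :: "nat \<Rightarrow> nat"
    and \<mu> \<nu> :: "(nat \<Rightarrow> 'k mat) \<times> ('a \<Rightarrow> 'k mat)"
    and m :: "nat \<Rightarrow> nat" and X :: "nat \<Rightarrow> (nat \<Rightarrow> 'k mat) \<times> ('a \<Rightarrow> 'k mat)"
    and h a b :: "nat \<Rightarrow> 'k mat"
  assumes inf: "infinite (UNIV :: 'k set)" and d: "d > 0" and c: "\<forall>j<d. c j < n"
    and \<mu>: "\<mu> \<in> T_c n Arr src tgt rho d c" and \<nu>: "\<nu> \<in> T_c n Arr src tgt rho d c"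
    and X: "\<And>l. l \<in> {1..d} \<Longrightarrow> is_rep n Arr src tgt rho (m l) (X l)"
    and h: "\<And>l. l \<in> {1..<d} \<Longrightarrow> is_hom n Arr (m l) (m (Suc l)) (X l) (X (Suc l)) (h l)"
    and a: "\<And>l. l \<in> {1..d} \<Longrightarrow>
      is_hom n Arr (m l) (m l + l) (X l) (dsum_rep (m l) l (X l) (sub_rep l \<mu>)) (a l)"
    and b: "\<And>l. l \<in> {1..d} \<Longrightarrow>
      is_hom n Arr (m l + l) l (dsum_rep (m l) l (X l) (sub_rep l \<mu>)) (sub_rep l \<nu>) (b l)"
    and ex: "\<And>l. l \<in> {1..d} \<Longrightarrow> short_exact (m l) (m l + l) l (a l) (b l)"
    and ha: "\<And>l. l \<in> {1..<d} \<Longrightarrow> diag2 (h l) (incl_mat l) * a l = a (Suc l) * h l"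
    and hb: "\<And>l. l \<in> {1..<d} \<Longrightarrow> incl_mat l * b l = b (Suc l) * diag2 (h l) (incl_mat l)"
begin

lemma carriers:
  assumes "l \<in> {1..d}"
  shows "a l \<in> carrier_mat (m l + l) (m l)" "b l \<in> carrier_mat l (m l + l)"
    "fst (X l) i \<in> carrier_mat (m l) (m l)" "snd (X l) x \<in> carrier_mat (m l) (m l)"
  using ex[OF assms] X[OF assms] is_rep_iff[of n Arr src tgt rho "m l" "fst (X l)" "snd (X l)"]
  by (auto simp: short_exact_def)

lemma h_carrier: "l \<in> {1..<d} \<Longrightarrow> h l \<in> carrier_mat (m (Suc l)) (m l)"
  using h by (auto simp: is_hom_def)

lemma sub_rep_carrier: "fst (sub_rep l R) i \<in> carrier_mat l l" "snd (sub_rep l R) x \<in> carrier_mat l l"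
  by (auto simp: sub_rep_def topleft_def)

lemma fst_sub_rep: "l \<le> d \<Longrightarrow> fst (sub_rep l \<mu>) i = A_c n l c i" "l \<le> d \<Longrightarrow> fst (sub_rep l \<nu>) i = A_c n l c i"
  by (simp_all add: sub_rep_def T_cD(2)[OF \<mu>] T_cD(2)[OF \<nu>] topleft_A_c)

lemma snd_sub_rep: "snd (sub_rep d \<mu>) x = snd \<mu> x" "snd (sub_rep d \<nu>) x = snd \<nu> x"
  by (simp_all add: sub_rep_def topleft_id T_cD(3)[OF \<mu>] T_cD(3)[OF \<nu>])

definition f where "f l = top_rows (m l) (a l)"
definition g where "g l = bot_rows (m l) l (a l)"

lemma fg_carrier:
  assumes "l \<in> {1..d}" shows "f l \<in> carrier_mat (m l) (m l)" "g l \<in> carrier_mat l (m l)"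
  using rows_carrier[OF carriers(1)[OF assms]] by (auto simp: f_def g_def)

lemma a_vec:
  assumes "l \<in> {1..d}" "y \<in> carrier_vec (m l)"
  shows "a l *\<^sub>v y = (f l *\<^sub>v y) @\<^sub>v (g l *\<^sub>v y)"
  using rows_mult_vec[OF carriers(1)[OF assms(1)] assms(2)] by (simp add: f_def g_def)

lemma fg_hom:
  assumes l: "l \<in> {1..d}" and y: "y \<in> carrier_vec (m l)"
  shows "i < n \<Longrightarrow> f l *\<^sub>v (fst (X l) i *\<^sub>v y) = fst (X l) i *\<^sub>v (f l *\<^sub>v y) \<and>
      g l *\<^sub>v (fst (X l) i *\<^sub>v y) = fst (sub_rep l \<mu>) i *\<^sub>v (g l *\<^sub>v y)"
    "x \<in> Arr \<Longrightarrow> f l *\<^sub>v (snd (X l) x *\<^sub>v y) = snd (X l) x *\<^sub>v (f l *\<^sub>v y) \<and>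
      g l *\<^sub>v (snd (X l) x *\<^sub>v y) = snd (sub_rep l \<mu>) x *\<^sub>v (g l *\<^sub>v y)"
proof -
  note cX = carriers(3,4)[OF l]
  note fy = mult_mat_vec_carrier[OF fg_carrier(1)[OF l] y] and gy = mult_mat_vec_carrier[OF fg_carrier(2)[OF l] y]
  note dsc = dsum_rep_carrier[OF cX(1) sub_rep_carrier(1) cX(2) sub_rep_carrier(2)]
  note dsv = dsum_rep_mult_vec[OF cX(1) sub_rep_carrier(1) cX(2) sub_rep_carrier(2) fy gy]
  have key: "f l *\<^sub>v (A *\<^sub>v y) = A *\<^sub>v (f l *\<^sub>v y) \<and> g l *\<^sub>v (A *\<^sub>v y) = B *\<^sub>v (g l *\<^sub>v y)"
    if A: "A \<in> carrier_mat (m l) (m l)" "B \<in> carrier_mat l l" "C \<in> carrier_mat (m l + l) (m l + l)"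
      "a l * A = C * a l" "C *\<^sub>v ((f l *\<^sub>v y) @\<^sub>v (g l *\<^sub>v y)) = (A *\<^sub>v (f l *\<^sub>v y)) @\<^sub>v (B *\<^sub>v (g l *\<^sub>v y))" for A B C
  proof -
    have "a l *\<^sub>v (A *\<^sub>v y) = C *\<^sub>v (a l *\<^sub>v y)"
      by (rule mult_mat_vec_commute[OF A(4) carriers(1)[OF l] A(1) A(3) carriers(1)[OF l] y])
    then have "(f l *\<^sub>v (A *\<^sub>v y)) @\<^sub>v (g l *\<^sub>v (A *\<^sub>v y)) = (A *\<^sub>v (f l *\<^sub>v y)) @\<^sub>v (B *\<^sub>v (g l *\<^sub>v y))"
      unfolding a_vec[OF l y] a_vec[OF l mult_mat_vec_carrier[OF A(1) y]] A(5) .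
    then show ?thesis
      by (subst (asm) append_vec_eq[of _ "m l"]) (use A fy mult_mat_vec_carrier[OF fg_carrier(1)[OF l] mult_mat_vec_carrier[OF A(1) y]] in auto)
  qed
  show "i < n \<Longrightarrow> f l *\<^sub>v (fst (X l) i *\<^sub>v y) = fst (X l) i *\<^sub>v (f l *\<^sub>v y) \<and>
      g l *\<^sub>v (fst (X l) i *\<^sub>v y) = fst (sub_rep l \<mu>) i *\<^sub>v (g l *\<^sub>v y)"
    by (rule key[OF cX(1) sub_rep_carrier(1) dsc(1) _ dsv(1)]) (use a[OF l] in \<open>auto simp: is_hom_def\<close>)
  show "x \<in> Arr \<Longrightarrow> f l *\<^sub>v (snd (X l) x *\<^sub>v y) = snd (X l) x *\<^sub>v (f l *\<^sub>v y) \<and>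
      g l *\<^sub>v (snd (X l) x *\<^sub>v y) = snd (sub_rep l \<mu>) x *\<^sub>v (g l *\<^sub>v y)"
    by (rule key[OF cX(2) sub_rep_carrier(2) dsc(2) _ dsv(2)]) (use a[OF l] in \<open>auto simp: is_hom_def\<close>)
qed

lemma b_hom:
  assumes l: "l \<in> {1..d}" and xv: "x \<in> carrier_vec (m l)" "v \<in> carrier_vec l"
  shows "i < n \<Longrightarrow> b l *\<^sub>v ((fst (X l) i *\<^sub>v x) @\<^sub>v (fst (sub_rep l \<mu>) i *\<^sub>v v)) = fst (sub_rep l \<nu>) i *\<^sub>v (b l *\<^sub>v (x @\<^sub>v v))"
    "y \<in> Arr \<Longrightarrow> b l *\<^sub>v ((snd (X l) y *\<^sub>v x) @\<^sub>v (snd (sub_rep l \<mu>) y *\<^sub>v v)) = snd (sub_rep l \<nu>) y *\<^sub>v (b l *\<^sub>v (x @\<^sub>v v))"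
proof -
  note cX = carriers(3,4)[OF l]
  note dsc = dsum_rep_carrier[OF cX(1) sub_rep_carrier(1) cX(2) sub_rep_carrier(2)]
  note dsv = dsum_rep_mult_vec[OF cX(1) sub_rep_carrier(1) cX(2) sub_rep_carrier(2) xv]
  note u = append_carrier_vec[OF xv]
  show "i < n \<Longrightarrow> b l *\<^sub>v ((fst (X l) i *\<^sub>v x) @\<^sub>v (fst (sub_rep l \<mu>) i *\<^sub>v v)) = fst (sub_rep l \<nu>) i *\<^sub>v (b l *\<^sub>v (x @\<^sub>v v))"
    unfolding dsv(1)[symmetric]
    by (rule mult_mat_vec_commute[OF _ carriers(2)[OF l] dsc(1) sub_rep_carrier(1) carriers(2)[OF l] u])
      (use b[OF l] in \<open>auto simp: is_hom_def\<close>)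
  show "y \<in> Arr \<Longrightarrow> b l *\<^sub>v ((snd (X l) y *\<^sub>v x) @\<^sub>v (snd (sub_rep l \<mu>) y *\<^sub>v v)) = snd (sub_rep l \<nu>) y *\<^sub>v (b l *\<^sub>v (x @\<^sub>v v))"
    unfolding dsv(2)[symmetric]
    by (rule mult_mat_vec_commute[OF _ carriers(2)[OF l] dsc(2) sub_rep_carrier(2) carriers(2)[OF l] u])
      (use b[OF l] in \<open>auto simp: is_hom_def\<close>)
qed

lemma fg_h:
  assumes l: "l \<in> {1..<d}" and y: "y \<in> carrier_vec (m l)"
  shows "f (Suc l) *\<^sub>v (h l *\<^sub>v y) = h l *\<^sub>v (f l *\<^sub>v y)"
    "g (Suc l) *\<^sub>v (h l *\<^sub>v y) = incl_mat l *\<^sub>v (g l *\<^sub>v y)"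
proof -
  have ll: "l \<in> {1..d}" "Suc l \<in> {1..d}" using l by auto
  have hy: "h l *\<^sub>v y \<in> carrier_vec (m (Suc l))" using h_carrier[OF l] y by simp
  note fy = mult_mat_vec_carrier[OF fg_carrier(1)[OF ll(1)] y] and gy = mult_mat_vec_carrier[OF fg_carrier(2)[OF ll(1)] y]
  have "diag2 (h l) (incl_mat l) *\<^sub>v (a l *\<^sub>v y) = a (Suc l) *\<^sub>v (h l *\<^sub>v y)"
    by (rule mult_mat_vec_commute[OF ha[OF l] diag2_carrier[OF h_carrier[OF l] incl_mat_carrier] carriers(1)[OF ll(1)]
          carriers(1)[OF ll(2)] h_carrier[OF l] y])
  then have "(h l *\<^sub>v (f l *\<^sub>v y)) @\<^sub>v (incl_mat l *\<^sub>v (g l *\<^sub>v y)) =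
     (f (Suc l) *\<^sub>v (h l *\<^sub>v y)) @\<^sub>v (g (Suc l) *\<^sub>v (h l *\<^sub>v y))"
    unfolding a_vec[OF ll(1) y] a_vec[OF ll(2) hy] diag2_mult_vec[OF h_carrier[OF l] incl_mat_carrier fy gy] .
  then have "h l *\<^sub>v (f l *\<^sub>v y) = f (Suc l) *\<^sub>v (h l *\<^sub>v y) \<and> incl_mat l *\<^sub>v (g l *\<^sub>v y) = g (Suc l) *\<^sub>v (h l *\<^sub>v y)"
    by (subst (asm) append_vec_eq[of _ "m (Suc l)"])
      (use mult_mat_vec_carrier[OF h_carrier[OF l] fy] mult_mat_vec_carrier[OF fg_carrier(1)[OF ll(2)] hy] in auto)
  then show "f (Suc l) *\<^sub>v (h l *\<^sub>v y) = h l *\<^sub>v (f l *\<^sub>v y)"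
    "g (Suc l) *\<^sub>v (h l *\<^sub>v y) = incl_mat l *\<^sub>v (g l *\<^sub>v y)" by auto
qed

lemma b_h:
  assumes l: "l \<in> {1..<d}" and xv: "x \<in> carrier_vec (m l)" "v \<in> carrier_vec l"
  shows "b (Suc l) *\<^sub>v ((h l *\<^sub>v x) @\<^sub>v (incl_mat l *\<^sub>v v)) = incl_mat l *\<^sub>v (b l *\<^sub>v (x @\<^sub>v v))"
proof -
  have ll: "l \<in> {1..d}" "Suc l \<in> {1..d}" using l by auto
  have D: "diag2 (h l) (incl_mat l) \<in> carrier_mat (m (Suc l) + Suc l) (m l + l)"
    by (rule diag2_carrier[OF h_carrier[OF l] incl_mat_carrier])
  have "incl_mat l *\<^sub>v (b l *\<^sub>v (x @\<^sub>v v)) = b (Suc l) *\<^sub>v (diag2 (h l) (incl_mat l) *\<^sub>v (x @\<^sub>v v))"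
    by (rule mult_mat_vec_commute[OF hb[OF l] incl_mat_carrier carriers(2)[OF ll(1)] carriers(2)[OF ll(2)] D append_carrier_vec[OF xv]])
  then show ?thesis unfolding diag2_mult_vec[OF h_carrier[OF l] incl_mat_carrier xv] by simp
qed

text \<open>\<open>char_matrix (f l) t\<close> is \<open>f l - t\<close>. Subtracting
  \<open>t\<close> from the endomorphism deforms the sequence, and outside finitely many eigenvalues
  the first component becomes invertible, so that the cokernel can be identified with the module of
  \<open>\<mu>\<close>.\<close>

definition good :: "'k \<Rightarrow> bool" where
  "good t \<longleftrightarrow> (\<forall>l\<in>{1..d}. det (char_matrix (f l) t) \<noteq> 0)"

definition finv :: "nat \<Rightarrow> 'k \<Rightarrow> 'k mat" where
  "finv l t = (SOME I. I \<in> carrier_mat (m l) (m l) \<and> char_matrix (f l) t * I = 1\<^sub>m (m l) \<and> I * char_matrix (f l) t = 1\<^sub>m (m l))"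

lemma char_carrier: "l \<in> {1..d} \<Longrightarrow> char_matrix (f l) t \<in> carrier_mat (m l) (m l)"
  using fg_carrier(1) by simp

lemma finv:
  assumes "good t" "l \<in> {1..d}"
  shows "finv l t \<in> carrier_mat (m l) (m l)" "char_matrix (f l) t * finv l t = 1\<^sub>m (m l)"
    "finv l t * char_matrix (f l) t = 1\<^sub>m (m l)"
proof -
  have "\<exists>I. I \<in> carrier_mat (m l) (m l) \<and> char_matrix (f l) t * I = 1\<^sub>m (m l) \<and> I * char_matrix (f l) t = 1\<^sub>m (m l)"
  proof -
    have "det (char_matrix (f l) t) \<noteq> 0" using assms by (auto simp: good_def)
    from det_nonzero_inverse[OF char_carrier[OF assms(2)] this] show ?thesis by blast
  qed
  from someI_ex[OF this] show "finv l t \<in> carrier_mat (m l) (m l)" "char_matrix (f l) t * finv l t = 1\<^sub>m (m l)"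
    "finv l t * char_matrix (f l) t = 1\<^sub>m (m l)" unfolding finv_def by blast+
qed

lemma finv_vec:
  assumes "good t" "l \<in> {1..d}" "y \<in> carrier_vec (m l)"
  shows "char_matrix (f l) t *\<^sub>v (finv l t *\<^sub>v y) = y" "finv l t *\<^sub>v (char_matrix (f l) t *\<^sub>v y) = y"
proof -
  note F = finv[OF assms(1,2)] and C = char_carrier[OF assms(2)]
  show "char_matrix (f l) t *\<^sub>v (finv l t *\<^sub>v y) = y"
    unfolding assoc_mult_mat_vec[OF C F(1) assms(3), symmetric] F(2) using assms(3) by simp
  show "finv l t *\<^sub>v (char_matrix (f l) t *\<^sub>v y) = y"
    unfolding assoc_mult_mat_vec[OF F(1) C assms(3), symmetric] F(3) using assms(3) by simp
qed

lemma char_vec: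
  assumes "l \<in> {1..d}" "y \<in> carrier_vec (m l)"
  shows "char_matrix (f l) t *\<^sub>v y = f l *\<^sub>v y + (- t) \<cdot>\<^sub>v y"
proof -
  have "dim_row (f l) = m l" using fg_carrier[OF assms(1)] by auto
  then have "char_matrix (f l) t *\<^sub>v y = f l *\<^sub>v y + ((- t) \<cdot>\<^sub>m 1\<^sub>m (m l)) *\<^sub>v y"
    unfolding char_matrix_def using fg_carrier[OF assms(1)] assms(2)
    by (simp add: add_mult_distrib_mat_vec[of _ "m l" "m l"])
  also have "((- t) \<cdot>\<^sub>m 1\<^sub>m (m l)) *\<^sub>v y = (- t) \<cdot>\<^sub>v y" using assms(2) by (intro eq_vecI) auto
  finally show ?thesis .
qed

text \<open>A retraction of the direct sum onto its second summand whose kernel is the image of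
  \<open>(f l - t, g l)\<close>; it realizes the identification of the cokernel.\<close>

definition proj :: "nat \<Rightarrow> 'k \<Rightarrow> 'k vec \<Rightarrow> 'k vec \<Rightarrow> 'k vec" where
  "proj l t x v = v - g l *\<^sub>v (finv l t *\<^sub>v x)"

text \<open>Whatever intertwines \<open>f l\<close> and \<open>f l'\<close> intertwines their
  resolvents. This is applied to the maps \<open>h l\<close> between levels as well as to the action
  within one level.\<close>

lemma finv_commute:
  assumes t: "good t" and l: "l \<in> {1..d}" "l' \<in> {1..d}" and A: "A \<in> carrier_mat (m l') (m l)"
    and x: "x \<in> carrier_vec (m l)"
    and comm: "\<And>y. y \<in> carrier_vec (m l) \<Longrightarrow> f l' *\<^sub>v (A *\<^sub>v y) = A *\<^sub>v (f l *\<^sub>v y)"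
  shows "finv l' t *\<^sub>v (A *\<^sub>v x) = A *\<^sub>v (finv l t *\<^sub>v x)"
proof -
  define y where "y = finv l t *\<^sub>v x"
  have y: "y \<in> carrier_vec (m l)" unfolding y_def using finv(1)[OF t l(1)] x by simp
  have Ay: "A *\<^sub>v y \<in> carrier_vec (m l')" using A y by simp
  have fy: "f l *\<^sub>v y \<in> carrier_vec (m l)" using fg_carrier(1)[OF l(1)] y by simp
  have xy: "x = char_matrix (f l) t *\<^sub>v y" unfolding y_def using finv_vec(1)[OF t l(1) x] by simp
  have "A *\<^sub>v x = A *\<^sub>v (f l *\<^sub>v y + (- t) \<cdot>\<^sub>v y)" unfolding xy char_vec[OF l(1) y] ..
  also have "\<dots> = A *\<^sub>v (f l *\<^sub>v y) + (- t) \<cdot>\<^sub>v (A *\<^sub>v y)"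
    using A y fy by (simp add: mult_add_distrib_mat_vec[OF A fy] mult_mat_vec[OF A y])
  also have "\<dots> = char_matrix (f l') t *\<^sub>v (A *\<^sub>v y)" unfolding char_vec[OF l(2) Ay] comm[OF y] ..
  finally show ?thesis using finv_vec(2)[OF t l(2) Ay] by (simp add: y_def)
qed

text \<open>The lift of \<open>unit_vec L s\<close> is made at level \<open>Suc s\<close> and then
  pushed up along \<open>h\<close> and the inclusions, so its projection has no entries below
  position \<open>s\<close>, for all good \<open>t\<close> at once. Applying the idempotent at
  \<open>c s\<close> first makes it homogeneous. These two properties will make the conjugating
  matrix triangular and graded.\<close>

lemma lift_exists:
  assumes s: "s < L" and L: "L \<le> d"
  shows "\<exists>x\<in>carrier_vec (m L). \<exists>v\<in>carrier_vec L. b L *\<^sub>v (x @\<^sub>v v) = unit_vec L s \<and>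
    fst (X L) (c s) *\<^sub>v x = x \<and> A_c n L c (c s) *\<^sub>v v = v \<and>
    (\<forall>t. good t \<longrightarrow> (\<forall>r<L. s < r \<longrightarrow> proj L t x v $ r = 0))"
  using s[THEN Suc_leI] L
proof (induction L rule: dec_induct)
  case base
  \<comment> \<open>At this level there is no position below \<open>s\<close>, so the triangularity
    condition is void.\<close>
  let ?L = "Suc s"
  have l: "?L \<in> {1..d}" using base by auto
  have cs: "c s < n" using c base by auto
  obtain u where u: "u \<in> carrier_vec (m ?L + ?L)" "b ?L *\<^sub>v u = unit_vec ?L s"
    using ex[OF l] unfolding short_exact_def by (meson unit_vec_carrier)
  obtain x0 v0 where xv: "x0 \<in> carrier_vec (m ?L)" "v0 \<in> carrier_vec ?L" "u = x0 @\<^sub>v v0"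
    using vec_split_append[OF u(1)] by blast
  define x where "x = fst (X ?L) (c s) *\<^sub>v x0"
  define v where "v = A_c n ?L c (c s) *\<^sub>v v0"
  have E: "fst (X ?L) (c s) * fst (X ?L) (c s) = fst (X ?L) (c s)"
    using X[OF l] is_rep_iff[of n Arr src tgt rho "m ?L" "fst (X ?L)" "snd (X ?L)"] cs by simp
  have x: "x \<in> carrier_vec (m ?L)" "fst (X ?L) (c s) *\<^sub>v x = x"
    using mult_mat_vec_carrier[OF carriers(3)[OF l] xv(1)] E unfolding x_def
    by (auto simp: assoc_mult_mat_vec[OF carriers(3)[OF l] carriers(3)[OF l] xv(1), symmetric])
  have vc: "v \<in> carrier_vec ?L" using A_c_carrier xv(2) unfolding v_def by (rule mult_mat_vec_carrier)
  have v: "A_c n ?L c (c s) *\<^sub>v v = v"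
  proof (rule eq_vecI)
    fix r assume "r < dim_vec v"
    then have "r < ?L" using vc by auto
    then show "(A_c n ?L c (c s) *\<^sub>v v) $ r = v $ r"
      using A_c_mult_vec_index[OF vc _ cs] A_c_mult_vec_index[OF xv(2) _ cs] by (simp add: v_def)
  qed (use vc in \<open>auto simp: A_c_def A_mat_def\<close>)
  have "b ?L *\<^sub>v (x @\<^sub>v v) = A_c n ?L c (c s) *\<^sub>v unit_vec ?L s"
    using b_hom(1)[OF l xv(1,2) cs] u(2) xv(3) base by (simp add: x_def v_def fst_sub_rep)
  also have "\<dots> = unit_vec ?L s"
  proof (rule eq_vecI)
    fix r assume "r < dim_vec (unit_vec ?L s)"
    then show "(A_c n ?L c (c s) *\<^sub>v unit_vec ?L s) $ r = unit_vec ?L s $ r"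
      by (subst A_c_mult_vec_index[OF unit_vec_carrier _ cs]) auto
  qed (auto simp: A_c_def A_mat_def)
  finally show ?case using x v vc by (intro bexI[of _ x] bexI[of _ v]) auto
next
  case (step L)
  have l: "L \<in> {1..<d}" "L \<in> {1..d}" "Suc L \<in> {1..d}" using step by auto
  have cs: "c s < n" using c step by auto
  obtain x v where xv: "x \<in> carrier_vec (m L)" "v \<in> carrier_vec L" "b L *\<^sub>v (x @\<^sub>v v) = unit_vec L s"
    "fst (X L) (c s) *\<^sub>v x = x" "A_c n L c (c s) *\<^sub>v v = v"
    "\<And>t r. good t \<Longrightarrow> r < L \<Longrightarrow> s < r \<Longrightarrow> proj L t x v $ r = 0"
    using step.IH step.prems by auto
  define x' where "x' = h L *\<^sub>v x"
  define v' where "v' = incl_mat L *\<^sub>v v"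
  have x': "x' \<in> carrier_vec (m (Suc L))" unfolding x'_def using h_carrier[OF l(1)] xv(1) by simp
  have v': "v' \<in> carrier_vec (Suc L)" unfolding v'_def using incl_mat_carrier xv(2) by (rule mult_mat_vec_carrier)
  have "b (Suc L) *\<^sub>v (x' @\<^sub>v v') = incl_mat L *\<^sub>v unit_vec L s"
    unfolding x'_def v'_def b_h[OF l(1) xv(1,2)] xv(3) ..
  also have "\<dots> = unit_vec (Suc L) s"
  proof (rule eq_vecI)
    fix r assume "r < dim_vec (unit_vec (Suc L) s)"
    then show "(incl_mat L *\<^sub>v unit_vec L s) $ r = unit_vec (Suc L) s $ r"
      using step.hyps by (auto simp: incl_mat_index[OF unit_vec_carrier])
  qed (auto simp: incl_mat_def)
  finally have 1: "b (Suc L) *\<^sub>v (x' @\<^sub>v v') = unit_vec (Suc L) s" .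
  have "h L * fst (X L) (c s) = fst (X (Suc L)) (c s) * h L"
    using h[OF l(1)] cs by (simp add: is_hom_def)
  from mult_mat_vec_commute[OF this h_carrier[OF l(1)] carriers(3)[OF l(2)] carriers(3)[OF l(3)] h_carrier[OF l(1)] xv(1)]
  have 2: "fst (X (Suc L)) (c s) *\<^sub>v x' = x'" unfolding x'_def xv(4) by simp
  have 3: "A_c n (Suc L) c (c s) *\<^sub>v v' = v'"
  proof (rule eq_vecI)
    fix r assume "r < dim_vec v'"
    then have r: "r < Suc L" using v' by auto
    have "v $ r = (if c r = c s then v $ r else 0)" if "r < L"
      using A_c_mult_vec_index[OF xv(2) that cs, where c = c] xv(5) by simp
    moreover have "v' $ r = (if r < L then v $ r else 0)"
      unfolding v'_def by (rule incl_mat_index[OF xv(2) r])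
    ultimately show "(A_c n (Suc L) c (c s) *\<^sub>v v') $ r = v' $ r"
      unfolding A_c_mult_vec_index[OF v' r cs] by (auto split: if_splits)
  qed (use v' in \<open>auto simp: A_c_def A_mat_def\<close>)
  have "proj (Suc L) t x' v' $ r = 0" if t: "good t" and r: "r < Suc L" "s < r" for t r
  proof -
    note fx = mult_mat_vec_carrier[OF finv(1)[OF t l(2)] xv(1)]
    note gfx = mult_mat_vec_carrier[OF fg_carrier(2)[OF l(2)] fx]
    have "finv (Suc L) t *\<^sub>v x' = h L *\<^sub>v (finv L t *\<^sub>v x)" unfolding x'_def
      by (rule finv_commute[OF t l(2,3) h_carrier[OF l(1)] xv(1) fg_h(1)[OF l(1)]])
    then have e: "proj (Suc L) t x' v' = v' - incl_mat L *\<^sub>v (g L *\<^sub>v (finv L t *\<^sub>v x))"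
      unfolding proj_def using fg_h(2)[OF l(1) fx] by simp
    have "proj (Suc L) t x' v' $ r = v' $ r - (incl_mat L *\<^sub>v (g L *\<^sub>v (finv L t *\<^sub>v x))) $ r"
      unfolding e using r v' by (simp add: incl_mat_def)
    also have "\<dots> = (if r < L then proj L t x v $ r else 0)"
      unfolding v'_def incl_mat_index[OF xv(2) r(1)] incl_mat_index[OF gfx r(1)]
      using carrier_vecD[OF gfx] by (auto simp: proj_def)
    finally show ?thesis using xv(6)[OF t _ r(2)] by auto
  qed
  then show ?case using 1 2 3 x' v' by (intro bexI[of _ x'] bexI[of _ v']) auto
qed

end

lemma mult_mat_zero_vec:
  fixes A :: "'a::comm_ring_1 mat"
  assumes "A \<in> carrier_mat n m"
  shows "A *\<^sub>v 0\<^sub>v m = 0\<^sub>v n"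
  using assms by (intro eq_vecI) (auto simp: index_mult_mat_vec_sum[OF assms zero_carrier_vec] simp del: index_mult_mat_vec)

lemma append_zero_vec: "0\<^sub>v p @\<^sub>v 0\<^sub>v q = 0\<^sub>v (p + q)"
  by (intro eq_vecI) auto

context flag_sequences
begin

text \<open>The columns of \<open>WW\<close> lift the unit vectors through \<open>b d\<close> and
  give a basis of the cokernel of \<open>(f d - t, g d)\<close> for almost all \<open>t\<close>. In
  this basis the arrows act by \<open>N x t\<close>: at \<open>t = 0\<close> this is
  \<open>\<nu>\<close>, for almost all \<open>t\<close> it is conjugate to \<open>\<mu>\<close>
  through \<open>proj\<close>. As \<open>N x t\<close> is rational in \<open>t\<close> with
  denominator \<open>D t\<close>, equations valid on the orbit persist at
  \<open>t = 0\<close>.\<close>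

theorem in_zariski_closure:
  "\<nu> \<in> zariski_closure n Arr d ((\<lambda>g. conj_rep d g \<mu>) ` normalizer d (T_c n Arr src tgt rho d c))"
proof -
  have dd: "d \<in> {1..d}" using d by simp
  define p where "p = m d"
  note fc = fg_carrier(1)[OF dd, folded p_def] and gc = fg_carrier(2)[OF dd, folded p_def]
    and ac = carriers(1)[OF dd, folded p_def] and bc = carriers(2)[OF dd, folded p_def]
    and Xc = carriers(3,4)[OF dd, folded p_def]
  define lifts where "lifts s x v \<longleftrightarrow> x \<in> carrier_vec p \<and> v \<in> carrier_vec d \<and> b d *\<^sub>v (x @\<^sub>v v) = unit_vec d s \<and>
    fst (X d) (c s) *\<^sub>v x = x \<and> A_c n d c (c s) *\<^sub>v v = v \<and>
    (\<forall>t. good t \<longrightarrow> (\<forall>r<d. s < r \<longrightarrow> proj d t x v $ r = 0))" for s x v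
  have "\<exists>x v. lifts s x v" if "s < d" for s
    using lift_exists[OF that order_refl] unfolding lifts_def p_def by blast
  then obtain xs vs where lf: "\<And>s. s < d \<Longrightarrow> lifts s (xs s) (vs s)" by metis
  have xs: "\<And>s. s < d \<Longrightarrow> xs s \<in> carrier_vec p" and vs: "\<And>s. s < d \<Longrightarrow> vs s \<in> carrier_vec d"
    and bxv: "\<And>s. s < d \<Longrightarrow> b d *\<^sub>v (xs s @\<^sub>v vs s) = unit_vec d s"
    and Ex: "\<And>s. s < d \<Longrightarrow> fst (X d) (c s) *\<^sub>v xs s = xs s"
    and Ev: "\<And>s. s < d \<Longrightarrow> A_c n d c (c s) *\<^sub>v vs s = vs s"
    and low: "\<And>s t r. s < d \<Longrightarrow> good t \<Longrightarrow> r < d \<Longrightarrow> s < r \<Longrightarrow> proj d t (xs s) (vs s) $ r = 0"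
    using lf unfolding lifts_def by blast+
  define WW where "WW = mat (p + d) d (\<lambda>(i, s). (xs s @\<^sub>v vs s) $ i)"
  have WWc: "WW \<in> carrier_mat (p + d) d" by (simp add: WW_def)
  define Wx where "Wx = top_rows p WW"
  define Wv where "Wv = bot_rows p d WW"
  have Wxc: "Wx \<in> carrier_mat p d" and Wvc: "Wv \<in> carrier_mat d d"
    using rows_carrier[OF WWc] by (auto simp: Wx_def Wv_def)
  have WWz: "WW *\<^sub>v z = (Wx *\<^sub>v z) @\<^sub>v (Wv *\<^sub>v z)" if "z \<in> carrier_vec d" for z
    using rows_mult_vec[OF WWc that] by (simp add: Wx_def Wv_def)
  have WWu: "WW *\<^sub>v unit_vec d s = xs s @\<^sub>v vs s" if s: "s < d" for s
  proof (rule eq_vecI)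
    fix i assume "i < dim_vec (xs s @\<^sub>v vs s)"
    then have "i < p + d" using xs[OF s] vs[OF s] by simp
    then show "(WW *\<^sub>v unit_vec d s) $ i = (xs s @\<^sub>v vs s) $ i"
      unfolding mult_mat_unit_vec[OF WWc \<open>i < p + d\<close> s] using s by (simp add: WW_def)
  qed (use xs[OF s] vs[OF s] in \<open>auto simp: WW_def\<close>)
  have Wu: "Wx *\<^sub>v unit_vec d s = xs s" "Wv *\<^sub>v unit_vec d s = vs s" if s: "s < d" for s
  proof -
    have "(Wx *\<^sub>v unit_vec d s) @\<^sub>v (Wv *\<^sub>v unit_vec d s) = xs s @\<^sub>v vs s"
      using WWu[OF s] WWz[OF unit_vec_carrier] by simp
    then have "Wx *\<^sub>v unit_vec d s = xs s \<and> Wv *\<^sub>v unit_vec d s = vs s"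
      by (subst (asm) append_vec_eq[of _ p]) (use mult_mat_vec_carrier[OF Wxc unit_vec_carrier] xs[OF s] in auto)
    then show "Wx *\<^sub>v unit_vec d s = xs s" "Wv *\<^sub>v unit_vec d s = vs s" by auto
  qed
  have bWW: "b d * WW = 1\<^sub>m d"
  proof (rule mat_eq_on_vecs[OF mult_carrier_mat[OF bc WWc] one_carrier_mat])
    fix s assume s: "s < d"
    show "b d * WW *\<^sub>v unit_vec d s = 1\<^sub>m d *\<^sub>v unit_vec d s"
      unfolding assoc_mult_mat_vec[OF bc WWc unit_vec_carrier] WWu[OF s] bxv[OF s] by simp
  qed
  have bWWz: "b d *\<^sub>v (WW *\<^sub>v z) = z" if "z \<in> carrier_vec d" for z
    unfolding assoc_mult_mat_vec[OF bc WWc that, symmetric] bWW using that by simp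
  have ba: "b d *\<^sub>v (a d *\<^sub>v y) = 0\<^sub>v d" if "y \<in> carrier_vec p" for y
    using ex[OF dd] that mult_mat_vec_carrier[OF ac that] unfolding short_exact_def p_def by blast
  have ainj: "y = 0\<^sub>v p" if "y \<in> carrier_vec p" "a d *\<^sub>v y = 0\<^sub>v (p + d)" for y
    using ex[OF dd] that unfolding short_exact_def p_def by blast
  note cc = char_carrier[OF dd, folded p_def]
  \<comment> \<open>Its columns are those of \<open>(f d - t, g d)\<close> followed by the lifts; it
    is invertible exactly when the lifts form a basis of the cokernel.\<close>
  define B where "B t = four_block_mat (char_matrix (f d) t) Wx (g d) Wv" for t
  have Bc: "B t \<in> carrier_mat (p + d) (p + d)" for t
    unfolding B_def using cc[of t] Wvc by simp
  have Bv: "B t *\<^sub>v (y @\<^sub>v z) = (char_matrix (f d) t *\<^sub>v y + Wx *\<^sub>v z) @\<^sub>v (g d *\<^sub>v y + Wv *\<^sub>v z)"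
    if "y \<in> carrier_vec p" "z \<in> carrier_vec d" for t y z
    unfolding B_def by (rule four_block_mat_mult_vec[OF cc Wxc gc Wvc that])
  have B0: "B 0 *\<^sub>v (y @\<^sub>v z) = a d *\<^sub>v y + WW *\<^sub>v z" if yz: "y \<in> carrier_vec p" "z \<in> carrier_vec d" for y z
  proof -
    note c4 = mult_mat_vec_carrier[OF fc yz(1)] mult_mat_vec_carrier[OF gc yz(1)]
      mult_mat_vec_carrier[OF Wxc yz(2)] mult_mat_vec_carrier[OF Wvc yz(2)]
    have "char_matrix (f d) 0 *\<^sub>v y = f d *\<^sub>v y"
      using char_vec[OF dd, folded p_def, OF yz(1), of 0] carrier_matD[OF fc] yz(1)
      by (intro eq_vecI) (auto simp: carrier_vecD)
    then show ?thesis unfolding Bv[OF yz] a_vec[OF dd, folded p_def, OF yz(1)] WWz[OF yz(2)]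
      using c4[THEN carrier_vecD] by (intro eq_vecI) (auto simp del: dim_mult_mat_vec)
  qed
  define D where "D t = det (B t)" for t
  have D0: "D 0 \<noteq> 0"
  proof
    assume "D 0 = 0"
    then obtain v where v: "v \<in> carrier_vec (p + d)" "v \<noteq> 0\<^sub>v (p + d)" "B 0 *\<^sub>v v = 0\<^sub>v (p + d)"
      unfolding D_def det_0_iff_vec_prod_zero_field[OF Bc] by blast
    obtain y z where yz: "y \<in> carrier_vec p" "z \<in> carrier_vec d" "v = y @\<^sub>v z"
      using vec_split_append[OF v(1)] by blast
    note ayc = mult_mat_vec_carrier[OF ac yz(1)] and Wzc = mult_mat_vec_carrier[OF WWc yz(2)]
    have eq: "a d *\<^sub>v y + WW *\<^sub>v z = 0\<^sub>v (p + d)" using v(3) B0[OF yz(1,2)] yz(3) by simp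
    have "b d *\<^sub>v (a d *\<^sub>v y + WW *\<^sub>v z) = 0\<^sub>v d + z"
      unfolding mult_add_distrib_mat_vec[OF bc ayc Wzc] ba[OF yz(1)] bWWz[OF yz(2)] ..
    then have "z = b d *\<^sub>v 0\<^sub>v (p + d)" unfolding eq using yz(2) by simp
    then have z0: "z = 0\<^sub>v d" using mult_mat_zero_vec[OF bc] by simp
    then have "WW *\<^sub>v z = 0\<^sub>v (p + d)" using mult_mat_zero_vec[OF WWc] by simp
    then have "a d *\<^sub>v y = 0\<^sub>v (p + d)" using eq ayc by simp
    then have "y = 0\<^sub>v p" using ainj yz(1) by blast
    then have "v = 0\<^sub>v (p + d)" unfolding yz(3) z0 by (simp add: append_zero_vec)
    then show False using v(2) by blast
  qed
  define rhs where "rhs x s = (snd (X d) x *\<^sub>v xs s) @\<^sub>v (snd \<mu> x *\<^sub>v vs s)" for x s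
  note \<mu>c = T_cD(3)[OF \<mu>] and \<nu>c = T_cD(3)[OF \<nu>]
  have rhsc: "rhs x s \<in> carrier_vec (p + d)" if "s < d" for x s
    unfolding rhs_def using mult_mat_vec_carrier[OF Xc(2) xs[OF that]] mult_mat_vec_carrier[OF \<mu>c vs[OF that]] by simp
  \<comment> \<open>Cramer's rule for the last \<open>d\<close> entries of the solution of
    \<open>B t u = rhs x s\<close>: these are the coordinates, in the basis of lifts, of the arrow
    applied to the \<open>s\<close>-th lift.\<close>
  define NN where "NN x t r s = (\<Sum>l<p + d. adj_mat (B t) $$ (p + r, l) * rhs x s $ l)" for x t r s
  define N where "N x t = mat d d (\<lambda>(r, s). NN x t r s / D t)" for x t
  have Nc: "N x t \<in> carrier_mat d d" for x t by (simp add: N_def)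
  have sol: "\<exists>y\<in>carrier_vec p. B t *\<^sub>v (y @\<^sub>v (N x t *\<^sub>v unit_vec d s)) = rhs x s" if Dt: "D t \<noteq> 0" and s: "s < d" for t x s
  proof -
    note adj = adj_mat[OF Bc[of t]]
    define w where "w = (1 / D t) \<cdot>\<^sub>v (adj_mat (B t) *\<^sub>v rhs x s)"
    have aw: "adj_mat (B t) *\<^sub>v rhs x s \<in> carrier_vec (p + d)" using mult_mat_vec_carrier[OF adj(1) rhsc[OF s]] .
    then have wc: "w \<in> carrier_vec (p + d)" by (simp add: w_def)
    have "B t *\<^sub>v w = (1 / D t) \<cdot>\<^sub>v (B t *\<^sub>v (adj_mat (B t) *\<^sub>v rhs x s))"
      unfolding w_def by (rule mult_mat_vec[OF Bc aw])
    also have "B t *\<^sub>v (adj_mat (B t) *\<^sub>v rhs x s) = (B t * adj_mat (B t)) *\<^sub>v rhs x s"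
      by (rule assoc_mult_mat_vec[OF Bc adj(1) rhsc[OF s], symmetric])
    also have "\<dots> = D t \<cdot>\<^sub>v rhs x s" unfolding adj(2) D_def using rhsc[OF s, of x] by (intro eq_vecI) auto
    also have "(1 / D t) \<cdot>\<^sub>v (D t \<cdot>\<^sub>v rhs x s) = rhs x s" using Dt by (simp add: smult_smult_assoc)
    finally have Bw: "B t *\<^sub>v w = rhs x s" .
    obtain y z where yz: "y \<in> carrier_vec p" "z \<in> carrier_vec d" "w = y @\<^sub>v z" using vec_split_append[OF wc] by blast
    have "z = N x t *\<^sub>v unit_vec d s"
    proof (rule eq_vecI)
      fix r assume "r < dim_vec (N x t *\<^sub>v unit_vec d s)"
      then have r: "r < d" by (simp add: N_def)
      have "z $ r = w $ (p + r)" using yz(3) carrier_vecD[OF yz(1)] carrier_vecD[OF yz(2)] r by simp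
      also have "\<dots> = NN x t r s / D t"
        using r carrier_vecD[OF aw] index_mult_mat_vec_sum[OF adj(1) rhsc[OF s], of "p + r" x] by (simp add: w_def NN_def)
      finally show "z $ r = (N x t *\<^sub>v unit_vec d s) $ r"
        unfolding mult_mat_unit_vec[OF Nc r s] using r s by (simp add: N_def)
    qed (use yz(2) in \<open>simp add: N_def\<close>)
    then show ?thesis using yz Bw by auto
  qed
  \<comment> \<open>Applying \<open>b d\<close> kills the image of \<open>a d\<close> and turns the
    lifts into unit vectors, so only the action of \<open>\<nu>\<close> is left.\<close>
  have N0: "N x 0 = snd \<nu> x" if x: "x \<in> Arr" for x
  proof (rule mat_eq_on_vecs[OF Nc \<nu>c])
    fix s assume s: "s < d"
    obtain y where y: "y \<in> carrier_vec p" "B 0 *\<^sub>v (y @\<^sub>v (N x 0 *\<^sub>v unit_vec d s)) = rhs x s"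
      using sol[OF D0 s] by blast
    have Nu: "N x 0 *\<^sub>v unit_vec d s \<in> carrier_vec d" using mult_mat_vec_carrier[OF Nc unit_vec_carrier] .
    note ayc = mult_mat_vec_carrier[OF ac y(1)] and Wzc = mult_mat_vec_carrier[OF WWc Nu]
    have "b d *\<^sub>v (a d *\<^sub>v y + WW *\<^sub>v (N x 0 *\<^sub>v unit_vec d s)) = 0\<^sub>v d + N x 0 *\<^sub>v unit_vec d s"
      unfolding mult_add_distrib_mat_vec[OF bc ayc Wzc] ba[OF y(1)] bWWz[OF Nu] ..
    then have "N x 0 *\<^sub>v unit_vec d s = b d *\<^sub>v rhs x s" using B0[OF y(1) Nu] y(2) Nu by simp
    also have "\<dots> = snd \<nu> x *\<^sub>v (b d *\<^sub>v (xs s @\<^sub>v vs s))"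
      using b_hom(2)[OF dd, folded p_def, OF xs[OF s] vs[OF s] x] by (simp add: rhs_def snd_sub_rep)
    finally show "N x 0 *\<^sub>v unit_vec d s = snd \<nu> x *\<^sub>v unit_vec d s" unfolding bxv[OF s] .
  qed
  have orbit: "\<exists>Q\<in>(\<lambda>g. conj_rep d g \<mu>) ` normalizer d (T_c n Arr src tgt rho d c).
      fst Q = A_c n d c \<and> (\<forall>x\<in>Arr. snd Q x = N x t)" if t: "good t" "D t \<noteq> 0" for t
  proof -
    note Ic = finv(1)[OF t(1) dd, folded p_def]
    \<comment> \<open>The Schur complement of \<open>f d - t\<close> in \<open>B t\<close>, that is,
      the matrix of \<open>proj\<close> on the lifts.\<close>
    define G where "G = Wv - g d * (finv d t * Wx)"
    have IWc: "finv d t * Wx \<in> carrier_mat p d" using Ic Wxc by simp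
    have gIWc: "g d * (finv d t * Wx) \<in> carrier_mat d d" using gc IWc by simp
    have Gc: "G \<in> carrier_mat d d" unfolding G_def by (rule minus_carrier_mat[OF gIWc])
    have Gv: "G *\<^sub>v z = proj d t (Wx *\<^sub>v z) (Wv *\<^sub>v z)" if z: "z \<in> carrier_vec d" for z
      unfolding G_def proj_def minus_mult_distrib_mat_vec[OF Wvc gIWc z]
        assoc_mult_mat_vec[OF gc IWc z] assoc_mult_mat_vec[OF Ic Wxc z] ..
    have Gu: "G *\<^sub>v unit_vec d s = proj d t (xs s) (vs s)" if s: "s < d" for s
      unfolding Gv[OF unit_vec_carrier] Wu[OF s] ..
    have "upper_triangular G"
    proof (rule upper_triangularI)
      fix i j assume ij: "j < i" "i < dim_row G"
      then have "i < d" "j < d" using Gc by auto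
      then show "G $$ (i, j) = 0"
        using mult_mat_unit_vec[OF Gc, of i j] Gu[of j] low[OF _ t(1) _ ij(1)] by simp
    qed
    have gr: "graded d c G" unfolding graded_def
    proof (intro allI impI)
      fix r s assume rs: "r < d" "s < d" "c r \<noteq> c s"
      have cs: "c s < n" using c rs by auto
      note ix = mult_mat_vec_carrier[OF Ic xs[OF rs(2)]]
      have "finv d t *\<^sub>v (fst (X d) (c s) *\<^sub>v xs s) = fst (X d) (c s) *\<^sub>v (finv d t *\<^sub>v xs s)"
        by (rule finv_commute[OF t(1) dd dd, folded p_def, OF Xc(1) xs[OF rs(2)]])
          (use fg_hom(1)[OF dd, folded p_def] cs in blast)
      then have "g d *\<^sub>v (finv d t *\<^sub>v xs s) = A_c n d c (c s) *\<^sub>v (g d *\<^sub>v (finv d t *\<^sub>v xs s))"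
        using fg_hom(1)[OF dd, folded p_def, OF ix cs] by (simp add: Ex[OF rs(2)] fst_sub_rep)
      then have "(g d *\<^sub>v (finv d t *\<^sub>v xs s)) $ r = 0"
        using A_c_mult_vec_index[OF mult_mat_vec_carrier[OF gc ix] rs(1) cs, of c] rs(3) by simp
      moreover have "vs s $ r = 0"
        using A_c_mult_vec_index[OF vs[OF rs(2)] rs(1) cs, of c] rs(3) Ev[OF rs(2)] by simp
      ultimately show "G $$ (r, s) = 0"
        using mult_mat_unit_vec[OF Gc rs(1,2)] Gu[OF rs(2)] carrier_vecD[OF mult_mat_vec_carrier[OF gc ix]] rs(1)
        by (simp add: proj_def)
    qed
    have "det G \<noteq> 0"
    proof
      assume "det G = 0"
      then obtain z where z: "z \<in> carrier_vec d" "z \<noteq> 0\<^sub>v d" "G *\<^sub>v z = 0\<^sub>v d"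
        unfolding det_0_iff_vec_prod_zero_field[OF Gc] by blast
      note Wxz = mult_mat_vec_carrier[OF Wxc z(1)] and Wvz = mult_mat_vec_carrier[OF Wvc z(1)]
      define y where "y = finv d t *\<^sub>v (Wx *\<^sub>v z)"
      have y: "y \<in> carrier_vec p" unfolding y_def using mult_mat_vec_carrier[OF Ic Wxz] .
      have ny: "- 1 \<cdot>\<^sub>v y \<in> carrier_vec p" using y by simp
      have gy: "g d *\<^sub>v y \<in> carrier_vec d" using mult_mat_vec_carrier[OF gc y] .
      have cy: "char_matrix (f d) t *\<^sub>v y = Wx *\<^sub>v z"
        unfolding y_def using finv_vec(1)[OF t(1) dd, folded p_def, OF Wxz] .
      have "char_matrix (f d) t *\<^sub>v (- 1 \<cdot>\<^sub>v y) + Wx *\<^sub>v z = 0\<^sub>v p"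
        unfolding mult_mat_vec[OF cc y] cy using carrier_vecD[OF Wxz]
        by (intro eq_vecI) (auto simp del: dim_mult_mat_vec)
      moreover have "g d *\<^sub>v (- 1 \<cdot>\<^sub>v y) + Wv *\<^sub>v z = 0\<^sub>v d"
      proof -
        have "g d *\<^sub>v (- 1 \<cdot>\<^sub>v y) + Wv *\<^sub>v z = G *\<^sub>v z"
          unfolding mult_mat_vec[OF gc y] Gv[OF z(1)] proj_def y_def[symmetric]
          using gy[THEN carrier_vecD] Wvz[THEN carrier_vecD]
          by (intro eq_vecI) (auto simp del: dim_mult_mat_vec)
        then show ?thesis using z(3) by simp
      qed
      ultimately have "B t *\<^sub>v ((- 1 \<cdot>\<^sub>v y) @\<^sub>v z) = 0\<^sub>v (p + d)"
        unfolding Bv[OF ny z(1)] by (simp add: append_zero_vec)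
      moreover have "(- 1 \<cdot>\<^sub>v y) @\<^sub>v z \<noteq> 0\<^sub>v (p + d)"
      proof
        assume "(- 1 \<cdot>\<^sub>v y) @\<^sub>v z = 0\<^sub>v (p + d)"
        also have "0\<^sub>v (p + d) = (0\<^sub>v p :: 'k vec) @\<^sub>v 0\<^sub>v d" by (simp add: append_zero_vec)
        finally show False using z(2) ny by (subst (asm) append_vec_eq[of _ p]) auto
      qed
      ultimately show False using t(2) append_carrier_vec[OF ny z(1)]
        unfolding D_def det_0_iff_vec_prod_zero_field[OF Bc] by blast
    qed
    then obtain G' where G': "G' \<in> carrier_mat d d" "G * G' = 1\<^sub>m d" "G' * G = 1\<^sub>m d"
      using det_nonzero_inverse[OF Gc] by blast
    have GN: "G * N x t = snd \<mu> x * G" if x: "x \<in> Arr" for x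
    proof (rule mat_eq_on_vecs[OF mult_carrier_mat[OF Gc Nc] mult_carrier_mat[OF \<mu>c Gc]])
      fix s assume s: "s < d"
      define z where "z = N x t *\<^sub>v unit_vec d s"
      have z: "z \<in> carrier_vec d" unfolding z_def using mult_mat_vec_carrier[OF Nc unit_vec_carrier] .
      obtain y where y: "y \<in> carrier_vec p" "B t *\<^sub>v (y @\<^sub>v z) = rhs x s" using sol[OF t(2) s] z_def by blast
      note Wxz = mult_mat_vec_carrier[OF Wxc z] and Wvz = mult_mat_vec_carrier[OF Wvc z]
      note cy = mult_mat_vec_carrier[OF cc[of t] y(1)] and gy = mult_mat_vec_carrier[OF gc y(1)]
      note Xx = mult_mat_vec_carrier[OF Xc(2)[of x] xs[OF s]] and ix = mult_mat_vec_carrier[OF Ic xs[OF s]]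
      have eqs: "char_matrix (f d) t *\<^sub>v y + Wx *\<^sub>v z = snd (X d) x *\<^sub>v xs s \<and> g d *\<^sub>v y + Wv *\<^sub>v z = snd \<mu> x *\<^sub>v vs s"
        using y(2) unfolding Bv[OF y(1) z] rhs_def
        by (subst (asm) append_vec_eq[of _ p]) (use cy Wxz Xx in auto)
      have 1: "proj d t (snd (X d) x *\<^sub>v xs s) (snd \<mu> x *\<^sub>v vs s) = G *\<^sub>v z"
      proof -
        have "finv d t *\<^sub>v (char_matrix (f d) t *\<^sub>v y + Wx *\<^sub>v z) = y + finv d t *\<^sub>v (Wx *\<^sub>v z)"
          unfolding mult_add_distrib_mat_vec[OF Ic cy Wxz] finv_vec(2)[OF t(1) dd, folded p_def, OF y(1)] ..
        moreover have "g d *\<^sub>v (y + finv d t *\<^sub>v (Wx *\<^sub>v z)) = g d *\<^sub>v y + g d *\<^sub>v (finv d t *\<^sub>v (Wx *\<^sub>v z))"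
          by (rule mult_add_distrib_mat_vec[OF gc y(1) mult_mat_vec_carrier[OF Ic Wxz]])
        ultimately show ?thesis
          unfolding Gv[OF z] proj_def eqs[THEN conjunct1, symmetric] eqs[THEN conjunct2, symmetric]
          using gy[THEN carrier_vecD] Wvz[THEN carrier_vecD]
            mult_mat_vec_carrier[OF gc mult_mat_vec_carrier[OF Ic Wxz], THEN carrier_vecD]
          by (intro eq_vecI) (auto simp del: dim_mult_mat_vec)
      qed
      have 2: "proj d t (snd (X d) x *\<^sub>v xs s) (snd \<mu> x *\<^sub>v vs s) = snd \<mu> x *\<^sub>v proj d t (xs s) (vs s)"
      proof -
        have "finv d t *\<^sub>v (snd (X d) x *\<^sub>v xs s) = snd (X d) x *\<^sub>v (finv d t *\<^sub>v xs s)"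
          by (rule finv_commute[OF t(1) dd dd, folded p_def, OF Xc(2) xs[OF s]])
            (use fg_hom(2)[OF dd, folded p_def] x in blast)
        moreover have "g d *\<^sub>v (snd (X d) x *\<^sub>v (finv d t *\<^sub>v xs s)) = snd \<mu> x *\<^sub>v (g d *\<^sub>v (finv d t *\<^sub>v xs s))"
          using fg_hom(2)[OF dd, folded p_def, OF ix x] by (simp add: snd_sub_rep)
        ultimately show ?thesis unfolding proj_def
          by (simp add: mult_minus_distrib_mat_vec[OF \<mu>c vs[OF s] mult_mat_vec_carrier[OF gc ix]])
      qed
      show "G * N x t *\<^sub>v unit_vec d s = snd \<mu> x * G *\<^sub>v unit_vec d s"
        unfolding assoc_mult_mat_vec[OF Gc Nc unit_vec_carrier] assoc_mult_mat_vec[OF \<mu>c Gc unit_vec_carrier]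
          z_def[symmetric] Gu[OF s] using 1 2 by simp
    qed
    have ut': "upper_triangular G'" and gr': "graded d c G'"
      using upper_triangular_inverse[OF Gc \<open>upper_triangular G\<close> G'(1,2)] graded_inverse[OF Gc G'(1,2) c gr] by auto
    have ne: "(T_c n Arr src tgt rho d c :: ((nat \<Rightarrow> 'k mat) \<times> ('a \<Rightarrow> 'k mat)) set) \<noteq> {}" using \<mu> by blast
    have "G' \<in> normalizer d (T_c n Arr src tgt rho d c :: ((nat \<Rightarrow> 'k mat) \<times> ('a \<Rightarrow> 'k mat)) set)"
      unfolding normalizer_T_c[OF c ne] using U_groupI[OF G'(1) ut' Gc G'(3)] gr' by blast
    moreover have "fst (conj_rep d G' \<mu>) = A_c n d c"
      unfolding conj_rep_eq[OF G'(1) Gc G'(3)] fst_conv T_cD(2)[OF \<mu>]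
      using conj_graded_A_c[OF G'(1) Gc G'(3) c] gr' by auto
    moreover have "snd (conj_rep d G' \<mu>) x = N x t" if x: "x \<in> Arr" for x
    proof -
      have "snd (conj_rep d G' \<mu>) x = G' * snd \<mu> x * G" unfolding conj_rep_eq[OF G'(1) Gc G'(3)] by simp
      also have "\<dots> = G' * (G * N x t)" unfolding GN[OF x] by (rule assoc_mult_mat[OF G'(1) \<mu>c Gc])
      also have "\<dots> = G' * G * N x t" by (rule assoc_mult_mat[OF G'(1) Gc Nc, symmetric])
      also have "\<dots> = N x t" unfolding G'(3) by (rule left_mult_one_mat[OF Nc])
      finally show ?thesis .
    qed
    ultimately show ?thesis by (intro bexI[of _ "conj_rep d G' \<mu>"]) auto
  qed
  \<comment> \<open>With the identity as embedding, the results on polynomial functions apply over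
    \<open>'k\<close> itself; coordinate 0 plays the role of the parameter \<open>t\<close>.\<close>
  interpret I: field_embedding "\<lambda>x::'k. x" by unfold_locales auto
  note [simp del] = I.emb_0 I.emb_1 I.emb_eq_0_iff I.emb_eq_iff
  have sU: "I.subfield_emb UNIV" by (auto simp: I.subfield_emb_def)
  have to_poly: "\<exists>P. \<forall>t. poly P t = F t" if Fp: "(\<lambda>z. F (z 0)) \<in> I.pfun (Suc 0)" for F
  proof -
    have "\<exists>P\<in>I.polys_over UNIV. \<forall>x. poly P x = F (((\<lambda>_. 0)(0 := x)) (0 :: nat))"
      by (rule I.pfun_last_poly[where f = "\<lambda>z. F (z 0)" and N = 0 and e = "\<lambda>_. 0" and E = UNIV, OF sU Fp])
        (rule UNIV_I)
    then show ?thesis unfolding fun_upd_same by (rule bexE) (rule exI)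
  qed
  have Bp: "(\<lambda>z. B (z 0) $$ (i, j)) \<in> I.pfun (Suc 0)" if ij: "i < p + d" "j < p + d" for i j
  proof (cases "i < p \<and> j < p \<and> i = j")
    case True
    have "B t $$ (i, j) = f d $$ (i, j) - t" for t
      using True ij carrier_matD[OF fc] carrier_matD[OF cc[of t]] carrier_matD[OF Wvc]
      by (auto simp: B_def char_matrix_def)
    moreover have "(\<lambda>z. f d $$ (i, j) - z 0) \<in> I.pfun (Suc 0)"
      by (intro I.pfun_diff I.pfun_const I.pfun_coord) simp
    ultimately show ?thesis by simp
  next
    case False
    have "B t $$ (i, j) = B 0 $$ (i, j)" for t
      using False ij carrier_matD[OF fc] carrier_matD[OF cc[of t]] carrier_matD[OF cc[of 0]] carrier_matD[OF Wvc]
      by (auto simp: B_def char_matrix_def)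
    then have "(\<lambda>z :: nat \<Rightarrow> 'k. B (z 0) $$ (i, j)) = (\<lambda>_. B 0 $$ (i, j))" by (intro ext)
    then show ?thesis using I.pfun_const[of "B 0 $$ (i, j)"] by (simp only:)
  qed
  have "(\<lambda>z. D (z 0)) \<in> I.pfun (Suc 0)"
    unfolding D_def by (rule I.pfun_det[of _ "p + d", OF Bc]) (rule Bp)
  then obtain PD where PD: "\<And>t. poly PD t = D t" using to_poly[of D] by blast
  have adjp: "(\<lambda>z. adj_mat (B (z 0)) $$ (i, j)) \<in> I.pfun (Suc 0)" if "i < p + d" "j < p + d" for i j
    by (rule I.pfun_adj_mat[of _ "p + d", OF Bc Bp that])
  have NNf: "(\<lambda>z. NN x (z 0) r s) \<in> I.pfun (Suc 0)" if "r < d" for x r s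
    unfolding NN_def using that by (intro I.pfun_sum I.pfun_mult I.pfun_const adjp) auto
  have NNp: "\<exists>P. \<forall>t. poly P t = NN x t r s" if "r < d" for x r s
    using to_poly[of "\<lambda>t. NN x t r s", OF NNf[OF that]] .
  \<comment> \<open>Along the family every polynomial function becomes a polynomial in
    \<open>t\<close> after multiplication with a power of \<open>D t\<close>, and
    \<open>D 0 \<noteq> 0\<close>.\<close>
  have rational: "\<exists>P e. \<forall>t. D t \<noteq> 0 \<longrightarrow> poly P t = D t ^ e * F (A_c n d c, \<lambda>x. N x t)"
    if "F \<in> poly_fun n Arr d" for F
    using that
  proof (induction rule: poly_fun.induct)
    case (pf_const k)
    show ?case by (rule exI[of _ "[:k:]"], rule exI[of _ 0]) simp
  next
    case (pf_E i r s)
    show ?case by (rule exI[of _ "[:A_c n d c i $$ (r, s):]"], rule exI[of _ 0]) simp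
  next
    case (pf_X x r s)
    obtain P where P: "\<And>t. poly P t = NN x t r s" using NNp[OF pf_X(2)] by blast
    show ?case by (rule exI[of _ P], rule exI[of _ 1]) (use pf_X P in \<open>simp add: N_def\<close>)
  next
    case (pf_add F1 F2)
    then obtain P1 e1 P2 e2 where
      "\<forall>t. D t \<noteq> 0 \<longrightarrow> poly P1 t = D t ^ e1 * F1 (A_c n d c, \<lambda>x. N x t)"
      "\<forall>t. D t \<noteq> 0 \<longrightarrow> poly P2 t = D t ^ e2 * F2 (A_c n d c, \<lambda>x. N x t)" by blast
    then show ?case
      by (intro exI[of _ "P1 * PD ^ e2 + P2 * PD ^ e1"] exI[of _ "e1 + e2"])
        (auto simp: PD power_add algebra_simps)
  next
    case (pf_mult F1 F2)
    then obtain P1 e1 P2 e2 where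
      "\<forall>t. D t \<noteq> 0 \<longrightarrow> poly P1 t = D t ^ e1 * F1 (A_c n d c, \<lambda>x. N x t)"
      "\<forall>t. D t \<noteq> 0 \<longrightarrow> poly P2 t = D t ^ e2 * F2 (A_c n d c, \<lambda>x. N x t)" by blast
    then show ?case
      by (intro exI[of _ "P1 * P2"] exI[of _ "e1 + e2"]) (auto simp: power_add algebra_simps)
  qed
  have bad: "finite {t. \<not> (good t \<and> D t \<noteq> 0)}"
  proof -
    have "PD \<noteq> 0" using PD[of 0] D0 by auto
    moreover have "char_poly (f l) \<noteq> 0" if "l \<in> {1..d}" for l
      using degree_monic_char_poly[OF fg_carrier(1)[OF that]] by auto
    ultimately have "finite ({t. poly PD t = 0} \<union> (\<Union>l\<in>{1..d}. {t. poly (char_poly (f l)) t = 0}))"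
      by (intro finite_UnI finite_UN_I poly_roots_finite) auto
    moreover have "{t. \<not> (good t \<and> D t \<noteq> 0)} \<subseteq> {t. poly PD t = 0} \<union> (\<Union>l\<in>{1..d}. {t. poly (char_poly (f l)) t = 0})"
    proof
      fix t assume "t \<in> {t. \<not> (good t \<and> D t \<noteq> 0)}"
      then consider "D t = 0" | l where "l \<in> {1..d}" "det (char_matrix (f l) t) = 0" by (auto simp: good_def)
      then show "t \<in> {t. poly PD t = 0} \<union> (\<Union>l\<in>{1..d}. {t. poly (char_poly (f l)) t = 0})"
      proof cases
        case 1
        then show ?thesis by (simp add: PD)
      next
        case 2
        then have "poly (char_poly (f l)) t = 0"
          using eigenvalue_det[OF fg_carrier(1)[OF 2(1)], of t] eigenvalue_root_char_poly[OF fg_carrier(1)[OF 2(1)], of t] by simp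
        then show ?thesis using 2(1) by blast
      qed
    qed
    ultimately show ?thesis by (rule rev_finite_subset)
  qed
  show ?thesis
    unfolding zariski_closure_def
  proof (rule CollectI, intro ballI impI)
    fix F :: "(nat \<Rightarrow> 'k mat) \<times> ('a \<Rightarrow> 'k mat) \<Rightarrow> 'k"
    assume F: "F \<in> poly_fun n Arr d"
      and van: "\<forall>Q\<in>(\<lambda>g. conj_rep d g \<mu>) ` normalizer d (T_c n Arr src tgt rho d c). F Q = 0"
    obtain P e where P: "\<And>t. D t \<noteq> 0 \<Longrightarrow> poly P t = D t ^ e * F (A_c n d c, \<lambda>x. N x t)"
      using rational[OF F] by blast
    have "poly P t = 0" if t: "good t" "D t \<noteq> 0" for t
    proof -
      obtain Q where Q: "Q \<in> (\<lambda>g. conj_rep d g \<mu>) ` normalizer d (T_c n Arr src tgt rho d c)"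
        "fst Q = A_c n d c" "\<forall>x\<in>Arr. snd Q x = N x t" using orbit[OF t] by blast
      have "F (A_c n d c, \<lambda>x. N x t) = F Q" using Q by (intro poly_fun_cong[OF F]) auto
      then show ?thesis using P[OF t(2)] van Q(1) by auto
    qed
    then have "UNIV - {t. \<not> (good t \<and> D t \<noteq> 0)} \<subseteq> {t. poly P t = 0}" by blast
    moreover have "infinite (UNIV - {t. \<not> (good t \<and> D t \<noteq> 0)})" using inf bad by (rule Diff_infinite_finite[rotated])
    ultimately have "P = 0" using poly_roots_finite[of P] finite_subset by blast
    then have "F (A_c n d c, \<lambda>x. N x 0) = 0" using P[OF D0] D0 by simp
    moreover have "F (A_c n d c, \<lambda>x. N x 0) = F \<nu>"
      using N0 T_cD(2)[OF \<nu>] by (intro poly_fun_cong[OF F]) auto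
    ultimately show "F \<nu> = 0" by simp
  qed
qed

end

subsection \<open>Lattices over a discrete valuation ring\<close>

text \<open>Vectors over the large field are functions on the naturals, so that the lattices of all
  levels of the flag live in one type; \<open>ap\<close> is the action of a matrix on them.\<close>

definition ap :: "nat \<Rightarrow> 'a::comm_ring_1 mat \<Rightarrow> (nat \<Rightarrow> 'a) \<Rightarrow> nat \<Rightarrow> 'a" where
  "ap d A u = (\<lambda>i. if i < d then \<Sum>j<d. A $$ (i, j) * u j else 0)"

lemma ap_mult:
  assumes "A \<in> carrier_mat d d" "B \<in> carrier_mat d d"
  shows "ap d (A * B) u = ap d A (ap d B u)"
proof
  fix i
  show "ap d (A * B) u i = ap d A (ap d B u) i"
  proof (cases "i < d")
    case True
    have "ap d (A * B) u i = (\<Sum>j<d. \<Sum>l<d. A $$ (i, l) * B $$ (l, j) * u j)"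
      using True by (simp add: ap_def index_mult_mat_sum[OF assms True] sum_distrib_right del: index_mult_mat)
    also have "\<dots> = (\<Sum>l<d. \<Sum>j<d. A $$ (i, l) * B $$ (l, j) * u j)" by (rule sum.swap)
    also have "\<dots> = ap d A (ap d B u) i"
      using True by (simp add: ap_def sum_distrib_left mult.assoc)
    finally show ?thesis .
  qed (simp add: ap_def)
qed

lemma ap_add: "ap d A (\<lambda>i. u i + v i) = (\<lambda>i. ap d A u i + ap d A v i)"
  and ap_diff: "ap d A (\<lambda>i. u i - v i) = (\<lambda>i. ap d A u i - ap d A v i)"
  and ap_scale: "ap d A (\<lambda>i. k * u i) = (\<lambda>i. k * ap d A u i)"
  and ap_zero: "ap d A (\<lambda>_. 0) = (\<lambda>_. 0)"
  by (auto simp: ap_def sum.distrib sum_subtractf algebra_simps sum_distrib_left)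

lemma ap_zero_mat: "ap d (0\<^sub>m d d) u = (\<lambda>_. 0)"
  by (auto simp: ap_def)

lemma ap_smult_one:
  assumes "\<And>i. i \<ge> d \<Longrightarrow> u i = 0"
  shows "ap d (k \<cdot>\<^sub>m 1\<^sub>m d) u = (\<lambda>i. k * u i)"
proof
  fix i
  have "(\<Sum>j<d. (k \<cdot>\<^sub>m 1\<^sub>m d) $$ (i, j) * u j) = (\<Sum>j<d. if j = i then k * u i else 0)" if "i < d"
    using that by (intro sum.cong) auto
  then show "ap d (k \<cdot>\<^sub>m 1\<^sub>m d) u i = k * u i" using assms[of i] by (auto simp: ap_def)
qed

lemma ap_support:
  assumes A: "A \<in> carrier_mat d d" "upper_triangular A" and u: "\<And>j. j \<ge> l \<Longrightarrow> u j = 0" and i: "i \<ge> l"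
  shows "ap d A u i = 0"
proof -
  have "A $$ (i, j) * u j = 0" if "i < d" for j
    using upper_triangularD[OF A(2), of j i] A(1) that u[of j] i by (cases "j < i") auto
  then show ?thesis by (auto simp: ap_def)
qed

lemma topleft_mult_vec:
  assumes A: "A \<in> carrier_mat d d" and l: "l \<le> d" and f: "\<And>j. j \<ge> l \<Longrightarrow> f j = 0"
  shows "topleft l A *\<^sub>v vec l f = vec l (ap d A f)"
proof (rule eq_vecI)
  fix i assume "i < dim_vec (vec l (ap d A f))"
  then have i: "i < l" by simp
  have "(topleft l A *\<^sub>v vec l f) $ i = (\<Sum>j<l. A $$ (i, j) * f j)"
    unfolding index_mult_mat_vec_sum[OF topleft_carrier vec_carrier i]
    using i by (intro sum.cong) (auto simp: topleft_def)
  also have "\<dots> = (\<Sum>j<d. A $$ (i, j) * f j)"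
    using l f by (intro sum.mono_neutral_left) auto
  finally show "(topleft l A *\<^sub>v vec l f) $ i = vec l (ap d A f) $ i" using i l by (simp add: ap_def)
qed (simp add: topleft_def)

section \<open>Linear algebra over the constants and extension of scalars\<close>

context field_embedding
begin

definition emb_subspace :: "(nat \<Rightarrow> 'w) set \<Rightarrow> bool" where
  "emb_subspace L \<longleftrightarrow> (\<lambda>_. 0) \<in> L \<and> (\<forall>u\<in>L. \<forall>v\<in>L. (\<lambda>i. u i + v i) \<in> L) \<and> (\<forall>c. \<forall>u\<in>L. (\<lambda>i. emb c * u i) \<in> L)"

lemma emb_subspaceD:
  assumes "emb_subspace L"
  shows "(\<lambda>_. 0) \<in> L" "u \<in> L \<Longrightarrow> v \<in> L \<Longrightarrow> (\<lambda>i. u i + v i) \<in> L" "u \<in> L \<Longrightarrow> (\<lambda>i. emb c * u i) \<in> L"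
    "u \<in> L \<Longrightarrow> v \<in> L \<Longrightarrow> (\<lambda>i. u i - v i) \<in> L"
proof -
  show *: "(\<lambda>_. 0) \<in> L" "u \<in> L \<Longrightarrow> v \<in> L \<Longrightarrow> (\<lambda>i. u i + v i) \<in> L" "u \<in> L \<Longrightarrow> (\<lambda>i. emb c * u i) \<in> L" for u v c
    using assms unfolding emb_subspace_def by auto
  show "u \<in> L \<Longrightarrow> v \<in> L \<Longrightarrow> (\<lambda>i. u i - v i) \<in> L"
    using *(2)[of u "\<lambda>i. - v i"] *(3)[of v "- 1"] by (simp add: emb_uminus)
qed

lemma emb_subspace_sum:
  assumes "emb_subspace L" "\<And>x. x \<in> A \<Longrightarrow> v x \<in> L"
  shows "(\<lambda>i. \<Sum>x\<in>A. emb (k x) * v x i) \<in> L"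
  using assms(2)
  by (induction A rule: infinite_finite_induct)
    (simp_all add: emb_subspaceD(1)[OF assms(1)] emb_subspaceD(2,3)[OF assms(1)])

definition emb_linear :: "(nat \<Rightarrow> 'w) set \<Rightarrow> ((nat \<Rightarrow> 'w) \<Rightarrow> nat \<Rightarrow> 'k) \<Rightarrow> bool" where
  "emb_linear L F \<longleftrightarrow> (\<forall>u\<in>L. \<forall>v\<in>L. \<forall>i. F (\<lambda>i. u i + v i) i = F u i + F v i) \<and>
     (\<forall>c. \<forall>u\<in>L. \<forall>i. F (\<lambda>i. emb c * u i) i = c * F u i)"

lemma emb_linearD:
  assumes "emb_linear L F"
  shows "u \<in> L \<Longrightarrow> v \<in> L \<Longrightarrow> F (\<lambda>i. u i + v i) i = F u i + F v i"
    "u \<in> L \<Longrightarrow> F (\<lambda>i. emb c * u i) i = c * F u i"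
  using assms unfolding emb_linear_def by simp_all

lemma emb_linear_zero: "emb_subspace L \<Longrightarrow> emb_linear L F \<Longrightarrow> F (\<lambda>_. 0) i = 0"
  using emb_linearD(2)[of L F "\<lambda>_. 0" 0 i] emb_subspaceD(1)[of L] by simp

lemma emb_linear_sum:
  assumes "emb_subspace L" "emb_linear L F" "\<And>x. x \<in> A \<Longrightarrow> v x \<in> L"
  shows "F (\<lambda>i. \<Sum>x\<in>A. emb (k x) * v x i) j = (\<Sum>x\<in>A. k x * F (v x) j)"
  using assms(3)
proof (induction A rule: infinite_finite_induct)
  case (insert x A)
  have "(\<lambda>i. \<Sum>x\<in>A. emb (k x) * v x i) \<in> L" using insert by (intro emb_subspace_sum[OF assms(1)]) auto
  moreover have "(\<lambda>i. emb (k x) * v x i) \<in> L" using insert by (intro emb_subspaceD(3)[OF assms(1)]) auto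
  ultimately have "F (\<lambda>i. emb (k x) * v x i + (\<Sum>x\<in>A. emb (k x) * v x i)) j =
     F (\<lambda>i. emb (k x) * v x i) j + F (\<lambda>i. \<Sum>x\<in>A. emb (k x) * v x i) j"
    by (rule emb_linearD(1)[OF assms(2), rotated])
  moreover have "F (\<lambda>i. emb (k x) * v x i) j = k x * F (v x) j"
    using insert.prems by (intro emb_linearD(2)[OF assms(2)]) simp
  ultimately show ?case using insert by simp
qed (simp_all add: emb_linear_zero[OF assms(1,2)])

text \<open>Among the given vectors a spanning set modulo \<open>P\<close> of least cardinality is a
  basis of \<open>L / P\<close>; \<open>q\<close> reads off coordinates and \<open>\<beta>\<close>
  lists representatives. The quotient is thus handled through functions on \<open>L\<close>, without
  a type for it.\<close>

lemma quotient_coordinates: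
  assumes L: "emb_subspace L" and P: "emb_subspace P" "P \<subseteq> L" and bs: "\<And>j. j < (n::nat) \<Longrightarrow> bs j \<in> L"
    and span: "\<And>u. u \<in> L \<Longrightarrow> \<exists>c. (\<lambda>r. u r - (\<Sum>j<n. emb (c j) * bs j r)) \<in> P"
  shows "\<exists>m q \<beta>. emb_linear L q \<and> (\<forall>u\<in>L. (\<forall>i<m. q u i = 0) \<longleftrightarrow> u \<in> P) \<and>
    (\<forall>j<m. \<beta> j \<in> L) \<and> (\<forall>i<m. \<forall>j<m. q (\<beta> j) i = (if i = j then 1 else 0))"
proof -
  define rm where "rm J u c = (\<lambda>r. u r - (\<Sum>j\<in>J. emb (c j) * bs j r))" for J u c
  define S where "S J \<longleftrightarrow> J \<subseteq> {..<n} \<and> (\<forall>u\<in>L. \<exists>c. rm J u c \<in> P)" for J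
  have "S {..<n}" using span by (auto simp: S_def rm_def)
  then obtain J where J: "S J" "\<And>J'. S J' \<Longrightarrow> card J \<le> card J'"
    using ex_has_least_nat[of S _ card] by blast
  have Jn: "J \<subseteq> {..<n}" using J(1) by (simp add: S_def)
  have fJ: "finite J" by (rule finite_subset[OF Jn]) simp
  have bJ: "bs j \<in> L" if "j \<in> J" for j using that Jn bs by auto
  have indep: "c j0 = 0" if c: "(\<lambda>r. \<Sum>j\<in>J. emb (c j) * bs j r) \<in> P" and j0: "j0 \<in> J" for c j0
  proof (rule ccontr)
    assume nz: "c j0 \<noteq> 0"
    have "S (J - {j0})" unfolding S_def
    proof (intro conjI ballI)
      show "J - {j0} \<subseteq> {..<n}" using Jn by blast
      fix u assume "u \<in> L"
      then obtain e where e: "rm J u e \<in> P" using J(1) by (auto simp: S_def)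
      define e' where "e' j = e j - e j0 / c j0 * c j" for j
      have "(\<lambda>r. rm J u e r + emb (e j0 / c j0) * (\<Sum>j\<in>J. emb (c j) * bs j r)) \<in> P"
        by (rule emb_subspaceD(2)[OF P(1) e emb_subspaceD(3)[OF P(1) c]])
      also have "(\<lambda>r. rm J u e r + emb (e j0 / c j0) * (\<Sum>j\<in>J. emb (c j) * bs j r)) = rm J u e'"
      proof
        fix r
        have ee: "emb (e' j) = emb (e j) - emb (e j0 / c j0) * emb (c j)" for j
          by (simp only: e'_def emb_diff emb_mult)
        show "rm J u e r + emb (e j0 / c j0) * (\<Sum>j\<in>J. emb (c j) * bs j r) = rm J u e' r"
          unfolding rm_def ee left_diff_distrib sum_subtractf sum_distrib_left mult.assoc by simp
      qed
      also have "rm J u e' = rm (J - {j0}) u e'"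
        using j0 fJ nz by (auto simp: rm_def e'_def sum.remove)
      finally show "\<exists>c. rm (J - {j0}) u c \<in> P" by blast
    qed
    then have "card J \<le> card (J - {j0})" by (rule J(2))
    moreover have "card (J - {j0}) < card J" using fJ j0 by (rule card_Diff1_less)
    ultimately show False by simp
  qed
  have uniq: "c j = c' j" if "rm J u c \<in> P" "rm J u c' \<in> P" "j \<in> J" for u c c' j
  proof -
    have "(\<lambda>r. rm J u c' r - rm J u c r) \<in> P" by (rule emb_subspaceD(4)[OF P(1) that(2,1)])
    also have "(\<lambda>r. rm J u c' r - rm J u c r) = (\<lambda>r. \<Sum>j\<in>J. emb (c j - c' j) * bs j r)"
      by (auto simp: rm_def emb_diff left_diff_distrib sum_subtractf)
    finally have "c j - c' j = 0" by (rule indep) (rule that(3))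
    then show ?thesis by simp
  qed
  define cf where "cf u = (SOME c. rm J u c \<in> P)" for u
  have cf: "rm J u (cf u) \<in> P" if "u \<in> L" for u
  proof -
    have "\<exists>c. rm J u c \<in> P" using J(1) that unfolding S_def by blast
    then show ?thesis unfolding cf_def by (rule someI_ex)
  qed
  define m where "m = card J"
  obtain h where h: "bij_betw h {..<m} J"
    using ex_bij_betw_nat_finite[OF fJ] by (auto simp: m_def lessThan_atLeast0)
  have hJ: "h i \<in> J" if "i < m" for i using h that by (auto simp: bij_betw_def)
  define q where "q u i = (if i < m then cf u (h i) else 0)" for u i
  have "emb_linear L q" unfolding emb_linear_def
  proof (intro conjI ballI allI)
    fix u v i assume uv: "u \<in> L" "v \<in> L"
    have "(\<lambda>r. rm J u (cf u) r + rm J v (cf v) r) \<in> P" by (rule emb_subspaceD(2)[OF P(1) cf[OF uv(1)] cf[OF uv(2)]])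
    also have "(\<lambda>r. rm J u (cf u) r + rm J v (cf v) r) = rm J (\<lambda>i. u i + v i) (\<lambda>j. cf u j + cf v j)"
      by (auto simp: rm_def emb_add distrib_right sum.distrib)
    finally have "cf (\<lambda>i. u i + v i) j = cf u j + cf v j" if "j \<in> J" for j
      using uniq[OF cf[OF emb_subspaceD(2)[OF L uv]] _ that] by blast
    then show "q (\<lambda>i. u i + v i) i = q u i + q v i" using hJ by (simp add: q_def)
  next
    fix c u i assume u: "u \<in> L"
    have "(\<lambda>r. emb c * rm J u (cf u) r) \<in> P" by (rule emb_subspaceD(3)[OF P(1) cf[OF u]])
    also have "(\<lambda>r. emb c * rm J u (cf u) r) = rm J (\<lambda>i. emb c * u i) (\<lambda>j. c * cf u j)"
      by (auto simp: rm_def emb_mult right_diff_distrib sum_distrib_left mult.assoc)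
    finally have "cf (\<lambda>i. emb c * u i) j = c * cf u j" if "j \<in> J" for j
      using uniq[OF cf[OF emb_subspaceD(3)[OF L u]] _ that] by blast
    then show "q (\<lambda>i. emb c * u i) i = c * q u i" using hJ by (simp add: q_def)
  qed
  moreover have "(\<forall>i<m. q u i = 0) \<longleftrightarrow> u \<in> P" if u: "u \<in> L" for u
  proof
    assume z: "\<forall>i<m. q u i = 0"
    have "cf u j = 0" if "j \<in> J" for j
    proof -
      obtain i where "i < m" "h i = j" using h \<open>j \<in> J\<close> by (auto simp: bij_betw_def)
      then show ?thesis using z by (auto simp: q_def)
    qed
    then have "rm J u (cf u) = u" by (auto simp: rm_def)
    then show "u \<in> P" using cf[OF u] by simp
  next
    assume "u \<in> P"
    then have "rm J u (\<lambda>_. 0) \<in> P" by (simp add: rm_def)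
    then show "\<forall>i<m. q u i = 0" using uniq[OF cf[OF u], of "\<lambda>_. 0"] hJ by (simp add: q_def)
  qed
  moreover have "q (bs (h j)) i = (if i = j then 1 else 0)" if ij: "i < m" "j < m" for i j
  proof -
    have "(\<Sum>j'\<in>J. emb (if j' = h j then 1 else 0) * bs j' r) = bs (h j) r" for r
    proof -
      have "(\<Sum>j'\<in>J. emb (if j' = h j then 1 else 0) * bs j' r) = (\<Sum>j'\<in>J. if j' = h j then bs (h j) r else 0)"
        by (intro sum.cong) auto
      then show ?thesis using fJ hJ[OF ij(2)] by simp
    qed
    then have "rm J (bs (h j)) (\<lambda>j'. if j' = h j then 1 else 0) \<in> P" using emb_subspaceD(1)[OF P(1)] by (simp add: rm_def)
    from uniq[OF cf[OF bJ[OF hJ[OF ij(2)]]] this hJ[OF ij(1)]]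
    have "cf (bs (h j)) (h i) = (if h i = h j then 1 else 0)" .
    moreover have "h i = h j \<longleftrightarrow> i = j" using h ij by (auto simp: bij_betw_def inj_on_def)
    ultimately show ?thesis using ij by (simp add: q_def)
  qed
  moreover have "bs (h j) \<in> L" if "j < m" for j using bJ hJ that by blast
  ultimately show ?thesis by (intro exI[of _ m] exI[of _ q] exI[of _ "\<lambda>j. bs (h j)"]) auto
qed

lemma map_mat_emb_mult:
  assumes "A \<in> carrier_mat n m" "B \<in> carrier_mat m k"
  shows "map_mat emb (A * B) = map_mat emb A * map_mat emb B"
proof (rule eq_matI)
  fix i j assume "i < dim_row (map_mat emb A * map_mat emb B)" "j < dim_col (map_mat emb A * map_mat emb B)"
  then have ij: "i < n" "j < k" using assms by auto
  have c: "map_mat emb A \<in> carrier_mat n m" "map_mat emb B \<in> carrier_mat m k" using assms by auto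
  have "map_mat emb (A * B) $$ (i, j) = emb ((A * B) $$ (i, j))" using ij assms by simp
  also have "\<dots> = (\<Sum>l<m. emb (A $$ (i, l)) * emb (B $$ (l, j)))"
    unfolding index_mult_mat_sum[OF assms ij] emb_sum emb_mult ..
  also have "\<dots> = (map_mat emb A * map_mat emb B) $$ (i, j)"
    unfolding index_mult_mat_sum[OF c ij] using ij assms by (intro sum.cong) auto
  finally show "map_mat emb (A * B) $$ (i, j) = (map_mat emb A * map_mat emb B) $$ (i, j)" .
qed (use assms in auto)

lemma path_mat_map_emb:
  assumes "\<And>a. X a \<in> carrier_mat m m"
  shows "path_mat m (\<lambda>a. map_mat emb (X a)) p = map_mat emb (path_mat m X p)"
proof (induction p rule: rev_induct)
  case Nil
  show ?case by (intro eq_matI) auto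
next
  case (snoc a p)
  show ?case unfolding path_mat_snoc snoc map_mat_emb_mult[OF assms path_mat_carrier[of X, OF assms]] ..
qed

lemma is_rep_map_emb:
  assumes "is_rep n Arr src tgt rho m R"
  shows "is_rep n Arr src tgt ((\<lambda>r p. emb (r p)) ` rho) m (\<lambda>i. map_mat emb (fst R i), \<lambda>a. map_mat emb (snd R a))"
proof -
  obtain E X where EX: "R = (E, X)" by (cases R)
  note R' = assms[unfolded EX is_rep_iff]
  have E: "\<And>i. E i \<in> carrier_mat m m" and X: "\<And>a. X a \<in> carrier_mat m m" using R' by auto
  have z: "map_mat emb (0\<^sub>m m m) = 0\<^sub>m m m" by (intro eq_matI) auto
  show ?thesis unfolding EX fst_conv snd_conv is_rep_iff
  proof (intro conjI allI impI ballI)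
    fix i j assume "i < n" "j < n"
    then show "map_mat emb (E i) * map_mat emb (E j) = (if i = j then map_mat emb (E i) else 0\<^sub>m m m)"
      using R' z unfolding map_mat_emb_mult[OF E E, symmetric] by auto
  next
    fix r s assume rs: "r < m" "s < m"
    have "(\<Sum>i<n. map_mat emb (E i) $$ (r, s)) = emb (\<Sum>i<n. E i $$ (r, s))"
      unfolding emb_sum using rs carrier_matD[OF E] by (intro sum.cong) auto
    then show "(\<Sum>i<n. map_mat emb (E i) $$ (r, s)) = (if r = s then 1 else 0)" using R' rs by auto
  next
    fix a assume a: "a \<in> Arr"
    have "map_mat emb (E (tgt a)) * map_mat emb (X a) * map_mat emb (E (src a)) = map_mat emb (E (tgt a) * X a * E (src a))"
      unfolding map_mat_emb_mult[OF E X, symmetric] map_mat_emb_mult[OF mult_carrier_mat[OF E X] E, symmetric] ..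
    also have "E (tgt a) * X a * E (src a) = X a" using R' a by (metis (no_types))
    finally show "map_mat emb (X a) = map_mat emb (E (tgt a)) * map_mat emb (X a) * map_mat emb (E (src a))" by simp
  next
    fix rel r s assume "rel \<in> (\<lambda>r p. emb (r p)) ` rho" and rs: "r < m" "s < m"
    then obtain r0 where r0: "r0 \<in> rho" "rel = (\<lambda>p. emb (r0 p))" by blast
    have pe: "path_mat m (\<lambda>a. map_mat emb (X a)) p $$ (r, s) = emb (path_mat m X p $$ (r, s))" for p
      unfolding path_mat_map_emb[of X, OF X] using rs carrier_matD[OF path_mat_carrier[of X m p, OF X]] by simp
    have "(\<Sum>p\<in>{p. rel p \<noteq> 0}. rel p * path_mat m (\<lambda>a. map_mat emb (X a)) p $$ (r, s)) =
      emb (\<Sum>p\<in>{p. r0 p \<noteq> 0}. r0 p * path_mat m X p $$ (r, s))"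
      unfolding pe r0(2) emb_sum emb_mult by simp
    also have "(\<Sum>p\<in>{p. r0 p \<noteq> 0}. r0 p * path_mat m X p $$ (r, s)) = 0" using R' r0(1) rs by blast
    finally show "(\<Sum>p\<in>{p. rel p \<noteq> 0}. rel p * path_mat m (\<lambda>a. map_mat emb (X a)) p $$ (r, s)) = 0" by simp
  qed (use R' z in auto)
qed

end

text \<open>What is used of a discrete valuation ring: every element is a constant plus a multiple
  of \<open>\<pi>\<close>, with the constant uniquely determined. Iterating this gives expansions in
  powers of \<open>\<pi>\<close> with digits in \<open>'k\<close>.\<close>

locale uniformized = field_embedding emb
  for emb :: "'k::field \<Rightarrow> 'w::field" +
  fixes R :: "'w set" and \<pi> :: 'w
  assumes R_add: "a \<in> R \<Longrightarrow> b \<in> R \<Longrightarrow> a + b \<in> R"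
    and R_mult: "a \<in> R \<Longrightarrow> b \<in> R \<Longrightarrow> a * b \<in> R"
    and R_emb: "emb c \<in> R"
    and \<pi>_R: "\<pi> \<in> R" and \<pi>_0: "\<pi> \<noteq> 0"
    and digit_exists: "a \<in> R \<Longrightarrow> \<exists>c. \<exists>b\<in>R. a = emb c + \<pi> * b"
    and digit_unique: "b \<in> R \<Longrightarrow> emb c = \<pi> * b \<Longrightarrow> c = 0"
begin

lemma R_0: "0 \<in> R" and R_1: "1 \<in> R"
  using R_emb[of 0] R_emb[of 1] by auto

lemma R_uminus: "a \<in> R \<Longrightarrow> - a \<in> R"
  using R_mult[OF R_emb[of "- 1"], of a] by (simp add: emb_uminus)

lemma R_diff: "a \<in> R \<Longrightarrow> b \<in> R \<Longrightarrow> a - b \<in> R"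
  using R_add[of a "- b"] R_uminus by simp

lemma R_sum: "(\<And>x. x \<in> A \<Longrightarrow> f x \<in> R) \<Longrightarrow> sum f A \<in> R"
  by (induction A rule: infinite_finite_induct) (auto simp: R_0 R_add)

lemma R_power: "a \<in> R \<Longrightarrow> a ^ k \<in> R"
  by (induction k) (auto simp: R_1 R_mult)

definition rs :: "'w \<Rightarrow> 'k" where "rs a = (THE c. \<exists>b\<in>R. a = emb c + \<pi> * b)"

lemma rs_eqI: "b \<in> R \<Longrightarrow> a = emb c + \<pi> * b \<Longrightarrow> rs a = c"
  unfolding rs_def
proof (rule the_equality)
  fix e assume b: "b \<in> R" "a = emb c + \<pi> * b" and "\<exists>b\<in>R. a = emb e + \<pi> * b"
  then obtain b' where b': "b' \<in> R" "a = emb e + \<pi> * b'" by blast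
  then have "emb (e - c) = \<pi> * (b - b')" using b by (simp add: emb_diff algebra_simps)
  from digit_unique[OF R_diff[OF b(1) b'(1)] this] show "e = c" by simp
qed blast

definition quo :: "'w \<Rightarrow> 'w" where "quo a = (a - emb (rs a)) / \<pi>"

lemma rs_quo: "a \<in> R \<Longrightarrow> a = emb (rs a) + \<pi> * quo a" "a \<in> R \<Longrightarrow> quo a \<in> R"
proof -
  assume "a \<in> R"
  then obtain c b where b: "b \<in> R" "a = emb c + \<pi> * b" using digit_exists by blast
  then have c: "rs a = c" by (rule rs_eqI)
  \<comment> \<open>The digit is the one just found, so the quotient formed by division in the large
    field lies in \<open>R\<close>.\<close>
  show "a = emb (rs a) + \<pi> * quo a" using \<pi>_0 by (simp add: quo_def)
  have "quo a = b" unfolding quo_def c using b(2) \<pi>_0 by simp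
  then show "quo a \<in> R" using b(1) by simp
qed

lemma rs_emb [simp]: "rs (emb c) = c" and rs_pi [simp]: "a \<in> R \<Longrightarrow> rs (\<pi> * a) = 0"
  by (auto intro: rs_eqI[OF R_0] rs_eqI)

lemma rs_0 [simp]: "rs 0 = 0" using rs_emb[of 0] by simp

lemma rs_add: "a \<in> R \<Longrightarrow> b \<in> R \<Longrightarrow> rs (a + b) = rs a + rs b"
proof -
  assume ab: "a \<in> R" "b \<in> R"
  have "a + b = emb (rs a + rs b) + \<pi> * (quo a + quo b)"
    using rs_quo(1)[OF ab(1)] rs_quo(1)[OF ab(2)] by (simp add: emb_add algebra_simps)
  then show ?thesis by (rule rs_eqI[OF R_add[OF rs_quo(2)[OF ab(1)] rs_quo(2)[OF ab(2)]]])
qed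

lemma rs_mult: "a \<in> R \<Longrightarrow> b \<in> R \<Longrightarrow> rs (a * b) = rs a * rs b"
proof -
  assume ab: "a \<in> R" "b \<in> R"
  have "a * b = (emb (rs a) + \<pi> * quo a) * (emb (rs b) + \<pi> * quo b)"
    using rs_quo(1)[OF ab(1)] rs_quo(1)[OF ab(2)] by simp
  also have "\<dots> = emb (rs a * rs b) + \<pi> * (emb (rs a) * quo b + quo a * emb (rs b) + \<pi> * (quo a * quo b))"
    by (simp add: emb_mult algebra_simps)
  finally show ?thesis
    by (rule rs_eqI[rotated]) (intro R_add R_mult R_emb \<pi>_R rs_quo(2) ab)
qed

lemma rs_sum: "(\<And>x. x \<in> A \<Longrightarrow> f x \<in> R) \<Longrightarrow> rs (sum f A) = (\<Sum>x\<in>A. rs (f x))"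
  by (induction A rule: infinite_finite_induct) (auto simp: rs_add R_sum)

text \<open>The coefficient of \<open>\<pi> ^ e\<close> in the expansion. No carries occur, because
  the digits come from a field contained in the ring; hence it is linear over
  \<open>'k\<close>.\<close>

fun dig :: "nat \<Rightarrow> 'w \<Rightarrow> 'k" where
  "dig 0 a = rs a"
| "dig (Suc e) a = dig e (quo a)"

lemma quo_add: "a \<in> R \<Longrightarrow> b \<in> R \<Longrightarrow> quo (a + b) = quo a + quo b"
  by (simp add: quo_def rs_add emb_add add_divide_distrib[symmetric] algebra_simps)

lemma quo_emb_mult: "a \<in> R \<Longrightarrow> quo (emb c * a) = emb c * quo a"
  by (simp add: quo_def rs_mult R_emb emb_mult algebra_simps diff_divide_distrib)

lemma dig_add: "a \<in> R \<Longrightarrow> b \<in> R \<Longrightarrow> dig e (a + b) = dig e a + dig e b"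
  by (induction e arbitrary: a b) (auto simp: rs_add quo_add rs_quo)

lemma dig_emb_mult: "a \<in> R \<Longrightarrow> dig e (emb c * a) = c * dig e a"
  by (induction e arbitrary: a) (auto simp: rs_mult R_emb quo_emb_mult rs_quo)

lemma dig_0 [simp]: "dig e 0 = 0"
  using dig_emb_mult[OF R_0, of e 0] by simp

lemma dig_sum: "(\<And>x. x \<in> A \<Longrightarrow> f x \<in> R) \<Longrightarrow> dig e (sum f A) = (\<Sum>x\<in>A. dig e (f x))"
  by (induction A rule: infinite_finite_induct) (auto simp: dig_add R_sum)

lemma dig_pi_power: "a \<in> R \<Longrightarrow> dig e (\<pi> ^ e * a) = rs a"
proof (induction e)
  case (Suc e)
  have "quo (\<pi> * (\<pi> ^ e * a)) = \<pi> ^ e * a"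
    using Suc.prems \<pi>_0 by (simp add: quo_def R_mult R_power \<pi>_R)
  then show ?case using Suc by (simp add: mult.assoc)
qed simp

definition lat :: "nat \<Rightarrow> (nat \<Rightarrow> 'w) set" where
  "lat l = {u. (\<forall>i. u i \<in> R) \<and> (\<forall>i\<ge>l. u i = 0)}"

lemma emb_subspace_lat: "emb_subspace (lat l)"
  unfolding emb_subspace_def lat_def by (auto simp: R_0 R_add R_mult R_emb)

lemma lat_scale: "r \<in> R \<Longrightarrow> u \<in> lat l \<Longrightarrow> (\<lambda>i. r * u i) \<in> lat l"
  by (auto simp: lat_def R_mult)

lemma lat_mono: "l \<le> l' \<Longrightarrow> lat l \<subseteq> lat l'"
  by (auto simp: lat_def)

lemma lat_emb: "(\<And>i. i \<ge> l \<Longrightarrow> f i = 0) \<Longrightarrow> (\<lambda>i. emb (f i)) \<in> lat l"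
  by (auto simp: lat_def R_emb)

text \<open>The multiples of the unit vectors by powers \<open>\<pi> ^ j\<close> with
  \<open>j < E\<close> span the quotient; each induction step splits off one more digit of the
  remainder.\<close>

lemma lat_finite_mod_power:
  "\<exists>n bs. (\<forall>j<n. bs j \<in> lat l) \<and> (\<forall>u\<in>lat l. \<exists>c. \<exists>w\<in>lat l.
     (\<lambda>r. u r - (\<Sum>j<(n::nat). emb (c j) * bs j r)) = (\<lambda>r. \<pi> ^ E * w r))"
proof (induction E)
  case 0
  show ?case by (rule exI[of _ 0]) auto
next
  case (Suc E)
  then obtain n bs where bs: "\<And>j. j < n \<Longrightarrow> bs j \<in> lat l"
    "\<And>u. u \<in> lat l \<Longrightarrow> \<exists>c. \<exists>w\<in>lat l. (\<lambda>r. u r - (\<Sum>j<(n::nat). emb (c j) * bs j r)) = (\<lambda>r. \<pi> ^ E * w r)" by blast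
  define bs' where "bs' j = (if j < n then bs j else (\<lambda>r. if r = j - n then \<pi> ^ E else 0))" for j
  have sumsplit: "(\<Sum>j<n + k. f j) = (\<Sum>j<n. f j) + (\<Sum>j<k. f (n + j))" for k and f :: "nat \<Rightarrow> 'w"
    by (induction k) (auto simp: add.assoc)
  have "bs' j \<in> lat l" if "j < n + l" for j
    using that bs(1)[of j] by (auto simp: bs'_def lat_def R_0 R_power \<pi>_R)
  moreover have "\<exists>c. \<exists>w\<in>lat l. (\<lambda>r. u r - (\<Sum>j<n + l. emb (c j) * bs' j r)) = (\<lambda>r. \<pi> ^ Suc E * w r)"
    if u: "u \<in> lat l" for u
  proof -
    obtain c w where cw: "w \<in> lat l" "(\<lambda>r. u r - (\<Sum>j<n. emb (c j) * bs j r)) = (\<lambda>r. \<pi> ^ E * w r)"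
      using bs(2)[OF u] by blast
    define c' where "c' j = (if j < n then c j else rs (w (j - n)))" for j
    define w' where "w' r = quo (w r)" for r
    have wR: "w r \<in> R" for r using cw(1) by (simp add: lat_def)
    have "quo 0 = 0" by (simp add: quo_def)
    then have "w' \<in> lat l" using cw(1) rs_quo(2) by (auto simp: lat_def w'_def)
    moreover have "u r - (\<Sum>j<n + l. emb (c' j) * bs' j r) = \<pi> ^ Suc E * w' r" for r
    proof -
      have "(\<Sum>j<n. emb (c' j) * bs' j r) = (\<Sum>j<n. emb (c j) * bs j r)"
        by (intro sum.cong) (auto simp: c'_def bs'_def)
      moreover have "(\<Sum>j<l. emb (c' (n + j)) * bs' (n + j) r) = (\<Sum>j<l. if j = r then emb (rs (w r)) * \<pi> ^ E else 0)"
        by (intro sum.cong) (auto simp: c'_def bs'_def)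
      moreover have "(\<Sum>j<l. if j = r then emb (rs (w r)) * \<pi> ^ E else 0) = emb (rs (w r)) * \<pi> ^ E"
        using cw(1) by (auto simp: lat_def)
      moreover have "u r - (\<Sum>j<n. emb (c j) * bs j r) = \<pi> ^ E * w r" using cw(2) by meson
      moreover have "\<pi> ^ E * w r = \<pi> ^ E * emb (rs (w r)) + \<pi> ^ Suc E * w' r"
        using rs_quo(1)[OF wR[of r]] unfolding w'_def by (metis distrib_left mult.assoc power_Suc2)
      ultimately show ?thesis unfolding sumsplit by (simp add: algebra_simps)
    qed
    ultimately show ?thesis by (intro exI[of _ c'] bexI[of _ w']) auto
  qed
  ultimately show ?case by (intro exI[of _ "n + l"] exI[of _ bs']) blast
qed

lemma ap_R: "(\<And>i j. i < d \<Longrightarrow> j < d \<Longrightarrow> A $$ (i, j) \<in> R) \<Longrightarrow> (\<And>i. u i \<in> R) \<Longrightarrow> ap d A u i \<in> R"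
  by (auto simp: ap_def R_0 intro!: R_sum R_mult)

lemma ap_lat:
  assumes "A \<in> carrier_mat d d" "upper_triangular A" "\<And>i j. i < d \<Longrightarrow> j < d \<Longrightarrow> A $$ (i, j) \<in> R" "u \<in> lat l"
  shows "ap d A u \<in> lat l"
  unfolding lat_def
proof (intro CollectI conjI allI impI)
  show "ap d A u i \<in> R" for i using assms(3,4) by (intro ap_R) (auto simp: lat_def)
  show "ap d A u i = 0" if "l \<le> i" for i
    by (rule ap_support[OF assms(1,2) _ that]) (use assms(4) in \<open>auto simp: lat_def\<close>)
qed

end

text \<open>\<open>N\<close> is a representation over a discrete valuation ring that is conjugate to \<open>\<mu>\<close> over the
  quotient field and reduces to \<open>\<nu>\<close>. The conjugating matrix is scaled to an integral \<open>G\<close>, and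
  \<open>\<Gamma>\<close> is its inverse up to a power of the uniformizer.\<close>

locale dvr_degeneration = uniformized emb R \<pi>
  for emb :: "'k::field \<Rightarrow> 'w::field" and R \<pi> +
  fixes n d :: nat and Arr :: "'a set" and src tgt :: "'a \<Rightarrow> nat"
    and rho :: "('a list \<Rightarrow> 'k) set" and c :: "nat \<Rightarrow> nat"
    and \<mu> \<nu> :: "(nat \<Rightarrow> 'k mat) \<times> ('a \<Rightarrow> 'k mat)"
    and G \<Gamma> :: "'w mat" and e :: nat and N :: "'a \<Rightarrow> 'w mat"
  assumes c: "\<forall>j<d. c j < n"
    and \<mu>: "\<mu> \<in> T_c n Arr src tgt rho d c" and \<nu>: "\<nu> \<in> T_c n Arr src tgt rho d c"
    and G: "G \<in> carrier_mat d d" "upper_triangular G" "graded d c G"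
      "\<And>i j. i < d \<Longrightarrow> j < d \<Longrightarrow> G $$ (i, j) \<in> R"
    and \<Gamma>: "\<Gamma> \<in> carrier_mat d d" "upper_triangular \<Gamma>"
      "\<And>i j. i < d \<Longrightarrow> j < d \<Longrightarrow> \<Gamma> $$ (i, j) \<in> R"
    and G\<Gamma>: "G * \<Gamma> = \<pi> ^ e \<cdot>\<^sub>m 1\<^sub>m d"
    and N: "\<And>a. N a \<in> carrier_mat d d" "\<And>a. upper_triangular (N a)"
      "\<And>a i j. i < d \<Longrightarrow> j < d \<Longrightarrow> N a $$ (i, j) \<in> R"
    and NG: "\<And>a. N a * G = G * map_mat emb (snd \<mu> a)"
    and res_N: "\<And>a i j. i < d \<Longrightarrow> j < d \<Longrightarrow> rs (N a $$ (i, j)) = snd \<nu> a $$ (i, j)"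
begin

text \<open>Vertices and arrows are merged into one index type, so that every compatibility with the
  action is proved once.\<close>

definition Op :: "nat + 'a \<Rightarrow> 'w mat" where
  "Op x = (case x of Inl i \<Rightarrow> A_c n d c i | Inr a \<Rightarrow> N a)"

definition opr :: "(nat \<Rightarrow> 'k mat) \<times> ('a \<Rightarrow> 'k mat) \<Rightarrow> nat + 'a \<Rightarrow> 'k mat" where
  "opr Y x = (case x of Inl i \<Rightarrow> fst Y i | Inr a \<Rightarrow> snd Y a)"

definition Mu :: "nat + 'a \<Rightarrow> 'k mat" where "Mu = opr \<mu>"
definition Nu :: "nat + 'a \<Rightarrow> 'k mat" where "Nu = opr \<nu>"

lemma A_c_upper: "upper_triangular (A_c n d c i :: 'x::field mat)"
  by (auto simp: A_c_def A_mat_def)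

lemma Mu: "Mu x \<in> carrier_mat d d" "upper_triangular (Mu x)"
  and Nu: "Nu x \<in> carrier_mat d d" "upper_triangular (Nu x)"
  using T_cD(2-4)[OF \<mu>] T_cD(2-4)[OF \<nu>] A_c_upper A_c_carrier
  by (auto simp: Mu_def Nu_def opr_def split: sum.splits)

lemma Op: "Op x \<in> carrier_mat d d" "upper_triangular (Op x)" "i < d \<Longrightarrow> j < d \<Longrightarrow> Op x $$ (i, j) \<in> R"
proof -
  have "(A_c n d c i' :: 'w mat) $$ (i, j) \<in> R" if "i < d" "j < d" for i i' j
    using that R_0 R_1 by (auto simp: A_c_def A_mat_def)
  then show "Op x \<in> carrier_mat d d" "upper_triangular (Op x)" "i < d \<Longrightarrow> j < d \<Longrightarrow> Op x $$ (i, j) \<in> R"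
    using N A_c_upper A_c_carrier by (auto simp: Op_def split: sum.splits)
qed

lemma map_A_c: "map_mat emb (A_c n d c i) = A_c n d c i"
  by (intro eq_matI) (auto simp: A_c_def A_mat_def)

lemma Op_G: "Op x * G = G * map_mat emb (Mu x)"
  using NG G(3) graded_commute[OF G(1) c] T_cD(2)[OF \<mu>] map_A_c
  by (auto simp: Op_def Mu_def opr_def split: sum.splits)

lemma res_Op: "i < d \<Longrightarrow> j < d \<Longrightarrow> rs (Op x $$ (i, j)) = Nu x $$ (i, j)"
  using res_N T_cD(2)[OF \<nu>] rs_emb[of 1]
  by (auto simp: Op_def Nu_def opr_def A_c_def A_mat_def split: sum.splits)

lemma pie: "\<pi> ^ e \<noteq> 0" using \<pi>_0 by simp

lemma G_inverse: "G * (inverse (\<pi> ^ e) \<cdot>\<^sub>m \<Gamma>) = 1\<^sub>m d"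
  unfolding mult_smult_distrib[OF G(1) \<Gamma>(1)] G\<Gamma> using pie by (intro eq_matI) auto

lemma \<Gamma>G: "\<Gamma> * G = \<pi> ^ e \<cdot>\<^sub>m 1\<^sub>m d"
proof -
  have "(inverse (\<pi> ^ e) \<cdot>\<^sub>m \<Gamma>) * G = 1\<^sub>m d"
    by (rule mat_inv_eq(2)[OF G(1) _ G_inverse]) (use \<Gamma> in simp)
  then have "inverse (\<pi> ^ e) \<cdot>\<^sub>m (\<Gamma> * G) = 1\<^sub>m d" by (simp add: mult_smult_assoc_mat[OF \<Gamma>(1) G(1)])
  then have "\<pi> ^ e \<cdot>\<^sub>m (inverse (\<pi> ^ e) \<cdot>\<^sub>m (\<Gamma> * G)) = \<pi> ^ e \<cdot>\<^sub>m 1\<^sub>m d" by simp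
  moreover have "\<pi> ^ e \<cdot>\<^sub>m (inverse (\<pi> ^ e) \<cdot>\<^sub>m (\<Gamma> * G)) = \<Gamma> * G"
    using pie by (intro eq_matI) auto
  ultimately show ?thesis by simp
qed

abbreviation app :: "'w mat \<Rightarrow> (nat \<Rightarrow> 'w) \<Rightarrow> nat \<Rightarrow> 'w" where "app \<equiv> ap d"

lemma lat_supp: "u \<in> lat l \<Longrightarrow> i \<ge> l \<Longrightarrow> u i = 0" and lat_R: "u \<in> lat l \<Longrightarrow> u i \<in> R"
  by (auto simp: lat_def)

lemma app_G\<Gamma>:
  assumes "u \<in> lat d"
  shows "app G (app \<Gamma> u) = (\<lambda>i. \<pi> ^ e * u i)" "app \<Gamma> (app G u) = (\<lambda>i. \<pi> ^ e * u i)"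
proof -
  have s: "\<And>i. i \<ge> d \<Longrightarrow> u i = 0" using assms by (auto simp: lat_def)
  show "app G (app \<Gamma> u) = (\<lambda>i. \<pi> ^ e * u i)"
    unfolding ap_mult[OF G(1) \<Gamma>(1), symmetric] G\<Gamma> by (rule ap_smult_one[OF s])
  show "app \<Gamma> (app G u) = (\<lambda>i. \<pi> ^ e * u i)"
    unfolding ap_mult[OF \<Gamma>(1) G(1), symmetric] \<Gamma>G by (rule ap_smult_one[OF s])
qed

lemma app_Op_G: "app (Op x) (app G u) = app G (app (map_mat emb (Mu x)) u)"
  unfolding ap_mult[OF Op(1) G(1), symmetric] Op_G by (rule ap_mult[OF G(1)]) (use Mu in simp)

lemma emb_Mu:
  "map_mat emb (Mu x) \<in> carrier_mat d d" "upper_triangular (map_mat emb (Mu x))"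
  "i < d \<Longrightarrow> j < d \<Longrightarrow> map_mat emb (Mu x) $$ (i, j) \<in> R"
proof -
  note c = carrier_matD[OF Mu(1)[of x]]
  show "map_mat emb (Mu x) \<in> carrier_mat d d" using c by auto
  show "upper_triangular (map_mat emb (Mu x))"
  proof
    fix i j assume "j < i" "i < dim_row (map_mat emb (Mu x))"
    then show "map_mat emb (Mu x) $$ (i, j) = 0" using upper_triangularD[OF Mu(2)[of x], of j i] c by simp
  qed
  show "i < d \<Longrightarrow> j < d \<Longrightarrow> map_mat emb (Mu x) $$ (i, j) \<in> R" using c R_emb by simp
qed

text \<open>The relation \<open>Op G = G Mu\<close> is multiplied by \<open>\<Gamma>\<close> on both
  sides, after which the factor \<open>\<pi> ^ e\<close> cancels.\<close>

lemma app_\<Gamma>_Op: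
  assumes u: "u \<in> lat d"
  shows "app \<Gamma> (app (Op x) u) = app (map_mat emb (Mu x)) (app \<Gamma> u)"
proof
  fix i
  let ?M = "app (map_mat emb (Mu x))"
  have \<Gamma>u: "app \<Gamma> u \<in> lat d" by (rule ap_lat[OF \<Gamma> u])
  have M\<Gamma>u: "?M (app \<Gamma> u) \<in> lat d" by (rule ap_lat[OF emb_Mu \<Gamma>u])
  have "app \<Gamma> (app (Op x) (app G (app \<Gamma> u))) i = \<pi> ^ e * app \<Gamma> (app (Op x) u) i"
    unfolding app_G\<Gamma>[OF u] ap_scale ..
  moreover have "app \<Gamma> (app (Op x) (app G (app \<Gamma> u))) i = \<pi> ^ e * ?M (app \<Gamma> u) i"
    unfolding app_Op_G app_G\<Gamma>(2)[OF M\<Gamma>u] ..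
  ultimately have "\<pi> ^ e * app \<Gamma> (app (Op x) u) i = \<pi> ^ e * ?M (app \<Gamma> u) i" by (rule trans[OF sym])
  then show "app \<Gamma> (app (Op x) u) i = ?M (app \<Gamma> u) i" unfolding mult_left_cancel[OF pie] .
qed

definition Gbar :: "'k mat" where "Gbar = mat d d (\<lambda>(i, j). rs (G $$ (i, j)))"

lemma Gbar: "Gbar \<in> carrier_mat d d" "upper_triangular Gbar"
  using G(1,2) by (auto simp: Gbar_def upper_triangularD)

definition RES :: "(nat \<Rightarrow> 'w) \<Rightarrow> nat \<Rightarrow> 'k" where "RES u = (\<lambda>i. rs (u i))"
text \<open>Since \<open>\<Gamma> G = \<pi>^e\<close>, on \<open>u = G w\<close> this is the residue of \<open>w\<close>.\<close>

definition KAP :: "(nat \<Rightarrow> 'w) \<Rightarrow> nat \<Rightarrow> 'k" where "KAP u = (\<lambda>i. dig e (app \<Gamma> u i))"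

definition ksupp :: "nat \<Rightarrow> (nat \<Rightarrow> 'k) set" where "ksupp l = {f. \<forall>i\<ge>l. f i = 0}"

lemma RES_supp: "u \<in> lat l \<Longrightarrow> RES u \<in> ksupp l"
  by (auto simp: RES_def ksupp_def lat_def)

lemma \<Gamma>_lat: "u \<in> lat l \<Longrightarrow> app \<Gamma> u \<in> lat l" by (rule ap_lat[OF \<Gamma>])
lemma G_lat: "u \<in> lat l \<Longrightarrow> app G u \<in> lat l" by (rule ap_lat[OF G(1,2,4)])
lemma Op_lat: "u \<in> lat l \<Longrightarrow> app (Op x) u \<in> lat l" by (rule ap_lat[OF Op])
lemma Mu_lat: "u \<in> lat l \<Longrightarrow> app (map_mat emb (Mu x)) u \<in> lat l" by (rule ap_lat[OF emb_Mu])

lemma KAP_supp: "u \<in> lat l \<Longrightarrow> KAP u \<in> ksupp l"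
  unfolding KAP_def ksupp_def by (auto simp: lat_supp[OF \<Gamma>_lat])

lemma apk_supp: "A \<in> carrier_mat d d \<Longrightarrow> upper_triangular A \<Longrightarrow> f \<in> ksupp l \<Longrightarrow> ap d A f \<in> ksupp l"
  unfolding ksupp_def by (auto intro: ap_support)

lemma RES_add: "u \<in> lat l \<Longrightarrow> v \<in> lat l \<Longrightarrow> RES (\<lambda>i. u i + v i) = (\<lambda>i. RES u i + RES v i)"
  by (auto simp: RES_def rs_add lat_R)

lemma RES_emb: "RES (\<lambda>i. emb (f i)) = f" by (simp add: RES_def)

lemma RES_ap:
  assumes "\<And>i j. i < d \<Longrightarrow> j < d \<Longrightarrow> A $$ (i, j) \<in> R" "u \<in> lat l"
    "\<And>i j. i < d \<Longrightarrow> j < d \<Longrightarrow> rs (A $$ (i, j)) = B $$ (i, j)"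
  shows "RES (app A u) = ap d B (RES u)"
proof
  fix i
  have "rs (\<Sum>j<d. A $$ (i, j) * u j) = (\<Sum>j<d. B $$ (i, j) * rs (u j))" if i: "i < d"
  proof -
    have "rs (\<Sum>j<d. A $$ (i, j) * u j) = (\<Sum>j<d. rs (A $$ (i, j) * u j))"
      using i by (intro rs_sum) (simp add: R_mult assms(1) lat_R[OF assms(2)])
    also have "\<dots> = (\<Sum>j<d. B $$ (i, j) * rs (u j))"
      using i by (intro sum.cong refl) (simp add: rs_mult assms(1,3) lat_R[OF assms(2)])
    finally show ?thesis .
  qed
  then show "RES (app A u) i = ap d B (RES u) i" by (simp add: RES_def ap_def)
qed

lemma RES_Op: "u \<in> lat l \<Longrightarrow> RES (app (Op x) u) = ap d (Nu x) (RES u)"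
  by (rule RES_ap[OF Op(3) _ res_Op])

lemma RES_G: "u \<in> lat l \<Longrightarrow> RES (app G u) = ap d Gbar (RES u)"
  by (rule RES_ap[OF G(4)]) (auto simp: Gbar_def)

lemma KAP_add: "u \<in> lat l \<Longrightarrow> v \<in> lat l \<Longrightarrow> KAP (\<lambda>i. u i + v i) = (\<lambda>i. KAP u i + KAP v i)"
  unfolding KAP_def ap_add using lat_R[OF \<Gamma>_lat] by (auto simp: dig_add)

lemma KAP_emb: "u \<in> lat l \<Longrightarrow> KAP (\<lambda>i. emb k * u i) = (\<lambda>i. k * KAP u i)"
  unfolding KAP_def ap_scale using lat_R[OF \<Gamma>_lat] by (auto simp: dig_emb_mult)

lemma KAP_G: "l \<le> d \<Longrightarrow> u \<in> lat l \<Longrightarrow> KAP (app G u) = RES u"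
proof -
  assume "l \<le> d" "u \<in> lat l"
  then have "u \<in> lat d" using lat_mono by blast
  then show ?thesis unfolding KAP_def app_G\<Gamma>(2)[OF \<open>u \<in> lat d\<close>]
    by (auto simp: RES_def dig_pi_power lat_R)
qed

text \<open>The entries of \<open>\<mu>\<close> are constants and therefore commute with taking a
  digit. This linearity is what splits off the summand belonging to \<open>\<mu>\<close>.\<close>

lemma KAP_Op:
  assumes "l \<le> d" "u \<in> lat l"
  shows "KAP (app (Op x) u) = ap d (Mu x) (KAP u)"
proof
  fix i
  have u: "u \<in> lat d" using assms lat_mono by blast
  note y = lat_R[OF \<Gamma>_lat[OF u]]
  have "KAP (app (Op x) u) i = dig e (app (map_mat emb (Mu x)) (app \<Gamma> u) i)"
    unfolding KAP_def app_\<Gamma>_Op[OF u] ..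
  also have "\<dots> = ap d (Mu x) (KAP u) i"
  proof (cases "i < d")
    case True
    have "app (map_mat emb (Mu x)) (app \<Gamma> u) i = (\<Sum>j<d. emb (Mu x $$ (i, j)) * app \<Gamma> u j)"
      using True carrier_matD[OF Mu(1)] by (simp add: ap_def)
    also have "dig e \<dots> = (\<Sum>j<d. Mu x $$ (i, j) * dig e (app \<Gamma> u j))"
      using y by (simp add: dig_sum R_mult R_emb dig_emb_mult)
    finally show ?thesis using True by (simp add: ap_def KAP_def)
  qed (simp add: ap_def)
  finally show "KAP (app (Op x) u) i = ap d (Mu x) (KAP u) i" .
qed

text \<open>The reduction of \<open>Op G = G Mu\<close> modulo \<open>\<pi>\<close>, read on
  constant vectors.\<close>

lemma Gbar_Mu: "f \<in> ksupp d \<Longrightarrow> ap d Gbar (ap d (Mu x) f) = ap d (Nu x) (ap d Gbar f)"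
proof -
  assume f: "f \<in> ksupp d"
  define u where "u = (\<lambda>i. emb (f i))"
  have u: "u \<in> lat d" using f by (auto simp: u_def ksupp_def intro: lat_emb)
  have rM: "RES (app (map_mat emb (Mu x)) u) = ap d (Mu x) f"
    using RES_ap[OF emb_Mu(3) u, of x "Mu x"] carrier_matD[OF Mu(1)] by (simp add: u_def RES_emb)
  have "RES (app (Op x) (app G u)) = ap d (Nu x) (ap d Gbar f)"
    unfolding RES_Op[OF G_lat[OF u]] RES_G[OF u] by (simp add: u_def RES_emb)
  moreover have "RES (app (Op x) (app G u)) = ap d Gbar (ap d (Mu x) f)"
    unfolding app_Op_G RES_G[OF Mu_lat[OF u]] rM ..
  ultimately show ?thesis by simp
qed

definition Pl :: "nat \<Rightarrow> (nat \<Rightarrow> 'w) set" where "Pl l = app G ` lat l"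

lemma Pl_lat: "Pl l \<subseteq> lat l" using G_lat by (auto simp: Pl_def)

lemma emb_subspace_Pl: "emb_subspace (Pl l)"
  unfolding emb_subspace_def Pl_def
proof (intro conjI ballI allI)
  have "app G (\<lambda>_. 0) \<in> app G ` lat l" by (rule imageI[OF emb_subspaceD(1)[OF emb_subspace_lat]])
  then show "(\<lambda>_. 0) \<in> app G ` lat l" unfolding ap_zero .
  fix u v assume "u \<in> app G ` lat l" "v \<in> app G ` lat l"
  then obtain u' v' where *: "u' \<in> lat l" "v' \<in> lat l" "u = app G u'" "v = app G v'" by blast
  show "(\<lambda>i. u i + v i) \<in> app G ` lat l"
    unfolding *(3,4) ap_add[symmetric] by (rule imageI[OF emb_subspaceD(2)[OF emb_subspace_lat *(1,2)]])
next
  fix k u assume "u \<in> app G ` lat l"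
  then obtain u' where *: "u' \<in> lat l" "u = app G u'" by blast
  show "(\<lambda>i. emb k * u i) \<in> app G ` lat l"
    unfolding *(2) ap_scale[symmetric] by (rule imageI[OF emb_subspaceD(3)[OF emb_subspace_lat *(1)]])
qed

lemma Pl_Op:
  assumes "u \<in> Pl l" shows "app (Op x) u \<in> Pl l"
proof -
  obtain w where w: "w \<in> lat l" "u = app G w" using assms by (auto simp: Pl_def)
  show ?thesis unfolding w(2) app_Op_G Pl_def using Mu_lat[OF w(1)] by (rule imageI)
qed

lemma Pl_scale: "u \<in> Pl l \<Longrightarrow> r \<in> R \<Longrightarrow> (\<lambda>i. r * u i) \<in> Pl l"
proof -
  assume "u \<in> Pl l" and r: "r \<in> R"
  then obtain w where w: "w \<in> lat l" "u = app G w" by (auto simp: Pl_def)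
  have "(\<lambda>i. r * u i) = app G (\<lambda>i. r * w i)" unfolding w(2) ap_scale ..
  then show ?thesis using lat_scale[OF r w(1)] by (auto simp: Pl_def)
qed

lemma Pl_mono: "l \<le> l' \<Longrightarrow> Pl l \<subseteq> Pl l'" using lat_mono by (auto simp: Pl_def)

text \<open>From \<open>G \<Gamma> = \<pi> ^ e\<close> it follows that \<open>\<pi> ^ e\<close>
  annihilates the quotient, so finitely many digits span it.\<close>

lemma quotients_exist:
  assumes "l \<le> d"
  shows "\<exists>m q \<beta>. emb_linear (lat l) q \<and> (\<forall>u\<in>lat l. (\<forall>i<m. q u i = 0) \<longleftrightarrow> u \<in> Pl l) \<and>
    (\<forall>j<m. \<beta> j \<in> lat l) \<and> (\<forall>i<m. \<forall>j<m. q (\<beta> j) i = (if i = j then 1 else 0))"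
proof -
  obtain k bs where bs: "\<And>j. j < k \<Longrightarrow> bs j \<in> lat l" "\<And>u. u \<in> lat l \<Longrightarrow> \<exists>c. \<exists>w\<in>lat l.
     (\<lambda>r. u r - (\<Sum>j<(k::nat). emb (c j) * bs j r)) = (\<lambda>r. \<pi> ^ e * w r)"
    using lat_finite_mod_power[of l e] by blast
  have "\<exists>c. (\<lambda>r. u r - (\<Sum>j<k. emb (c j) * bs j r)) \<in> Pl l" if u: "u \<in> lat l" for u
  proof -
    obtain c w where w: "w \<in> lat l" "(\<lambda>r. u r - (\<Sum>j<k. emb (c j) * bs j r)) = (\<lambda>r. \<pi> ^ e * w r)"
      using bs(2)[OF u] by blast
    have "w \<in> lat d" using w(1) lat_mono[OF assms] by blast
    then have "(\<lambda>r. \<pi> ^ e * w r) = app G (app \<Gamma> w)" using app_G\<Gamma>(1) by simp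
    then show ?thesis using w \<Gamma>_lat[OF w(1)] by (auto simp: Pl_def)
  qed
  then show ?thesis by (intro quotient_coordinates[OF emb_subspace_lat emb_subspace_Pl Pl_lat, of k bs] bs(1))
qed

lemma is_rep_Op:
  "is_rep n Arr src tgt ((\<lambda>r p. emb (r p)) ` rho) d (A_c n d c, N)"
proof -
  define G' where "G' = inverse (\<pi> ^ e) \<cdot>\<^sub>m \<Gamma>"
  have G': "G' \<in> carrier_mat d d" "G * G' = 1\<^sub>m d" using \<Gamma> G_inverse by (auto simp: G'_def)
  have "N a = G * map_mat emb (snd \<mu> a) * G'" for a
  proof -
    have "G * map_mat emb (snd \<mu> a) * G' = N a * (G * G')"
      unfolding NG[symmetric] by (rule assoc_mult_mat[OF N(1) G(1) G'(1)])
    then show ?thesis using G'(2) right_mult_one_mat[OF N(1)] by simp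
  qed
  moreover have "A_c n d c i = G * map_mat emb (fst \<mu> i) * G'" for i
    using conj_graded_A_c[OF G(1) G' c] G(3) unfolding T_cD(2)[OF \<mu>] map_A_c by simp
  ultimately have "(A_c n d c, N) = (\<lambda>i. G * map_mat emb (fst \<mu> i) * G', \<lambda>a. G * map_mat emb (snd \<mu> a) * G')"
    by auto
  then show ?thesis using is_rep_conj[OF G(1) G' is_rep_map_emb[OF T_cD(1)[OF \<mu>]]] by simp
qed

end

context field_embedding
begin

lemma emb_linear_diff:
  assumes "emb_subspace L" "emb_linear L F" "u \<in> L" "v \<in> L"
  shows "F (\<lambda>i. u i - v i) i = F u i - F v i"
proof -
  have "F (\<lambda>i. (u i - v i) + v i) i = F (\<lambda>i. u i - v i) i + F v i"
    by (rule emb_linearD(1)[OF assms(2) emb_subspaceD(4)[OF assms(1,3,4)] assms(4)])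
  then show ?thesis by simp
qed

end

subsection \<open>Exact sequences from lattices\<close>

lemma zero_mat_mult_vec:
  fixes v :: "'a::comm_ring_1 vec"
  assumes "v \<in> carrier_vec k"
  shows "0\<^sub>m j k *\<^sub>v v = 0\<^sub>v j"
  by (intro eq_vecI) (auto simp: index_mult_mat_vec_sum[OF zero_carrier_mat assms] simp del: index_mult_mat_vec)

context dvr_degeneration
begin

lemma emb_linear_ap:
  assumes "emb_linear (lat l) F" "\<And>u. u \<in> lat l \<Longrightarrow> app A u \<in> lat l"
  shows "emb_linear (lat l) (\<lambda>u. F (app A u))"
  unfolding emb_linear_def ap_add ap_scale
  using emb_linearD[OF assms(1)] assms(2) by blast

lemma emb_linear_pi:
  assumes "emb_linear (lat l) F"
  shows "emb_linear (lat l) (\<lambda>u. F (\<lambda>i. \<pi> * u i))"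
  unfolding emb_linear_def
proof (intro conjI ballI allI)
  fix u v i assume uv: "u \<in> lat l" "v \<in> lat l"
  show "F (\<lambda>i. \<pi> * (u i + v i)) i = F (\<lambda>i. \<pi> * u i) i + F (\<lambda>i. \<pi> * v i) i"
    unfolding distrib_left by (rule emb_linearD(1)[OF assms lat_scale[OF \<pi>_R uv(1)] lat_scale[OF \<pi>_R uv(2)]])
next
  fix k u i assume u: "u \<in> lat l"
  show "F (\<lambda>i. \<pi> * (emb k * u i)) i = k * F (\<lambda>i. \<pi> * u i) i"
    unfolding mult.left_commute[of \<pi>] by (rule emb_linearD(2)[OF assms lat_scale[OF \<pi>_R u]])
qed

lemma emb_linear_mono: "emb_linear L F \<Longrightarrow> L' \<subseteq> L \<Longrightarrow> emb_linear L' F"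
  unfolding emb_linear_def by blast

lemma emb_linear_RES: "emb_linear (lat l) RES"
  unfolding emb_linear_def RES_def by (auto simp: rs_add rs_mult R_emb lat_R)

lemma emb_linear_KAP: "emb_linear (lat l) KAP"
  unfolding emb_linear_def
proof (intro conjI ballI allI)
  fix u v i assume "u \<in> lat l" "v \<in> lat l"
  from KAP_add[OF this] show "KAP (\<lambda>i. u i + v i) i = KAP u i + KAP v i" by (rule fun_cong)
next
  fix k u i assume "u \<in> lat l"
  from KAP_emb[OF this] show "KAP (\<lambda>i. emb k * u i) i = k * KAP u i" by (rule fun_cong)
qed

lemma ksuppD: "f \<in> ksupp l \<Longrightarrow> i \<ge> l \<Longrightarrow> f i = 0" by (simp add: ksupp_def)

lemma incl_mat_ksupp: "f \<in> ksupp l \<Longrightarrow> incl_mat l *\<^sub>v vec l f = vec (Suc l) f"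
  by (intro eq_vecI)
    (auto simp: incl_mat_index[OF vec_carrier] ksuppD carrier_matD[OF incl_mat_carrier] less_Suc_eq
      simp del: index_mult_mat_vec)

lemma topleft_ksupp:
  "A \<in> carrier_mat d d \<Longrightarrow> l \<le> d \<Longrightarrow> f \<in> ksupp l \<Longrightarrow> topleft l A *\<^sub>v vec l f = vec l (ap d A f)"
  by (rule topleft_mult_vec) (auto simp: ksuppD)

text \<open>Coordinates on the quotients \<open>lat l / Pl l\<close> are fixed for each level
  independently; \<open>m l\<close> is the dimension. The maps between levels are expressed in these
  bases afterwards.\<close>

context
  fixes m :: "nat \<Rightarrow> nat" and q :: "nat \<Rightarrow> (nat \<Rightarrow> 'w) \<Rightarrow> nat \<Rightarrow> 'k" and \<beta> :: "nat \<Rightarrow> nat \<Rightarrow> nat \<Rightarrow> 'w"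
  assumes q: "\<And>l. l \<le> d \<Longrightarrow> emb_linear (lat l) (q l)"
    and q_kernel: "\<And>l u. l \<le> d \<Longrightarrow> u \<in> lat l \<Longrightarrow> (\<forall>i<m l. q l u i = 0) \<longleftrightarrow> u \<in> Pl l"
    and \<beta>: "\<And>l j. l \<le> d \<Longrightarrow> j < m l \<Longrightarrow> \<beta> l j \<in> lat l"
    and q\<beta>: "\<And>l i j. l \<le> d \<Longrightarrow> i < m l \<Longrightarrow> j < m l \<Longrightarrow> q l (\<beta> l j) i = (if i = j then 1 else 0)"
begin

definition Q :: "nat \<Rightarrow> (nat \<Rightarrow> 'w) \<Rightarrow> 'k vec" where "Q l u = vec (m l) (q l u)"

lemma Q_carrier: "Q l u \<in> carrier_vec (m l)" by (simp add: Q_def)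

lemma Q_\<beta>: "l \<le> d \<Longrightarrow> j < m l \<Longrightarrow> Q l (\<beta> l j) = unit_vec (m l) j"
  by (intro eq_vecI) (auto simp: Q_def q\<beta>)

lemma Q_zero: "l \<le> d \<Longrightarrow> u \<in> lat l \<Longrightarrow> Q l u = 0\<^sub>v (m l) \<longleftrightarrow> u \<in> Pl l"
  unfolding q_kernel[symmetric] by (auto simp: Q_def vec_eq_iff)

lemma q_span:
  assumes "l \<le> d" "i < m l"
  shows "q l (\<lambda>r. \<Sum>j<m l. emb (k j) * \<beta> l j r) i = k i"
proof -
  have "q l (\<lambda>r. \<Sum>j<m l. emb (k j) * \<beta> l j r) i = (\<Sum>j<m l. k j * q l (\<beta> l j) i)"
    by (rule emb_linear_sum[OF emb_subspace_lat q[OF assms(1)]]) (use \<beta>[OF assms(1)] in simp)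
  also have "\<dots> = (\<Sum>j<m l. if j = i then k i else 0)"
    using assms by (intro sum.cong) (auto simp: q\<beta>)
  finally show ?thesis using assms by simp
qed

lemma span_lat: "l \<le> d \<Longrightarrow> (\<lambda>r. \<Sum>j<m l. emb (k j) * \<beta> l j r) \<in> lat l"
  by (rule emb_subspace_sum[OF emb_subspace_lat]) (simp add: \<beta>)

lemma Q_surj:
  assumes "l \<le> d" "w \<in> carrier_vec (m l)"
  shows "\<exists>u\<in>lat l. Q l u = w"
  by (rule bexI[OF _ span_lat[OF assms(1), of "\<lambda>j. w $ j"]])
    (use assms in \<open>auto simp: Q_def q_span\<close>)

lemma Q_append_surj:
  assumes "l \<le> d" "w \<in> carrier_vec (m l + l)"
  shows "\<exists>u\<in>lat l. \<exists>f\<in>ksupp l. Q l u @\<^sub>v vec l f = w"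
proof -
  obtain x v where xv: "x \<in> carrier_vec (m l)" "v \<in> carrier_vec l" "w = x @\<^sub>v v"
    using vec_split_append[OF assms(2)] by blast
  obtain u where u: "u \<in> lat l" "Q l u = x" using Q_surj[OF assms(1) xv(1)] by blast
  define f where "f i = (if i < l then v $ i else 0)" for i
  have "vec l f = v" using xv(2) by (intro eq_vecI) (auto simp: f_def)
  then show ?thesis using u xv(3) by (intro bexI[of _ u] bexI[of _ f]) (auto simp: f_def ksupp_def)
qed

text \<open>Every coordinate vector is the class of some lattice vector, so identities between maps
  on the quotients may be checked on representatives.\<close>

lemma mat_eq_on_Q:
  assumes "l \<le> d" "A \<in> carrier_mat k (m l)" "B \<in> carrier_mat k (m l)"
    and "\<And>u. u \<in> lat l \<Longrightarrow> A *\<^sub>v Q l u = B *\<^sub>v Q l u"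
  shows "A = B"
  by (rule mat_eq_on_vecs[OF assms(2,3)]) (use Q_surj[OF assms(1)] assms(4) in \<open>metis unit_vec_carrier\<close>)

lemma mat_eq_on_Q_append:
  assumes "l \<le> d" "A \<in> carrier_mat k (m l + l)" "B \<in> carrier_mat k (m l + l)"
    and "\<And>u f. u \<in> lat l \<Longrightarrow> f \<in> ksupp l \<Longrightarrow> A *\<^sub>v (Q l u @\<^sub>v vec l f) = B *\<^sub>v (Q l u @\<^sub>v vec l f)"
  shows "A = B"
  by (rule mat_eq_on_vecs[OF assms(2,3)]) (use Q_append_surj[OF assms(1)] assms(4) in \<open>metis unit_vec_carrier\<close>)

text \<open>For an \<open>F\<close> vanishing on \<open>Pl l\<close> this is the matrix, in the
  basis \<open>\<beta> l\<close>, of the induced map on the quotient.\<close>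

definition induced_mat :: "nat \<Rightarrow> nat \<Rightarrow> ((nat \<Rightarrow> 'w) \<Rightarrow> nat \<Rightarrow> 'k) \<Rightarrow> 'k mat" where
  "induced_mat k l F = mat k (m l) (\<lambda>(i, j). F (\<beta> l j) i)"

lemma induced_mat_carrier: "induced_mat k l F \<in> carrier_mat k (m l)" by (simp add: induced_mat_def)

lemma induced_mat:
  assumes l: "l \<le> d" and F: "emb_linear (lat l) F" "\<And>u i. u \<in> Pl l \<Longrightarrow> i < k \<Longrightarrow> F u i = 0" and u: "u \<in> lat l"
  shows "induced_mat k l F *\<^sub>v Q l u = vec k (F u)"
proof (rule eq_vecI)
  fix i assume "i < dim_vec (vec k (F u))"
  then have i: "i < k" by simp
  define s where "s = (\<lambda>r. \<Sum>j<m l. emb (q l u j) * \<beta> l j r)"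
  have s: "s \<in> lat l" unfolding s_def by (rule span_lat[OF l])
  have us: "(\<lambda>i. u i - s i) \<in> lat l" by (rule emb_subspaceD(4)[OF emb_subspace_lat u s])
  have "\<forall>i<m l. q l (\<lambda>i. u i - s i) i = 0"
    unfolding emb_linear_diff[OF emb_subspace_lat q[OF l] u s] by (simp add: s_def q_span[OF l])
  then have "(\<lambda>i. u i - s i) \<in> Pl l" unfolding q_kernel[OF l us] .
  then have "F u i = F s i" using F(2)[OF _ i] emb_linear_diff[OF emb_subspace_lat F(1) u s, of i] by simp
  also have "F s i = (\<Sum>j<m l. q l u j * F (\<beta> l j) i)"
    unfolding s_def by (rule emb_linear_sum[OF emb_subspace_lat F(1)]) (use \<beta>[OF l] in simp)
  also have "\<dots> = (induced_mat k l F *\<^sub>v Q l u) $ i"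
    unfolding index_mult_mat_vec_sum[OF induced_mat_carrier Q_carrier i]
    using i by (simp add: induced_mat_def Q_def mult.commute)
  finally show "(induced_mat k l F *\<^sub>v Q l u) $ i = vec k (F u) $ i" using i by simp
qed (simp add: induced_mat_def)

lemma q_Pl: "l \<le> d \<Longrightarrow> u \<in> Pl l \<Longrightarrow> i < m l \<Longrightarrow> q l u i = 0"
  using q_kernel[of l u] Pl_lat[of l] by blast

definition Xop :: "nat \<Rightarrow> nat + 'a \<Rightarrow> 'k mat" where
  "Xop l x = induced_mat (m l) l (\<lambda>u. q l (app (Op x) u))"

lemma Xop_carrier: "Xop l x \<in> carrier_mat (m l) (m l)" by (simp add: Xop_def induced_mat_carrier)

lemma Xop_Q:
  assumes "l \<le> d" "u \<in> lat l" shows "Xop l x *\<^sub>v Q l u = Q l (app (Op x) u)"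
  unfolding Xop_def Q_def[of l "app (Op x) u"]
  by (rule induced_mat[OF assms(1) emb_linear_ap[OF q[OF assms(1)] Op_lat] q_Pl[OF assms(1) Pl_Op] assms(2)])

definition X :: "nat \<Rightarrow> (nat \<Rightarrow> 'k mat) \<times> ('a \<Rightarrow> 'k mat)" where
  "X l = (\<lambda>i. Xop l (Inl i), \<lambda>a. Xop l (Inr a))"

lemma path_Q:
  assumes l: "l \<le> d" and u: "u \<in> lat l"
  shows "path_mat d N p \<in> carrier_mat d d \<and> app (path_mat d N p) u \<in> lat l \<and>
    path_mat (m l) (\<lambda>a. Xop l (Inr a)) p *\<^sub>v Q l u = Q l (app (path_mat d N p) u)"
proof (induction p rule: rev_induct)
  case Nil
  have "app (1 \<cdot>\<^sub>m 1\<^sub>m d) u = (\<lambda>i. 1 * u i)"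
    by (rule ap_smult_one) (use lat_supp[OF u] l in simp)
  moreover have "1 \<cdot>\<^sub>m 1\<^sub>m d = (1\<^sub>m d :: 'w mat)" by (intro eq_matI) auto
  ultimately have "app (1\<^sub>m d) u = u" by simp
  then show ?case using u Q_carrier by (simp add: path_mat_def)
next
  case (snoc a p)
  note IH = conjunct1[OF snoc] conjunct1[OF conjunct2[OF snoc]] conjunct2[OF conjunct2[OF snoc]]
  have N': "N a = Op (Inr a)" by (simp add: Op_def)
  have A: "app (path_mat d N (p @ [a])) u = app (Op (Inr a)) (app (path_mat d N p) u)"
    unfolding path_mat_snoc N' by (rule ap_mult[OF Op(1) IH(1)])
  have "path_mat (m l) (\<lambda>a. Xop l (Inr a)) (p @ [a]) *\<^sub>v Q l u = Xop l (Inr a) *\<^sub>v Q l (app (path_mat d N p) u)"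
    unfolding path_mat_snoc IH(3)[symmetric]
    by (rule assoc_mult_mat_vec[OF Xop_carrier path_mat_carrier Q_carrier]) (rule Xop_carrier)
  also have "\<dots> = Q l (app (path_mat d N (p @ [a])) u)"
    unfolding Xop_Q[OF l IH(2)] A ..
  finally show ?case using mult_carrier_mat[OF N(1) IH(1), of a] Op_lat[OF IH(2), of "Inr a"]
    unfolding A[symmetric] path_mat_snoc[of d] by blast
qed

lemma entry_Q:
  assumes "l \<le> d" "A \<in> carrier_mat (m l) (m l)" "r < m l" "s < m l" "A *\<^sub>v Q l (\<beta> l s) = Q l v"
  shows "A $$ (r, s) = q l v r"
  using mult_mat_unit_vec[OF assms(2,3,4)] assms(3,5) unfolding Q_\<beta>[OF assms(1,4)] by (simp add: Q_def)

text \<open>On classes \<open>Q l u\<close> each condition becomes the corresponding identity for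
  the integral representation, which holds because that representation is conjugate to
  \<open>\<mu>\<close> over the large field.\<close>

lemma is_rep_X:
  assumes l: "l \<le> d"
  shows "is_rep n Arr src tgt rho (m l) (X l)"
  unfolding X_def is_rep_iff
proof (intro conjI allI impI ballI)
  note rep = is_rep_Op[unfolded is_rep_iff]
  have Qz: "Q l (\<lambda>_. 0) = 0\<^sub>v (m l)" using Q_zero[OF l emb_subspaceD(1)[OF emb_subspace_lat]] emb_subspaceD(1)[OF emb_subspace_Pl] by simp
  have zero: "Xop l x = 0\<^sub>m (m l) (m l)" if "Op x = 0\<^sub>m d d" for x
    by (rule mat_eq_on_Q[OF l Xop_carrier zero_carrier_mat]) (simp add: Xop_Q[OF l] that ap_zero_mat Qz zero_mat_mult_vec[OF Q_carrier])
  have comp: "Xop l x * Xop l y *\<^sub>v Q l u = Q l (app (Op x * Op y) u)" if u: "u \<in> lat l" for x y u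
    unfolding assoc_mult_mat_vec[OF Xop_carrier Xop_carrier Q_carrier] Xop_Q[OF l u]
      Xop_Q[OF l Op_lat[OF u]] ap_mult[OF Op(1) Op(1)] ..
  show "Xop l (Inl i) \<in> carrier_mat (m l) (m l)" "Xop l (Inr a) \<in> carrier_mat (m l) (m l)" for i a
    by (rule Xop_carrier)+
  show "Xop l (Inl i) = 0\<^sub>m (m l) (m l)" if "n \<le> i" for i
    by (rule zero) (use that in \<open>simp add: Op_def A_c_def\<close>)
  show "Xop l (Inr a) = 0\<^sub>m (m l) (m l)" if "a \<notin> Arr" for a
    by (rule zero) (use that rep in \<open>simp add: Op_def\<close>)
  show "Xop l (Inl i) * Xop l (Inl j) = (if i = j then Xop l (Inl i) else 0\<^sub>m (m l) (m l))"
    if ij: "i < n" "j < n" for i j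
  proof (rule mat_eq_on_Q[OF l mult_carrier_mat[OF Xop_carrier Xop_carrier]])
    have E: "Op (Inl i) * Op (Inl j) = (if i = j then Op (Inl i) else 0\<^sub>m d d)"
      using rep ij by (simp add: Op_def)
    show "Xop l (Inl i) * Xop l (Inl j) *\<^sub>v Q l u = (if i = j then Xop l (Inl i) else 0\<^sub>m (m l) (m l)) *\<^sub>v Q l u"
      if u: "u \<in> lat l" for u
      unfolding comp[OF u] E by (simp add: Xop_Q[OF l u] ap_zero_mat Qz zero_mat_mult_vec[OF Q_carrier])
  qed (simp add: Xop_carrier)
  show "Xop l (Inr a) = Xop l (Inl (tgt a)) * Xop l (Inr a) * Xop l (Inl (src a))" if a: "a \<in> Arr" for a
  proof (rule mat_eq_on_Q[OF l, where k = "m l"])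
    have E: "Op (Inr a) = Op (Inl (tgt a)) * Op (Inr a) * Op (Inl (src a))"
      using rep a by (simp add: Op_def)
    show "Xop l (Inr a) *\<^sub>v Q l u = Xop l (Inl (tgt a)) * Xop l (Inr a) * Xop l (Inl (src a)) *\<^sub>v Q l u"
      if u: "u \<in> lat l" for u
    proof -
      have "Xop l (Inl (tgt a)) * Xop l (Inr a) * Xop l (Inl (src a)) *\<^sub>v Q l u =
          Xop l (Inl (tgt a)) * Xop l (Inr a) *\<^sub>v Q l (app (Op (Inl (src a))) u)"
        unfolding assoc_mult_mat_vec[OF mult_carrier_mat[OF Xop_carrier Xop_carrier] Xop_carrier Q_carrier] Xop_Q[OF l u] ..
      also have "\<dots> = Q l (app (Op (Inl (tgt a)) * Op (Inr a)) (app (Op (Inl (src a))) u))"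
        by (rule comp[OF Op_lat[OF u]])
      also have "\<dots> = Q l (app (Op (Inr a)) u)"
        unfolding ap_mult[OF mult_carrier_mat[OF Op(1) Op(1)] Op(1), symmetric] E[symmetric] ..
      finally show ?thesis unfolding Xop_Q[OF l u] ..
    qed
  qed (rule Xop_carrier mult_carrier_mat[OF mult_carrier_mat[OF Xop_carrier Xop_carrier] Xop_carrier])+
  fix r s assume rs: "r < m l" "s < m l"
  note bs = \<beta>[OF l rs(2)]
  show "(\<Sum>i<n. Xop l (Inl i) $$ (r, s)) = (if r = s then 1 else 0)"
  proof -
    have "(\<Sum>i<n. Xop l (Inl i) $$ (r, s)) = (\<Sum>i<n. 1 * q l (app (Op (Inl i)) (\<beta> l s)) r)"
      using entry_Q[OF l Xop_carrier rs Xop_Q[OF l bs]] by simp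
    also have "\<dots> = q l (\<lambda>t. \<Sum>i<n. emb 1 * app (Op (Inl i)) (\<beta> l s) t) r"
      by (rule emb_linear_sum[OF emb_subspace_lat q[OF l], symmetric]) (rule Op_lat[OF bs])
    also have "(\<lambda>t. \<Sum>i<n. emb 1 * app (Op (Inl i)) (\<beta> l s) t) = \<beta> l s"
    proof
      fix t
      show "(\<Sum>i<n. emb 1 * app (Op (Inl i)) (\<beta> l s) t) = \<beta> l s t"
      proof (cases "t < d")
        case True
        have "(\<Sum>i<n. emb 1 * app (Op (Inl i)) (\<beta> l s) t) = (\<Sum>i<n. \<Sum>j<d. Op (Inl i) $$ (t, j) * \<beta> l s j)"
          using True by (simp add: ap_def)
        also have "\<dots> = (\<Sum>j<d. \<Sum>i<n. Op (Inl i) $$ (t, j) * \<beta> l s j)" by (rule sum.swap)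
        also have "\<dots> = (\<Sum>j<d. (\<Sum>i<n. Op (Inl i) $$ (t, j)) * \<beta> l s j)" by (simp add: sum_distrib_right)
        also have "\<dots> = (\<Sum>j<d. if j = t then \<beta> l s t else 0)"
          using rep True by (intro sum.cong) (auto simp: Op_def)
        finally show ?thesis using True by simp
      qed (use lat_supp[OF bs, of t] l in \<open>simp add: ap_def\<close>)
    qed
    finally show ?thesis using q\<beta>[OF l rs] by simp
  qed
  fix rel assume rel: "rel \<in> rho"
  let ?S = "{p. rel p \<noteq> 0}"
  let ?P = "\<lambda>p. path_mat d N p"
  have R0: "\<forall>rel\<in>(\<lambda>r p. emb (r p)) ` rho. \<forall>r<d. \<forall>s<d. (\<Sum>p\<in>{p. rel p \<noteq> 0}. rel p * ?P p $$ (r, s)) = 0"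
    using rep by (elim conjE)
  have R1: "(\<Sum>p\<in>?S. emb (rel p) * ?P p $$ (t, j)) = 0" if "t < d" "j < d" for t j
    using bspec[OF R0 imageI[OF rel]] that by simp
  have "(\<Sum>p\<in>?S. rel p * path_mat (m l) (\<lambda>a. Xop l (Inr a)) p $$ (r, s)) = (\<Sum>p\<in>?S. rel p * q l (app (?P p) (\<beta> l s)) r)"
    using entry_Q[OF l path_mat_carrier[of "\<lambda>a. Xop l (Inr a)", OF Xop_carrier] rs conjunct2[OF conjunct2[OF path_Q[OF l bs]]]] by simp
  also have "\<dots> = q l (\<lambda>t. \<Sum>p\<in>?S. emb (rel p) * app (?P p) (\<beta> l s) t) r"
    by (rule emb_linear_sum[OF emb_subspace_lat q[OF l], symmetric]) (use path_Q[OF l bs] in blast)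
  also have "(\<lambda>t. \<Sum>p\<in>?S. emb (rel p) * app (?P p) (\<beta> l s) t) = (\<lambda>_. 0)"
  proof
    fix t
    show "(\<Sum>p\<in>?S. emb (rel p) * app (?P p) (\<beta> l s) t) = 0"
    proof (cases "t < d")
      case True
      have "(\<Sum>p\<in>?S. emb (rel p) * app (?P p) (\<beta> l s) t) = (\<Sum>p\<in>?S. \<Sum>j<d. emb (rel p) * ?P p $$ (t, j) * \<beta> l s j)"
        using True by (simp add: ap_def sum_distrib_left mult.assoc)
      also have "\<dots> = (\<Sum>j<d. \<Sum>p\<in>?S. emb (rel p) * ?P p $$ (t, j) * \<beta> l s j)" by (rule sum.swap)
      also have "\<dots> = (\<Sum>j<d. (\<Sum>p\<in>?S. emb (rel p) * ?P p $$ (t, j)) * \<beta> l s j)" by (simp add: sum_distrib_right)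
      also have "\<dots> = 0"
      proof (rule sum.neutral, rule ballI)
        fix j assume "j \<in> {..<d}"
        then show "(\<Sum>p\<in>?S. emb (rel p) * ?P p $$ (t, j)) * \<beta> l s j = 0" using R1[OF True, of j] by simp
      qed
      finally show ?thesis .
    qed (simp add: ap_def)
  qed
  also have "q l (\<lambda>_. 0) r = 0" by (rule emb_linear_zero[OF emb_subspace_lat q[OF l]])
  finally show "(\<Sum>p\<in>?S. rel p * path_mat (m l) (\<lambda>a. Xop l (Inr a)) p $$ (r, s)) = 0" .
qed

text \<open>The map of quotients induced by the inclusion of \<open>lat l\<close> in
  \<open>lat (Suc l)\<close>.\<close>

definition h :: "nat \<Rightarrow> 'k mat" where "h l = induced_mat (m (Suc l)) l (q (Suc l))"

lemma h_carrier: "h l \<in> carrier_mat (m (Suc l)) (m l)" by (simp add: h_def induced_mat_carrier)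

lemma h_Q:
  assumes "l < d" "u \<in> lat l" shows "h l *\<^sub>v Q l u = Q (Suc l) u"
proof -
  have l: "l \<le> d" "Suc l \<le> d" using assms by auto
  have P: "u \<in> Pl l \<Longrightarrow> u \<in> Pl (Suc l)" for u using Pl_mono[of l "Suc l"] by auto
  show ?thesis
    unfolding h_def Q_def[of "Suc l"]
    by (rule induced_mat[OF l(1) emb_linear_mono[OF q[OF l(2)] lat_mono] q_Pl[OF l(2) P] assms(2)]) simp
qed

lemma lat_Suc: "u \<in> lat l \<Longrightarrow> u \<in> lat (Suc l)" using lat_mono[of l "Suc l"] by auto

lemma ksupp_Suc: "f \<in> ksupp l \<Longrightarrow> f \<in> ksupp (Suc l)" by (simp add: ksupp_def)

lemma sub_carrier: "fst (sub_rep l Y) i \<in> carrier_mat l l" "snd (sub_rep l Y) a \<in> carrier_mat l l"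
  by (simp_all add: sub_rep_def topleft_def)

lemma opr_sub: "opr (sub_rep l Y) x = topleft l (opr Y x)"
  by (simp add: opr_def sub_rep_def split: sum.splits)

lemma opr_X: "opr (X l) x = Xop l x"
  by (simp add: opr_def X_def split: sum.splits)

lemma is_homI:
  assumes "f \<in> carrier_mat k' k" "\<And>x. f * opr Y x = opr Y' x * f"
  shows "is_hom n Arr k k' Y Y' f"
  using assms(1) assms(2)[of "Inl _"] assms(2)[of "Inr _"] by (simp add: is_hom_def opr_def)

lemma h_hom:
  assumes l: "l < d"
  shows "is_hom n Arr (m l) (m (Suc l)) (X l) (X (Suc l)) (h l)"
proof (rule is_homI[OF h_carrier], unfold opr_X)
  fix x
  have l': "l \<le> d" "Suc l \<le> d" using l by auto
  show "h l * Xop l x = Xop (Suc l) x * h l"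
  proof (rule mat_eq_on_Q[OF l'(1) mult_carrier_mat[OF h_carrier Xop_carrier] mult_carrier_mat[OF Xop_carrier h_carrier]])
    fix u assume u: "u \<in> lat l"
    show "h l * Xop l x *\<^sub>v Q l u = Xop (Suc l) x * h l *\<^sub>v Q l u"
      unfolding assoc_mult_mat_vec[OF h_carrier Xop_carrier Q_carrier] assoc_mult_mat_vec[OF Xop_carrier h_carrier Q_carrier]
        Xop_Q[OF l'(1) u] h_Q[OF l u] h_Q[OF l Op_lat[OF u]] Xop_Q[OF l'(2) lat_Suc[OF u]] ..
  qed
qed

text \<open>Following Zwara: on classes modulo \<open>G L\<close>, where \<open>L\<close> is the lattice of level \<open>l\<close>, the map \<open>a\<close> sends
  \<open>u\<close> to the class of \<open>\<pi> u\<close> together with \<open>KAP (\<pi> u)\<close>, and \<open>b\<close> sends \<open>(u, f)\<close> to the residue of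
  \<open>u + G (f - KAP u)\<close>.\<close>

definition a :: "nat \<Rightarrow> 'k mat" where
  "a l = induced_mat (m l + l) l (\<lambda>u i. if i < m l then q l (\<lambda>r. \<pi> * u r) i else KAP (\<lambda>r. \<pi> * u r) (i - m l))"

lemma a_carrier: "a l \<in> carrier_mat (m l + l) (m l)" by (simp add: a_def induced_mat_carrier)

lemma a_Q:
  assumes l: "l \<le> d" and u: "u \<in> lat l"
  shows "a l *\<^sub>v Q l u = Q l (\<lambda>r. \<pi> * u r) @\<^sub>v vec l (KAP (\<lambda>r. \<pi> * u r))"
proof -
  let ?F = "\<lambda>u i. if i < m l then q l (\<lambda>r. \<pi> * u r) i else KAP (\<lambda>r. \<pi> * u r) (i - m l)"
  have "emb_linear (lat l) ?F"
    using emb_linearD[OF emb_linear_pi[OF q[OF l]]] emb_linearD[OF emb_linear_pi[OF emb_linear_KAP, of l]]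
    unfolding emb_linear_def by simp
  \<comment> \<open>For \<open>u = G w\<close> the digit in question is the residue of
    \<open>\<pi> w\<close>, which is 0.\<close>
  moreover have "?F u i = 0" if uP: "u \<in> Pl l" for u i
  proof -
    obtain w where w: "w \<in> lat l" "u = app G w" using uP by (auto simp: Pl_def)
    have "KAP (\<lambda>r. \<pi> * u r) = RES (\<lambda>r. \<pi> * w r)"
      unfolding w(2) ap_scale[symmetric] by (rule KAP_G[OF l lat_scale[OF \<pi>_R w(1)]])
    then have "KAP (\<lambda>r. \<pi> * u r) j = 0" for j using lat_R[OF w(1)] by (simp add: RES_def)
    then show ?thesis using q_Pl[OF l Pl_scale[OF uP \<pi>_R]] by simp
  qed
  ultimately have "a l *\<^sub>v Q l u = vec (m l + l) (?F u)"
    unfolding a_def using u by (intro induced_mat[OF l])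
  then show ?thesis by (intro eq_vecI) (auto simp: Q_def)
qed

definition Fb :: "(nat \<Rightarrow> 'w) \<Rightarrow> nat \<Rightarrow> 'k" where
  "Fb u = (\<lambda>i. RES u i - ap d Gbar (KAP u) i)"

definition b :: "nat \<Rightarrow> 'k mat" where
  "b l = mat l (m l + l) (\<lambda>(i, j). if j < m l then Fb (\<beta> l j) i else Gbar $$ (i, j - m l))"

lemma b_carrier: "b l \<in> carrier_mat l (m l + l)" by (simp add: b_def)

lemma emb_linear_Fb: "emb_linear (lat l) Fb"
  unfolding emb_linear_def
proof (intro conjI ballI allI)
  fix u v i assume uv: "u \<in> lat l" "v \<in> lat l"
  show "Fb (\<lambda>i. u i + v i) i = Fb u i + Fb v i"
    unfolding Fb_def KAP_add[OF uv] ap_add emb_linearD(1)[OF emb_linear_RES uv] by simp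
next
  fix k u i assume u: "u \<in> lat l"
  show "Fb (\<lambda>i. emb k * u i) i = k * Fb u i"
    unfolding Fb_def KAP_emb[OF u] ap_scale emb_linearD(2)[OF emb_linear_RES u] by (simp add: right_diff_distrib)
qed

lemma b_Q:
  assumes l: "l \<le> d" and u: "u \<in> lat l" and f: "f \<in> ksupp l"
  shows "b l *\<^sub>v (Q l u @\<^sub>v vec l f) = vec l (\<lambda>i. RES u i - ap d Gbar (KAP u) i + ap d Gbar f i)"
proof (rule eq_vecI)
  fix i assume "i < dim_vec (vec l (\<lambda>i. RES u i - ap d Gbar (KAP u) i + ap d Gbar f i))"
  then have i: "i < l" by simp
  \<comment> \<open>For \<open>u = G w\<close> both terms equal \<open>Gbar\<close> applied to the
    residue of \<open>w\<close>, so the formula for \<open>b\<close> depends only on the class of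
    \<open>u\<close>.\<close>
  have Fb0: "Fb u i = 0" if uP: "u \<in> Pl l" for u i
  proof -
    obtain w where w: "w \<in> lat l" "u = app G w" using uP by (auto simp: Pl_def)
    show ?thesis unfolding Fb_def w(2) KAP_G[OF l w(1)] RES_G[OF w(1)] by simp
  qed
  have "(\<Sum>j<m l. b l $$ (i, j) * (Q l u @\<^sub>v vec l f) $ j) = (induced_mat l l Fb *\<^sub>v Q l u) $ i"
    unfolding index_mult_mat_vec_sum[OF induced_mat_carrier Q_carrier i]
    using i by (intro sum.cong) (auto simp: b_def induced_mat_def Q_def)
  also have "induced_mat l l Fb *\<^sub>v Q l u = vec l (Fb u)" by (rule induced_mat[OF l emb_linear_Fb _ u]) (rule Fb0)
  also have "vec l (Fb u) $ i = Fb u i" using i by simp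
  finally have 1: "(\<Sum>j<m l. b l $$ (i, j) * (Q l u @\<^sub>v vec l f) $ j) = Fb u i" .
  have "(\<Sum>j<l. b l $$ (i, m l + j) * (Q l u @\<^sub>v vec l f) $ (m l + j)) = (topleft l Gbar *\<^sub>v vec l f) $ i"
    unfolding index_mult_mat_vec_sum[OF topleft_carrier vec_carrier i]
    using i carrier_vecD[OF Q_carrier[of l u]] by (intro sum.cong) (auto simp: b_def topleft_def)
  also have "\<dots> = ap d Gbar f i" unfolding topleft_ksupp[OF Gbar(1) l f] using i by simp
  finally have 2: "(\<Sum>j<l. b l $$ (i, m l + j) * (Q l u @\<^sub>v vec l f) $ (m l + j)) = ap d Gbar f i" .
  have split: "(\<Sum>j<k + k'. g j) = (\<Sum>j<k. g j) + (\<Sum>j<k'. g (k + j))" for k k' and g :: "nat \<Rightarrow> 'k"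
    by (induction k') (auto simp: add.assoc)
  have c: "Q l u @\<^sub>v vec l f \<in> carrier_vec (m l + l)" using Q_carrier[of l u] by simp
  show "(b l *\<^sub>v (Q l u @\<^sub>v vec l f)) $ i = vec l (\<lambda>i. RES u i - ap d Gbar (KAP u) i + ap d Gbar f i) $ i"
    unfolding index_mult_mat_vec_sum[OF b_carrier c i] split 1 2 using i by (simp add: Fb_def)
qed (simp add: b_def)

abbreviation DM :: "nat \<Rightarrow> (nat \<Rightarrow> 'k mat) \<times> ('a \<Rightarrow> 'k mat)" where
  "DM l \<equiv> dsum_rep (m l) l (X l) (sub_rep l \<mu>)"

lemma X_carrier: "fst (X l) i \<in> carrier_mat (m l) (m l)" "snd (X l) y \<in> carrier_mat (m l) (m l)"
  by (simp_all add: X_def Xop_carrier)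

lemma DM_carrier: "opr (DM l) x \<in> carrier_mat (m l + l) (m l + l)"
  using dsum_rep_carrier[of "X l" "m l" "sub_rep l \<mu>" l, OF X_carrier(1) sub_carrier(1) X_carrier(2) sub_carrier(2)]
  by (simp add: opr_def split: sum.splits)

lemma DM_Q:
  assumes l: "l \<le> d" and u: "u \<in> lat l" and f: "f \<in> ksupp l"
  shows "opr (DM l) x *\<^sub>v (Q l u @\<^sub>v vec l f) = Q l (app (Op x) u) @\<^sub>v vec l (ap d (Mu x) f)"
proof -
  have "opr (DM l) x *\<^sub>v (Q l u @\<^sub>v vec l f) = (Xop l x *\<^sub>v Q l u) @\<^sub>v (topleft l (Mu x) *\<^sub>v vec l f)"
    using dsum_rep_mult_vec[of "X l" "m l" "sub_rep l \<mu>" l "Q l u" "vec l f",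
        OF X_carrier(1) sub_carrier(1) X_carrier(2) sub_carrier(2) Q_carrier vec_carrier]
    by (simp add: opr_def X_def sub_rep_def Mu_def split: sum.splits)
  then show ?thesis unfolding Xop_Q[OF l u] topleft_ksupp[OF Mu(1) l f] .
qed

lemma KAP_pi_supp: "u \<in> lat l \<Longrightarrow> KAP (\<lambda>r. \<pi> * u r) \<in> ksupp l"
  by (rule KAP_supp[OF lat_scale[OF \<pi>_R]])

lemma a_hom:
  assumes l: "l \<le> d"
  shows "is_hom n Arr (m l) (m l + l) (X l) (DM l) (a l)"
proof (rule is_homI[OF a_carrier], unfold opr_X)
  fix x
  show "a l * Xop l x = opr (DM l) x * a l"
  proof (rule mat_eq_on_Q[OF l mult_carrier_mat[OF a_carrier Xop_carrier] mult_carrier_mat[OF DM_carrier a_carrier]])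
    fix u assume u: "u \<in> lat l"
    note pu = lat_scale[OF \<pi>_R u]
    show "a l * Xop l x *\<^sub>v Q l u = opr (DM l) x * a l *\<^sub>v Q l u"
      unfolding assoc_mult_mat_vec[OF a_carrier Xop_carrier Q_carrier] assoc_mult_mat_vec[OF DM_carrier a_carrier Q_carrier]
        Xop_Q[OF l u] a_Q[OF l u] a_Q[OF l Op_lat[OF u]] DM_Q[OF l pu KAP_pi_supp[OF u]]
        KAP_Op[OF l pu, symmetric] ap_scale ..
  qed
qed

lemma b_hom:
  assumes l: "l \<le> d"
  shows "is_hom n Arr (m l + l) l (DM l) (sub_rep l \<nu>) (b l)"
proof (rule is_homI[OF b_carrier])
  fix x
  have T: "opr (sub_rep l \<nu>) x = topleft l (Nu x)" by (simp add: opr_sub Nu_def)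
  show "b l * opr (DM l) x = opr (sub_rep l \<nu>) x * b l"
    unfolding T
  proof (rule mat_eq_on_Q_append[OF l mult_carrier_mat[OF b_carrier DM_carrier] mult_carrier_mat[OF topleft_carrier b_carrier]])
    fix u f assume u: "u \<in> lat l" and f: "f \<in> ksupp l"
    have c: "Q l u @\<^sub>v vec l f \<in> carrier_vec (m l + l)" using Q_carrier[of l u] by simp
    have le: "ksupp l \<subseteq> ksupp d" using l by (auto simp: ksupp_def)
    have fd: "f \<in> ksupp d" "KAP u \<in> ksupp d" using le f KAP_supp[OF u] by auto
    have s: "(\<lambda>i. RES u i - ap d Gbar (KAP u) i + ap d Gbar f i) \<in> ksupp l"
      using RES_supp[OF u] apk_supp[OF Gbar KAP_supp[OF u]] apk_supp[OF Gbar f] by (auto simp: ksupp_def)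
    show "b l * opr (DM l) x *\<^sub>v (Q l u @\<^sub>v vec l f) = topleft l (Nu x) * b l *\<^sub>v (Q l u @\<^sub>v vec l f)"
      unfolding assoc_mult_mat_vec[OF b_carrier DM_carrier c] assoc_mult_mat_vec[OF topleft_carrier b_carrier c]
        DM_Q[OF l u f] b_Q[OF l u f] b_Q[OF l Op_lat[OF u] apk_supp[OF Mu f]] topleft_ksupp[OF Nu(1) l s]
        RES_Op[OF u] KAP_Op[OF l u] Gbar_Mu[OF fd(1)] Gbar_Mu[OF fd(2)] ap_add ap_diff ..
  qed
qed

lemma RES_zero:
  assumes "u \<in> lat l" "\<And>i. i < l \<Longrightarrow> RES u i = 0"
  shows "\<exists>w\<in>lat l. u = (\<lambda>i. \<pi> * w i)"
proof -
  have z: "rs (u i) = 0" for i using assms(2)[of i] lat_supp[OF assms(1), of i] by (cases "i < l") (auto simp: RES_def)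
  have "quo 0 = 0" by (simp add: quo_def)
  then have "(\<lambda>i. quo (u i)) \<in> lat l" using lat_R[OF assms(1)] lat_supp[OF assms(1)] rs_quo(2) by (simp add: lat_def)
  moreover have "u i = \<pi> * quo (u i)" for i using rs_quo(1)[OF lat_R[OF assms(1), of i]] unfolding z by simp
  ultimately show ?thesis by (intro bexI[of _ "\<lambda>i. quo (u i)"]) blast+
qed

lemma vec_eq_zero: "vec k F = 0\<^sub>v k \<longleftrightarrow> (\<forall>i<k. F i = 0)" by (auto simp: vec_eq_iff)

text \<open>With \<open>L\<close> the lattice of level \<open>l\<close>, the pair
  \<open>(u, f)\<close> stands for \<open>u + G (f - KAP u)\<close> modulo \<open>\<pi> G L\<close>.
  In this reading \<open>a\<close> is multiplication by \<open>\<pi>\<close> from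
  \<open>L / G L\<close>, and \<open>b\<close> is reduction modulo \<open>\<pi>\<close>.\<close>

lemma exact:
  assumes l: "l \<le> d"
  shows "short_exact (m l) (m l + l) l (a l) (b l)"
  unfolding short_exact_def
proof (intro conjI ballI impI a_carrier b_carrier)
  fix v :: "'k vec" assume v: "v \<in> carrier_vec (m l)" and av: "a l *\<^sub>v v = 0\<^sub>v (m l + l)"
  obtain u where u: "u \<in> lat l" "Q l u = v" using Q_surj[OF l v] by blast
  have "Q l (\<lambda>r. \<pi> * u r) @\<^sub>v vec l (KAP (\<lambda>r. \<pi> * u r)) = 0\<^sub>v (m l) @\<^sub>v 0\<^sub>v l"
    using av unfolding u(2)[symmetric] a_Q[OF l u(1)] append_zero_vec .
  then have "Q l (\<lambda>r. \<pi> * u r) = 0\<^sub>v (m l)" "vec l (KAP (\<lambda>r. \<pi> * u r)) = 0\<^sub>v l"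
    using append_vec_eq[OF Q_carrier zero_carrier_vec] by auto
  then have P: "(\<lambda>r. \<pi> * u r) \<in> Pl l" and K: "\<And>i. i < l \<Longrightarrow> KAP (\<lambda>r. \<pi> * u r) i = 0"
    using Q_zero[OF l lat_scale[OF \<pi>_R u(1)]] by (auto simp: vec_eq_zero)
  obtain w where w: "w \<in> lat l" "(\<lambda>r. \<pi> * u r) = app G w" using P by (auto simp: Pl_def)
  \<comment> \<open>As \<open>w\<close> is divisible by \<open>\<pi>\<close>, the equation
    \<open>\<pi> u = G w\<close> can be divided by \<open>\<pi>\<close>, which puts \<open>u\<close>
    into \<open>Pl l\<close>.\<close>
  have "RES w i = 0" if "i < l" for i using K[OF that] unfolding w(2) KAP_G[OF l w(1)] .
  then obtain w' where w': "w' \<in> lat l" "w = (\<lambda>i. \<pi> * w' i)" using RES_zero[OF w(1)] by blast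
  have "(\<lambda>r. \<pi> * u r) = (\<lambda>r. \<pi> * app G w' r)" unfolding w(2) w'(2) ap_scale ..
  then have "\<pi> * u r = \<pi> * app G w' r" for r by (rule fun_cong)
  then have "u = app G w'" using \<pi>_0 by auto
  then have "u \<in> Pl l" using w'(1) by (auto simp: Pl_def)
  then show "v = 0\<^sub>v (m l)" unfolding u(2)[symmetric] Q_zero[OF l u(1)] .
next
  fix w :: "'k vec" assume w: "w \<in> carrier_vec l"
  \<comment> \<open>Constants are their own residues, and the second component \<open>KAP u\<close>
    cancels the correction term of \<open>b\<close>.\<close>
  define f where "f i = (if i < l then w $ i else 0)" for i
  define u where "u = (\<lambda>i. emb (f i))"
  have u: "u \<in> lat l" unfolding u_def by (rule lat_emb) (simp add: f_def)
  have "b l *\<^sub>v (Q l u @\<^sub>v vec l (KAP u)) = vec l f"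
    unfolding b_Q[OF l u KAP_supp[OF u]] by (simp add: u_def RES_emb)
  also have "vec l f = w" using w by (intro eq_vecI) (auto simp: f_def)
  finally show "\<exists>v\<in>carrier_vec (m l + l). b l *\<^sub>v v = w"
    using Q_carrier[of l u] by (intro bexI[of _ "Q l u @\<^sub>v vec l (KAP u)"]) auto
next
  fix v :: "'k vec" assume v: "v \<in> carrier_vec (m l + l)"
  obtain u f where uf: "u \<in> lat l" "f \<in> ksupp l" "Q l u @\<^sub>v vec l f = v" using Q_append_surj[OF l v] by blast
  show "b l *\<^sub>v v = 0\<^sub>v l \<longleftrightarrow> (\<exists>u\<in>carrier_vec (m l). a l *\<^sub>v u = v)"
  proof
    assume "\<exists>u\<in>carrier_vec (m l). a l *\<^sub>v u = v"
    then obtain x where x: "x \<in> carrier_vec (m l)" "a l *\<^sub>v x = v" by blast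
    obtain w where w: "w \<in> lat l" "Q l w = x" using Q_surj[OF l x(1)] by blast
    note pw = lat_scale[OF \<pi>_R w(1)]
    have "b l *\<^sub>v v = vec l (RES (\<lambda>r. \<pi> * w r))"
      unfolding x(2)[symmetric] w(2)[symmetric] a_Q[OF l w(1)] b_Q[OF l pw KAP_supp[OF pw]] by simp
    then show "b l *\<^sub>v v = 0\<^sub>v l" using lat_R[OF w(1)] by (simp add: RES_def vec_eq_zero)
  next
    assume "b l *\<^sub>v v = 0\<^sub>v l"
    then have z: "RES u i - ap d Gbar (KAP u) i + ap d Gbar f i = 0" if "i < l" for i
      using that unfolding uf(3)[symmetric] b_Q[OF l uf(1,2)] by (simp add: vec_eq_zero)
    \<comment> \<open>The corrected vector \<open>u' = u + G t\<close> has the class of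
      \<open>u\<close> and satisfies \<open>KAP u' = f\<close>; its residue is \<open>b l\<close>
      applied to \<open>v\<close>. So \<open>u'\<close> is \<open>\<pi> w\<close>, and
      \<open>w\<close> represents the preimage under \<open>a l\<close>.\<close>
    define t where "t = (\<lambda>i. emb (f i - KAP u i))"
    have t: "t \<in> lat l" unfolding t_def using ksuppD[OF uf(2)] ksuppD[OF KAP_supp[OF uf(1)]] by (intro lat_emb) simp
    define u' where "u' = (\<lambda>i. u i + app G t i)"
    have u': "u' \<in> lat l" unfolding u'_def by (rule emb_subspaceD(2)[OF emb_subspace_lat uf(1) G_lat[OF t]])
    have Rt: "RES t = (\<lambda>i. f i - KAP u i)" unfolding t_def by (rule RES_emb)
    have "RES u' i = 0" if "i < l" for i
      unfolding u'_def RES_add[OF uf(1) G_lat[OF t]] RES_G[OF t] Rt ap_diff using z[OF that] by (simp add: algebra_simps)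
    then obtain w where w: "w \<in> lat l" "u' = (\<lambda>i. \<pi> * w i)" using RES_zero[OF u'] by blast
    have "KAP u' = f" unfolding u'_def KAP_add[OF uf(1) G_lat[OF t]] KAP_G[OF l t] Rt by simp
    moreover have "Q l u' = Q l u"
    proof (rule eq_vecI)
      fix i assume "i < dim_vec (Q l u)"
      then have i: "i < m l" by (simp add: Q_def)
      have "q l u' i = q l u i + q l (app G t) i" unfolding u'_def by (rule emb_linearD(1)[OF q[OF l] uf(1) G_lat[OF t]])
      moreover have "q l (app G t) i = 0" by (rule q_Pl[OF l _ i]) (use t in \<open>simp add: Pl_def\<close>)
      ultimately show "Q l u' $ i = Q l u $ i" using i by (simp add: Q_def)
    qed (simp add: Q_def)
    ultimately have "a l *\<^sub>v Q l w = v" unfolding a_Q[OF l w(1)] w(2)[symmetric] using uf(3) by simp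
    then show "\<exists>u\<in>carrier_vec (m l). a l *\<^sub>v u = v" using Q_carrier by blast
  qed
qed

text \<open>On representatives the vertical maps leave \<open>u\<close> and \<open>f\<close>
  unchanged, and the formulas for \<open>a\<close> and \<open>b\<close> do not involve the
  level.\<close>

lemma squares:
  assumes l: "l < d"
  shows "diag2 (h l) (incl_mat l) * a l = a (Suc l) * h l"
    "incl_mat l * b l = b (Suc l) * diag2 (h l) (incl_mat l)"
proof -
  have l': "l \<le> d" "Suc l \<le> d" using l by auto
  have dc: "diag2 (h l) (incl_mat l) \<in> carrier_mat (m (Suc l) + Suc l) (m l + l)"
    by (rule diag2_carrier[OF h_carrier incl_mat_carrier])
  have dQ: "diag2 (h l) (incl_mat l) *\<^sub>v (Q l u @\<^sub>v vec l f) = Q (Suc l) u @\<^sub>v vec (Suc l) f"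
    if "u \<in> lat l" "f \<in> ksupp l" for u f
    unfolding diag2_mult_vec[OF h_carrier incl_mat_carrier Q_carrier vec_carrier] h_Q[OF l that(1)] incl_mat_ksupp[OF that(2)] ..
  show "diag2 (h l) (incl_mat l) * a l = a (Suc l) * h l"
  proof (rule mat_eq_on_Q[OF l'(1) mult_carrier_mat[OF dc a_carrier] mult_carrier_mat[OF a_carrier h_carrier]])
    fix u assume u: "u \<in> lat l"
    show "diag2 (h l) (incl_mat l) * a l *\<^sub>v Q l u = a (Suc l) * h l *\<^sub>v Q l u"
      unfolding assoc_mult_mat_vec[OF dc a_carrier Q_carrier] assoc_mult_mat_vec[OF a_carrier h_carrier Q_carrier]
        a_Q[OF l'(1) u] h_Q[OF l u] a_Q[OF l'(2) lat_Suc[OF u]] dQ[OF lat_scale[OF \<pi>_R u] KAP_pi_supp[OF u]] ..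
  qed
  show "incl_mat l * b l = b (Suc l) * diag2 (h l) (incl_mat l)"
  proof (rule mat_eq_on_Q_append[OF l'(1) mult_carrier_mat[OF incl_mat_carrier b_carrier] mult_carrier_mat[OF b_carrier dc]])
    fix u f assume u: "u \<in> lat l" and f: "f \<in> ksupp l"
    have c: "Q l u @\<^sub>v vec l f \<in> carrier_vec (m l + l)" using Q_carrier[of l u] by simp
    have s: "(\<lambda>i. RES u i - ap d Gbar (KAP u) i + ap d Gbar f i) \<in> ksupp l"
      using RES_supp[OF u] apk_supp[OF Gbar KAP_supp[OF u]] apk_supp[OF Gbar f] by (auto simp: ksupp_def)
    show "incl_mat l * b l *\<^sub>v (Q l u @\<^sub>v vec l f) = b (Suc l) * diag2 (h l) (incl_mat l) *\<^sub>v (Q l u @\<^sub>v vec l f)"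
      unfolding assoc_mult_mat_vec[OF incl_mat_carrier b_carrier c] assoc_mult_mat_vec[OF b_carrier dc c]
        b_Q[OF l'(1) u f] dQ[OF u f] b_Q[OF l'(2) lat_Suc[OF u] ksupp_Suc[OF f]] incl_mat_ksupp[OF s] ..
  qed
qed

lemma sequences_of_quotients:
  "(\<forall>l\<in>{1..d}. is_rep n Arr src tgt rho (m l) (X l)) \<and>
   (\<forall>l\<in>{1..<d}. is_hom n Arr (m l) (m (Suc l)) (X l) (X (Suc l)) (h l)) \<and>
   (\<forall>l\<in>{1..d}.
      is_hom n Arr (m l) (m l + l) (X l) (dsum_rep (m l) l (X l) (sub_rep l \<mu>)) (a l) \<and>
      is_hom n Arr (m l + l) l (dsum_rep (m l) l (X l) (sub_rep l \<mu>)) (sub_rep l \<nu>) (b l) \<and>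
      short_exact (m l) (m l + l) l (a l) (b l)) \<and>
   (\<forall>l\<in>{1..<d}.
      diag2 (h l) (incl_mat l) * a l = a (Suc l) * h l \<and>
      incl_mat l * b l = b (Suc l) * diag2 (h l) (incl_mat l))"
  using is_rep_X h_hom a_hom b_hom exact squares by simp

end

theorem flag_sequences_exist:
  "\<exists>m X h a b.
    (\<forall>l\<in>{1..d}. is_rep n Arr src tgt rho (m l) (X l)) \<and>
    (\<forall>l\<in>{1..<d}. is_hom n Arr (m l) (m (Suc l)) (X l) (X (Suc l)) (h l)) \<and>
    (\<forall>l\<in>{1..d}.
       is_hom n Arr (m l) (m l + l) (X l) (dsum_rep (m l) l (X l) (sub_rep l \<mu>)) (a l) \<and>
       is_hom n Arr (m l + l) l (dsum_rep (m l) l (X l) (sub_rep l \<mu>)) (sub_rep l \<nu>) (b l) \<and>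
       short_exact (m l) (m l + l) l (a l) (b l)) \<and>
    (\<forall>l\<in>{1..<d}.
       diag2 (h l) (incl_mat l) * a l = a (Suc l) * h l \<and>
       incl_mat l * b l = b (Suc l) * diag2 (h l) (incl_mat l))"
proof -
  define good where "good l m q \<beta> \<longleftrightarrow> emb_linear (lat l) q \<and> (\<forall>u\<in>lat l. (\<forall>i<m. q u i = 0) \<longleftrightarrow> u \<in> Pl l) \<and>
    (\<forall>j<m. \<beta> j \<in> lat l) \<and> (\<forall>i<m. \<forall>j<m. q (\<beta> j) i = (if i = j then 1 else 0))"
    for l and m :: nat and q and \<beta> :: "nat \<Rightarrow> nat \<Rightarrow> 'w"
  have "\<forall>l. \<exists>t. l \<le> d \<longrightarrow> good l (fst t) (fst (snd t)) (snd (snd t))"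
    using quotients_exist unfolding good_def[symmetric] by simp
  then obtain t where t: "\<And>l. l \<le> d \<Longrightarrow> good l (fst (t l)) (fst (snd (t l))) (snd (snd (t l)))"
    unfolding choice_iff by blast
  define m q \<beta> where "m l = fst (t l)" "q l = fst (snd (t l))" "\<beta> l = snd (snd (t l))" for l
  then have mq: "good l (m l) (q l) (\<beta> l)" if "l \<le> d" for l using t[OF that] by simp
  have "l \<le> d \<Longrightarrow> emb_linear (lat l) (q l)" "l \<le> d \<Longrightarrow> u \<in> lat l \<Longrightarrow> (\<forall>i<m l. q l u i = 0) \<longleftrightarrow> u \<in> Pl l"
    "l \<le> d \<Longrightarrow> j < m l \<Longrightarrow> \<beta> l j \<in> lat l"
    "l \<le> d \<Longrightarrow> i < m l \<Longrightarrow> j < m l \<Longrightarrow> q l (\<beta> l j) i = (if i = j then 1 else 0)" for l u i j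
    using mq unfolding good_def by blast+
  from sequences_of_quotients[of q m \<beta>, OF this] show ?thesis by blast
qed

end

subsection \<open>A generic conjugate of the representation\<close>

lemma alg_closed_infinite:
  assumes "alg_closed TYPE('k::field)"
  shows "infinite (UNIV :: 'k set)"
proof
  assume fin: "finite (UNIV :: 'k set)"
  define p :: "'k poly" where "p = (\<Prod>x\<in>UNIV. [:- x, 1:])"
  have "degree p = card (UNIV :: 'k set)" unfolding p_def by (subst degree_prod_eq_sum_degree) auto
  then have "degree p > 0" using fin by (simp add: card_gt_0_iff)
  moreover from this have "degree (p + 1) = degree p" by (intro degree_add_eq_left) simp
  ultimately obtain x where "poly (p + 1) x = 0" using assms unfolding alg_closed_def by metis
  moreover have "poly p x = 0" using fin by (auto simp: p_def poly_prod)
  ultimately show False by simp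
qed

text \<open>The sets of points of \<open>N\<close> at which a given \<open>f\<close> is nonzero have
  the finite intersection property, and so do the complements of points in an infinite field. The
  second component \<open>\<xi>\<close> yields an ultrapower element different from every
  constant.\<close>

lemma generic_point:
  fixes P :: "('g \<Rightarrow> 'k::field) set"
  assumes inf: "infinite (UNIV :: 'k set)" and ne: "P \<noteq> {}" and P: "\<And>F. finite F \<Longrightarrow> F \<subseteq> P \<Longrightarrow> \<exists>g\<in>N. \<forall>f\<in>F. f g \<noteq> 0"
  shows "\<exists>\<gamma> \<xi>. (\<forall>i. \<gamma> i \<in> N) \<and>
    (\<forall>f\<in>P. eventually (\<lambda>i. f (\<gamma> i) \<noteq> 0) (univ_ultra :: (('g \<times> 'k) filter \<Rightarrow> 'g \<times> 'k) filter)) \<and>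
    (\<forall>x. eventually (\<lambda>i. \<xi> i \<noteq> (x :: 'k)) (univ_ultra :: (('g \<times> 'k) filter \<Rightarrow> 'g \<times> 'k) filter))"
proof -
  define S where "S = (\<lambda>(f :: 'g \<Rightarrow> 'k, x). {g \<in> N. f g \<noteq> 0} \<times> (UNIV - {x :: 'k}))"
  define B where "B = (INF p\<in>P \<times> UNIV. principal (S p))"
  have "B \<noteq> bot"
    unfolding B_def
  proof (rule INF_filter_not_bot)
    fix X assume X: "X \<subseteq> P \<times> (UNIV :: 'k set)" "finite X"
    have "finite (fst ` X)" "fst ` X \<subseteq> P" using X by auto
    from P[OF this] obtain g where g: "g \<in> N" "\<And>f. f \<in> fst ` X \<Longrightarrow> f g \<noteq> 0" by blast
    obtain x where x: "x \<notin> snd ` X" using X(2) inf ex_new_if_finite[of "snd ` X"] by auto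
    have "(g, x) \<in> (\<Inter>p\<in>X. S p)" using g x by (force simp: S_def)
    then show "(INF p\<in>X. principal (S p)) \<noteq> bot"
      unfolding INF_principal_finite[OF X(2)] principal_eq_bot_iff by blast
  qed
  have evB: "eventually (\<lambda>i. i B \<in> S p) univ_ultra" if "p \<in> P \<times> UNIV" for p
  proof (rule eventually_univ_ultra_proj[OF \<open>B \<noteq> bot\<close>])
    show "eventually (\<lambda>b. b \<in> S p) B"
      unfolding B_def by (rule eventually_INF1[OF that]) (simp add: eventually_principal)
  qed
  obtain g0 where g0: "g0 \<in> N" using P[of "{}"] by auto
  \<comment> \<open>The default \<open>g0\<close> puts every coordinate, not only almost every one,
    into \<open>N\<close>.\<close>
  define \<gamma> where "\<gamma> i = (if fst (i B) \<in> N then fst (i B) else g0)" for i :: "('g \<times> 'k) filter \<Rightarrow> 'g \<times> 'k"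
  have 1: "eventually (\<lambda>i. f (\<gamma> i) \<noteq> 0) univ_ultra" if "f \<in> P" for f
    by (rule eventually_mono[OF evB[of "(f, 0)"]]) (use that in \<open>auto simp: S_def \<gamma>_def\<close>)
  have 2: "eventually (\<lambda>i. snd (i B) \<noteq> x) univ_ultra" for x
  proof -
    obtain f where "f \<in> P" using ne by blast
    then show ?thesis by (intro eventually_mono[OF evB[of "(f, x)"]]) (auto simp: S_def)
  qed
  show ?thesis
    by (rule exI[of _ \<gamma>], rule exI[of _ "\<lambda>i. snd (i B)"]) (use 1 2 g0 in \<open>auto simp: \<gamma>_def\<close>)
qed

section \<open>Matrices over the ultrapower and the system for the conjugating matrix\<close>

definition umat :: "nat \<Rightarrow> (('s filter \<Rightarrow> 's) \<Rightarrow> 'k::field mat) \<Rightarrow> ('s, 'k) ultrapower mat" where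
  "umat d A = mat d d (\<lambda>(r, s). abs_ultrapower (\<lambda>i. A i $$ (r, s)))"

lemma umat_carrier: "umat d A \<in> carrier_mat d d" by (simp add: umat_def)

lemma umat_mult:
  assumes "\<And>i. A i \<in> carrier_mat d d" "\<And>i. B i \<in> carrier_mat d d"
  shows "umat d (\<lambda>i. A i * B i) = umat d A * umat d B"
proof (rule eq_matI)
  fix r s assume "r < dim_row (umat d A * umat d B)" "s < dim_col (umat d A * umat d B)"
  then have rs: "r < d" "s < d" by (simp_all add: umat_def)
  show "umat d (\<lambda>i. A i * B i) $$ (r, s) = (umat d A * umat d B) $$ (r, s)"
    unfolding index_mult_mat_sum[OF umat_carrier umat_carrier rs]
    using rs by (simp add: umat_def index_mult_mat_sum[OF assms] abs_ultrapower_sum abs_ultrapower_simps del: index_mult_mat)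
qed (simp_all add: umat_def)

lemma umat_const: "A \<in> carrier_mat d d \<Longrightarrow> umat d (\<lambda>_. A) = map_mat ultra_const A"
  by (intro eq_matI) (auto simp: umat_def ultra_const_def)

definition graded_upper_mat :: "nat \<Rightarrow> (nat \<Rightarrow> nat) \<Rightarrow> (nat \<Rightarrow> 'w::field) \<Rightarrow> 'w mat" where
  "graded_upper_mat d c y = mat d d (\<lambda>(r, s). if r \<le> s \<and> c r = c s then y (r * d + s) else 0)"

lemma graded_upper_mat: "graded_upper_mat d c y \<in> carrier_mat d d" "upper_triangular (graded_upper_mat d c y)" "graded d c (graded_upper_mat d c y)"
  by (auto simp: graded_upper_mat_def graded_def)

lemma upper_triangular_smult: "upper_triangular A \<Longrightarrow> A \<in> carrier_mat d d \<Longrightarrow> upper_triangular (k \<cdot>\<^sub>m A)"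
  for A :: "'w::field mat"
  by (auto simp: upper_triangularD)

context field_embedding
begin

lemma pfun_graded_upper_mat:
  assumes "i < d" "j < d"
  shows "(\<lambda>y. graded_upper_mat d c y $$ (i, j)) \<in> pfun (d * d)"
proof -
  have "i * d + j < Suc i * d" using assms by simp
  also have "\<dots> \<le> d * d" using assms by (intro mult_le_mono1) simp
  finally show ?thesis using assms pfun_coord pfun_0 by (cases "i \<le> j \<and> c i = c j") (auto simp: graded_upper_mat_def)
qed

lemma pfun_graded_upper_mat_conj:
  assumes "A \<in> carrier_mat d d" "i < d" "j < d"
  shows "(\<lambda>y. (graded_upper_mat d c y * map_mat emb A * adj_mat (graded_upper_mat d c y)) $$ (i, j)) \<in> pfun (d * d)"
proof (rule pfun_mat_mult[OF _ _ _ _ assms(2,3)])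
  show "(\<lambda>y. (graded_upper_mat d c y * map_mat emb A) $$ (i, j)) \<in> pfun (d * d)" if ij: "i < d" "j < d" for i j
  proof (rule pfun_mat_mult[OF graded_upper_mat(1) _ _ _ ij])
    show "map_mat emb A \<in> carrier_mat d d" using assms(1) by simp
    show "(\<lambda>y. map_mat emb A $$ (i, j)) \<in> pfun (d * d)" if "i < d" "j < d" for i j
      using that assms(1) pfun_const by simp
  qed (rule pfun_graded_upper_mat)
  show "(\<lambda>y. adj_mat (graded_upper_mat d c y) $$ (i, j)) \<in> pfun (d * d)" if ij: "i < d" "j < d" for i j
    by (rule pfun_adj_mat[OF graded_upper_mat(1) _ ij]) (rule pfun_graded_upper_mat)
  show "graded_upper_mat d c y * map_mat emb A \<in> carrier_mat d d" for y
    using assms(1) by (intro mult_carrier_mat[OF graded_upper_mat(1)]) simp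
  show "adj_mat (graded_upper_mat d c y) \<in> carrier_mat d d" for y by (rule adj_mat(1)[OF graded_upper_mat(1)])
qed

lemma pfun_graded_upper_mat_det: "(\<lambda>y. det (graded_upper_mat d c y)) \<in> pfun (d * d)"
  by (rule pfun_det[OF graded_upper_mat(1) pfun_graded_upper_mat])

text \<open>This is \<open>det g\<close> times the \<open>(r, s)\<close> entry of
  \<open>g A g^-1 - B\<close>, with the adjugate in place of the inverse so as to remain polynomial.
  Being strictly below \<open>det g\<close> then means that the entry of the conjugate is integral
  and reduces to that of \<open>B\<close>.\<close>

definition conj_entry where
  "conj_entry d c A B r s y =
    (graded_upper_mat d c y * map_mat emb A * adj_mat (graded_upper_mat d c y)) $$ (r, s) - emb (B $$ (r, s)) * det (graded_upper_mat d c y)"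

lemma pfun_conj_entry: "A \<in> carrier_mat d d \<Longrightarrow> r < d \<Longrightarrow> s < d \<Longrightarrow> conj_entry d c A B r s \<in> pfun (d * d)"
  unfolding conj_entry_def by (intro pfun_diff pfun_graded_upper_mat_conj pfun_mult pfun_const pfun_graded_upper_mat_det)

text \<open>The inequality with left side 0 expresses the invertibility of the matrix as part of the
  system.\<close>

definition conj_system where
  "conj_system d c Arr \<mu> \<nu> = insert (\<lambda>_. 0, \<lambda>y. det (graded_upper_mat d c y))
    ((\<lambda>(a, r, s). (conj_entry d c (snd \<mu> a) (snd \<nu> a) r s, \<lambda>y. det (graded_upper_mat d c y))) ` (Arr \<times> {..<d} \<times> {..<d}))"


end

section \<open>From a solution of the system to the exact sequences\<close>

context valued_alg_closed
begin

lemma power_scale_finite: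
  assumes "\<pi> \<in> V" "\<And>a. a \<in> D \<Longrightarrow> \<exists>e. \<pi> ^ e * a \<in> V" "finite A" "A \<subseteq> D"
  shows "\<exists>e. \<forall>a\<in>A. \<pi> ^ e * a \<in> V"
  using assms(3,4)
proof (induction A rule: finite_induct)
  case (insert x A)
  then obtain e where e: "\<And>a. a \<in> A \<Longrightarrow> \<pi> ^ e * a \<in> V" by auto
  obtain e' where e': "\<pi> ^ e' * x \<in> V" using assms(2) insert.prems by auto
  have pw: "\<pi> ^ k \<in> V" for k by (induction k) (auto simp: V_1 V_mult assms(1))
  have "\<pi> ^ (e + e') * a \<in> V" if "a \<in> A" for a
    using V_mult[OF pw[of e'] e[OF that]] by (simp add: power_add mult.assoc mult.left_commute)
  moreover have "\<pi> ^ (e + e') * x \<in> V" using V_mult[OF pw[of e] e'] by (simp add: power_add mult.assoc)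
  ultimately show ?case by (intro exI[of _ "e + e'"]) auto
qed simp

lemma sat_conj_system:
  "sat (conj_system d c Arr \<mu> \<nu>) y \<longleftrightarrow> det (graded_upper_mat d c y) \<noteq> 0 \<and>
    (\<forall>a\<in>Arr. \<forall>r<d. \<forall>s<d. conj_entry d c (snd \<mu> a) (snd \<nu> a) r s y \<prec> det (graded_upper_mat d c y))"
  unfolding sat_def conj_system_def by auto

text \<open>The system has constant coefficients, so it can be solved over a discretely valued
  subfield \<open>D\<close>. The solution provides a matrix \<open>g\<close> over \<open>D\<close>
  whose conjugate of \<open>\<mu>\<close> is integral and reduces to \<open>\<nu>\<close>, and the
  lattice construction applies to the ring \<open>V \<inter> D\<close>.\<close>

lemma flag_sequences_of_system:
  fixes \<mu> \<nu> :: "(nat \<Rightarrow> 'k mat) \<times> ('a \<Rightarrow> 'k mat)"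
  assumes fin: "finite Arr" and c: "\<forall>j<d. c j < n"
    and \<mu>: "\<mu> \<in> T_c n Arr src tgt rho d c" and \<nu>: "\<nu> \<in> T_c n Arr src tgt rho d c"
    and y: "sat (conj_system d c Arr \<mu> \<nu>) y"
  shows "\<exists>m X h a b.
    (\<forall>l\<in>{1..d}. is_rep n Arr src tgt rho (m l) (X l)) \<and>
    (\<forall>l\<in>{1..<d}. is_hom n Arr (m l) (m (Suc l)) (X l) (X (Suc l)) (h l)) \<and>
    (\<forall>l\<in>{1..d}.
       is_hom n Arr (m l) (m l + l) (X l) (dsum_rep (m l) l (X l) (sub_rep l \<mu>)) (a l) \<and>
       is_hom n Arr (m l + l) l (dsum_rep (m l) l (X l) (sub_rep l \<mu>)) (sub_rep l \<nu>) (b l) \<and>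
       short_exact (m l) (m l + l) l (a l) (b l)) \<and>
    (\<forall>l\<in>{1..<d}.
       diag2 (h l) (incl_mat l) * a l = a (Suc l) * h l \<and>
       incl_mat l * b l = b (Suc l) * diag2 (h l) (incl_mat l))"
proof -
  let ?S = "conj_system d c Arr \<mu> \<nu>"
  note mc = T_cD(3)[OF \<mu>]
  have "finite ?S" using fin by (simp add: conj_system_def)
  moreover have "?S \<subseteq> pfun (d * d) \<times> pfun (d * d)"
    unfolding conj_system_def using pfun_0 pfun_graded_upper_mat_det pfun_conj_entry[OF mc] by auto
  ultimately have "\<exists>D z. vbounded D \<and> (\<forall>i<d * d. z i \<in> D) \<and> sat ?S z"
    by (rule specializableD[OF specializable_UNIV _ _ UNIV_I y])
  then obtain D z where D: "vbounded D" "\<And>i. i < d * d \<Longrightarrow> z i \<in> D" "sat ?S z" by blast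
  have sub: "subfield_emb D" using D(1) by (simp add: vbounded_def)
  obtain \<pi> where \<pi>: "\<pi> \<in> D" "\<pi> \<in> M" "\<pi> \<noteq> 0" "\<And>a. a \<in> D \<inter> M \<Longrightarrow> \<exists>v\<in>D \<inter> V. a = \<pi> * v"
    "\<And>a. a \<in> D \<Longrightarrow> \<exists>e. \<pi> ^ e * a \<in> V"
    using vbounded_uniformizer[OF D(1)] by blast
  define g where "g = graded_upper_mat d c z"
  define g' where "g' = inverse (det g) \<cdot>\<^sub>m adj_mat g"
  define K where "K a = g * map_mat emb (snd \<mu> a) * g'" for a
  have g: "g \<in> carrier_mat d d" "upper_triangular g" "graded d c g" unfolding g_def by (rule graded_upper_mat)+
  have dg: "det g \<noteq> 0" using D(3) unfolding sat_conj_system g_def by blast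
  have g'c: "g' \<in> carrier_mat d d" using adj_mat(1)[OF g(1)] by (simp add: g'_def)
  have gg': "g * g' = 1\<^sub>m d"
    using adj_mat[OF g(1)] dg by (auto simp: g'_def mult_smult_distrib[OF g(1) adj_mat(1)[OF g(1)]])
  have g'g: "g' * g = 1\<^sub>m d" by (rule mat_inv_eq(2)[OF g(1) g'c gg'])
  have g'u: "upper_triangular g'" by (rule upper_triangular_inverse[OF g(1,2) g'c gg'])
  have mec: "map_mat emb (snd \<mu> a) \<in> carrier_mat d d" for a using mc by simp
  have gmc: "g * map_mat emb (snd \<mu> a) \<in> carrier_mat d d" for a by (rule mult_carrier_mat[OF g(1) mec])
  have Kc: "K a \<in> carrier_mat d d" for a unfolding K_def by (rule mult_carrier_mat[OF gmc g'c])
  have Ke: "K a $$ (r, s) = (g * map_mat emb (snd \<mu> a) * adj_mat g) $$ (r, s) / det g" if "r < d" "s < d" for a r s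
  proof -
    have "K a = inverse (det g) \<cdot>\<^sub>m (g * map_mat emb (snd \<mu> a) * adj_mat g)"
      unfolding K_def g'_def by (rule mult_smult_distrib[OF gmc adj_mat(1)[OF g(1)]])
    then show ?thesis
      using that carrier_matD[OF mult_carrier_mat[OF gmc adj_mat(1)[OF g(1)]]] by (simp add: divide_inverse mult.commute del: index_mult_mat)
  qed
  have Dg: "g $$ (r, s) \<in> D" if "r < d" "s < d" for r s
    unfolding g_def by (rule pfun_in_subfield[OF sub pfun_graded_upper_mat[OF that] D(2)])
  have Dd: "det g \<in> D" unfolding g_def by (rule pfun_in_subfield[OF sub pfun_graded_upper_mat_det D(2)])
  have Dg': "g' $$ (r, s) \<in> D" if rs: "r < d" "s < d" for r s
  proof -
    have "adj_mat g $$ (r, s) \<in> D"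
      unfolding g_def by (rule pfun_in_subfield[OF sub pfun_adj_mat[OF graded_upper_mat(1) pfun_graded_upper_mat rs] D(2)])
    then show ?thesis using rs carrier_matD[OF adj_mat(1)[OF g(1)]] subfieldD(3,5)[OF sub] Dd by (simp add: g'_def)
  qed
  have DK: "K a $$ (r, s) \<in> D" if rs: "r < d" "s < d" for a r s
  proof -
    have "(g * map_mat emb (snd \<mu> a) * adj_mat g) $$ (r, s) \<in> D"
      unfolding g_def by (rule pfun_in_subfield[OF sub pfun_graded_upper_mat_conj[OF mc rs] D(2)])
    then show ?thesis unfolding Ke[OF rs] by (rule subfieldD(7)[OF sub _ Dd])
  qed
  have KM: "K a $$ (r, s) - emb (snd \<nu> a $$ (r, s)) \<in> M" if rs: "r < d" "s < d" for a r s
  proof (cases "a \<in> Arr")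
    case True
    have "conj_entry d c (snd \<mu> a) (snd \<nu> a) r s z \<prec> det g"
      using D(3) True rs unfolding sat_conj_system g_def by blast
    then have "(g * map_mat emb (snd \<mu> a) * adj_mat g) $$ (r, s) - emb (snd \<nu> a $$ (r, s)) * det g \<prec> det g"
      unfolding conj_entry_def g_def .
    then show ?thesis unfolding vlt_iff[OF dg] Ke[OF rs] using dg by (simp add: diff_divide_distrib)
  next
    case False
    have "map_mat emb (snd \<mu> a) = 0\<^sub>m d d" unfolding T_cD(5)[OF \<mu> False] by (intro eq_matI) auto
    then have "K a = 0\<^sub>m d d" unfolding K_def using g(1) g'c by simp
    then show ?thesis using rs M_0 unfolding T_cD(5)[OF \<nu> False] by simp
  qed
  have KV: "K a $$ (r, s) \<in> V" if rs: "r < d" "s < d" for a r s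
    using V_add[OF M_V[OF KM[OF rs]] V_emb[of "snd \<nu> a $$ (r, s)"], of a] by simp
  have piV: "\<pi> \<in> V" by (rule M_V[OF \<pi>(2)])
  interpret uniformized emb "V \<inter> D" \<pi>
  proof unfold_locales
    show "\<exists>c. \<exists>b\<in>V \<inter> D. a = emb c + \<pi> * b" if a: "a \<in> V \<inter> D" for a
    proof -
      obtain c where c: "a - emb c \<in> M" using residue_exists a by blast
      moreover have "a - emb c \<in> D" using subfieldD(6)[OF sub _ subfieldD(1)[OF sub]] a by blast
      ultimately obtain v where "v \<in> D \<inter> V" "a - emb c = \<pi> * v" using \<pi>(4) by blast
      then show ?thesis by (intro exI[of _ c] bexI[of _ v]) (auto simp: algebra_simps)
    qed
    show "c = 0" if "b \<in> V \<inter> D" "emb c = \<pi> * b" for b c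
      using M_mult[OF \<pi>(2), of b] that emb_in_M[of c] by simp
  qed (use V_add V_mult V_emb subfieldD[OF sub] piV \<pi>(1,3) in auto)
  define ent where "ent A = (\<lambda>(r, s). A $$ (r, s)) ` ({..<d} \<times> {..<d})" for A :: "'w mat"
  have ent: "finite (ent A)" "r < d \<Longrightarrow> s < d \<Longrightarrow> A $$ (r, s) \<in> ent A" for A r s by (auto simp: ent_def)
  have "ent g \<subseteq> D" "ent g' \<subseteq> D" using Dg Dg' by (auto simp: ent_def)
  from power_scale_finite[OF piV \<pi>(5) ent(1) this(1)] power_scale_finite[OF piV \<pi>(5) ent(1) this(2)]
  obtain e1 e2 where e: "\<And>r s. r < d \<Longrightarrow> s < d \<Longrightarrow> \<pi> ^ e1 * g $$ (r, s) \<in> V"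
    "\<And>r s. r < d \<Longrightarrow> s < d \<Longrightarrow> \<pi> ^ e2 * g' $$ (r, s) \<in> V" using ent(2) by blast
  have piD: "\<pi> ^ k \<in> D" for k by (induction k) (auto simp: subfieldD[OF sub] \<pi>(1))
  have Gc: "\<pi> ^ e1 \<cdot>\<^sub>m g \<in> carrier_mat d d" using g(1) by simp
  \<comment> \<open>Scaling by \<open>\<pi> ^ e1\<close> and \<open>\<pi> ^ e2\<close> makes
    \<open>g\<close> and its inverse integral; scaling does not affect the conjugation, and the
    product of the two is \<open>\<pi> ^ (e1 + e2)\<close>.\<close>
  interpret dvr_degeneration emb "V \<inter> D" \<pi> n d Arr src tgt rho c \<mu> \<nu> "\<pi> ^ e1 \<cdot>\<^sub>m g" "\<pi> ^ e2 \<cdot>\<^sub>m g'" "e1 + e2" K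
  proof unfold_locales
    show "upper_triangular (\<pi> ^ e1 \<cdot>\<^sub>m g)" "upper_triangular (\<pi> ^ e2 \<cdot>\<^sub>m g')"
      by (rule upper_triangular_smult[OF g(2,1)] upper_triangular_smult[OF g'u g'c])+
    show "graded d c (\<pi> ^ e1 \<cdot>\<^sub>m g)" using g(1,3) unfolding graded_def by auto
    show "(\<pi> ^ e1 \<cdot>\<^sub>m g) $$ (i, j) \<in> V \<inter> D" "(\<pi> ^ e2 \<cdot>\<^sub>m g') $$ (i, j) \<in> V \<inter> D" if "i < d" "j < d" for i j
      using that e g(1) g'c Dg Dg' piD subfieldD(3)[OF sub] by simp_all
    show "\<pi> ^ e1 \<cdot>\<^sub>m g * (\<pi> ^ e2 \<cdot>\<^sub>m g') = \<pi> ^ (e1 + e2) \<cdot>\<^sub>m 1\<^sub>m d"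
      unfolding mult_smult_assoc_mat[OF g(1) smult_carrier_mat[OF g'c]] mult_smult_distrib[OF g(1) g'c] gg'
      by (intro eq_matI) (auto simp: power_add)
    show "upper_triangular (K a)" for a
    proof -
      have "upper_triangular (map_mat emb (snd \<mu> a))"
      proof
        fix i j assume "j < i" "i < dim_row (map_mat emb (snd \<mu> a))"
        then show "map_mat emb (snd \<mu> a) $$ (i, j) = 0"
          using upper_triangularD[OF T_cD(4)[OF \<mu>], of j i a] carrier_matD[OF mc[of a]] by simp
      qed
      then show ?thesis unfolding K_def
        by (intro upper_triangular_mult[OF gmc g'c upper_triangular_mult[OF g(1) mec g(2)] g'u])
    qed
    show "K a $$ (i, j) \<in> V \<inter> D" if "i < d" "j < d" for a i j using KV[OF that] DK[OF that] by blast
    show "K a * (\<pi> ^ e1 \<cdot>\<^sub>m g) = \<pi> ^ e1 \<cdot>\<^sub>m g * map_mat emb (snd \<mu> a)" for a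
    proof -
      have "K a * g = g * map_mat emb (snd \<mu> a) * (g' * g)"
        unfolding K_def by (rule assoc_mult_mat[OF gmc g'c g(1)])
      then have "K a * g = g * map_mat emb (snd \<mu> a)" unfolding g'g using right_mult_one_mat[OF gmc] by simp
      then show ?thesis unfolding mult_smult_distrib[OF Kc g(1)] mult_smult_assoc_mat[OF g(1) mec] by simp
    qed
    show "rs (K a $$ (i, j)) = snd \<nu> a $$ (i, j)" if ij: "i < d" "j < d" for a i j
    proof -
      have "K a $$ (i, j) - emb (snd \<nu> a $$ (i, j)) \<in> D"
        by (rule subfieldD(6)[OF sub DK[OF ij] subfieldD(1)[OF sub]])
      then obtain v where "v \<in> D \<inter> V" "K a $$ (i, j) - emb (snd \<nu> a $$ (i, j)) = \<pi> * v"
        using \<pi>(4) KM[OF ij] by blast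
      then show ?thesis by (intro rs_eqI[of v]) (auto simp: algebra_simps)
    qed
  qed (use c \<mu> \<nu> Gc g'c Kc in auto)
  show ?thesis by (rule flag_sequences_exist)
qed

end

section \<open>From the orbit closure to a solution of the system\<close>

lemma field_embedding_ultra_const: "field_embedding ultra_const"
  by unfold_locales (simp_all add: ultra_const_hom)

lemma one_in_normalizer:
  assumes "\<forall>j<d. c j < n" "T_c n Arr src tgt rho d c \<noteq> ({} :: ((nat \<Rightarrow> 'k::field mat) \<times> ('a \<Rightarrow> 'k mat)) set)"
  shows "1\<^sub>m d \<in> normalizer d (T_c n Arr src tgt rho d c :: ((nat \<Rightarrow> 'k mat) \<times> ('a \<Rightarrow> 'k mat)) set)"
  unfolding normalizer_T_c[OF assms] using U_groupI[of "1\<^sub>m d" d "1\<^sub>m d"] by (simp add: graded_def)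

lemma poly_fun_prod:
  "finite A \<Longrightarrow> (\<And>x. x \<in> A \<Longrightarrow> f x \<in> poly_fun n Arr d) \<Longrightarrow> (\<lambda>R. \<Prod>x\<in>A. f x R) \<in> poly_fun n Arr d"
  by (induction A rule: finite_induct) (auto intro: pf_const pf_mult)

text \<open>If every point of \<open>S\<close> annihilated some member of \<open>F\<close>, the
  product of the members would vanish on \<open>S\<close> and therefore at
  \<open>\<nu>\<close>.\<close>

lemma zariski_closure_avoid:
  assumes cl: "\<nu> \<in> zariski_closure n Arr d S" and F: "finite F" "F \<subseteq> {f \<in> poly_fun n Arr d. f \<nu> \<noteq> 0}"
  shows "\<exists>Q\<in>S. \<forall>f\<in>F. f Q \<noteq> 0"
proof (rule ccontr)
  assume "\<not> ?thesis"
  then have "(\<Prod>f\<in>F. f Q) = 0" if "Q \<in> S" for Q using that F(1) by auto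
  moreover have "(\<lambda>R. \<Prod>f\<in>F. f R) \<in> poly_fun n Arr d" using F by (intro poly_fun_prod) auto
  moreover have "\<forall>f\<in>poly_fun n Arr d. (\<forall>Q\<in>S. f Q = 0) \<longrightarrow> f \<nu> = 0"
    using cl unfolding zariski_closure_def by (rule CollectD)
  ultimately have "(\<Prod>f\<in>F. f \<nu>) = 0" by (meson bspec)
  then show False using F by auto
qed

lemma flag_sequences_of_closure:
  fixes \<mu> \<nu> :: "(nat \<Rightarrow> 'k::field mat) \<times> ('a \<Rightarrow> 'k mat)"
  assumes ac: "alg_closed TYPE('k)" and fin: "finite Arr" and c: "\<forall>j<d. c j < n"
    and \<mu>: "\<mu> \<in> T_c n Arr src tgt rho d c" and \<nu>: "\<nu> \<in> T_c n Arr src tgt rho d c"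
    and cl: "\<nu> \<in> zariski_closure n Arr d ((\<lambda>g. conj_rep d g \<mu>) ` normalizer d (T_c n Arr src tgt rho d c))"
  shows "\<exists>m X h a b.
    (\<forall>l\<in>{1..d}. is_rep n Arr src tgt rho (m l) (X l)) \<and>
    (\<forall>l\<in>{1..<d}. is_hom n Arr (m l) (m (Suc l)) (X l) (X (Suc l)) (h l)) \<and>
    (\<forall>l\<in>{1..d}.
       is_hom n Arr (m l) (m l + l) (X l) (dsum_rep (m l) l (X l) (sub_rep l \<mu>)) (a l) \<and>
       is_hom n Arr (m l + l) l (dsum_rep (m l) l (X l) (sub_rep l \<mu>)) (sub_rep l \<nu>) (b l) \<and>
       short_exact (m l) (m l + l) l (a l) (b l)) \<and>
    (\<forall>l\<in>{1..<d}.
       diag2 (h l) (incl_mat l) * a l = a (Suc l) * h l \<and>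
       incl_mat l * b l = b (Suc l) * diag2 (h l) (incl_mat l))"
proof -
  define Nor where "Nor = normalizer d (T_c n Arr src tgt rho d c :: ((nat \<Rightarrow> 'k mat) \<times> ('a \<Rightarrow> 'k mat)) set)"
  define PF where "PF = (poly_fun n Arr d :: ((nat \<Rightarrow> 'k mat) \<times> ('a \<Rightarrow> 'k mat) \<Rightarrow> 'k) set)"
  have "T_c n Arr src tgt rho d c \<noteq> ({} :: ((nat \<Rightarrow> 'k mat) \<times> ('a \<Rightarrow> 'k mat)) set)" using \<mu> by blast
  note Nor_iff = normalizer_T_c[OF c this, folded Nor_def]
  define P where "P = (\<lambda>f g. f (conj_rep d g \<mu>)) ` {f \<in> PF. f \<nu> \<noteq> 0}"
  have "(\<lambda>_. 1) \<in> {f \<in> PF. f \<nu> \<noteq> 0}" using pf_const[of 1] by (auto simp: PF_def)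
  then have "P \<noteq> {}" unfolding P_def by blast
  moreover have "\<exists>g\<in>Nor. \<forall>f\<in>F. f g \<noteq> 0" if F: "finite F" "F \<subseteq> P" for F
  proof -
    obtain F' where F': "F' \<subseteq> {f \<in> PF. f \<nu> \<noteq> 0}" "finite F'" "F = (\<lambda>f g. f (conj_rep d g \<mu>)) ` F'"
      using finite_subset_image[OF F(1) F(2)[unfolded P_def]] by blast
    have "\<exists>Q\<in>(\<lambda>g. conj_rep d g \<mu>) ` Nor. \<forall>f\<in>F'. f Q \<noteq> 0"
      using zariski_closure_avoid[OF cl F'(2)] F'(1) unfolding Nor_def PF_def by blast
    then show ?thesis unfolding F'(3) by blast
  qed
  ultimately have "\<exists>\<gamma> \<xi>. (\<forall>i. \<gamma> i \<in> Nor) \<and>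
    (\<forall>f\<in>P. eventually (\<lambda>i. f (\<gamma> i) \<noteq> 0) (univ_ultra :: (('k mat \<times> 'k) filter \<Rightarrow> 'k mat \<times> 'k) filter)) \<and>
    (\<forall>x. eventually (\<lambda>i. \<xi> i \<noteq> (x :: 'k)) (univ_ultra :: (('k mat \<times> 'k) filter \<Rightarrow> 'k mat \<times> 'k) filter))"
    by (rule generic_point[OF alg_closed_infinite[OF ac]])
  then obtain \<gamma> :: "(('k mat \<times> 'k) filter \<Rightarrow> 'k mat \<times> 'k) \<Rightarrow> 'k mat" and \<xi> :: "(('k mat \<times> 'k) filter \<Rightarrow> 'k mat \<times> 'k) \<Rightarrow> 'k" where
    gen: "\<forall>i. \<gamma> i \<in> Nor" "\<forall>f\<in>P. eventually (\<lambda>i. f (\<gamma> i) \<noteq> 0) univ_ultra"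
    "\<forall>x. eventually (\<lambda>i. \<xi> i \<noteq> x) (univ_ultra :: (('k mat \<times> 'k) filter \<Rightarrow> 'k mat \<times> 'k) filter)"
    by (elim exE conjE)
  note \<gamma> = spec[OF gen(1)] bspec[OF gen(2)] and \<xi> = spec[OF gen(3)]
  interpret field_embedding "ultra_const :: 'k \<Rightarrow> ('k mat \<times> 'k, 'k) ultrapower"
    by (rule field_embedding_ultra_const)
  let ?emb = "ultra_const :: 'k \<Rightarrow> ('k mat \<times> 'k, 'k) ultrapower"
  \<comment> \<open>Values at the generic orbit point are sent to values at \<open>\<nu>\<close>.
    This is well defined because a function that does not vanish at \<open>\<nu>\<close> is nonzero
    at the generic point.\<close>
  define G0 where "G0 = (\<lambda>f. (abs_ultrapower (\<lambda>i. f (conj_rep d (\<gamma> i) \<mu>)), f \<nu>)) ` PF"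
  have "place G0"
    unfolding place_def
  proof (intro conjI allI impI)
    show "(?emb k, k) \<in> G0" for k
      unfolding G0_def by (rule image_eqI[of _ _ "\<lambda>_. k"]) (simp_all add: PF_def pf_const ultra_const_def)
    fix a e b e' assume "(a, e) \<in> G0" "(b, e') \<in> G0"
    then obtain f f' where f: "f \<in> PF" "f' \<in> PF" "a = abs_ultrapower (\<lambda>i. f (conj_rep d (\<gamma> i) \<mu>))" "e = f \<nu>"
      "b = abs_ultrapower (\<lambda>i. f' (conj_rep d (\<gamma> i) \<mu>))" "e' = f' \<nu>" unfolding G0_def by blast
    show "(a + b, e + e') \<in> G0" unfolding G0_def
      by (rule image_eqI[of _ _ "\<lambda>R. f R + f' R"])
        (use f in \<open>simp_all add: PF_def pf_add abs_ultrapower_simps\<close>)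
    show "(a * b, e * e') \<in> G0" unfolding G0_def
      by (rule image_eqI[of _ _ "\<lambda>R. f R * f' R"])
        (use f in \<open>simp_all add: PF_def pf_mult abs_ultrapower_simps\<close>)
  next
    fix k assume "(0, k) \<in> G0"
    then obtain f where f: "f \<in> PF" "abs_ultrapower (\<lambda>i. f (conj_rep d (\<gamma> i) \<mu>)) =
        (0 :: ('k mat \<times> 'k, 'k) ultrapower)" "k = f \<nu>"
      unfolding G0_def by auto
    show "k = 0"
    proof (rule ccontr)
      assume "k \<noteq> 0"
      then have "(\<lambda>g. f (conj_rep d g \<mu>)) \<in> P" using f by (auto simp: P_def)
      from \<gamma>(2)[OF this] have "eventually (\<lambda>i. f (conj_rep d (\<gamma> i) \<mu>) \<noteq> 0) univ_ultra" .
      moreover have "eventually (\<lambda>i. f (conj_rep d (\<gamma> i) \<mu>) = 0) univ_ultra"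
        using f(2) unfolding abs_ultrapower_simps(5)[symmetric] abs_ultrapower_eq_iff .
      ultimately have "eventually (\<lambda>i. False) (univ_ultra :: (('k mat \<times> 'k) filter \<Rightarrow> 'k mat \<times> 'k) filter)"
        by eventually_elim simp
      then show False by simp
    qed
  qed
  from max_place_exists[OF this] obtain G where G: "G0 \<subseteq> G" "max_place G" by blast
  define V M where "V = Domain G" "M = {a. (a, 0) \<in> G}"
  interpret valued_field ?emb V M unfolding V_M_def by (rule max_place_valued_field[OF ac G(2)])
  \<comment> \<open>Since \<open>\<tau>\<close> differs from all constants, either
    \<open>\<tau>\<close> minus its residue or, if \<open>\<tau>\<close> is not integral, its
    inverse is a nonzero element of \<open>M\<close>.\<close>
  define \<tau> where "\<tau> = (abs_ultrapower \<xi> :: ('k mat \<times> 'k, 'k) ultrapower)"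
  have \<tau>: "\<tau> \<noteq> ?emb x" for x
  proof
    assume "\<tau> = ?emb x"
    then have "eventually (\<lambda>i. \<xi> i = x) univ_ultra"
      unfolding \<tau>_def ultra_const_def abs_ultrapower_eq_iff .
    with \<xi>[of x] have "eventually (\<lambda>i. False) (univ_ultra :: (('k mat \<times> 'k) filter \<Rightarrow> 'k mat \<times> 'k) filter)"
      by eventually_elim simp
    then show False by simp
  qed
  have "\<exists>t\<in>M. t \<noteq> 0"
  proof (cases "\<tau> \<in> V")
    case True
    then obtain x where "\<tau> - ?emb x \<in> M" using residue_exists by blast
    then show ?thesis using \<tau>[of x] by (intro bexI[of _ "\<tau> - ?emb x"]) auto
  next
    case False
    then have "inverse \<tau> \<in> M" using V_total[of \<tau>] M_iff[of "inverse \<tau>"] by auto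
    then show ?thesis using \<tau>[of 0] by (intro bexI[of _ "inverse \<tau>"]) auto
  qed
  then obtain t where t: "t \<in> M" "t \<noteq> 0" by blast
  interpret valued_alg_closed ?emb V M t
    by unfold_locales (use t alg_closed_infinite[OF ac] alg_closed_ultrapower[OF ac] in auto)
  have \<gamma>n: "\<gamma> i \<in> U_group d" "graded d c (\<gamma> i)" for i using \<gamma>(1)[of i] by (simp_all add: Nor_iff)
  have \<gamma>c: "\<gamma> i \<in> carrier_mat d d" "upper_triangular (\<gamma> i)" for i using \<gamma>n(1)[of i] by (simp_all add: U_group_def)
  have "\<forall>i. \<exists>g'. g' \<in> carrier_mat d d \<and> \<gamma> i * g' = 1\<^sub>m d" using U_group_inverse[OF \<gamma>n(1)] by blast
  then obtain \<delta> where \<delta>: "\<And>i. \<delta> i \<in> carrier_mat d d" "\<And>i. \<gamma> i * \<delta> i = 1\<^sub>m d" by metis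
  define y where "y = (\<lambda>k. abs_ultrapower (\<lambda>i. \<gamma> i $$ (k div d, k mod d)) :: ('k mat \<times> 'k, 'k) ultrapower)"
  have gmy: "graded_upper_mat d c y = umat d \<gamma>"
  proof (rule eq_matI)
    fix r s assume "r < dim_row (umat d \<gamma>)" "s < dim_col (umat d \<gamma>)"
    then have rs: "r < d" "s < d" by (simp_all add: umat_def)
    have "(r * d + s) div d = r" "(r * d + s) mod d = s" using rs by simp_all
    moreover have "\<gamma> i $$ (r, s) = 0" if "\<not> (r \<le> s \<and> c r = c s)" for i
      using that upper_triangularD[OF \<gamma>c(2)[of i], of s r] carrier_matD[OF \<gamma>c(1)[of i]] \<gamma>n(2)[of i] rs
      by (auto simp: graded_def)
    ultimately show "graded_upper_mat d c y $$ (r, s) = umat d \<gamma> $$ (r, s)"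
      using rs by (simp add: graded_upper_mat_def umat_def y_def abs_ultrapower_simps)
  qed (simp_all add: graded_upper_mat_def umat_def)
  define g where "g = umat d \<gamma>"
  note gc = umat_carrier[of d \<gamma>, folded g_def]
  have "g * umat d \<delta> = 1\<^sub>m d"
    unfolding g_def umat_mult[OF \<gamma>c(1) \<delta>(1), symmetric] \<delta>(2)
    by (subst umat_const[OF one_carrier_mat]) (auto intro!: eq_matI)
  note g\<delta> = this mat_inv_eq(2)[OF gc umat_carrier this]
  have "det g * det (umat d \<delta>) = 1" using det_mult[OF gc umat_carrier, of \<delta>] g\<delta>(1) by simp
  then have dg: "det g \<noteq> 0" by auto
  \<comment> \<open>The generic matrix has the coordinatewise inverse
    \<open>umat d \<delta>\<close>, so its adjugate can be traded for the actual conjugates at the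
    indices \<open>i\<close>.\<close>
  have adj: "adj_mat g = det g \<cdot>\<^sub>m umat d \<delta>"
  proof -
    have "umat d \<delta> * (g * adj_mat g) = umat d \<delta> * g * adj_mat g"
      by (rule assoc_mult_mat[OF umat_carrier gc adj_mat(1)[OF gc], symmetric])
    also have "\<dots> = adj_mat g" unfolding g\<delta>(2) by (rule left_mult_one_mat[OF adj_mat(1)[OF gc]])
    also have "umat d \<delta> * (g * adj_mat g) = det g \<cdot>\<^sub>m umat d \<delta>"
      unfolding adj_mat(2)[OF gc] mult_smult_distrib[OF umat_carrier one_carrier_mat] right_mult_one_mat[OF umat_carrier] ..
    finally show ?thesis by simp
  qed
  have "\<not> vle (det g) (conj_entry d c (snd \<mu> x) (snd \<nu> x) r s y)" if x: "x \<in> Arr" and rs: "r < d" "s < d" for x r s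
  proof -
    note mc = T_cD(3)[OF \<mu>, of x]
    have gmc: "\<gamma> i * snd \<mu> x \<in> carrier_mat d d" for i by (rule mult_carrier_mat[OF \<gamma>c(1) mc])
    define E where "E = umat d (\<lambda>i. \<gamma> i * snd \<mu> x * \<delta> i)"
    have E: "E = g * map_mat ?emb (snd \<mu> x) * umat d \<delta>"
      unfolding E_def umat_mult[OF gmc \<delta>(1)] umat_mult[of \<gamma> d "\<lambda>_. snd \<mu> x", OF \<gamma>c(1) mc] umat_const[OF mc] g_def ..
    have Ec: "E \<in> carrier_mat d d" unfolding E_def by (rule umat_carrier)
    have "g * map_mat ?emb (snd \<mu> x) * adj_mat g = det g \<cdot>\<^sub>m E"
      unfolding adj E by (rule mult_smult_distrib[OF mult_carrier_mat[OF gc] umat_carrier]) (use mc in simp)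
    then have "conj_entry d c (snd \<mu> x) (snd \<nu> x) r s y = det g * (E $$ (r, s) - ?emb (snd \<nu> x $$ (r, s)))"
      unfolding conj_entry_def gmy g_def[symmetric] using rs Ec by (simp add: algebra_simps)
    moreover have "E $$ (r, s) - ?emb (snd \<nu> x $$ (r, s)) \<in> M"
    proof -
      \<comment> \<open>This polynomial function vanishes at \<open>\<nu>\<close>, so its value at
        the generic point has residue 0.\<close>
      have "(\<lambda>R. snd R x $$ (r, s) + - (snd \<nu> x $$ (r, s))) \<in> PF"
        unfolding PF_def by (intro pf_add pf_X pf_const x rs)
      then have "(abs_ultrapower (\<lambda>i. snd (conj_rep d (\<gamma> i) \<mu>) x $$ (r, s) + - (snd \<nu> x $$ (r, s))), 0) \<in> G0"
        unfolding G0_def by (rule image_eqI[rotated]) simp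
      then have "abs_ultrapower (\<lambda>i. snd (conj_rep d (\<gamma> i) \<mu>) x $$ (r, s) + - (snd \<nu> x $$ (r, s))) \<in> M"
        using G(1) unfolding V_M_def by blast
      moreover have "snd (conj_rep d (\<gamma> i) \<mu>) x = \<gamma> i * snd \<mu> x * \<delta> i" for i
        unfolding conj_rep_eq[OF \<gamma>c(1) \<delta>] by simp
      ultimately show ?thesis using rs by (simp add: E_def umat_def ultra_const_def abs_ultrapower_simps)
    qed
    ultimately show ?thesis unfolding vlt_iff[OF dg] using dg by simp
  qed
  then have "sat (conj_system d c Arr \<mu> \<nu>) y"
    unfolding sat_conj_system gmy g_def[symmetric] using dg by blast
  from flag_sequences_of_system[OF fin c \<mu> \<nu> this] show ?thesis .
qed

lemma poly_fun_0: "f \<in> poly_fun n Arr 0 \<Longrightarrow> f R = f R'"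
  by (induction rule: poly_fun.induct) auto

theorem theorem4p6:
  fixes n d :: nat and Arr :: "'a set" and src tgt :: "'a \<Rightarrow> nat"
    and rho :: "('a list \<Rightarrow> 'k::field) set" and c :: "nat \<Rightarrow> nat"
    and \<mu> \<nu> :: "(nat \<Rightarrow> 'k mat) \<times> ('a \<Rightarrow> 'k mat)"
  assumes "alg_closed TYPE('k)"
    and "is_quiver n Arr src tgt"
    and "admissible Arr src tgt rho"
    and "\<forall>j<d. c j < n"
    and "\<mu> \<in> T_c n Arr src tgt rho d c"
    and "\<nu> \<in> T_c n Arr src tgt rho d c"
  shows "\<nu> \<in> zariski_closure n Arr d
            ((\<lambda>g. conj_rep d g \<mu>) ` normalizer d (T_c n Arr src tgt rho d c)) \<longleftrightarrow>
         (\<exists>m :: nat \<Rightarrow> nat. \<exists>X :: nat \<Rightarrow> (nat \<Rightarrow> 'k mat) \<times> ('a \<Rightarrow> 'k mat).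
          \<exists>h a b :: nat \<Rightarrow> 'k mat.
            (\<forall>l\<in>{1..d}. is_rep n Arr src tgt rho (m l) (X l)) \<and>
            (\<forall>l\<in>{1..<d}. is_hom n Arr (m l) (m (Suc l)) (X l) (X (Suc l)) (h l)) \<and>
            (\<forall>l\<in>{1..d}.
               is_hom n Arr (m l) (m l + l) (X l) (dsum_rep (m l) l (X l) (sub_rep l \<mu>)) (a l) \<and>
               is_hom n Arr (m l + l) l (dsum_rep (m l) l (X l) (sub_rep l \<mu>)) (sub_rep l \<nu>) (b l) \<and>
               short_exact (m l) (m l + l) l (a l) (b l)) \<and>
            (\<forall>l\<in>{1..<d}.
               diag2 (h l) (incl_mat l) * a l = a (Suc l) * h l \<and>
               incl_mat l * b l = b (Suc l) * diag2 (h l) (incl_mat l)))"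
    (is "?closure \<longleftrightarrow> (\<exists>m X h a b. ?seq m X h a b)")
proof
  assume ?closure
  moreover have "finite Arr" using assms(2) by (simp add: is_quiver_def)
  ultimately show "\<exists>m X h a b. ?seq m X h a b"
    by (intro flag_sequences_of_closure[OF assms(1) _ assms(4-6)])
next
  assume "\<exists>m X h a b. ?seq m X h a b"
  then obtain m X h a b where seq: "?seq m X h a b" by (elim exE)
  show ?closure
  \<comment> \<open>For \<open>d = 0\<close> there are no matrix entries, so every polynomial
    function is constant and the closure condition follows from the orbit being nonempty.\<close>
  proof (cases "d = 0")
    case True
    have "1\<^sub>m d \<in> normalizer d (T_c n Arr src tgt rho d c :: ((nat \<Rightarrow> 'k mat) \<times> ('a \<Rightarrow> 'k mat)) set)"
      using assms(5) by (intro one_in_normalizer[OF assms(4)]) blast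
    then have orbit: "conj_rep d (1\<^sub>m d) \<mu> \<in> (\<lambda>g. conj_rep d g \<mu>) ` normalizer d (T_c n Arr src tgt rho d c)" by blast
    show ?thesis
      unfolding zariski_closure_def
    proof (intro CollectI ballI impI)
      fix f assume f: "f \<in> poly_fun n Arr d"
        and van: "\<forall>Q\<in>(\<lambda>g. conj_rep d g \<mu>) ` normalizer d (T_c n Arr src tgt rho d c). f Q = 0"
      have "f \<nu> = f (conj_rep d (1\<^sub>m d) \<mu>)" by (rule poly_fun_0) (use f True in simp)
      also have "\<dots> = 0" using van orbit by (rule bspec)
      finally show "f \<nu> = 0" .
    qed
  next
    case False
    interpret flag_sequences n d Arr src tgt rho c \<mu> \<nu> m X h a b
      by unfold_locales (use False seq assms(4-6) alg_closed_infinite[OF assms(1)] in blast)+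
    show ?thesis by (rule in_zariski_closure)
  qed
qed

end
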